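(* Let $\mathcal V$ be an extensive category with finite limits and small coproducts, equipped with its cartesian monoidal structure. The functor $\mathsf{S_i}\colon \mathcal V\text{-}\mathbf{Cat}^s\to \mathbf{Cat}^s_{sp}(\mathcal V)$ is left adjoint to the functor $\mathsf{En}'\colon \mathbf{Cat}^s_{sp}(\mathcal V)\to\mathcal V\text{-}\mathbf{Cat}^s$; that is, there is an adjunction $\mathsf{S_i}\dashv\mathsf{En}'$.
   Context: **Ambient category.** $\mathcal V$ is extensive: for every small family $(x_i)_{i\in\kappa}$ of objects the functor $\prod_{i}\mathcal V/x_i\to\mathcal V/\coprod_i x_i$, $(f_i)_i\mapsto\coprod_i f_i$, is an equivalence. $\mathbf 1$ is the terminal object, $!$ the unique arrow to it, $\langle-,-\rangle$ pairing, $\pi_j$ the $j$-th product projection. **Enriched side.** $\mathcal V\text{-}\mathbf{Cat}^s$ is the category of $\mathcal V$-enriched categories $\mathcal M$ (and enriched functors) such that $\mathcal M_0$ (the objects) is a set and for all $a,b\in\mathcal M_0$ the arrows $\mathbf 1\to\mathcal M_{ab}$ form a set; $\mathcal M_{ab}$ is the hom-object from $a$ to $b$, $\circ_{abc}\colon\mathcal M_{bc}\times\mathcal M_{ab}\to\mathcal M_{ac}$ composition, $i_a\colon\mathbf 1\to\mathcal M_{aa}$ the identity. **Internal side.** An internal category $A=(A_0,A_1,A_2,\partial_0,\partial_1,\iota,c)$ has domain $\partial_0$ and codomain $\partial_1\colon A_1\to A_0$, identity $\iota\colon A_0\to A_1$, composable pairs $A_2$ (pullback, with projections $\Pi_1,\Pi_2\colon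 A_2\to A_1$, $\partial_0\Pi_1=\partial_1\Pi_2$) and composition $c\colon A_2\to A_1$ ("first after second"). For $u,v\colon X\to A_1$ with $\partial_0u=\partial_1v$, $u\times_{A_0}v\colon X\to A_2$ is the induced arrow. $E_A\colon\mathsf{End}(A)\to A_1$ is the equalizer of $\partial_0,\partial_1$; $I_A\colon\mathsf{Idem}(A)\to\mathsf{End}(A)$ is the equalizer of the identity and the arrow $\mathsf{End}(A)\to\mathsf{End}(A)$ induced by $c(E_A\times_{A_0}E_A)$. An arrow $u\colon X\to A_1$ that factors through $E_AI_A$ has its factorization denoted $u^*\colon X\to\mathsf{Idem}(A)$; in particular $\iota^*\colon A_0\to\mathsf{Idem}(A)$. An internal functor $F=(F_0,F_1)\colon A\to B$ induces $F_1^*\colon\mathsf{Idem}(A)\to\mathsf{Idem}(B)$ with $E_BI_BF_1^*=F_1E_AI_A$. A split of $A$ is a pair $R_A,S_A\colon\mathsf{Idem}(A)\to A_1$ with $\partial_0R_A=\partial_0E_AI_A=\partial_1S_A$, $\partial_1R_A=\partial_0S_A$, $c(S_A\times_{A_0}R_A)=E_AI_A$, $c(R_A\times_{A_0}S_A)=\iota\partial_0S_A$. It is canonical if (1) $R_A\iota^*=S_A\iota^*=\iota$; and (2) for every object $X$ and all $f^*,g^*\colon X\to\mathsf{Idem}(A)$, writing $f=E_AI_Af^*$, $g=E_AI_Ag^*$, if $f,g,f$ are composable and $c(f\times_{A_0}c(g\times_{A_0}f))=g$, then $R_A\big(c(R_Af^*\times_{A_0}c(g\times_{A_0}S_Af^*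 ))\big)^*=c(R_Ag^*\times_{A_0}S_Af^* )$ and $S_A\big(c(R_Af^*\times_{A_0}c(g\times_{A_0}S_Af^* ))\big)^*=c(R_Af^*\times_{A_0}S_Ag^* )$. An internal functor $F\colon A\to B$ between internal categories with splits preserves the split if $F_1R_A=R_BF_1^*$ and $F_1S_A=S_BF_1^*$. $\mathbf{Cat}^s_{sp}(\mathcal V)$ has as objects the internal categories $A$ in $\mathcal V$, with a (chosen) canonical split, such that the arrows $\mathbf 1\to A_1$ form a set; morphisms are split-preserving internal functors. **The functor $\mathsf{En}'$.** $\mathsf{En}'(A)$ has as objects the arrows $\alpha\colon\mathbf 1\to A_0$; the hom-object $\mathsf{En}'(A)_{\alpha\beta}$ comes with $\uparrow_\alpha^\beta\colon\mathsf{En}'(A)_{\alpha\beta}\to A_1$ universal among arrows $u$ into $A_1$ with $\partial_0u=\alpha\,!$, $\partial_1u=\beta\,!$. Composition is determined by $\uparrow_\alpha^\gamma\circ_{\alpha\beta\gamma}=c(\uparrow_\beta^\gamma\pi_1\times_{A_0}\uparrow_\alpha^\beta\pi_2)$ and identities by $\uparrow_\alpha^\alpha i_\alpha=\iota\alpha$. On $F\colon A\to B$: $\alpha\mapsto F_0\alpha$ and $\uparrow_{F_0\alpha}^{F_0\beta}\mathsf{En}'(F)_{\alpha\beta}=F_1\uparrow_\alpha^\beta$. **The functor $\mathsf{S_i}$.** For $a\in\mathcal M_0$ let $\epsilon_a\colon\mathfrak M_a\to\mathcal M_{aa}$ be the equalizer of $\circ_{aaa}\langle\mathsf{id},\mathsf{id}\rangle$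 and $\mathsf{id}$. $\mathsf{S_i}(\mathcal M)_0$ is the joint equalizer of the three arrows $\coprod_{a,b,c}\mathcal M_{bc}\times\mathcal M_{ab}\to\coprod_{a,b}\mathcal M_{ab}$ induced by first projection, second projection and composition; it is identified with $\coprod_a\mathfrak M_a$. For $a,b\in\mathcal M_0$ let $\alpha_{ab}=\circ_{abb}(\mathsf{id}\times\circ_{aab})(\epsilon_b\times\mathsf{id}\times\epsilon_a)\colon\mathfrak M_b\times\mathcal M_{ab}\times\mathfrak M_a\to\mathcal M_{ab}$, and let $\hat\alpha_{ab}\colon\mathsf{S_i}(\mathcal M)_{ab}\to\mathfrak M_b\times\mathcal M_{ab}\times\mathfrak M_a$ be the equalizer of $\langle\pi_1,\alpha_{ab},\pi_3\rangle$ and $\mathsf{id}$. Put $\mathsf{S_i}(\mathcal M)_1=\coprod_{a,b}\mathsf{S_i}(\mathcal M)_{ab}$; $\partial_0,\partial_1$ are given on the summand $ab$ by $\pi_3\hat\alpha_{ab}$ (into $\mathfrak M_a$) and $\pi_1\hat\alpha_{ab}$ (into $\mathfrak M_b$); $\iota$ is given on $\mathfrak M_a$ by the factorization of $\langle\mathsf{id},\epsilon_a,\mathsf{id}\rangle$ through $\hat\alpha_{aa}$; $\mathsf{S_i}(\mathcal M)_2=\coprod_{a,b,c}\mathsf{S_i}(\mathcal M)_{abc}$ where $\mathsf{S_i}(\mathcal M)_{abc}$ is the pullback of $\partial_0\colon\mathsf{S_i}(\mathcal M)_{bc}\to\mathfrak M_b$ and $\partial_1\colon\mathsf{S_i}(\mathcal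 M)_{ab}\to\mathfrak M_b$, with projections $\Pi_1^{abc},\Pi_2^{abc}$; composition $c_{abc}\colon\mathsf{S_i}(\mathcal M)_{abc}\to\mathsf{S_i}(\mathcal M)_{ac}$ is determined by $\hat\alpha_{ac}c_{abc}=\langle\pi_1\hat\alpha_{bc}\Pi_1^{abc},\ \circ_{abc}\langle\pi_2\hat\alpha_{bc}\Pi_1^{abc},\pi_2\hat\alpha_{ab}\Pi_2^{abc}\rangle,\ \pi_3\hat\alpha_{ab}\Pi_2^{abc}\rangle$. $\mathsf{Idem}(\mathsf{S_i}(\mathcal M))=\coprod_a\mathsf{Idem}(\mathsf{S_i}(\mathcal M))_a$, with $I_a\colon\mathsf{Idem}(\mathsf{S_i}(\mathcal M))_a\to\mathsf{S_i}(\mathcal M)_{aa}$ the $a$-component of its inclusion into $\mathsf{S_i}(\mathcal M)_1$; let $\omega_a\colon\mathsf{Idem}(\mathsf{S_i}(\mathcal M))_a\to\mathfrak M_a$ be the arrow with $\epsilon_a\omega_a=\pi_2\hat\alpha_{aa}I_a$. The canonical split of $\mathsf{S_i}(\mathcal M)$ has $a$-components $R_a,S_a\colon\mathsf{Idem}(\mathsf{S_i}(\mathcal M))_a\to\mathsf{S_i}(\mathcal M)_{aa}$ determined by $\hat\alpha_{aa}R_a=\langle\omega_a,\epsilon_a\omega_a,\pi_3\hat\alpha_{aa}I_a\rangle$ and $\hat\alpha_{aa}S_a=\langle\pi_1\hat\alpha_{aa}I_a,\epsilon_a\omega_a,\omega_a\rangle$. On an enriched functor $\mathcal F\colon\mathcal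 M\to\mathcal N$: $\mathsf{S_i}(\mathcal F)_0$ has components $\mathsf{S_i}(\mathcal F)_{0,a}\colon\mathfrak M_a\to\mathfrak N_{\mathcal F_0a}$ with $\epsilon_{\mathcal F_0a}\mathsf{S_i}(\mathcal F)_{0,a}=\mathcal F_{aa}\epsilon_a$, and $\mathsf{S_i}(\mathcal F)_1$ has components $\mathsf{S_i}(\mathcal F)_{1,ab}\colon\mathsf{S_i}(\mathcal M)_{ab}\to\mathsf{S_i}(\mathcal N)_{\mathcal F_0a\,\mathcal F_0b}$ with $\hat\alpha_{\mathcal F_0a\,\mathcal F_0b}\mathsf{S_i}(\mathcal F)_{1,ab}=(\mathsf{S_i}(\mathcal F)_{0,b}\times\mathcal F_{ab}\times\mathsf{S_i}(\mathcal F)_{0,a})\hat\alpha_{ab}$.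
   Formalization: Adds the condition that a small coproduct of objects each having only a set of arrows from 1 again has only a set of such arrows; it holds if V is locally small and is equivalent to S_i landing in Cat^s_sp(V), which can fail otherwise. *)

theory Defs
  imports "HOL-Library.FuncSet"
begin

unbundle cardinal_syntax

section \<open>Categories, functors, limits, adjunctions\<close>

text \<open>
  Objects and arrows of a category are carrier sets inside two types. \<open>Comp C g f\<close> is
  ``\<open>g\<close> after \<open>f\<close>'' and is meaningful only for composable arrows of \<open>C\<close>.
\<close>

record ('o, 'a) cat =
  Obj :: "'o set"
  Arr :: "'a set"
  Dom :: "'a \<Rightarrow> 'o"
  Cod :: "'a \<Rightarrow> 'o"
  Ident :: "'o \<Rightarrow> 'a"
  Comp :: "'a \<Rightarrow> 'a \<Rightarrow> 'a"

definition hom :: "('o, 'a) cat \<Rightarrow> 'o \<Rightarrow> 'o \<Rightarrow> 'a set" where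
  "hom C x y = {f \<in> Arr C. Dom C f = x \<and> Cod C f = y}"

locale category =
  fixes C :: "('o, 'a) cat"
  assumes dom_obj: "f \<in> Arr C \<Longrightarrow> Dom C f \<in> Obj C"
    and cod_obj: "f \<in> Arr C \<Longrightarrow> Cod C f \<in> Obj C"
    and ident_hom: "x \<in> Obj C \<Longrightarrow> Ident C x \<in> hom C x x"
    and comp_hom: "f \<in> hom C x y \<Longrightarrow> g \<in> hom C y z \<Longrightarrow> Comp C g f \<in> hom C x z"
    and comp_ident_right: "f \<in> hom C x y \<Longrightarrow> Comp C f (Ident C x) = f"
    and comp_ident_left: "f \<in> hom C x y \<Longrightarrow> Comp C (Ident C y) f = f"
    and comp_assoc: "f \<in> hom C w x \<Longrightarrow> g \<in> hom C x y \<Longrightarrow> h \<in> hom C y z \<Longrightarrow>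
      Comp C h (Comp C g f) = Comp C (Comp C h g) f"

record ('o, 'a, 'p, 'b) fct =
  FObj :: "'o \<Rightarrow> 'p"
  FArr :: "'a \<Rightarrow> 'b"

locale cat_functor = C: category C + D: category D
  for C :: "('o, 'a) cat" and D :: "('p, 'b) cat" +
  fixes F :: "('o, 'a, 'p, 'b) fct"
  assumes map_obj: "x \<in> Obj C \<Longrightarrow> FObj F x \<in> Obj D"
    and map_hom: "f \<in> hom C x y \<Longrightarrow> FArr F f \<in> hom D (FObj F x) (FObj F y)"
    and map_ident: "x \<in> Obj C \<Longrightarrow> FArr F (Ident C x) = Ident D (FObj F x)"
    and map_comp: "f \<in> hom C x y \<Longrightarrow> g \<in> hom C y z \<Longrightarrow>
      FArr F (Comp C g f) = Comp D (FArr F g) (FArr F f)"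

definition id_fct :: "('o, 'a, 'o, 'a) fct" where
  "id_fct = \<lparr>FObj = (\<lambda>x. x), FArr = (\<lambda>f. f)\<rparr>"

definition comp_fct :: "('p, 'b, 'q, 'c) fct \<Rightarrow> ('o, 'a, 'p, 'b) fct \<Rightarrow> ('o, 'a, 'q, 'c) fct" where
  "comp_fct G F = \<lparr>FObj = (\<lambda>x. FObj G (FObj F x)), FArr = (\<lambda>f. FArr G (FArr F f))\<rparr>"

definition is_iso :: "('o, 'a) cat \<Rightarrow> 'a \<Rightarrow> bool" where
  "is_iso C f \<longleftrightarrow> f \<in> Arr C \<and> (\<exists>g \<in> hom C (Cod C f) (Dom C f).
     Comp C g f = Ident C (Dom C f) \<and> Comp C f g = Ident C (Cod C f))"

definition nat_iso ::
  "('o, 'a) cat \<Rightarrow> ('p, 'b) cat \<Rightarrow> ('o, 'a, 'p, 'b) fct \<Rightarrow> ('o, 'a, 'p, 'b) fct \<Rightarrow> ('o \<Rightarrow> 'b) \<Rightarrow> bool"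
where
  "nat_iso C D F G t \<longleftrightarrow>
     (\<forall>x \<in> Obj C. t x \<in> hom D (FObj F x) (FObj G x) \<and> is_iso D (t x)) \<and>
     (\<forall>f \<in> Arr C. Comp D (t (Cod C f)) (FArr F f) = Comp D (FArr G f) (t (Dom C f)))"

definition is_equivalence :: "('o, 'a) cat \<Rightarrow> ('p, 'b) cat \<Rightarrow> ('o, 'a, 'p, 'b) fct \<Rightarrow> bool" where
  "is_equivalence C D F \<longleftrightarrow> cat_functor C D F \<and>
     (\<exists>G. cat_functor D C G \<and>
        (\<exists>\<eta>. nat_iso C C id_fct (comp_fct G F) \<eta>) \<and>
        (\<exists>\<epsilon>. nat_iso D D (comp_fct F G) id_fct \<epsilon>))"

text \<open>
  \<open>F\<close> is left adjoint to \<open>G\<close>: bijections \<open>\<phi> x y : D(F x, y) \<cong> C(x, G y)\<close>, natural in \<open>x\<close> and \<open>y\<close>.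
\<close>

locale adjunction = F: cat_functor C D F + G: cat_functor D C G
  for C :: "('o, 'a) cat" and D :: "('p, 'b) cat"
    and F :: "('o, 'a, 'p, 'b) fct" and G :: "('p, 'b, 'o, 'a) fct" +
  fixes \<phi> :: "'o \<Rightarrow> 'p \<Rightarrow> 'b \<Rightarrow> 'a"
  assumes bij: "x \<in> Obj C \<Longrightarrow> y \<in> Obj D \<Longrightarrow>
      bij_betw (\<phi> x y) (hom D (FObj F x) y) (hom C x (FObj G y))"
    and natural: "f \<in> hom C x' x \<Longrightarrow> g \<in> hom D y y' \<Longrightarrow> h \<in> hom D (FObj F x) y \<Longrightarrow>
      \<phi> x' y' (Comp D g (Comp D h (FArr F f))) = Comp C (FArr G g) (Comp C (\<phi> x y h) f)"

definition is_cone ::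
  "('j, 'k) cat \<Rightarrow> ('o, 'a) cat \<Rightarrow> ('j, 'k, 'o, 'a) fct \<Rightarrow> 'o \<Rightarrow> ('j \<Rightarrow> 'a) \<Rightarrow> bool" where
  "is_cone J C D l p \<longleftrightarrow> l \<in> Obj C \<and> (\<forall>j \<in> Obj J. p j \<in> hom C l (FObj D j)) \<and>
     (\<forall>u \<in> Arr J. Comp C (FArr D u) (p (Dom J u)) = p (Cod J u))"

definition is_limit ::
  "('j, 'k) cat \<Rightarrow> ('o, 'a) cat \<Rightarrow> ('j, 'k, 'o, 'a) fct \<Rightarrow> 'o \<Rightarrow> ('j \<Rightarrow> 'a) \<Rightarrow> bool" where
  "is_limit J C D l p \<longleftrightarrow> is_cone J C D l p \<and>
     (\<forall>m q. is_cone J C D m q \<longrightarrow>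
        (\<exists>!h. h \<in> hom C m l \<and> (\<forall>j \<in> Obj J. Comp C (p j) h = q j)))"

text \<open>Every finite category is isomorphic to one whose objects and arrows are natural numbers.\<close>

definition has_finite_limits :: "('o, 'a) cat \<Rightarrow> bool" where
  "has_finite_limits C \<longleftrightarrow>
     (\<forall>(J :: (nat, nat) cat) D. finite (Obj J) \<and> finite (Arr J) \<and> cat_functor J C D \<longrightarrow>
        (\<exists>l p. is_limit J C D l p))"

text \<open>An arrow of the slice over \<open>x\<close> from \<open>f\<close> to \<open>g\<close> is \<open>(f, h, g)\<close> with \<open>g h = f\<close>.\<close>

definition slice :: "('o, 'a) cat \<Rightarrow> 'o \<Rightarrow> ('a, 'a \<times> 'a \<times> 'a) cat" where
  "slice C x = \<lparr>
     Obj = {f \<in> Arr C. Cod C f = x},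
     Arr = {(f, h, g). f \<in> Arr C \<and> Cod C f = x \<and> g \<in> Arr C \<and> Cod C g = x \<and>
              h \<in> hom C (Dom C f) (Dom C g) \<and> Comp C g h = f},
     Dom = (\<lambda>(f, h, g). f),
     Cod = (\<lambda>(f, h, g). g),
     Ident = (\<lambda>f. (f, Ident C (Dom C f), f)),
     Comp = (\<lambda>(g', k, g'') (f, h, g). (f, Comp C k h, g''))\<rparr>"

definition prod_cat :: "'i set \<Rightarrow> ('i \<Rightarrow> ('o, 'a) cat) \<Rightarrow> ('i \<Rightarrow> 'o, 'i \<Rightarrow> 'a) cat" where
  "prod_cat I Cs = \<lparr>
     Obj = (\<Pi>\<^sub>E i\<in>I. Obj (Cs i)),
     Arr = (\<Pi>\<^sub>E i\<in>I. Arr (Cs i)),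
     Dom = (\<lambda>f. \<lambda>i\<in>I. Dom (Cs i) (f i)),
     Cod = (\<lambda>f. \<lambda>i\<in>I. Cod (Cs i) (f i)),
     Ident = (\<lambda>x. \<lambda>i\<in>I. Ident (Cs i) (x i)),
     Comp = (\<lambda>g f. \<lambda>i\<in>I. Comp (Cs i) (g i) (f i))\<rparr>"

text \<open>
  Smallness is relative to an infinite cardinal \<open>\<kappa>\<close>: a set is small if it has fewer than \<open>\<kappa>\<close>
  elements (for \<open>\<kappa>\<close> inaccessible: if it is equipotent to a member of the universe determined by
  \<open>\<kappa>\<close>). Throughout, \<open>\<kappa>\<close> will live on the type \<open>'a\<close> of arrows of the ambient category, so that every
  small set, of whatever type, is equipotent to a set of type \<open>'a set\<close>. This is no restriction,
  since the arrows of a category need not exhaust \<open>'a\<close>.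
\<close>

definition small :: "'k rel \<Rightarrow> 'x set \<Rightarrow> bool" where
  "small \<kappa> X \<longleftrightarrow> |X| <o \<kappa>"

definition restrict2 :: "'x set \<Rightarrow> ('x \<Rightarrow> 'x \<Rightarrow> 'y) \<Rightarrow> 'x \<Rightarrow> 'x \<Rightarrow> 'y" where
  "restrict2 X f = (\<lambda>a b. if a \<in> X \<and> b \<in> X then f a b else undefined)"


section \<open>Data of enriched and internal categories\<close>

text \<open>
  A \<open>\<V>\<close>-category: \<open>ehom M a b\<close> is the hom-object from \<open>a\<close> to \<open>b\<close>, and \<open>ecomp M a b c\<close> is the arrow
  from the product of \<open>ehom M b c\<close> and \<open>ehom M a b\<close> to \<open>ehom M a c\<close>.
  In an enriched functor, \<open>efun1 F a b\<close> is the action on the hom-object from \<open>a\<close> to \<open>b\<close>.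
\<close>

record ('o, 'a) ecat =
  eobj :: "'a set"
  ehom :: "'a \<Rightarrow> 'a \<Rightarrow> 'o"
  ecomp :: "'a \<Rightarrow> 'a \<Rightarrow> 'a \<Rightarrow> 'a"
  eid :: "'a \<Rightarrow> 'a"

record ('o, 'a) efun =
  esrc :: "('o, 'a) ecat"
  etgt :: "('o, 'a) ecat"
  efun0 :: "'a \<Rightarrow> 'a"
  efun1 :: "'a \<Rightarrow> 'a \<Rightarrow> 'a"

record ('o, 'a) icat =
  A0 :: 'o
  A1 :: 'o
  A2 :: 'o
  d0 :: 'a
  d1 :: 'a
  ipr1 :: 'a
  ipr2 :: 'a
  iident :: 'a
  icomp :: 'a

record ('o, 'a) icat_split = "('o, 'a) icat" +
  spR :: 'a
  spS :: 'a

record ('o, 'a) ifun =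
  isrc :: "('o, 'a) icat_split"
  itgt :: "('o, 'a) icat_split"
  ifun0 :: 'a
  ifun1 :: 'a


context
  fixes V :: "('o, 'a) cat"
begin

abbreviation comp_in (infixr \<open>\<cdot>\<close> 65) where
  "g \<cdot> f \<equiv> Comp V g f"


section \<open>Limits and coproducts in the ambient category\<close>

definition is_terminal :: "'o \<Rightarrow> bool" where
  "is_terminal t \<longleftrightarrow> t \<in> Obj V \<and> (\<forall>x \<in> Obj V. \<exists>!h. h \<in> hom V x t)"

definition is_product :: "'o \<Rightarrow> 'o \<Rightarrow> 'o \<Rightarrow> 'a \<Rightarrow> 'a \<Rightarrow> bool" where
  "is_product x y p p1 p2 \<longleftrightarrow> p \<in> Obj V \<and> p1 \<in> hom V p x \<and> p2 \<in> hom V p y \<and>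
     (\<forall>z f g. f \<in> hom V z x \<and> g \<in> hom V z y \<longrightarrow>
        (\<exists>!h. h \<in> hom V z p \<and> p1 \<cdot> h = f \<and> p2 \<cdot> h = g))"

definition is_equalizer :: "'a \<Rightarrow> 'a \<Rightarrow> 'a \<Rightarrow> bool" where
  "is_equalizer f g e \<longleftrightarrow> e \<in> Arr V \<and> Cod V e = Dom V f \<and> f \<cdot> e = g \<cdot> e \<and>
     (\<forall>z u. u \<in> hom V z (Dom V f) \<and> f \<cdot> u = g \<cdot> u \<longrightarrow>
        (\<exists>!h. h \<in> hom V z (Dom V e) \<and> e \<cdot> h = u))"

definition is_pullback :: "'a \<Rightarrow> 'a \<Rightarrow> 'o \<Rightarrow> 'a \<Rightarrow> 'a \<Rightarrow> bool" where
  "is_pullback f g p p1 p2 \<longleftrightarrow> p \<in> Obj V \<and> p1 \<in> hom V p (Dom V f) \<and> p2 \<in> hom V p (Dom V g) \<and>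
     f \<cdot> p1 = g \<cdot> p2 \<and>
     (\<forall>z u v. u \<in> hom V z (Dom V f) \<and> v \<in> hom V z (Dom V g) \<and> f \<cdot> u = g \<cdot> v \<longrightarrow>
        (\<exists>!h. h \<in> hom V z p \<and> p1 \<cdot> h = u \<and> p2 \<cdot> h = v))"

definition is_coproduct :: "'i set \<Rightarrow> ('i \<Rightarrow> 'o) \<Rightarrow> 'o \<Rightarrow> ('i \<Rightarrow> 'a) \<Rightarrow> bool" where
  "is_coproduct I x s j \<longleftrightarrow> s \<in> Obj V \<and> (\<forall>i \<in> I. j i \<in> hom V (x i) s) \<and>
     (\<forall>t f. t \<in> Obj V \<and> (\<forall>i \<in> I. f i \<in> hom V (x i) t) \<longrightarrow>
        (\<exists>!h. h \<in> hom V s t \<and> (\<forall>i \<in> I. h \<cdot> j i = f i)))"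

text \<open>A fixed (arbitrary) choice of these limits and coproducts; \<open>trm\<close> is the terminal object.\<close>

definition trm :: 'o where
  "trm = (SOME t. is_terminal t)"

definition bang :: "'o \<Rightarrow> 'a" where
  "bang x = (THE h. h \<in> hom V x trm)"

definition prod_choice :: "'o \<Rightarrow> 'o \<Rightarrow> 'o \<times> 'a \<times> 'a" where
  "prod_choice x y = (SOME (p, p1, p2). is_product x y p p1 p2)"

definition prd :: "'o \<Rightarrow> 'o \<Rightarrow> 'o" where
  "prd x y = fst (prod_choice x y)"

definition pr1 :: "'o \<Rightarrow> 'o \<Rightarrow> 'a" where
  "pr1 x y = fst (snd (prod_choice x y))"

definition pr2 :: "'o \<Rightarrow> 'o \<Rightarrow> 'a" where
  "pr2 x y = snd (snd (prod_choice x y))"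

definition pair :: "'a \<Rightarrow> 'a \<Rightarrow> 'a" where
  "pair f g = (THE h. h \<in> hom V (Dom V f) (prd (Cod V f) (Cod V g)) \<and>
     pr1 (Cod V f) (Cod V g) \<cdot> h = f \<and> pr2 (Cod V f) (Cod V g) \<cdot> h = g)"

definition times2 :: "'a \<Rightarrow> 'a \<Rightarrow> 'a" where
  "times2 f g = pair (f \<cdot> pr1 (Dom V f) (Dom V g)) (g \<cdot> pr2 (Dom V f) (Dom V g))"

definition prd3 :: "'o \<Rightarrow> 'o \<Rightarrow> 'o \<Rightarrow> 'o" where
  "prd3 x y z = prd x (prd y z)"

definition proj1 :: "'o \<Rightarrow> 'o \<Rightarrow> 'o \<Rightarrow> 'a" where
  "proj1 x y z = pr1 x (prd y z)"

definition proj2 :: "'o \<Rightarrow> 'o \<Rightarrow> 'o \<Rightarrow> 'a" where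
  "proj2 x y z = pr1 y z \<cdot> pr2 x (prd y z)"

definition proj3 :: "'o \<Rightarrow> 'o \<Rightarrow> 'o \<Rightarrow> 'a" where
  "proj3 x y z = pr2 y z \<cdot> pr2 x (prd y z)"

definition tuple3 :: "'a \<Rightarrow> 'a \<Rightarrow> 'a \<Rightarrow> 'a" where
  "tuple3 f g h = pair f (pair g h)"

definition times3 :: "'a \<Rightarrow> 'a \<Rightarrow> 'a \<Rightarrow> 'a" where
  "times3 f g h = times2 f (times2 g h)"

definition equalizer :: "'a \<Rightarrow> 'a \<Rightarrow> 'a" where
  "equalizer f g = (SOME e. is_equalizer f g e)"

definition pullback_choice :: "'a \<Rightarrow> 'a \<Rightarrow> 'o \<times> 'a \<times> 'a" where
  "pullback_choice f g = (SOME (p, p1, p2). is_pullback f g p p1 p2)"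

definition pbk :: "'a \<Rightarrow> 'a \<Rightarrow> 'o" where
  "pbk f g = fst (pullback_choice f g)"

definition pbk1 :: "'a \<Rightarrow> 'a \<Rightarrow> 'a" where
  "pbk1 f g = fst (snd (pullback_choice f g))"

definition pbk2 :: "'a \<Rightarrow> 'a \<Rightarrow> 'a" where
  "pbk2 f g = snd (snd (pullback_choice f g))"

definition coprod_choice :: "'i set \<Rightarrow> ('i \<Rightarrow> 'o) \<Rightarrow> 'o \<times> ('i \<Rightarrow> 'a)" where
  "coprod_choice I x = (SOME (s, j). is_coproduct I x s j)"

definition coprod :: "'i set \<Rightarrow> ('i \<Rightarrow> 'o) \<Rightarrow> 'o" where
  "coprod I x = fst (coprod_choice I x)"

definition inj_coprod :: "'i set \<Rightarrow> ('i \<Rightarrow> 'o) \<Rightarrow> 'i \<Rightarrow> 'a" where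
  "inj_coprod I x = snd (coprod_choice I x)"

text \<open>The arrow from the coproduct to \<open>t\<close> with components \<open>f i\<close>.\<close>

definition cotuple :: "'i set \<Rightarrow> ('i \<Rightarrow> 'o) \<Rightarrow> 'o \<Rightarrow> ('i \<Rightarrow> 'a) \<Rightarrow> 'a" where
  "cotuple I x t f = (THE h. h \<in> hom V (coprod I x) t \<and> (\<forall>i \<in> I. h \<cdot> inj_coprod I x i = f i))"

text \<open>The factorization of \<open>u\<close> through \<open>m\<close>; used only when it exists and is unique.\<close>

definition factor :: "'a \<Rightarrow> 'a \<Rightarrow> 'a" where
  "factor m u = (THE h. h \<in> hom V (Dom V u) (Dom V m) \<and> m \<cdot> h = u)"

definition has_small_coproducts :: "'a rel \<Rightarrow> bool" where
  "has_small_coproducts \<kappa> \<longleftrightarrow>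
     (\<forall>(I :: 'a set) x. small \<kappa> I \<and> (\<forall>i \<in> I. x i \<in> Obj V) \<longrightarrow> (\<exists>s j. is_coproduct I x s j))"

text \<open>The functor sending a family of arrows \<open>f i\<close> into \<open>x i\<close> to its coproduct.\<close>

definition coprod_fct :: "'i set \<Rightarrow> ('i \<Rightarrow> 'o) \<Rightarrow>
    ('i \<Rightarrow> 'a, 'i \<Rightarrow> 'a \<times> 'a \<times> 'a, 'a, 'a \<times> 'a \<times> 'a) fct" where
  "coprod_fct I x =
     (let obj_map = (\<lambda>f. cotuple I (\<lambda>i. Dom V (f i)) (coprod I x) (\<lambda>i. inj_coprod I x i \<cdot> f i)) in
      \<lparr>FObj = obj_map,
       FArr = (\<lambda>t.
         let f = (\<lambda>i\<in>I. fst (t i)); h = (\<lambda>i\<in>I. fst (snd (t i))); g = (\<lambda>i\<in>I. snd (snd (t i))) in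
         (obj_map f,
          cotuple I (\<lambda>i. Dom V (f i)) (coprod I (\<lambda>i. Dom V (g i)))
            (\<lambda>i. inj_coprod I (\<lambda>i. Dom V (g i)) i \<cdot> h i),
          obj_map g))\<rparr>)"

definition extensive :: "'a rel \<Rightarrow> bool" where
  "extensive \<kappa> \<longleftrightarrow>
     (\<forall>(I :: 'a set) x. small \<kappa> I \<and> (\<forall>i \<in> I. x i \<in> Obj V) \<longrightarrow>
        is_equivalence (prod_cat I (\<lambda>i. slice V (x i))) (slice V (coprod I x)) (coprod_fct I x))"

text \<open>
  Objects with a small set of global elements are closed under small coproducts. This holds if
  \<open>V\<close> is locally small and \<open>\<kappa>\<close> arbitrary, and also if the terminal object is connected and \<open>\<kappa>\<close> is
  regular. It is exactly what is needed for the arrows from the terminal object into the object of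
  arrows of \<open>S\<^sub>i(M)\<close> to form a small set whenever \<open>M\<close> is an object of the category of small
  enriched categories.
\<close>

definition small_points_closed :: "'a rel \<Rightarrow> bool" where
  "small_points_closed \<kappa> \<longleftrightarrow>
     (\<forall>(I :: 'a set) x. small \<kappa> I \<and> (\<forall>i \<in> I. x i \<in> Obj V \<and> small \<kappa> (hom V trm (x i))) \<longrightarrow>
        small \<kappa> (hom V trm (coprod I x)))"


section \<open>Enriched categories\<close>

text \<open>The canonical isomorphism \<open>(x \<times> y) \<times> z \<rightarrow> x \<times> (y \<times> z)\<close>.\<close>

definition assoc :: "'o \<Rightarrow> 'o \<Rightarrow> 'o \<Rightarrow> 'a" where
  "assoc x y z =
     pair (pr1 x y \<cdot> pr1 (prd x y) z) (pair (pr2 x y \<cdot> pr1 (prd x y) z) (pr2 (prd x y) z))"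

definition enriched_category :: "('o, 'a) ecat \<Rightarrow> bool" where
  "enriched_category M \<longleftrightarrow>
     (\<forall>a \<in> eobj M. \<forall>b \<in> eobj M. ehom M a b \<in> Obj V) \<and>
     (\<forall>a \<in> eobj M. \<forall>b \<in> eobj M. \<forall>c \<in> eobj M.
        ecomp M a b c \<in> hom V (prd (ehom M b c) (ehom M a b)) (ehom M a c)) \<and>
     (\<forall>a \<in> eobj M. eid M a \<in> hom V trm (ehom M a a)) \<and>
     (\<forall>a \<in> eobj M. \<forall>b \<in> eobj M. \<forall>c \<in> eobj M. \<forall>d \<in> eobj M.
        ecomp M a b d \<cdot> times2 (ecomp M b c d) (Ident V (ehom M a b)) =
        ecomp M a c d \<cdot> times2 (Ident V (ehom M c d)) (ecomp M a b c) \<cdot>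
          assoc (ehom M c d) (ehom M b c) (ehom M a b)) \<and>
     (\<forall>a \<in> eobj M. \<forall>b \<in> eobj M.
        ecomp M a b b \<cdot> times2 (eid M b) (Ident V (ehom M a b)) = pr2 trm (ehom M a b) \<and>
        ecomp M a a b \<cdot> times2 (Ident V (ehom M a b)) (eid M a) = pr1 (ehom M a b) trm)"

text \<open>
  The maps \<open>efun0\<close>, \<open>efun1\<close> are required to be \<open>undefined\<close> outside the objects of the source, so
  that equality of these records is equality of enriched functors.
\<close>

definition enriched_functor :: "('o, 'a) efun \<Rightarrow> bool" where
  "enriched_functor F \<longleftrightarrow>
     (let M = esrc F; N = etgt F in
      enriched_category M \<and> enriched_category N \<and>
      efun0 F \<in> eobj M \<rightarrow>\<^sub>E eobj N \<and>
      efun1 F = restrict2 (eobj M) (efun1 F) \<and>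
      (\<forall>a \<in> eobj M. \<forall>b \<in> eobj M.
         efun1 F a b \<in> hom V (ehom M a b) (ehom N (efun0 F a) (efun0 F b))) \<and>
      (\<forall>a \<in> eobj M. \<forall>b \<in> eobj M. \<forall>c \<in> eobj M.
         efun1 F a c \<cdot> ecomp M a b c =
         ecomp N (efun0 F a) (efun0 F b) (efun0 F c) \<cdot> times2 (efun1 F b c) (efun1 F a b)) \<and>
      (\<forall>a \<in> eobj M. efun1 F a a \<cdot> eid M a = eid N (efun0 F a)))"

definition small_enriched_category :: "'a rel \<Rightarrow> ('o, 'a) ecat \<Rightarrow> bool" where
  "small_enriched_category \<kappa> M \<longleftrightarrow> enriched_category M \<and> small \<kappa> (eobj M) \<and>
     (\<forall>a \<in> eobj M. \<forall>b \<in> eobj M. small \<kappa> (hom V trm (ehom M a b)))"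

definition VCat :: "'a rel \<Rightarrow> (('o, 'a) ecat, ('o, 'a) efun) cat" where
  "VCat \<kappa> = \<lparr>
     Obj = {M. small_enriched_category \<kappa> M},
     Arr = {F. enriched_functor F \<and>
              small_enriched_category \<kappa> (esrc F) \<and> small_enriched_category \<kappa> (etgt F)},
     Dom = esrc,
     Cod = etgt,
     Ident = (\<lambda>M. \<lparr>esrc = M, etgt = M, efun0 = (\<lambda>a\<in>eobj M. a),
                efun1 = restrict2 (eobj M) (\<lambda>a b. Ident V (ehom M a b))\<rparr>),
     Comp = (\<lambda>G F. \<lparr>esrc = esrc F, etgt = etgt G,
                efun0 = (\<lambda>a\<in>eobj (esrc F). efun0 G (efun0 F a)),
                efun1 = restrict2 (eobj (esrc F))
                  (\<lambda>a b. efun1 G (efun0 F a) (efun0 F b) \<cdot> efun1 F a b)\<rparr>)\<rparr>"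


section \<open>Internal categories and splits\<close>

text \<open>The arrow induced into the object of composable pairs, and the composite of \<open>v\<close> followed by \<open>u\<close>.\<close>

definition ipair :: "('o, 'a, 'z) icat_scheme \<Rightarrow> 'a \<Rightarrow> 'a \<Rightarrow> 'a" where
  "ipair A u v = (THE h. h \<in> hom V (Dom V u) (A2 A) \<and> ipr1 A \<cdot> h = u \<and> ipr2 A \<cdot> h = v)"

definition cmp :: "('o, 'a, 'z) icat_scheme \<Rightarrow> 'a \<Rightarrow> 'a \<Rightarrow> 'a" where
  "cmp A u v = icomp A \<cdot> ipair A u v"

definition internal_category :: "('o, 'a, 'z) icat_scheme \<Rightarrow> bool" where
  "internal_category A \<longleftrightarrow>
     A0 A \<in> Obj V \<and> A1 A \<in> Obj V \<and>
     d0 A \<in> hom V (A1 A) (A0 A) \<and> d1 A \<in> hom V (A1 A) (A0 A) \<and>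
     is_pullback (d0 A) (d1 A) (A2 A) (ipr1 A) (ipr2 A) \<and>
     iident A \<in> hom V (A0 A) (A1 A) \<and> icomp A \<in> hom V (A2 A) (A1 A) \<and>
     d0 A \<cdot> iident A = Ident V (A0 A) \<and> d1 A \<cdot> iident A = Ident V (A0 A) \<and>
     d0 A \<cdot> icomp A = d0 A \<cdot> ipr2 A \<and> d1 A \<cdot> icomp A = d1 A \<cdot> ipr1 A \<and>
     cmp A (iident A \<cdot> d1 A) (Ident V (A1 A)) = Ident V (A1 A) \<and>
     cmp A (Ident V (A1 A)) (iident A \<cdot> d0 A) = Ident V (A1 A) \<and>
     (\<forall>X u v w. u \<in> hom V X (A1 A) \<and> v \<in> hom V X (A1 A) \<and> w \<in> hom V X (A1 A) \<and>
        d0 A \<cdot> u = d1 A \<cdot> v \<and> d0 A \<cdot> v = d1 A \<cdot> w \<longrightarrow>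
        cmp A u (cmp A v w) = cmp A (cmp A u v) w)"

text \<open>\<open>End_incl\<close>, \<open>Idem_incl\<close> are the equalizers \<open>E\<^sub>A\<close>, \<open>I\<^sub>A\<close>, and \<open>EI\<close> is their composite.\<close>

definition End_incl :: "('o, 'a, 'z) icat_scheme \<Rightarrow> 'a" where
  "End_incl A = equalizer (d0 A) (d1 A)"

definition Idem_incl :: "('o, 'a, 'z) icat_scheme \<Rightarrow> 'a" where
  "Idem_incl A = equalizer (Ident V (Dom V (End_incl A)))
     (factor (End_incl A) (cmp A (End_incl A) (End_incl A)))"

definition Idem :: "('o, 'a, 'z) icat_scheme \<Rightarrow> 'o" where
  "Idem A = Dom V (Idem_incl A)"

definition EI :: "('o, 'a, 'z) icat_scheme \<Rightarrow> 'a" where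
  "EI A = End_incl A \<cdot> Idem_incl A"

definition star :: "('o, 'a, 'z) icat_scheme \<Rightarrow> 'a \<Rightarrow> 'a" where
  "star A u = factor (EI A) u"

definition is_split :: "('o, 'a) icat_split \<Rightarrow> bool" where
  "is_split A \<longleftrightarrow>
     spR A \<in> hom V (Idem A) (A1 A) \<and> spS A \<in> hom V (Idem A) (A1 A) \<and>
     d0 A \<cdot> spR A = d0 A \<cdot> EI A \<and> d1 A \<cdot> spS A = d0 A \<cdot> EI A \<and>
     d1 A \<cdot> spR A = d0 A \<cdot> spS A \<and>
     cmp A (spS A) (spR A) = EI A \<and>
     cmp A (spR A) (spS A) = iident A \<cdot> d0 A \<cdot> spS A"

text \<open>
  In the second condition \<open>h\<close> is the composite of \<open>g\<close> with the section and the retraction of \<open>f\<close>;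
  it is idempotent because \<open>f\<close> and \<open>g\<close> are and \<open>f g f = g\<close>.
\<close>

definition is_canonical_split :: "('o, 'a) icat_split \<Rightarrow> bool" where
  "is_canonical_split A \<longleftrightarrow> is_split A \<and>
     spR A \<cdot> star A (iident A) = iident A \<and> spS A \<cdot> star A (iident A) = iident A \<and>
     (\<forall>X fs gs. fs \<in> hom V X (Idem A) \<and> gs \<in> hom V X (Idem A) \<longrightarrow>
        (let f = EI A \<cdot> fs; g = EI A \<cdot> gs;
             h = cmp A (spR A \<cdot> fs) (cmp A g (spS A \<cdot> fs)) in
         d0 A \<cdot> f = d1 A \<cdot> g \<and> d0 A \<cdot> g = d1 A \<cdot> f \<and> cmp A f (cmp A g f) = g \<longrightarrow>
         spR A \<cdot> star A h = cmp A (spR A \<cdot> gs) (spS A \<cdot> fs) \<and>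
         spS A \<cdot> star A h = cmp A (spR A \<cdot> fs) (spS A \<cdot> gs)))"

definition internal_functor :: "('o, 'a) ifun \<Rightarrow> bool" where
  "internal_functor F \<longleftrightarrow>
     (let A = isrc F; B = itgt F in
      internal_category A \<and> internal_category B \<and>
      ifun0 F \<in> hom V (A0 A) (A0 B) \<and> ifun1 F \<in> hom V (A1 A) (A1 B) \<and>
      d0 B \<cdot> ifun1 F = ifun0 F \<cdot> d0 A \<and> d1 B \<cdot> ifun1 F = ifun0 F \<cdot> d1 A \<and>
      ifun1 F \<cdot> iident A = iident B \<cdot> ifun0 F \<and>
      ifun1 F \<cdot> icomp A = cmp B (ifun1 F \<cdot> ipr1 A) (ifun1 F \<cdot> ipr2 A))"

definition Idem_map :: "('o, 'a) ifun \<Rightarrow> 'a" where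
  "Idem_map F = star (itgt F) (ifun1 F \<cdot> EI (isrc F))"

definition preserves_split :: "('o, 'a) ifun \<Rightarrow> bool" where
  "preserves_split F \<longleftrightarrow>
     ifun1 F \<cdot> spR (isrc F) = spR (itgt F) \<cdot> Idem_map F \<and>
     ifun1 F \<cdot> spS (isrc F) = spS (itgt F) \<cdot> Idem_map F"

definition small_split_category :: "'a rel \<Rightarrow> ('o, 'a) icat_split \<Rightarrow> bool" where
  "small_split_category \<kappa> A \<longleftrightarrow>
     internal_category A \<and> is_canonical_split A \<and> small \<kappa> (hom V trm (A1 A))"

definition Cat_sp :: "'a rel \<Rightarrow> (('o, 'a) icat_split, ('o, 'a) ifun) cat" where
  "Cat_sp \<kappa> = \<lparr>
     Obj = {A. small_split_category \<kappa> A},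
     Arr = {F. internal_functor F \<and> preserves_split F \<and>
              small_split_category \<kappa> (isrc F) \<and> small_split_category \<kappa> (itgt F)},
     Dom = isrc,
     Cod = itgt,
     Ident = (\<lambda>A. \<lparr>isrc = A, itgt = A, ifun0 = Ident V (A0 A), ifun1 = Ident V (A1 A)\<rparr>),
     Comp = (\<lambda>G F. \<lparr>isrc = isrc F, itgt = itgt G,
                ifun0 = ifun0 G \<cdot> ifun0 F, ifun1 = ifun1 G \<cdot> ifun1 F\<rparr>)\<rparr>"


section \<open>The functor \<open>En'\<close>\<close>

definition is_universal_between :: "('o, 'a, 'z) icat_scheme \<Rightarrow> 'a \<Rightarrow> 'a \<Rightarrow> 'a \<Rightarrow> bool" where
  "is_universal_between A \<alpha> \<beta> e \<longleftrightarrow>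
     e \<in> Arr V \<and> Cod V e = A1 A \<and>
     d0 A \<cdot> e = \<alpha> \<cdot> bang (Dom V e) \<and> d1 A \<cdot> e = \<beta> \<cdot> bang (Dom V e) \<and>
     (\<forall>X u. u \<in> hom V X (A1 A) \<and> d0 A \<cdot> u = \<alpha> \<cdot> bang X \<and> d1 A \<cdot> u = \<beta> \<cdot> bang X \<longrightarrow>
        (\<exists>!h. h \<in> hom V X (Dom V e) \<and> e \<cdot> h = u))"

definition up :: "('o, 'a, 'z) icat_scheme \<Rightarrow> 'a \<Rightarrow> 'a \<Rightarrow> 'a" where
  "up A \<alpha> \<beta> = (SOME e. is_universal_between A \<alpha> \<beta> e)"

definition En_obj :: "('o, 'a) icat_split \<Rightarrow> ('o, 'a) ecat" where
  "En_obj A =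
     (let H = (\<lambda>\<alpha> \<beta>. Dom V (up A \<alpha> \<beta>)) in
      \<lparr>eobj = hom V trm (A0 A),
       ehom = H,
       ecomp = (\<lambda>\<alpha> \<beta> \<gamma>. factor (up A \<alpha> \<gamma>)
          (cmp A (up A \<beta> \<gamma> \<cdot> pr1 (H \<beta> \<gamma>) (H \<alpha> \<beta>)) (up A \<alpha> \<beta> \<cdot> pr2 (H \<beta> \<gamma>) (H \<alpha> \<beta>)))),
       eid = (\<lambda>\<alpha>. factor (up A \<alpha> \<alpha>) (iident A \<cdot> \<alpha>))\<rparr>)"

definition En_arr :: "('o, 'a) ifun \<Rightarrow> ('o, 'a) efun" where
  "En_arr F =
     \<lparr>esrc = En_obj (isrc F), etgt = En_obj (itgt F),
      efun0 = (\<lambda>\<alpha>\<in>hom V trm (A0 (isrc F)). ifun0 F \<cdot> \<alpha>),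
      efun1 = restrict2 (hom V trm (A0 (isrc F)))
        (\<lambda>\<alpha> \<beta>. factor (up (itgt F) (ifun0 F \<cdot> \<alpha>) (ifun0 F \<cdot> \<beta>)) (ifun1 F \<cdot> up (isrc F) \<alpha> \<beta>))\<rparr>"

definition En :: "(('o, 'a) icat_split, ('o, 'a) ifun, ('o, 'a) ecat, ('o, 'a) efun) fct" where
  "En = \<lparr>FObj = En_obj, FArr = En_arr\<rparr>"


section \<open>The functor \<open>S\<^sub>i\<close>\<close>

text \<open>\<open>eps M a\<close> is the inclusion \<open>\<epsilon>\<^sub>a\<close> of the object \<open>idems M a\<close> of idempotents on \<open>a\<close>.\<close>

definition eps :: "('o, 'a) ecat \<Rightarrow> 'a \<Rightarrow> 'a" where
  "eps M a = equalizer
     (ecomp M a a a \<cdot> pair (Ident V (ehom M a a)) (Ident V (ehom M a a))) (Ident V (ehom M a a))"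

definition idems :: "('o, 'a) ecat \<Rightarrow> 'a \<Rightarrow> 'o" where
  "idems M a = Dom V (eps M a)"

definition alpha :: "('o, 'a) ecat \<Rightarrow> 'a \<Rightarrow> 'a \<Rightarrow> 'a" where
  "alpha M a b = ecomp M a b b \<cdot> times2 (Ident V (ehom M b b)) (ecomp M a a b) \<cdot>
     times3 (eps M b) (Ident V (ehom M a b)) (eps M a)"

definition alpha_hat :: "('o, 'a) ecat \<Rightarrow> 'a \<Rightarrow> 'a \<Rightarrow> 'a" where
  "alpha_hat M a b =
     (let x = idems M b; y = ehom M a b; z = idems M a in
      equalizer (tuple3 (proj1 x y z) (alpha M a b) (proj3 x y z)) (Ident V (prd3 x y z)))"

definition Si_hom :: "('o, 'a) ecat \<Rightarrow> 'a \<Rightarrow> 'a \<Rightarrow> 'o" where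
  "Si_hom M a b = Dom V (alpha_hat M a b)"

text \<open>The three components of \<open>\<alpha>\<close>-hat: target idempotent, underlying arrow, source idempotent.\<close>

definition ah1 :: "('o, 'a) ecat \<Rightarrow> 'a \<Rightarrow> 'a \<Rightarrow> 'a" where
  "ah1 M a b = proj1 (idems M b) (ehom M a b) (idems M a) \<cdot> alpha_hat M a b"

definition ah2 :: "('o, 'a) ecat \<Rightarrow> 'a \<Rightarrow> 'a \<Rightarrow> 'a" where
  "ah2 M a b = proj2 (idems M b) (ehom M a b) (idems M a) \<cdot> alpha_hat M a b"

definition ah3 :: "('o, 'a) ecat \<Rightarrow> 'a \<Rightarrow> 'a \<Rightarrow> 'a" where
  "ah3 M a b = proj3 (idems M b) (ehom M a b) (idems M a) \<cdot> alpha_hat M a b"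

definition Si_pairs :: "('o, 'a) ecat \<Rightarrow> 'a \<Rightarrow> 'a \<Rightarrow> 'a \<Rightarrow> 'o" where
  "Si_pairs M a b c = pbk (ah3 M b c) (ah1 M a b)"

definition Si_pi1 :: "('o, 'a) ecat \<Rightarrow> 'a \<Rightarrow> 'a \<Rightarrow> 'a \<Rightarrow> 'a" where
  "Si_pi1 M a b c = pbk1 (ah3 M b c) (ah1 M a b)"

definition Si_pi2 :: "('o, 'a) ecat \<Rightarrow> 'a \<Rightarrow> 'a \<Rightarrow> 'a \<Rightarrow> 'a" where
  "Si_pi2 M a b c = pbk2 (ah3 M b c) (ah1 M a b)"

definition Si_ident :: "('o, 'a) ecat \<Rightarrow> 'a \<Rightarrow> 'a" where
  "Si_ident M a =
     factor (alpha_hat M a a) (tuple3 (Ident V (idems M a)) (eps M a) (Ident V (idems M a)))"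

definition Si_comp :: "('o, 'a) ecat \<Rightarrow> 'a \<Rightarrow> 'a \<Rightarrow> 'a \<Rightarrow> 'a" where
  "Si_comp M a b c = factor (alpha_hat M a c)
     (tuple3 (ah1 M b c \<cdot> Si_pi1 M a b c)
        (ecomp M a b c \<cdot> pair (ah2 M b c \<cdot> Si_pi1 M a b c) (ah2 M a b \<cdot> Si_pi2 M a b c))
        (ah3 M a b \<cdot> Si_pi2 M a b c))"

text \<open>Index sets, summands and injections of the coproducts \<open>S\<^sub>i(M)\<^sub>0\<close>, \<open>S\<^sub>i(M)\<^sub>1\<close>, \<open>S\<^sub>i(M)\<^sub>2\<close>; the
  joint equalizer defining \<open>S\<^sub>i(M)\<^sub>0\<close> is identified with the coproduct of the \<open>idems M a\<close>.\<close>

abbreviation Ix2 :: "('o, 'a) ecat \<Rightarrow> ('a \<times> 'a) set" where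
  "Ix2 M \<equiv> eobj M \<times> eobj M"

abbreviation Ix3 :: "('o, 'a) ecat \<Rightarrow> ('a \<times> 'a \<times> 'a) set" where
  "Ix3 M \<equiv> eobj M \<times> eobj M \<times> eobj M"

abbreviation fam1 :: "('o, 'a) ecat \<Rightarrow> 'a \<times> 'a \<Rightarrow> 'o" where
  "fam1 M \<equiv> (\<lambda>(a, b). Si_hom M a b)"

abbreviation fam2 :: "('o, 'a) ecat \<Rightarrow> 'a \<times> 'a \<times> 'a \<Rightarrow> 'o" where
  "fam2 M \<equiv> (\<lambda>(a, b, c). Si_pairs M a b c)"

definition Si0 :: "('o, 'a) ecat \<Rightarrow> 'o" where
  "Si0 M = coprod (eobj M) (idems M)"

definition Si1 :: "('o, 'a) ecat \<Rightarrow> 'o" where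
  "Si1 M = coprod (Ix2 M) (fam1 M)"

definition Si2 :: "('o, 'a) ecat \<Rightarrow> 'o" where
  "Si2 M = coprod (Ix3 M) (fam2 M)"

definition inj0 :: "('o, 'a) ecat \<Rightarrow> 'a \<Rightarrow> 'a" where
  "inj0 M a = inj_coprod (eobj M) (idems M) a"

definition inj1 :: "('o, 'a) ecat \<Rightarrow> 'a \<Rightarrow> 'a \<Rightarrow> 'a" where
  "inj1 M a b = inj_coprod (Ix2 M) (fam1 M) (a, b)"

definition Si_icat :: "('o, 'a) ecat \<Rightarrow> ('o, 'a) icat" where
  "Si_icat M =
     \<lparr>A0 = Si0 M, A1 = Si1 M, A2 = Si2 M,
      d0 = cotuple (Ix2 M) (fam1 M) (Si0 M) (\<lambda>(a, b). inj0 M a \<cdot> ah3 M a b),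
      d1 = cotuple (Ix2 M) (fam1 M) (Si0 M) (\<lambda>(a, b). inj0 M b \<cdot> ah1 M a b),
      ipr1 = cotuple (Ix3 M) (fam2 M) (Si1 M) (\<lambda>(a, b, c). inj1 M b c \<cdot> Si_pi1 M a b c),
      ipr2 = cotuple (Ix3 M) (fam2 M) (Si1 M) (\<lambda>(a, b, c). inj1 M a b \<cdot> Si_pi2 M a b c),
      iident = cotuple (eobj M) (idems M) (Si1 M) (\<lambda>a. inj1 M a a \<cdot> Si_ident M a),
      icomp = cotuple (Ix3 M) (fam2 M) (Si1 M) (\<lambda>(a, b, c). inj1 M a c \<cdot> Si_comp M a b c)\<rparr>"

text \<open>
  The \<open>a\<close>-component of \<open>Idem(S\<^sub>i(M))\<close> is its pullback along the injection of the summand \<open>aa\<close>;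
  \<open>Idem_inj\<close> is the injection into \<open>Idem(S\<^sub>i(M))\<close>, and \<open>Idem_comp\<close> is the \<open>a\<close>-component \<open>I\<^sub>a\<close> of
  the inclusion into \<open>S\<^sub>i(M)\<^sub>1\<close>.
\<close>

definition Idem_inj :: "('o, 'a) ecat \<Rightarrow> 'a \<Rightarrow> 'a" where
  "Idem_inj M a = pbk1 (EI (Si_icat M)) (inj1 M a a)"

definition Idem_comp :: "('o, 'a) ecat \<Rightarrow> 'a \<Rightarrow> 'a" where
  "Idem_comp M a = pbk2 (EI (Si_icat M)) (inj1 M a a)"

definition omega :: "('o, 'a) ecat \<Rightarrow> 'a \<Rightarrow> 'a" where
  "omega M a = factor (eps M a) (ah2 M a a \<cdot> Idem_comp M a)"

definition Ra :: "('o, 'a) ecat \<Rightarrow> 'a \<Rightarrow> 'a" where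
  "Ra M a = factor (alpha_hat M a a)
     (tuple3 (omega M a) (eps M a \<cdot> omega M a) (ah3 M a a \<cdot> Idem_comp M a))"

definition Sa :: "('o, 'a) ecat \<Rightarrow> 'a \<Rightarrow> 'a" where
  "Sa M a = factor (alpha_hat M a a)
     (tuple3 (ah1 M a a \<cdot> Idem_comp M a) (eps M a \<cdot> omega M a) (omega M a))"

definition Si_obj :: "('o, 'a) ecat \<Rightarrow> ('o, 'a) icat_split" where
  "Si_obj M = icat.extend (Si_icat M)
     \<lparr>spR = (THE h. h \<in> hom V (Idem (Si_icat M)) (Si1 M) \<and>
               (\<forall>a \<in> eobj M. h \<cdot> Idem_inj M a = inj1 M a a \<cdot> Ra M a)),
      spS = (THE h. h \<in> hom V (Idem (Si_icat M)) (Si1 M) \<and>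
               (\<forall>a \<in> eobj M. h \<cdot> Idem_inj M a = inj1 M a a \<cdot> Sa M a))\<rparr>"

definition Si_arr0 :: "('o, 'a) efun \<Rightarrow> 'a \<Rightarrow> 'a" where
  "Si_arr0 F a = factor (eps (etgt F) (efun0 F a)) (efun1 F a a \<cdot> eps (esrc F) a)"

definition Si_arr1 :: "('o, 'a) efun \<Rightarrow> 'a \<Rightarrow> 'a \<Rightarrow> 'a" where
  "Si_arr1 F a b = factor (alpha_hat (etgt F) (efun0 F a) (efun0 F b))
     (times3 (Si_arr0 F b) (efun1 F a b) (Si_arr0 F a) \<cdot> alpha_hat (esrc F) a b)"

definition Si_arr :: "('o, 'a) efun \<Rightarrow> ('o, 'a) ifun" where
  "Si_arr F =
     (let M = esrc F; N = etgt F in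
      \<lparr>isrc = Si_obj M, itgt = Si_obj N,
       ifun0 = cotuple (eobj M) (idems M) (Si0 N) (\<lambda>a. inj0 N (efun0 F a) \<cdot> Si_arr0 F a),
       ifun1 = cotuple (Ix2 M) (fam1 M) (Si1 N)
         (\<lambda>(a, b). inj1 N (efun0 F a) (efun0 F b) \<cdot> Si_arr1 F a b)\<rparr>)"

definition Si :: "(('o, 'a) ecat, ('o, 'a) efun, ('o, 'a) icat_split, ('o, 'a) ifun) fct" where
  "Si = \<lparr>FObj = Si_obj, FArr = Si_arr\<rparr>"

end

end

theory Submission
  imports Defs
begin

text \<open>
  Everything is computed with generalized elements. An element of \<open>S\<^sub>i(M)\<^sub>1\<close> at stage \<open>X\<close> is, locally on a
  coproduct decomposition of \<open>X\<close>, a triple \<open>(p, x, q)\<close> with \<open>x : X \<rightarrow> M\<^sub>a\<^sub>b\<close>, idempotents \<open>p\<close> on \<open>b\<close> and \<open>q\<close>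
  on \<open>a\<close>, and \<open>p x = x = x q\<close>. Extensivity supplies the decompositions, and it makes a stage initial
  on which two elements with different indices agree; hence all equations may be checked on triples,
  where they are those of the idempotent completion of an ordinary category.

  The adjunction is given by universal arrows \<open>M \<rightarrow> En'(S\<^sub>i(M))\<close> sending \<open>x\<close> to \<open>(1, x, 1)\<close>. Since
  \<open>(p, x, q) = (p, p, 1) (1, x, 1) (1, q, q)\<close>, whose outer factors are the retraction of \<open>(1, p, 1)\<close> and the
  section of \<open>(1, q, 1)\<close>, a split-preserving extension of \<open>F : M \<rightarrow> En'(A)\<close> must send \<open>(p, x, q)\<close> to
  \<open>R(F p) F x S(F q)\<close>. That this preserves splits is the second condition on canonical splits, and
  that it restricts to \<open>F\<close> along the unit is the first.
\<close>

text \<open>An arrow into a coproduct need not factor through one injection, so a generalized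
  element of \<open>Si1\<close> has no global pair of indices. This shapes every argument about
  \<open>Si_icat\<close>: equations are restricted along a jointly epic family on which indices
  exist, and when several elements occur, the next one is decomposed over each piece of the previous
  decomposition. Pieces on which indices clash are initial; parallel arrows out of them agree, so
  the clash is disposed of instead of being excluded by some connectedness of the terminal object.

  Functoriality of \<open>Si V\<close> is never computed from its components.
  \<open>Si_arr V f\<close> is recognised as the extension of the unit after \<open>f\<close>;
  uniqueness of extensions then yields preservation of identities and composites, and the unit
  equation yields naturality.

  Infinity of \<open>\<kappa>\<close> makes the index sets of pairs and triples of objects small
  again and supplies the empty coproduct. The closure condition on global points is what bounds the
  points of \<open>Si1\<close>.\<close>

lemma in_hom [simp]: "f \<in> hom C x y \<longleftrightarrow> f \<in> Arr C \<and> Dom C f = x \<and> Cod C f = y"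
  by (simp add: hom_def)

section \<open>Rewrite rules for typing and composition in a category\<close>

context category
begin

lemma obj_dom [simp]: "f \<in> Arr C \<Longrightarrow> Dom C f \<in> Obj C"
  and obj_cod [simp]: "f \<in> Arr C \<Longrightarrow> Cod C f \<in> Obj C"
  by (simp_all add: dom_obj cod_obj)

lemma comp_typing [simp]:
  assumes "f \<in> Arr C" "g \<in> Arr C" "Dom C g = Cod C f"
  shows "Comp C g f \<in> Arr C" "Dom C (Comp C g f) = Dom C f" "Cod C (Comp C g f) = Cod C g"
  using comp_hom[of f "Dom C f" "Cod C f" g "Cod C g"] assms by simp_all

lemma ident_typing [simp]:
  assumes "x \<in> Obj C"
  shows "Ident C x \<in> Arr C" "Dom C (Ident C x) = x" "Cod C (Ident C x) = x"
  using ident_hom[OF assms] by simp_all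

lemma ident_right [simp]: "f \<in> Arr C \<Longrightarrow> Dom C f = x \<Longrightarrow> Comp C f (Ident C x) = f"
  using comp_ident_right[of f x "Cod C f"] by simp

lemma ident_left [simp]: "f \<in> Arr C \<Longrightarrow> Cod C f = x \<Longrightarrow> Comp C (Ident C x) f = f"
  using comp_ident_left[of f "Dom C f" x] by simp

lemma assoc_C [simp]:
  assumes "f \<in> Arr C" "g \<in> Arr C" "h \<in> Arr C" "Dom C g = Cod C f" "Dom C h = Cod C g"
  shows "Comp C (Comp C h g) f = Comp C h (Comp C g f)"
  using comp_assoc[of f "Dom C f" "Cod C f" g "Cod C g" h "Cod C h"] assms by simp

text \<open>Since \<open>assoc_C\<close> nests composites to the right, a known product
  \<open>g f = u\<close> is no longer visible inside \<open>g (f k)\<close>. This rule applies the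
  equation there.\<close>

lemma comp_extend:
  assumes "Comp C g f = u" "f \<in> Arr C" "g \<in> Arr C" "Dom C g = Cod C f" "k \<in> Arr C" "Cod C k = Dom C f"
  shows "Comp C g (Comp C f k) = Comp C u k"
  using assms by (metis assoc_C)

end

locale ambient = category V for V :: "('o, 'a) cat" +
  fixes \<kappa> :: "'a rel"
  assumes card_order: "Card_order \<kappa>" and infinite_Field: "infinite (Field \<kappa>)"
    and finite_limits: "has_finite_limits V"
    and small_coproducts: "has_small_coproducts V \<kappa>"
    and extensive_V: "extensive V \<kappa>"
    and points_closed: "small_points_closed V \<kappa>"
begin

abbreviation comp_V (infixr \<open>\<cdot>\<close> 65) where "g \<cdot> f \<equiv> Comp V g f"

subsection \<open>Finite limits\<close>

definition J_empty :: "(nat, nat) cat" where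
  "J_empty = \<lparr>Obj = {}, Arr = {}, Dom = (\<lambda>i. i), Cod = (\<lambda>i. i), Ident = (\<lambda>i. i), Comp = (\<lambda>g f. f)\<rparr>"

definition J_pair :: "(nat, nat) cat" where
  "J_pair = \<lparr>Obj = {0, 1}, Arr = {0, 1}, Dom = (\<lambda>i. i), Cod = (\<lambda>i. i), Ident = (\<lambda>i. i),
     Comp = (\<lambda>g f. f)\<rparr>"

text \<open>The arrows 0 and 1 are the identities of the objects 0 and 1, while 2 and 3 form the
  parallel pair. In a composable pair at least one factor is an identity, so \<open>Comp\<close>
  only has to return the other one.\<close>

definition J_parallel :: "(nat, nat) cat" where
  "J_parallel = \<lparr>Obj = {0, 1}, Arr = {0, 1, 2, 3}, Dom = (\<lambda>i. if i = 1 then 1 else 0),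
     Cod = (\<lambda>i. if i = 0 then 0 else 1), Ident = (\<lambda>i. i),
     Comp = (\<lambda>g f. if f \<le> 1 then g else f)\<rparr>"

lemma exists_limit:
  assumes "finite (Obj J)" "finite (Arr J)" "cat_functor J V (D :: (nat, nat, 'o, 'a) fct)"
  shows "\<exists>l p. is_limit J V D l p"
  using finite_limits assms unfolding has_finite_limits_def by blast

lemma terminal_exists: "\<exists>t. is_terminal V t"
proof -
  \<comment> \<open>The diagram is empty, so its values are never inspected and a limit cone is just
    a terminal object.\<close>
  define D :: "(nat, nat, 'o, 'a) fct" where "D = \<lparr>FObj = undefined, FArr = undefined\<rparr>"
  have "cat_functor J_empty V D"
    by unfold_locales (auto simp: J_empty_def hom_def)
  then obtain l p where "is_limit J_empty V D l p"
    using exists_limit[of J_empty D] by (auto simp: J_empty_def)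
  then have "is_terminal V l"
    unfolding is_limit_def is_cone_def is_terminal_def J_empty_def by simp
  then show ?thesis by blast
qed

lemma product_exists:
  assumes "x \<in> Obj V" "y \<in> Obj V"
  shows "\<exists>p p1 p2. is_product V x y p p1 p2"
proof -
  define D :: "(nat, nat, 'o, 'a) fct" where
    "D = \<lparr>FObj = (\<lambda>i. if i = 0 then x else y), FArr = (\<lambda>i. Ident V (if i = 0 then x else y))\<rparr>"
  have "cat_functor J_pair V D"
    by unfold_locales (auto simp: J_pair_def hom_def D_def assms)
  then obtain l p where l: "is_limit J_pair V D l p"
    using exists_limit[of J_pair D] by (auto simp: J_pair_def)
  have cone: "is_cone J_pair V D z q \<longleftrightarrow> z \<in> Obj V \<and> q 0 \<in> hom V z x \<and> q 1 \<in> hom V z y" for z q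
    unfolding is_cone_def J_pair_def D_def by auto
  have "is_product V x y l (p 0) (p 1)"
    unfolding is_product_def
  proof (intro conjI allI impI)
    show "l \<in> Obj V" "p 0 \<in> hom V l x" "p 1 \<in> hom V l y"
      using l cone unfolding is_limit_def by blast+
    fix z f g assume fg: "f \<in> hom V z x \<and> g \<in> hom V z y"
    have "is_cone J_pair V D z (\<lambda>i. if i = 0 then f else g)"
      unfolding cone using fg obj_dom by auto
    then have "\<exists>!h. h \<in> hom V z l \<and> (\<forall>j \<in> Obj J_pair. p j \<cdot> h = (if j = 0 then f else g))"
      using l unfolding is_limit_def by blast
    then show "\<exists>!h. h \<in> hom V z l \<and> p 0 \<cdot> h = f \<and> p 1 \<cdot> h = g"
      by (simp add: J_pair_def)
  qed
  then show ?thesis by blast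
qed

lemma equalizer_exists:
  assumes "f \<in> Arr V" "g \<in> Arr V" "Dom V f = Dom V g" "Cod V f = Cod V g"
  shows "\<exists>e. is_equalizer V f g e"
proof -
  let ?x = "Dom V f" let ?y = "Cod V f"
  define D :: "(nat, nat, 'o, 'a) fct" where
    "D = \<lparr>FObj = (\<lambda>i. if i = 0 then ?x else ?y),
      FArr = (\<lambda>i. if i = 0 then Ident V ?x else if i = 1 then Ident V ?y else if i = 2 then f else g)\<rparr>"
  have arr: "f \<in> Arr J_parallel \<longleftrightarrow> f = 0 \<or> f = 1 \<or> f = 2 \<or> f = 3" for f
    by (auto simp: J_parallel_def)
  interpret J: category J_parallel
    by unfold_locales (auto simp: J_parallel_def hom_def)
  have "cat_functor J_parallel V D"
  proof
    show "FObj D x \<in> Obj V" if "x \<in> Obj J_parallel" for x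
      using assms by (simp add: D_def)
    show "FArr D (Ident J_parallel x) = Ident V (FObj D x)" if "x \<in> Obj J_parallel" for x
      using that by (auto simp: D_def J_parallel_def)
    show "FArr D u \<in> hom V (FObj D x) (FObj D y)" if "u \<in> hom J_parallel x y" for u x y
      using that assms by (auto simp: D_def J_parallel_def hom_def)
    show "FArr D (Comp J_parallel v u) = FArr D v \<cdot> FArr D u"
      if "u \<in> hom J_parallel x y" "v \<in> hom J_parallel y z" for u v x y z
      using that assms by (auto simp: D_def J_parallel_def hom_def)
  qed
  then obtain l p where l: "is_limit J_parallel V D l p"
    using exists_limit[of J_parallel D] by (auto simp: J_parallel_def)
  have cone: "is_cone J_parallel V D z q \<longleftrightarrow>
      z \<in> Obj V \<and> q 0 \<in> hom V z ?x \<and> q 1 = f \<cdot> q 0 \<and> q 1 = g \<cdot> q 0" for z q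
    unfolding is_cone_def J_parallel_def D_def using assms by (auto simp: assms)
  have "is_equalizer V f g (p 0)"
    unfolding is_equalizer_def
  proof (intro conjI allI impI)
    have c: "is_cone J_parallel V D l p" using l unfolding is_limit_def by blast
    show "p 0 \<in> Arr V" "Cod V (p 0) = ?x" "f \<cdot> p 0 = g \<cdot> p 0"
      using c unfolding cone by auto
    fix z u assume u: "u \<in> hom V z ?x \<and> f \<cdot> u = g \<cdot> u"
    have "is_cone J_parallel V D z (\<lambda>i. if i = 0 then u else f \<cdot> u)"
      unfolding cone using u obj_dom by auto
    then have *: "\<exists>!h. h \<in> hom V z l \<and>
        (\<forall>j \<in> Obj J_parallel. p j \<cdot> h = (if j = 0 then u else f \<cdot> u))"
      using l unfolding is_limit_def by blast
    \<comment> \<open>The leg at object 1 is forced to be \<open>f\<close> after the leg at 0, so a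
      mediating arrow is tested on the leg at 0 alone.\<close>
    have "h \<in> hom V z l \<and> (\<forall>j \<in> Obj J_parallel. p j \<cdot> h = (if j = 0 then u else f \<cdot> u))
        \<longleftrightarrow> h \<in> hom V z (Dom V (p 0)) \<and> p 0 \<cdot> h = u" for h
      using c unfolding cone by (auto simp: J_parallel_def assms)
    with * show "\<exists>!h. h \<in> hom V z (Dom V (p 0)) \<and> p 0 \<cdot> h = u"
      by simp
  qed
  then show ?thesis by blast
qed

section \<open>Calculus of the chosen finite limits\<close>

lemma trm_terminal: "is_terminal V (trm V)"
  unfolding trm_def using terminal_exists by (rule someI_ex)

lemma trm_obj [simp]: "trm V \<in> Obj V"
  using trm_terminal unfolding is_terminal_def by blast

lemma bang_typing [simp]:
  assumes "x \<in> Obj V"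
  shows "bang V x \<in> Arr V" "Dom V (bang V x) = x" "Cod V (bang V x) = trm V"
proof -
  have "\<exists>!h. h \<in> hom V x (trm V)"
    using trm_terminal assms unfolding is_terminal_def by blast
  then have "bang V x \<in> hom V x (trm V)"
    unfolding bang_def by (rule theI')
  then show "bang V x \<in> Arr V" "Dom V (bang V x) = x" "Cod V (bang V x) = trm V" by auto
qed

lemma to_trm_eq:
  assumes "u \<in> Arr V" "v \<in> Arr V" "Cod V u = trm V" "Cod V v = trm V" "Dom V u = Dom V v"
  shows "u = v"
proof -
  have "\<exists>!h. h \<in> hom V (Dom V u) (trm V)"
    using trm_terminal assms obj_dom unfolding is_terminal_def by blast
  then show ?thesis using assms by (auto simp del: in_hom simp: hom_def)
qed

lemma bang_comp [simp]:
  "u \<in> Arr V \<Longrightarrow> Cod V u = x \<Longrightarrow> bang V x \<cdot> u = bang V (Dom V u)"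
  by (rule to_trm_eq) auto

lemma prd_is_product:
  assumes "x \<in> Obj V" "y \<in> Obj V"
  shows "is_product V x y (prd V x y) (pr1 V x y) (pr2 V x y)"
proof -
  have "case prod_choice V x y of (p, p1, p2) \<Rightarrow> is_product V x y p p1 p2"
    unfolding prod_choice_def using product_exists[OF assms]
    by (intro someI_ex[of "\<lambda>(p, p1, p2). is_product V x y p p1 p2"]) auto
  then show ?thesis
    unfolding prd_def pr1_def pr2_def by (simp add: case_prod_beta)
qed

lemma prd_typing [simp]:
  assumes "x \<in> Obj V" "y \<in> Obj V"
  shows "prd V x y \<in> Obj V" "pr1 V x y \<in> Arr V" "pr2 V x y \<in> Arr V"
    "Dom V (pr1 V x y) = prd V x y" "Dom V (pr2 V x y) = prd V x y"
    "Cod V (pr1 V x y) = x" "Cod V (pr2 V x y) = y"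
  using prd_is_product[OF assms] unfolding is_product_def by auto

lemma pair_ex1:
  assumes "f \<in> Arr V" "g \<in> Arr V" "Dom V f = Dom V g"
  shows "\<exists>!h. h \<in> hom V (Dom V f) (prd V (Cod V f) (Cod V g)) \<and>
     pr1 V (Cod V f) (Cod V g) \<cdot> h = f \<and> pr2 V (Cod V f) (Cod V g) \<cdot> h = g"
proof -
  have "f \<in> hom V (Dom V f) (Cod V f) \<and> g \<in> hom V (Dom V f) (Cod V g)"
    using assms by simp
  with prd_is_product[of "Cod V f" "Cod V g"] show ?thesis
    unfolding is_product_def using assms obj_cod by blast
qed

lemma pair_typing [simp]:
  assumes "f \<in> Arr V" "g \<in> Arr V" "Dom V f = Dom V g"
  shows "pair V f g \<in> Arr V" "Dom V (pair V f g) = Dom V g"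
    "Cod V (pair V f g) = prd V (Cod V f) (Cod V g)"
  using theI'[OF pair_ex1[OF assms]] assms unfolding pair_def by auto

lemma pr_pair [simp]:
  assumes "f \<in> Arr V" "g \<in> Arr V" "Dom V f = Dom V g" "Cod V f = x" "Cod V g = y"
  shows "pr1 V x y \<cdot> pair V f g = f" "pr2 V x y \<cdot> pair V f g = g"
  using theI'[OF pair_ex1[OF assms(1-3)]] assms unfolding pair_def by auto

lemma pair_eqI:
  assumes "x \<in> Obj V" "y \<in> Obj V" "h \<in> Arr V" "k \<in> Arr V" "Cod V h = prd V x y"
    "Cod V k = prd V x y" "Dom V h = Dom V k"
    "pr1 V x y \<cdot> h = pr1 V x y \<cdot> k" "pr2 V x y \<cdot> h = pr2 V x y \<cdot> k"
  shows "h = k"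
proof -
  have "\<exists>!t. t \<in> hom V (Dom V h) (prd V x y) \<and> pr1 V x y \<cdot> t = pr1 V x y \<cdot> k \<and>
     pr2 V x y \<cdot> t = pr2 V x y \<cdot> k"
    using pair_ex1[of "pr1 V x y \<cdot> k" "pr2 V x y \<cdot> k"] assms(1-7) by simp
  then show ?thesis using assms by auto
qed

lemma pair_comp [simp]:
  assumes "f \<in> Arr V" "g \<in> Arr V" "Dom V f = Dom V g" "k \<in> Arr V" "Cod V k = Dom V g"
  shows "pair V f g \<cdot> k = pair V (f \<cdot> k) (g \<cdot> k)"
proof (rule pair_eqI[of "Cod V f" "Cod V g"])
  show "pr1 V (Cod V f) (Cod V g) \<cdot> pair V f g \<cdot> k = pr1 V (Cod V f) (Cod V g) \<cdot> pair V (f \<cdot> k) (g \<cdot> k)"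
    using comp_extend[OF pr_pair(1)[OF assms(1-3) refl refl]] assms by simp
  show "pr2 V (Cod V f) (Cod V g) \<cdot> pair V f g \<cdot> k = pr2 V (Cod V f) (Cod V g) \<cdot> pair V (f \<cdot> k) (g \<cdot> k)"
    using comp_extend[OF pr_pair(2)[OF assms(1-3) refl refl]] assms by simp
qed (use assms in simp_all)

lemma pair_pr [simp]:
  assumes "x \<in> Obj V" "y \<in> Obj V" "h \<in> Arr V" "Cod V h = prd V x y"
  shows "pair V (pr1 V x y \<cdot> h) (pr2 V x y \<cdot> h) = h"
  by (rule pair_eqI[of x y]) (use assms in simp_all)

lemma pair_inject:
  assumes "pair V f g = pair V f' g'" "f \<in> Arr V" "g \<in> Arr V" "Dom V f = Dom V g"
    "f' \<in> Arr V" "g' \<in> Arr V" "Dom V f' = Dom V g'" "Cod V f = Cod V f'" "Cod V g = Cod V g'"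
  shows "f = f'" "g = g'"
  using assms by (metis pr_pair)+

text \<open>This keeps only the uniqueness half of the universal properties of \<open>eps\<close>,
  \<open>alpha_hat\<close>, \<open>EI\<close> and \<open>up\<close>. With it a value of
  \<open>factor\<close> is computed by exhibiting some factorization.\<close>

definition mono_V :: "'a \<Rightarrow> bool" where
  "mono_V m \<longleftrightarrow> m \<in> Arr V \<and> (\<forall>u v. u \<in> Arr V \<and> v \<in> Arr V \<and> Dom V u = Dom V v \<and>
     Cod V u = Dom V m \<and> Cod V v = Dom V m \<and> m \<cdot> u = m \<cdot> v \<longrightarrow> u = v)"

lemma mono_V_D:
  assumes "mono_V m" "m \<cdot> u = m \<cdot> v" "u \<in> Arr V" "v \<in> Arr V" "Dom V u = Dom V v"
    "Cod V u = Dom V m" "Cod V v = Dom V m"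
  shows "u = v"
  using assms unfolding mono_V_def by blast

lemma mono_V_comp:
  assumes "mono_V m" "mono_V n" "Dom V m = Cod V n"
  shows "mono_V (m \<cdot> n)"
  unfolding mono_V_def
proof (intro conjI allI impI)
  have a: "m \<in> Arr V" "n \<in> Arr V" using assms unfolding mono_V_def by blast+
  show "m \<cdot> n \<in> Arr V" using assms(3) a by simp
  fix u v assume *: "u \<in> Arr V \<and> v \<in> Arr V \<and> Dom V u = Dom V v \<and> Cod V u = Dom V (m \<cdot> n) \<and>
     Cod V v = Dom V (m \<cdot> n) \<and> (m \<cdot> n) \<cdot> u = (m \<cdot> n) \<cdot> v"
  have t: "u \<in> Arr V" "v \<in> Arr V" "Cod V u = Dom V n" "Cod V v = Dom V n"
    "(m \<cdot> n) \<cdot> u = (m \<cdot> n) \<cdot> v"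
    using * a assms(3) by simp_all
  then have "m \<cdot> n \<cdot> u = m \<cdot> n \<cdot> v" using a assms(3) by simp
  then have "n \<cdot> u = n \<cdot> v" using mono_V_D[OF assms(1)] * a assms(3) by simp
  then show "u = v" using mono_V_D[OF assms(2)] * a assms(3) by simp
qed

lemma factor_eqI:
  assumes "mono_V m" "m \<cdot> h = u" "h \<in> Arr V" "Cod V h = Dom V m"
  shows "factor V m u = h"
proof -
  have "m \<in> Arr V" using assms(1) unfolding mono_V_def by blast
  then have "Dom V u = Dom V h" using assms by auto
  then show ?thesis
    unfolding factor_def using assms mono_V_D[OF assms(1)]
    by (intro the_equality) auto
qed

lemma equalizer_is:
  assumes "f \<in> Arr V" "g \<in> Arr V" "Dom V f = Dom V g" "Cod V f = Cod V g"
  shows "is_equalizer V f g (equalizer V f g)"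
  unfolding equalizer_def by (rule someI_ex[OF equalizer_exists[OF assms]])

lemma equalizer_props:
  assumes "f \<in> Arr V" "g \<in> Arr V" "Dom V f = Dom V g" "Cod V f = Cod V g"
  shows equalizer_arr: "equalizer V f g \<in> Arr V"
    and equalizer_cod: "Cod V (equalizer V f g) = Dom V f"
    and equalizer_eq: "f \<cdot> equalizer V f g = g \<cdot> equalizer V f g"
    and equalizer_mono: "mono_V (equalizer V f g)"
proof -
  note e = equalizer_is[OF assms]
  show *: "equalizer V f g \<in> Arr V" "Cod V (equalizer V f g) = Dom V f"
    "f \<cdot> equalizer V f g = g \<cdot> equalizer V f g"
    using e unfolding is_equalizer_def by blast+
  show "mono_V (equalizer V f g)"
    unfolding mono_V_def
  proof (intro conjI allI impI)
    let ?e = "equalizer V f g"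
    fix u v assume h: "u \<in> Arr V \<and> v \<in> Arr V \<and> Dom V u = Dom V v \<and>
       Cod V u = Dom V ?e \<and> Cod V v = Dom V ?e \<and> ?e \<cdot> u = ?e \<cdot> v"
    have "f \<cdot> ?e \<cdot> u = g \<cdot> ?e \<cdot> u"
      using comp_extend[OF *(3)] h * assms by simp
    moreover have "?e \<cdot> u \<in> hom V (Dom V u) (Dom V f)" using h * by simp
    ultimately have "\<exists>!w. w \<in> hom V (Dom V u) (Dom V ?e) \<and> ?e \<cdot> w = ?e \<cdot> u"
      using e unfolding is_equalizer_def by blast
    then show "u = v" using h by auto
  qed (fact *)
qed

lemma equalizer_factor:
  assumes "f \<in> Arr V" "g \<in> Arr V" "Dom V f = Dom V g" "Cod V f = Cod V g"
    "u \<in> Arr V" "Cod V u = Dom V f" "f \<cdot> u = g \<cdot> u"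
  shows "factor V (equalizer V f g) u \<in> Arr V"
    "Dom V (factor V (equalizer V f g) u) = Dom V u"
    "Cod V (factor V (equalizer V f g) u) = Dom V (equalizer V f g)"
    "equalizer V f g \<cdot> factor V (equalizer V f g) u = u"
proof -
  have "\<exists>!h. h \<in> hom V (Dom V u) (Dom V (equalizer V f g)) \<and> equalizer V f g \<cdot> h = u"
  proof -
    have "u \<in> hom V (Dom V u) (Dom V f) \<and> f \<cdot> u = g \<cdot> u" using assms by simp
    with equalizer_is[OF assms(1-4)] show ?thesis unfolding is_equalizer_def by blast
  qed
  from theI'[OF this] show "factor V (equalizer V f g) u \<in> Arr V"
    "Dom V (factor V (equalizer V f g) u) = Dom V u"
    "Cod V (factor V (equalizer V f g) u) = Dom V (equalizer V f g)"
    "equalizer V f g \<cdot> factor V (equalizer V f g) u = u"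
    unfolding factor_def by auto
qed

text \<open>The usual construction: equalize the two composites out of the product of the
  domains.\<close>

lemma pullback_exists:
  assumes "f \<in> Arr V" "g \<in> Arr V" "Cod V f = Cod V g"
  shows "\<exists>p p1 p2. is_pullback V f g p p1 p2"
proof -
  let ?x = "Dom V f" let ?y = "Dom V g"
  let ?a = "f \<cdot> pr1 V ?x ?y" and ?b = "g \<cdot> pr2 V ?x ?y"
  have ab: "?a \<in> Arr V" "?b \<in> Arr V" "Dom V ?a = Dom V ?b" "Cod V ?a = Cod V ?b"
    using assms by auto
  note e = equalizer_props[OF ab]
  let ?e = "equalizer V ?a ?b"
  have ec: "Cod V ?e = prd V ?x ?y" using e(2) assms by simp
  have "is_pullback V f g (Dom V ?e) (pr1 V ?x ?y \<cdot> ?e) (pr2 V ?x ?y \<cdot> ?e)"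
    unfolding is_pullback_def
  proof (intro conjI allI impI)
    show "Dom V ?e \<in> Obj V" "pr1 V ?x ?y \<cdot> ?e \<in> hom V (Dom V ?e) ?x"
      "pr2 V ?x ?y \<cdot> ?e \<in> hom V (Dom V ?e) ?y" using e(1) ec assms by auto
    show "f \<cdot> pr1 V ?x ?y \<cdot> ?e = g \<cdot> pr2 V ?x ?y \<cdot> ?e"
      using e(1,3) ec assms by simp
    fix z u v assume uv: "u \<in> hom V z ?x \<and> v \<in> hom V z ?y \<and> f \<cdot> u = g \<cdot> v"
    let ?h = "factor V ?e (pair V u v)"
    have h: "?h \<in> Arr V" "Dom V ?h = z" "Cod V ?h = Dom V ?e" "?e \<cdot> ?h = pair V u v"
      using equalizer_factor[OF ab, of "pair V u v"] uv assms by auto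
    show "\<exists>!h. h \<in> hom V z (Dom V ?e) \<and> (pr1 V ?x ?y \<cdot> ?e) \<cdot> h = u \<and> (pr2 V ?x ?y \<cdot> ?e) \<cdot> h = v"
    proof (rule ex1I[of _ ?h])
      show "?h \<in> hom V z (Dom V ?e) \<and> (pr1 V ?x ?y \<cdot> ?e) \<cdot> ?h = u \<and> (pr2 V ?x ?y \<cdot> ?e) \<cdot> ?h = v"
        using h uv e(1) ec assms by simp
    next
      fix k assume k: "k \<in> hom V z (Dom V ?e) \<and> (pr1 V ?x ?y \<cdot> ?e) \<cdot> k = u \<and> (pr2 V ?x ?y \<cdot> ?e) \<cdot> k = v"
      have "?e \<cdot> k = pair V u v"
        by (rule pair_eqI[of ?x ?y]) (use k uv e(1) ec assms in auto)
      then show "k = ?h"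
        using mono_V_D[OF e(4), of k ?h] h k by simp
    qed
  qed
  then show ?thesis by blast
qed

lemma pbk_is:
  assumes "f \<in> Arr V" "g \<in> Arr V" "Cod V f = Cod V g"
  shows "is_pullback V f g (pbk V f g) (pbk1 V f g) (pbk2 V f g)"
proof -
  have "case pullback_choice V f g of (p, p1, p2) \<Rightarrow> is_pullback V f g p p1 p2"
    unfolding pullback_choice_def using pullback_exists[OF assms]
    by (intro someI_ex[of "\<lambda>(p, p1, p2). is_pullback V f g p p1 p2"]) auto
  then show ?thesis
    unfolding pbk_def pbk1_def pbk2_def by (simp add: case_prod_beta)
qed

lemma pbk_typing [simp]:
  assumes "f \<in> Arr V" "g \<in> Arr V" "Cod V f = Cod V g"
  shows "pbk V f g \<in> Obj V" "pbk1 V f g \<in> Arr V" "pbk2 V f g \<in> Arr V"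
    "Dom V (pbk1 V f g) = pbk V f g" "Dom V (pbk2 V f g) = pbk V f g"
    "Cod V (pbk1 V f g) = Dom V f" "Cod V (pbk2 V f g) = Dom V g"
  using pbk_is[OF assms] unfolding is_pullback_def by auto

lemma pbk_square:
  assumes "f \<in> Arr V" "g \<in> Arr V" "Cod V f = Cod V g"
  shows "f \<cdot> pbk1 V f g = g \<cdot> pbk2 V f g"
  using pbk_is[OF assms] unfolding is_pullback_def by auto

lemma pullback_lift:
  assumes "is_pullback V f g p p1 p2" "f \<in> Arr V" "g \<in> Arr V"
    "u \<in> Arr V" "v \<in> Arr V" "Cod V u = Dom V f" "Cod V v = Dom V g" "Dom V u = Dom V v" "f \<cdot> u = g \<cdot> v"
  obtains h where "h \<in> Arr V" "Dom V h = Dom V v" "Cod V h = p" "p1 \<cdot> h = u" "p2 \<cdot> h = v"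
proof -
  have "u \<in> hom V (Dom V v) (Dom V f) \<and> v \<in> hom V (Dom V v) (Dom V g) \<and> f \<cdot> u = g \<cdot> v"
    using assms by simp
  with assms(1) have "\<exists>h. h \<in> hom V (Dom V v) p \<and> p1 \<cdot> h = u \<and> p2 \<cdot> h = v"
    unfolding is_pullback_def by blast
  then show thesis using that by auto
qed

lemma pullback_eqI:
  assumes "is_pullback V f g p p1 p2" "f \<in> Arr V" "g \<in> Arr V"
    "h \<in> Arr V" "k \<in> Arr V" "Cod V h = p" "Cod V k = p" "Dom V h = Dom V k"
    "p1 \<cdot> h = p1 \<cdot> k" "p2 \<cdot> h = p2 \<cdot> k"
  shows "h = k"
proof -
  have t: "p1 \<in> Arr V" "p2 \<in> Arr V" "Dom V p1 = p" "Dom V p2 = p" "Cod V p1 = Dom V f"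
    "Cod V p2 = Dom V g" "f \<cdot> p1 = g \<cdot> p2"
    using assms(1) unfolding is_pullback_def by auto
  have "f \<cdot> p1 \<cdot> k = g \<cdot> p2 \<cdot> k"
    using comp_extend[OF t(7), of k] t assms by simp
  moreover have "p1 \<cdot> k \<in> hom V (Dom V k) (Dom V f)" "p2 \<cdot> k \<in> hom V (Dom V k) (Dom V g)"
    using t assms by simp_all
  ultimately have "\<exists>!w. w \<in> hom V (Dom V k) p \<and> p1 \<cdot> w = p1 \<cdot> k \<and> p2 \<cdot> w = p2 \<cdot> k"
    using assms(1) unfolding is_pullback_def by blast
  then show ?thesis using assms by auto
qed

end

section \<open>Fullness and essential surjectivity of an equivalence\<close>

lemma is_iso_inverse:
  assumes "is_iso C f"
  obtains g where "f \<in> Arr C" "g \<in> Arr C" "Dom C g = Cod C f" "Cod C g = Dom C f"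
    "Comp C g f = Ident C (Dom C f)" "Comp C f g = Ident C (Cod C f)"
  using assms unfolding is_iso_def by auto

text \<open>The preimage of \<open>t\<close> is the inverse of \<open>\<eta> b\<close>, after
  \<open>G t\<close>, after \<open>\<eta> a\<close>. Naturality of \<open>\<eta>\<close> shows that
  it has the same image under \<open>G F\<close> as \<open>t\<close> under \<open>G\<close>;
  naturality of \<open>\<epsilon>\<close> makes \<open>G\<close> faithful enough to remove
  \<open>G\<close>. No triangle identity is involved.\<close>

lemma equivalence_full:
  assumes "is_equivalence C D F" "a \<in> Obj C" "b \<in> Obj C" "t \<in> hom D (FObj F a) (FObj F b)"
  obtains h where "h \<in> hom C a b" "FArr F h = t"
proof -
  obtain G \<eta> \<epsilon> where F: "cat_functor C D F" and G: "cat_functor D C G"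
    and \<eta>: "nat_iso C C id_fct (comp_fct G F) \<eta>" and \<epsilon>: "nat_iso D D (comp_fct F G) id_fct \<epsilon>"
    using assms(1) unfolding is_equivalence_def by blast
  interpret F: cat_functor C D F by (fact F)
  interpret G: cat_functor D C G by (fact G)
  have \<eta>_iso: "\<eta> x \<in> hom C x (FObj G (FObj F x))" "is_iso C (\<eta> x)" if "x \<in> Obj C" for x
    using \<eta> that unfolding nat_iso_def id_fct_def comp_fct_def by auto
  have \<eta>_nat: "Comp C (\<eta> y) f = Comp C (FArr G (FArr F f)) (\<eta> x)" if "f \<in> hom C x y" for f x y
    using \<eta> that unfolding nat_iso_def id_fct_def comp_fct_def by auto
  have \<epsilon>_iso: "\<epsilon> x \<in> hom D (FObj F (FObj G x)) x" "is_iso D (\<epsilon> x)" if "x \<in> Obj D" for x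
    using \<epsilon> that unfolding nat_iso_def id_fct_def comp_fct_def by auto
  have \<epsilon>_nat: "Comp D (\<epsilon> y) (FArr F (FArr G f)) = Comp D f (\<epsilon> x)" if "f \<in> hom D x y" for f x y
    using \<epsilon> that unfolding nat_iso_def id_fct_def comp_fct_def by auto
  have Fab: "FObj F a \<in> Obj D" "FObj F b \<in> Obj D" using assms F.map_obj by auto
  have Gt: "FArr G t \<in> hom C (FObj G (FObj F a)) (FObj G (FObj F b))"
    using G.map_hom assms(4) by blast
  obtain \<eta>a where a: "\<eta>a \<in> Arr C" "Dom C \<eta>a = FObj G (FObj F a)" "Cod C \<eta>a = a"
    "Comp C (\<eta> a) \<eta>a = Ident C (FObj G (FObj F a))"
    using is_iso_inverse[OF \<eta>_iso(2)[OF assms(2)]] \<eta>_iso(1)[OF assms(2)] by auto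
  obtain \<eta>b where b: "\<eta>b \<in> Arr C" "Dom C \<eta>b = FObj G (FObj F b)" "Cod C \<eta>b = b"
    "Comp C (\<eta> b) \<eta>b = Ident C (FObj G (FObj F b))"
    using is_iso_inverse[OF \<eta>_iso(2)[OF assms(3)]] \<eta>_iso(1)[OF assms(3)] by auto
  obtain \<epsilon>a where ea: "\<epsilon>a \<in> Arr D" "Dom D \<epsilon>a = FObj F a" "Cod D \<epsilon>a = FObj F (FObj G (FObj F a))"
    "Comp D (\<epsilon> (FObj F a)) \<epsilon>a = Ident D (FObj F a)"
    using is_iso_inverse[OF \<epsilon>_iso(2)[OF Fab(1)]] \<epsilon>_iso(1)[OF Fab(1)] by auto
  note e1 = \<eta>_iso(1)[OF assms(2)] \<eta>_iso(1)[OF assms(3)] \<epsilon>_iso(1)[OF Fab(1)] \<epsilon>_iso(1)[OF Fab(2)]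
  define h where "h = Comp C \<eta>b (Comp C (FArr G t) (\<eta> a))"
  have h: "h \<in> hom C a b"
    unfolding h_def using a b Gt e1 by simp
  then have Fh: "FArr F h \<in> hom D (FObj F a) (FObj F b)" by (rule F.map_hom)
  then have GFh: "FArr G (FArr F h) \<in> hom C (FObj G (FObj F a)) (FObj G (FObj F b))" by (rule G.map_hom)
  have "Comp C (FArr G (FArr F h)) (\<eta> a) = Comp C (\<eta> b) h"
    using \<eta>_nat[OF h] by simp
  also have "\<dots> = Comp C (Comp C (\<eta> b) \<eta>b) (Comp C (FArr G t) (\<eta> a))"
    unfolding h_def using b(1-3) Gt e1 by simp
  also have "\<dots> = Comp C (FArr G t) (\<eta> a)"
    unfolding b(4) using Gt e1 by simp
  finally have "Comp C (Comp C (FArr G (FArr F h)) (\<eta> a)) \<eta>a = Comp C (Comp C (FArr G t) (\<eta> a)) \<eta>a"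
    by simp
  then have eq: "FArr G (FArr F h) = FArr G t"
    using a GFh Gt e1 by simp
  \<comment> \<open>Both sides equal \<open>\<epsilon> (FObj F b)\<close> after \<open>F\<close> of
    the common value \<open>G (F h) = G t\<close>; the right inverse of
    \<open>\<epsilon> (FObj F a)\<close> then cancels.\<close>
  have "Comp D (FArr F h) (\<epsilon> (FObj F a)) = Comp D t (\<epsilon> (FObj F a))"
    using \<epsilon>_nat[OF Fh] \<epsilon>_nat[OF assms(4)] eq by simp
  then have "Comp D (Comp D (FArr F h) (\<epsilon> (FObj F a))) \<epsilon>a = Comp D (Comp D t (\<epsilon> (FObj F a))) \<epsilon>a"
    by simp
  then have "FArr F h = t"
    using ea Fh assms(4) e1 by simp
  with h show thesis by (rule that)
qed

lemma equivalence_ess_surj: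
  assumes "is_equivalence C D F" "y \<in> Obj D"
  obtains a e where "a \<in> Obj C" "e \<in> hom D (FObj F a) y" "is_iso D e"
proof -
  obtain G \<epsilon> where "cat_functor D C G" and \<epsilon>: "nat_iso D D (comp_fct F G) id_fct \<epsilon>"
    using assms(1) unfolding is_equivalence_def by blast
  then interpret G: cat_functor D C G by blast
  have "FObj G y \<in> Obj C" using assms(2) by (rule G.map_obj)
  moreover have "\<epsilon> y \<in> hom D (FObj F (FObj G y)) y" "is_iso D (\<epsilon> y)"
    using \<epsilon> assms(2) unfolding nat_iso_def id_fct_def comp_fct_def by auto
  ultimately show thesis by (rule that)
qed

context ambient
begin

subsection \<open>Small sets\<close>

lemma small_inj:
  assumes "inj_on f A" "f ` A \<subseteq> B" "small \<kappa> B"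
  shows "small \<kappa> A"
  using assms card_of_ordLeq[of A B] unfolding small_def by (metis ordLeq_ordLess_trans)

lemma small_finite:
  assumes "finite A"
  shows "small \<kappa> A"
proof -
  have "Well_order \<kappa>" using card_order by (simp add: card_order_on_def)
  then show ?thesis
    unfolding small_def using assms infinite_Field
    by (intro finite_ordLess_infinite) (auto simp: Field_card_of intro: card_of_well_order_on)
qed

text \<open>The product embeds into the square of the disjoint sum. The sum of two small sets is
  small because \<open>\<kappa>\<close> is infinite, and an infinite set is equipotent to its
  square.\<close>

lemma small_Times:
  assumes "small \<kappa> A" "small \<kappa> B"
  shows "small \<kappa> (A \<times> B)"
proof (cases "finite (A <+> B)")
  case True
  then have "finite (A \<times> B)" by auto
  then show ?thesis by (rule small_finite)
next
  case False
  let ?C = "A <+> B"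
  have C: "|?C| <o \<kappa>"
    using assms infinite_Field card_order unfolding small_def
    by (intro card_of_Plus_ordLess_infinite_Field)
  have "inj_on (map_prod Inl Inr) (A \<times> B)" "map_prod Inl Inr ` (A \<times> B) \<subseteq> ?C \<times> ?C"
    by (auto simp: inj_on_def)
  then have "|A \<times> B| \<le>o |?C \<times> ?C|"
    using card_of_ordLeq by blast
  also have "|?C \<times> ?C| =o |?C|"
    using card_of_Times_same_infinite False by blast
  finally have "|A \<times> B| \<le>o |?C|" .
  then show ?thesis
    unfolding small_def using C by (rule ordLeq_ordLess_trans)
qed

text \<open>The field of \<open>\<kappa>\<close> consists of elements of the arrow type, so a small
  set of any type injects into it. This connects the hypotheses on \<open>V\<close>, stated for
  index sets of type \<open>'a set\<close>, with index sets of pairs and triples.\<close>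

lemma small_encoding:
  assumes "small \<kappa> (I :: 'i set)"
  obtains e :: "'i \<Rightarrow> 'a" where "inj_on e I" "small \<kappa> (e ` I)"
proof -
  have "|I| \<le>o \<kappa>" using assms unfolding small_def by (rule ordLess_imp_ordLeq)
  then have "|I| \<le>o |Field \<kappa>|"
    using card_of_Field_ordIso[OF card_order] ordIso_symmetric ordLeq_ordIso_trans by blast
  then obtain e where e: "inj_on e I" "e ` I \<subseteq> Field \<kappa>"
    using card_of_ordLeq[of I "Field \<kappa>"] by auto
  have "small \<kappa> (e ` I)"
    by (rule small_inj[of "inv_into I e" _ I]) (use e assms in \<open>auto simp: inj_on_inv_into inv_into_into\<close>)
  with e(1) show thesis by (rule that)
qed

subsection \<open>Coproducts\<close>

lemma coproductD:
  assumes "is_coproduct V I x s j"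
  shows "s \<in> Obj V" "i \<in> I \<Longrightarrow> j i \<in> Arr V" "i \<in> I \<Longrightarrow> Dom V (j i) = x i" "i \<in> I \<Longrightarrow> Cod V (j i) = s"
    "i \<in> I \<Longrightarrow> x i \<in> Obj V"
proof -
  show *: "s \<in> Obj V" "i \<in> I \<Longrightarrow> j i \<in> Arr V" "i \<in> I \<Longrightarrow> Dom V (j i) = x i" "i \<in> I \<Longrightarrow> Cod V (j i) = s"
    using assms unfolding is_coproduct_def by auto
  show "i \<in> I \<Longrightarrow> x i \<in> Obj V" using *(2,3) obj_dom by metis
qed

lemma coproduct_ex1:
  assumes "is_coproduct V I x s j" "t \<in> Obj V" "\<And>i. i \<in> I \<Longrightarrow> f i \<in> hom V (x i) t"
  shows "\<exists>!h. h \<in> hom V s t \<and> (\<forall>i \<in> I. h \<cdot> j i = f i)"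
proof -
  have *: "t \<in> Obj V \<and> (\<forall>i \<in> I. f i \<in> hom V (x i) t)" using assms by blast
  have "\<forall>t f. t \<in> Obj V \<and> (\<forall>i \<in> I. f i \<in> hom V (x i) t) \<longrightarrow>
        (\<exists>!h. h \<in> hom V s t \<and> (\<forall>i \<in> I. h \<cdot> j i = f i))"
    using assms(1) unfolding is_coproduct_def by (elim conjE)
  then show ?thesis using * by (elim allE[of _ t] allE[of _ f] impE)
qed

lemma coproduct_glue:
  assumes "is_coproduct V I x s j" "t \<in> Obj V" "\<And>i. i \<in> I \<Longrightarrow> f i \<in> hom V (x i) t"
  obtains h where "h \<in> Arr V" "Dom V h = s" "Cod V h = t" "\<forall>i \<in> I. h \<cdot> j i = f i"
  using ex1_implies_ex[OF coproduct_ex1[OF assms]] by auto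

lemma coproduct_eqI:
  assumes "is_coproduct V I x s j" "u \<in> Arr V" "v \<in> Arr V" "Dom V u = s" "Dom V v = s" "Cod V u = Cod V v"
    "\<And>i. i \<in> I \<Longrightarrow> u \<cdot> j i = v \<cdot> j i"
  shows "u = v"
proof -
  have "\<And>i. i \<in> I \<Longrightarrow> v \<cdot> j i \<in> hom V (x i) (Cod V v)"
    using coproductD[OF assms(1)] assms by simp
  moreover have "Cod V v \<in> Obj V" using assms by simp
  ultimately have "\<exists>!h. h \<in> hom V s (Cod V v) \<and> (\<forall>i \<in> I. h \<cdot> j i = v \<cdot> j i)"
    by (intro coproduct_ex1[OF assms(1)])
  moreover have "u \<in> hom V s (Cod V v) \<and> (\<forall>i \<in> I. u \<cdot> j i = v \<cdot> j i)"
    "v \<in> hom V s (Cod V v) \<and> (\<forall>i \<in> I. v \<cdot> j i = v \<cdot> j i)"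
    using assms by simp_all
  ultimately show ?thesis by blast
qed

lemma coproductI:
  assumes "s \<in> Obj V" "\<And>i. i \<in> I \<Longrightarrow> j i \<in> hom V (x i) s"
    "\<And>t f. t \<in> Obj V \<Longrightarrow> (\<And>i. i \<in> I \<Longrightarrow> f i \<in> hom V (x i) t) \<Longrightarrow>
       \<exists>h \<in> hom V s t. \<forall>i \<in> I. h \<cdot> j i = f i"
    "\<And>t u v. u \<in> hom V s t \<Longrightarrow> v \<in> hom V s t \<Longrightarrow> (\<And>i. i \<in> I \<Longrightarrow> u \<cdot> j i = v \<cdot> j i) \<Longrightarrow> u = v"
  shows "is_coproduct V I x s j"
  unfolding is_coproduct_def
proof (intro conjI allI impI ballI)
  fix t f assume *: "t \<in> Obj V \<and> (\<forall>i \<in> I. f i \<in> hom V (x i) t)"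
  then obtain h where h: "h \<in> hom V s t" "\<forall>i \<in> I. h \<cdot> j i = f i"
    using assms(3)[of t f] by auto
  show "\<exists>!h. h \<in> hom V s t \<and> (\<forall>i \<in> I. h \<cdot> j i = f i)"
  proof (rule ex1I[of _ h])
    show "h \<in> hom V s t \<and> (\<forall>i \<in> I. h \<cdot> j i = f i)" using h by blast
    fix k assume "k \<in> hom V s t \<and> (\<forall>i \<in> I. k \<cdot> j i = f i)"
    then show "k = h" using assms(4)[of k t h] h by auto
  qed
qed (use assms in blast)+

lemma coproduct_reindex:
  assumes "is_coproduct V I x s j" "bij_betw g I' I"
  shows "is_coproduct V I' (\<lambda>i. x (g i)) s (\<lambda>i. j (g i))"
proof (rule coproductI)
  have g: "g i \<in> I" if "i \<in> I'" for i using assms(2) that by (auto simp: bij_betw_def)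
  note c = coproductD[OF assms(1)]
  show "s \<in> Obj V" "\<And>i. i \<in> I' \<Longrightarrow> j (g i) \<in> hom V (x (g i)) s" using c g by auto
  have inv: "inv_into I' g i \<in> I'" "g (inv_into I' g i) = i" if "i \<in> I" for i
    using assms(2) that by (auto simp: bij_betw_def inv_into_into f_inv_into_f)
  have inv': "inv_into I' g (g i) = i" if "i \<in> I'" for i
    using assms(2) that by (auto simp: bij_betw_def)
  show "\<exists>h \<in> hom V s t. \<forall>i \<in> I'. h \<cdot> j (g i) = f i"
    if t: "t \<in> Obj V" "\<And>i. i \<in> I' \<Longrightarrow> f i \<in> hom V (x (g i)) t" for t f
  proof -
    have f: "\<And>i. i \<in> I \<Longrightarrow> f (inv_into I' g i) \<in> hom V (x i) t"
      using t inv by metis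
    obtain h where
      h: "h \<in> Arr V" "Dom V h = s" "Cod V h = t" "\<forall>i \<in> I. h \<cdot> j i = f (inv_into I' g i)"
      by (rule coproduct_glue[OF assms(1) t(1) f])
    then have "\<forall>i \<in> I'. h \<cdot> j (g i) = f i" using g inv' by simp
    with h show ?thesis by auto
  qed
  show "u = v" if "u \<in> hom V s t" "v \<in> hom V s t" "\<And>i. i \<in> I' \<Longrightarrow> u \<cdot> j (g i) = v \<cdot> j (g i)" for t u v
  proof (rule coproduct_eqI[OF assms(1)])
    show "u \<cdot> j i = v \<cdot> j i" if "i \<in> I" for i
      using \<open>\<And>i. i \<in> I' \<Longrightarrow> u \<cdot> j (g i) = v \<cdot> j (g i)\<close>[of "inv_into I' g i"] inv that by simp
  qed (use that in auto)
qed

lemma coproduct_iso: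
  assumes "is_coproduct V I x s j" "is_coproduct V I x s' j'"
  obtains \<theta> \<theta>' where "\<theta> \<in> Arr V" "Dom V \<theta> = s" "Cod V \<theta> = s'" "\<theta>' \<in> Arr V" "Dom V \<theta>' = s'" "Cod V \<theta>' = s"
    "\<theta>' \<cdot> \<theta> = Ident V s" "\<theta> \<cdot> \<theta>' = Ident V s'" "\<forall>i \<in> I. \<theta> \<cdot> j i = j' i"
    "\<forall>i \<in> I. \<theta>' \<cdot> j' i = j i"
proof -
  note c = coproductD[OF assms(1)] coproductD[OF assms(2)]
  obtain \<theta> where t: "\<theta> \<in> Arr V" "Dom V \<theta> = s" "Cod V \<theta> = s'" "\<forall>i \<in> I. \<theta> \<cdot> j i = j' i"
    using coproduct_glue[OF assms(1) c(6), of j'] c by auto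
  obtain \<theta>' where t': "\<theta>' \<in> Arr V" "Dom V \<theta>' = s'" "Cod V \<theta>' = s" "\<forall>i \<in> I. \<theta>' \<cdot> j' i = j i"
    using coproduct_glue[OF assms(2) c(1), of j] c by auto
  have "\<theta>' \<cdot> \<theta> = Ident V s"
    by (rule coproduct_eqI[OF assms(1)]) (use t t' c in auto)
  moreover have "\<theta> \<cdot> \<theta>' = Ident V s'"
    by (rule coproduct_eqI[OF assms(2)]) (use t t' c in auto)
  ultimately show thesis using that t t' by blast
qed

lemma coproduct_transport:
  assumes "is_coproduct V I x s j" "\<theta> \<in> Arr V" "Dom V \<theta> = s" "Cod V \<theta> = s'"
    "\<theta>' \<in> Arr V" "Dom V \<theta>' = s'" "Cod V \<theta>' = s" "\<theta>' \<cdot> \<theta> = Ident V s" "\<theta> \<cdot> \<theta>' = Ident V s'"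
  shows "is_coproduct V I x s' (\<lambda>i. \<theta> \<cdot> j i)"
proof (rule coproductI)
  note c = coproductD[OF assms(1)]
  show "s' \<in> Obj V" "\<And>i. i \<in> I \<Longrightarrow> \<theta> \<cdot> j i \<in> hom V (x i) s'" using c assms by auto
  show "\<exists>h \<in> hom V s' t. \<forall>i \<in> I. h \<cdot> \<theta> \<cdot> j i = f i"
    if t: "t \<in> Obj V" "\<And>i. i \<in> I \<Longrightarrow> f i \<in> hom V (x i) t" for t f
  proof -
    obtain h where h: "h \<in> Arr V" "Dom V h = s" "Cod V h = t" "\<forall>i \<in> I. h \<cdot> j i = f i"
      by (rule coproduct_glue[OF assms(1) t])
    have "(h \<cdot> \<theta>') \<cdot> \<theta> \<cdot> j i = f i" if "i \<in> I" for i
      using comp_extend[OF assms(8), of "j i"] that h c assms by simp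
    then show ?thesis using h assms by (intro bexI[of _ "h \<cdot> \<theta>'"]) auto
  qed
  show "u = v" if uv: "u \<in> hom V s' t" "v \<in> hom V s' t" "\<And>i. i \<in> I \<Longrightarrow> u \<cdot> \<theta> \<cdot> j i = v \<cdot> \<theta> \<cdot> j i" for t u v
  proof -
    have "u \<cdot> \<theta> = v \<cdot> \<theta>"
      by (rule coproduct_eqI[OF assms(1)]) (use uv c assms in auto)
    then have "(u \<cdot> \<theta>) \<cdot> \<theta>' = (v \<cdot> \<theta>) \<cdot> \<theta>'" by simp
    then show ?thesis using uv assms by simp
  qed
qed

text \<open>A coproduct over the encoded index set exists by assumption and is reindexed along the
  encoding; only then is the choice behind \<open>coprod\<close> justified at an arbitrary index
  type.\<close>

lemma coprod_is_coproduct: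
  assumes "small \<kappa> (I :: 'i set)" "\<And>i. i \<in> I \<Longrightarrow> x i \<in> Obj V"
  shows "is_coproduct V I x (coprod V I x) (inj_coprod V I x)"
proof -
  obtain e :: "'i \<Rightarrow> 'a" where e: "inj_on e I" "small \<kappa> (e ` I)"
    using small_encoding[OF assms(1)] .
  have "small \<kappa> (e ` I) \<and> (\<forall>i \<in> e ` I. x (inv_into I e i) \<in> Obj V)"
    using assms(2) e(2) by (simp add: inv_into_into)
  then have "\<exists>s j. is_coproduct V (e ` I) (\<lambda>i. x (inv_into I e i)) s j"
    using small_coproducts unfolding has_small_coproducts_def
    by (elim allE[of _ "e ` I"] allE[of _ "\<lambda>i. x (inv_into I e i)"] impE)
  then obtain s j where sj: "is_coproduct V (e ` I) (\<lambda>i. x (inv_into I e i)) s j"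
    by blast
  have "bij_betw e I (e ` I)" using e by (simp add: bij_betw_def)
  from coproduct_reindex[OF sj this] have "is_coproduct V I x s (\<lambda>i. j (e i))"
    unfolding is_coproduct_def using e by (simp cong: ball_cong)
  then have "case coprod_choice V I x of (s, j) \<Rightarrow> is_coproduct V I x s j"
    unfolding coprod_choice_def
    by (intro someI_ex[of "\<lambda>(s, j). is_coproduct V I x s j"]) auto
  then show ?thesis
    unfolding coprod_def inj_coprod_def by (simp add: case_prod_beta)
qed

lemma cotuple_props:
  assumes "small \<kappa> I" "t \<in> Obj V" "\<And>i. i \<in> I \<Longrightarrow> x i \<in> Obj V" "\<And>i. i \<in> I \<Longrightarrow> f i \<in> hom V (x i) t"
  shows "cotuple V I x t f \<in> Arr V" "Dom V (cotuple V I x t f) = coprod V I x"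
    "Cod V (cotuple V I x t f) = t"
    "i \<in> I \<Longrightarrow> cotuple V I x t f \<cdot> inj_coprod V I x i = f i"
proof -
  have "\<exists>!h. h \<in> hom V (coprod V I x) t \<and> (\<forall>i \<in> I. h \<cdot> inj_coprod V I x i = f i)"
    by (intro coproduct_ex1[OF coprod_is_coproduct]) (use assms in auto)
  from theI'[OF this]
  show "cotuple V I x t f \<in> Arr V" "Dom V (cotuple V I x t f) = coprod V I x"
    "Cod V (cotuple V I x t f) = t"
    "i \<in> I \<Longrightarrow> cotuple V I x t f \<cdot> inj_coprod V I x i = f i"
    unfolding cotuple_def by auto
qed

section \<open>Initial objects\<close>

definition initial :: "'o \<Rightarrow> bool" where
  "initial z \<longleftrightarrow> z \<in> Obj V \<and> (\<forall>t \<in> Obj V. \<exists>!h. h \<in> hom V z t)"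

lemma initial_eq:
  assumes "initial z" "u \<in> Arr V" "v \<in> Arr V" "Dom V u = z" "Dom V v = z" "Cod V u = Cod V v"
  shows "u = v"
proof -
  have "\<exists>!h. h \<in> hom V z (Cod V v)" using assms obj_cod unfolding initial_def by blast
  then show ?thesis using assms by (metis in_hom)
qed

lemma initial_arrow:
  assumes "initial z" "t \<in> Obj V"
  obtains h where "h \<in> Arr V" "Dom V h = z" "Cod V h = t"
  using assms unfolding initial_def by (metis in_hom)

lemma initial_exists: "\<exists>z. initial z"
proof -
  \<comment> \<open>The family is indexed by the empty set, so its value is arbitrary; its coproduct
    is initial.\<close>
  let ?x = "\<lambda>_ :: 'a. undefined :: 'o"
  have "is_coproduct V {} ?x (coprod V {} ?x) (inj_coprod V {} ?x)"
    by (rule coprod_is_coproduct) (auto intro: small_finite)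
  then have "initial (coprod V {} ?x)"
    unfolding is_coproduct_def initial_def by simp
  then show ?thesis by blast
qed

text \<open>This is how a stage is recognised as initial: it suffices to write its identity as a
  composite through a known initial object.\<close>

lemma initial_retract:
  assumes "initial z" "p \<in> Arr V" "Dom V p = T" "Cod V p = z" "q \<in> Arr V" "Dom V q = z" "Cod V q = T"
    "q \<cdot> p = Ident V T"
  shows "initial T"
  unfolding initial_def
proof (intro conjI ballI)
  show T: "T \<in> Obj V" using assms by auto
  fix t assume "t \<in> Obj V"
  then obtain h where h: "h \<in> Arr V" "Dom V h = z" "Cod V h = t"
    by (rule initial_arrow[OF assms(1)])
  show "\<exists>!h. h \<in> hom V T t"
  proof (rule ex1I[of _ "h \<cdot> p"])
    show "h \<cdot> p \<in> hom V T t" using h assms by simp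
    fix k assume k: "k \<in> hom V T t"
    have "k \<cdot> q = h" by (rule initial_eq[OF assms(1)]) (use k h assms in auto)
    then have "(k \<cdot> q) \<cdot> p = h \<cdot> p" by simp
    then show "k = h \<cdot> p" using k assms by simp
  qed
qed

subsection \<open>Extensivity\<close>

lemma extensive_equivalence:
  fixes I :: "'a set"
  assumes "small \<kappa> I" "\<And>i. i \<in> I \<Longrightarrow> x i \<in> Obj V"
  shows "is_equivalence (prod_cat I (\<lambda>i. slice V (x i))) (slice V (coprod V I x)) (coprod_fct V I x)"
proof -
  have "small \<kappa> I \<and> (\<forall>i \<in> I. x i \<in> Obj V)" using assms by blast
  then show ?thesis
    using extensive_V unfolding extensive_def by (elim allE[of _ I] allE[of _ x] impE)
qed

lemma slice_obj: "f \<in> Obj (slice V x) \<longleftrightarrow> f \<in> Arr V \<and> Cod V f = x"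
  by (simp add: slice_def)

lemma coprod_fct_obj:
  "FObj (coprod_fct V I x) f =
     cotuple V I (\<lambda>i. Dom V (f i)) (coprod V I x) (\<lambda>i. inj_coprod V I x i \<cdot> f i)"
  by (simp add: coprod_fct_def Let_def)

lemma coprod_fct_arr:
  assumes "t \<in> hom (prod_cat I (\<lambda>i. slice V (x i))) a b"
  shows "a \<in> extensional I" "b \<in> extensional I"
    "\<And>i. i \<in> I \<Longrightarrow> fst (snd (t i)) \<in> hom V (Dom V (a i)) (Dom V (b i)) \<and> b i \<cdot> fst (snd (t i)) = a i"
    "fst (snd (FArr (coprod_fct V I x) t)) =
       cotuple V I (\<lambda>i. Dom V (a i)) (coprod V I (\<lambda>i. Dom V (b i)))
         (\<lambda>i. inj_coprod V I (\<lambda>i. Dom V (b i)) i \<cdot> (\<lambda>i\<in>I. fst (snd (t i))) i)"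
proof -
  have t: "t \<in> (\<Pi>\<^sub>E i\<in>I. Arr (slice V (x i)))" and a: "a = (\<lambda>i\<in>I. fst (t i))"
    and b: "b = (\<lambda>i\<in>I. snd (snd (t i)))"
    using assms by (auto simp: prod_cat_def slice_def case_prod_beta)
  show "a \<in> extensional I" "b \<in> extensional I" by (simp_all add: a b)
  show "\<And>i. i \<in> I \<Longrightarrow> fst (snd (t i)) \<in> hom V (Dom V (a i)) (Dom V (b i)) \<and> b i \<cdot> fst (snd (t i)) = a i"
    using t by (force simp: a b slice_def PiE_def Pi_def)
  show "fst (snd (FArr (coprod_fct V I x) t)) =
       cotuple V I (\<lambda>i. Dom V (a i)) (coprod V I (\<lambda>i. Dom V (b i)))
         (\<lambda>i. inj_coprod V I (\<lambda>i. Dom V (b i)) i \<cdot> (\<lambda>i\<in>I. fst (snd (t i))) i)"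
    by (simp add: coprod_fct_def Let_def a b)
qed

text \<open>Fullness of the coproduct functor, unfolded.\<close>

lemma coprod_arrow_decompose:
  fixes I :: "'a set"
  assumes I: "small \<kappa> I" and x: "\<And>i. i \<in> I \<Longrightarrow> x i \<in> Obj V"
    and a: "\<And>i. i \<in> I \<Longrightarrow> a i \<in> Arr V \<and> Cod V (a i) = x i" "a \<in> extensional I"
    and b: "\<And>i. i \<in> I \<Longrightarrow> b i \<in> Arr V \<and> Cod V (b i) = x i" "b \<in> extensional I"
    and t: "t \<in> hom V (coprod V I (\<lambda>i. Dom V (a i))) (coprod V I (\<lambda>i. Dom V (b i)))"
    and over: "\<And>i. i \<in> I \<Longrightarrow> cotuple V I (\<lambda>i. Dom V (b i)) (coprod V I x) (\<lambda>i. inj_coprod V I x i \<cdot> b i) \<cdot>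
        t \<cdot> inj_coprod V I (\<lambda>i. Dom V (a i)) i = inj_coprod V I x i \<cdot> a i"
  obtains h where "\<And>i. i \<in> I \<Longrightarrow> h i \<in> hom V (Dom V (a i)) (Dom V (b i)) \<and> b i \<cdot> h i = a i \<and>
    t \<cdot> inj_coprod V I (\<lambda>i. Dom V (a i)) i = inj_coprod V I (\<lambda>i. Dom V (b i)) i \<cdot> h i"
proof -
  let ?A = "coprod V I (\<lambda>i. Dom V (a i))" and ?B = "coprod V I (\<lambda>i. Dom V (b i))"
  let ?F = "coprod_fct V I x"
  have ca: "is_coproduct V I (\<lambda>i. Dom V (a i)) ?A (inj_coprod V I (\<lambda>i. Dom V (a i)))"
    and cb: "is_coproduct V I (\<lambda>i. Dom V (b i)) ?B (inj_coprod V I (\<lambda>i. Dom V (b i)))"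
    and cx: "is_coproduct V I x (coprod V I x) (inj_coprod V I x)"
    by (rule coprod_is_coproduct; use I a b x in simp)+
  have inj: "inj_coprod V I x i \<cdot> a i \<in> hom V (Dom V (a i)) (coprod V I x)"
    "inj_coprod V I x i \<cdot> b i \<in> hom V (Dom V (b i)) (coprod V I x)" if "i \<in> I" for i
    using coproductD[OF cx] a b that by simp_all
  have Fa: "FObj ?F a \<in> Arr V" "Dom V (FObj ?F a) = ?A" "Cod V (FObj ?F a) = coprod V I x"
    "\<And>i. i \<in> I \<Longrightarrow> FObj ?F a \<cdot> inj_coprod V I (\<lambda>i. Dom V (a i)) i = inj_coprod V I x i \<cdot> a i"
    unfolding coprod_fct_obj by (rule cotuple_props; use I a coproductD(1)[OF cx] inj in simp)+
  have Fb: "FObj ?F b \<in> Arr V" "Dom V (FObj ?F b) = ?B" "Cod V (FObj ?F b) = coprod V I x"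
    unfolding coprod_fct_obj by (rule cotuple_props; use I b coproductD(1)[OF cx] inj in simp)+
  have eq: "FObj ?F b \<cdot> t = FObj ?F a"
  proof (rule coproduct_eqI[OF ca])
    show "(FObj ?F b \<cdot> t) \<cdot> inj_coprod V I (\<lambda>i. Dom V (a i)) i =
        FObj ?F a \<cdot> inj_coprod V I (\<lambda>i. Dom V (a i)) i" if "i \<in> I" for i
      using over[OF that] Fa Fb t coproductD[OF ca] that by (simp add: coprod_fct_obj[of I x b])
  qed (use Fa Fb t in simp_all)
  have ab: "a \<in> Obj (prod_cat I (\<lambda>i. slice V (x i)))" "b \<in> Obj (prod_cat I (\<lambda>i. slice V (x i)))"
    using a b by (auto simp: prod_cat_def slice_obj PiE_def)
  \<comment> \<open>The assumption \<open>over\<close>, glued along the injections, says that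
    \<open>t\<close> is an arrow of the slice between the images of \<open>a\<close> and
    \<open>b\<close>. Fullness lifts it to a family of slice arrows, whose middle components are the
    required \<open>h\<close>.\<close>
  have *: "(FObj ?F a, t, FObj ?F b) \<in> hom (slice V (coprod V I x)) (FObj ?F a) (FObj ?F b)"
    using Fa Fb t eq by (simp add: slice_def)
  obtain T where T: "T \<in> hom (prod_cat I (\<lambda>i. slice V (x i))) a b"
    "FArr ?F T = (FObj ?F a, t, FObj ?F b)"
    by (rule equivalence_full[OF extensive_equivalence[OF I x] ab *])
  note T' = coprod_fct_arr[OF T(1)]
  let ?h = "\<lambda>i. fst (snd (T i))"
  have "t = cotuple V I (\<lambda>i. Dom V (a i)) ?B
         (\<lambda>i. inj_coprod V I (\<lambda>i. Dom V (b i)) i \<cdot> (\<lambda>i\<in>I. ?h i) i)"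
    using T'(4) T(2) by simp
  moreover have "inj_coprod V I (\<lambda>i. Dom V (b i)) i \<cdot> (\<lambda>i\<in>I. ?h i) i \<in> hom V (Dom V (a i)) ?B"
    if "i \<in> I" for i
    using T'(3)[OF that] coproductD[OF cb] that by simp
  ultimately have "t \<cdot> inj_coprod V I (\<lambda>i. Dom V (a i)) i =
      inj_coprod V I (\<lambda>i. Dom V (b i)) i \<cdot> (\<lambda>i\<in>I. ?h i) i" if "i \<in> I" for i
    using cotuple_props(4)[of I ?B "\<lambda>i. Dom V (a i)"] I a coproductD(1)[OF cb] that by simp
  with T'(3) show thesis by (intro that[of ?h]) simp
qed

text \<open>Disjointness and monicity of the injections, both extracted from fullness. Put
  \<open>u\<close> at index \<open>i\<close>, respectively \<open>v\<close> at index
  \<open>j\<close>, and initial arrows elsewhere: both families have coproduct \<open>T\<close>, and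
  the identity of \<open>T\<close> becomes an arrow between them over \<open>coprod V I x\<close>,
  precisely because of \<open>eq\<close>. Its component at \<open>i\<close> compares
  \<open>u\<close> with \<open>v\<close> if \<open>i = j\<close>, and otherwise factors the identity
  of \<open>T\<close> through an initial object.\<close>

lemma coprod_inj_eq_aux:
  fixes I :: "'a set"
  assumes I: "small \<kappa> I" and x: "\<And>i. i \<in> I \<Longrightarrow> x i \<in> Obj V"
    and i: "i \<in> I" and j: "j \<in> I"
    and u: "u \<in> hom V T (x i)" and v: "v \<in> hom V T (x j)"
    and eq: "inj_coprod V I x i \<cdot> u = inj_coprod V I x j \<cdot> v"
  shows "if i = j then u = v else initial T"
proof -
  obtain z where z: "initial z" using initial_exists by blast
  define zt where "zt t = (SOME h. h \<in> hom V z t)" for t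
  have zt: "zt t \<in> Arr V" "Dom V (zt t) = z" "Cod V (zt t) = t" if "t \<in> Obj V" for t
  proof -
    have "\<exists>h. h \<in> hom V z t" using z that unfolding initial_def by blast
    then have "zt t \<in> hom V z t" unfolding zt_def by (rule someI_ex)
    then show "zt t \<in> Arr V" "Dom V (zt t) = z" "Cod V (zt t) = t" by auto
  qed
  have T: "T \<in> Obj V" "z \<in> Obj V" using u z unfolding initial_def by auto
  \<comment> \<open>\<open>T\<close> is the coproduct of the family with \<open>T\<close> at one index and the initial object elsewhere.\<close>
  define a where "a i u = (\<lambda>k\<in>I. if k = i then u else zt (x k))" for i u
  have a: "a i u \<in> extensional I" "k \<in> I \<Longrightarrow> a i u k \<in> Arr V \<and> Cod V (a i u k) = x k"
    "k \<in> I \<Longrightarrow> Dom V (a i u k) = (if k = i then T else z)"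
    if "i \<in> I" "u \<in> hom V T (x i)" for i u k
    using that zt x by (auto simp: a_def)
  let ?P = "\<lambda>i u. coprod V I (\<lambda>k. Dom V (a i u k))"
  let ?inj = "\<lambda>i u. inj_coprod V I (\<lambda>k. Dom V (a i u k))"
  have cP: "is_coproduct V I (\<lambda>k. Dom V (a i u k)) (?P i u) (?inj i u)"
    if "i \<in> I" "u \<in> hom V T (x i)" for i u
    by (rule coprod_is_coproduct) (use I a[OF that] T in simp_all)
  have cx: "is_coproduct V I x (coprod V I x) (inj_coprod V I x)"
    by (rule coprod_is_coproduct) (use I x in simp_all)
  note cPi = coproductD[OF cP[OF i u]] and cPj = coproductD[OF cP[OF j v]] and cxD = coproductD[OF cx]
  \<comment> \<open>\<open>\<theta>i\<close> and \<open>\<theta>j\<close> retract the injections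
    that carry \<open>T\<close>; they identify the two coproducts with \<open>T\<close>.\<close>
  obtain \<theta>i where \<theta>i: "\<theta>i \<in> Arr V" "Dom V \<theta>i = ?P i u" "Cod V \<theta>i = T"
      "\<forall>k \<in> I. \<theta>i \<cdot> ?inj i u k = (if k = i then Ident V T else zt T)"
    by (rule coproduct_glue[OF cP[OF i u] T(1), of "\<lambda>k. if k = i then Ident V T else zt T"]) (use a[OF i u] zt T in auto)
  obtain \<theta>j where \<theta>j: "\<theta>j \<in> Arr V" "Dom V \<theta>j = ?P j v" "Cod V \<theta>j = T"
      "\<forall>k \<in> I. \<theta>j \<cdot> ?inj j v k = (if k = j then Ident V T else zt T)"
    by (rule coproduct_glue[OF cP[OF j v] T(1), of "\<lambda>k. if k = j then Ident V T else zt T"]) (use a[OF j v] zt T in auto)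
  \<comment> \<open>This is the identity of \<open>T\<close>, read between the two presentations of
    \<open>T\<close> as a coproduct.\<close>
  define t where "t = ?inj j v j \<cdot> \<theta>i"
  have t: "t \<in> hom V (?P i u) (?P j v)"
    unfolding t_def using \<theta>i cPj j a(3)[OF j v j] by simp
  let ?F = "cotuple V I (\<lambda>k. Dom V (a j v k)) (coprod V I x) (\<lambda>k. inj_coprod V I x k \<cdot> a j v k)"
  have F: "?F \<in> Arr V" "Dom V ?F = ?P j v" "Cod V ?F = coprod V I x"
    "\<And>k. k \<in> I \<Longrightarrow> ?F \<cdot> ?inj j v k = inj_coprod V I x k \<cdot> a j v k"
    by (rule cotuple_props; use I a(2)[OF j v] cxD in simp)+
  have over: "?F \<cdot> t \<cdot> ?inj i u k = inj_coprod V I x k \<cdot> a i u k" if k: "k \<in> I" for k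
  proof (cases "k = i")
    case True
    have "?F \<cdot> t \<cdot> ?inj i u k = ?F \<cdot> ?inj j v j \<cdot> \<theta>i \<cdot> ?inj i u i"
      using True t_def \<theta>i cPj cPi i j a(3)[OF j v j] by simp
    also have "\<dots> = ?F \<cdot> ?inj j v j"
      using \<theta>i(4) i cPj(2,3)[OF j] a(3)[OF j v j] by simp
    also have "\<dots> = inj_coprod V I x j \<cdot> v"
      using F(4)[OF j] j by (simp add: a_def)
    finally show ?thesis using eq True i by (simp add: a_def)
  next
    case False
    then have "Dom V (a i u k) = z" using a(3)[OF i u k] by simp
    then show ?thesis
      by (intro initial_eq[OF z]) (use F t cPi(2-4)[OF k] cxD(2-4)[OF k] a(2)[OF i u k] in simp_all)
  qed
  obtain h where h: "\<And>k. k \<in> I \<Longrightarrow> h k \<in> hom V (Dom V (a i u k)) (Dom V (a j v k)) \<and>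
      a j v k \<cdot> h k = a i u k \<and> t \<cdot> ?inj i u k = ?inj j v k \<cdot> h k"
    by (rule coprod_arrow_decompose[OF I x a(2)[OF i u] a(1)[OF i u] a(2)[OF j v] a(1)[OF j v] t over]) auto
  have "?inj j v j = t \<cdot> ?inj i u i"
    using t_def \<theta>i i j cPi(2-4)[OF i] cPj(2-4)[OF j] a(3)[OF j v j] by simp
  also have "\<dots> = ?inj j v i \<cdot> h i" using h[OF i] by simp
  finally have "\<theta>j \<cdot> ?inj j v j = \<theta>j \<cdot> ?inj j v i \<cdot> h i" by simp
  also have "\<dots> = (\<theta>j \<cdot> ?inj j v i) \<cdot> h i"
    using \<theta>j cPj(2-4)[OF i] h[OF i] by simp
  \<comment> \<open>Retracting with \<open>\<theta>j\<close> displays the identity of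
    \<open>T\<close> as a composite through \<open>h i\<close>; for \<open>i\<close> different from
    \<open>j\<close> the intermediate object is the initial \<open>z\<close>.\<close>
  finally have id: "Ident V T = (if i = j then Ident V T else zt T) \<cdot> h i"
    using \<theta>j(4) i j by simp
  have hi: "h i \<in> hom V T (if i = j then T else z)"
    using h[OF i] a(3)[OF i u i] a(3)[OF j v i] by simp
  show ?thesis
  proof (cases "i = j")
    case True
    then have "h i = Ident V T" using id hi by simp
    moreover have "v \<cdot> h i = u" using h[OF i] True i by (simp add: a_def)
    ultimately show ?thesis using True v by auto
  next
    case False
    then have "initial T" using id hi zt T by (intro initial_retract[OF z, of "h i" T "zt T"]) auto
    with False show ?thesis by simp
  qed
qed

text \<open>Essential surjectivity: as an object of the slice, \<open>f\<close> is isomorphic to a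
  coproduct of arrows \<open>w i\<close>. The arrow underlying this isomorphism is invertible in
  \<open>V\<close> and transports the injections to the domain of \<open>f\<close>.\<close>

lemma coprod_decompose_aux:
  fixes I :: "'a set"
  assumes I: "small \<kappa> I" and x: "\<And>i. i \<in> I \<Longrightarrow> x i \<in> Obj V"
    and f: "f \<in> Arr V" "Cod V f = coprod V I x"
  obtains X k w where "is_coproduct V I X (Dom V f) k"
    "\<forall>i\<in>I. w i \<in> hom V (X i) (x i) \<and> f \<cdot> k i = inj_coprod V I x i \<cdot> w i"
proof -
  let ?F = "coprod_fct V I x"
  have *: "f \<in> Obj (slice V (coprod V I x))" using f by (simp add: slice_obj)
  obtain w e where w: "w \<in> Obj (prod_cat I (\<lambda>i. slice V (x i)))"
    and e: "e \<in> hom (slice V (coprod V I x)) (FObj ?F w) f" "is_iso (slice V (coprod V I x)) e"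
    by (rule equivalence_ess_surj[OF extensive_equivalence[OF I x] *])
  have w: "w i \<in> Arr V" "Cod V (w i) = x i" if "i \<in> I" for i
    using w that by (auto simp: prod_cat_def slice_obj PiE_def Pi_def)
  let ?X = "\<lambda>i. Dom V (w i)"
  have cX: "is_coproduct V I ?X (coprod V I ?X) (inj_coprod V I ?X)"
    and cx: "is_coproduct V I x (coprod V I x) (inj_coprod V I x)"
    by (rule coprod_is_coproduct; use I w x in simp)+
  have F: "FObj ?F w \<in> Arr V" "Dom V (FObj ?F w) = coprod V I ?X" "Cod V (FObj ?F w) = coprod V I x"
    "\<And>i. i \<in> I \<Longrightarrow> FObj ?F w \<cdot> inj_coprod V I ?X i = inj_coprod V I x i \<cdot> w i"
    unfolding coprod_fct_obj by (rule cotuple_props; use I w coproductD[OF cx] in simp)+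
  obtain \<theta> where e': "e = (FObj ?F w, \<theta>, f)" "\<theta> \<in> hom V (coprod V I ?X) (Dom V f)" "f \<cdot> \<theta> = FObj ?F w"
    using e(1) F by (auto simp: slice_def)
  obtain e2 where e2: "e2 \<in> Arr (slice V (coprod V I x))" "Dom (slice V (coprod V I x)) e2 = f"
    "Cod (slice V (coprod V I x)) e2 = FObj ?F w"
    "Comp (slice V (coprod V I x)) e2 e = Ident (slice V (coprod V I x)) (FObj ?F w)"
    "Comp (slice V (coprod V I x)) e e2 = Ident (slice V (coprod V I x)) f"
    using is_iso_inverse[OF e(2)] e(1) by auto
  obtain \<theta>' where \<theta>': "e2 = (f, \<theta>', FObj ?F w)" "\<theta>' \<in> hom V (Dom V f) (coprod V I ?X)"
  proof -
    obtain p \<theta>' r where e2': "e2 = (p, \<theta>', r)" by (cases e2)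
    then have "p = f" "r = FObj ?F w" using e2(2,3) by (simp_all add: slice_def)
    moreover from this have "\<theta>' \<in> hom V (Dom V f) (coprod V I ?X)"
      using e2(1) F(2) unfolding e2' by (simp add: slice_def del: in_hom)
    ultimately show thesis using that e2' by blast
  qed
  have inv: "\<theta>' \<cdot> \<theta> = Ident V (coprod V I ?X)" "\<theta> \<cdot> \<theta>' = Ident V (Dom V f)"
    using e2(4,5) e'(1) \<theta>'(1) F by (simp_all add: slice_def)
  show thesis
  proof (rule that[of ?X "\<lambda>i. \<theta> \<cdot> inj_coprod V I ?X i" w])
    show "is_coproduct V I ?X (Dom V f) (\<lambda>i. \<theta> \<cdot> inj_coprod V I ?X i)"
      by (rule coproduct_transport[OF cX, of _ _ \<theta>']) (use e' \<theta>' inv in simp_all)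
    show "\<forall>i\<in>I. w i \<in> hom V (Dom V (w i)) (x i) \<and> f \<cdot> \<theta> \<cdot> inj_coprod V I ?X i = inj_coprod V I x i \<cdot> w i"
    proof
      fix i assume i: "i \<in> I"
      have "f \<cdot> \<theta> \<cdot> inj_coprod V I ?X i = FObj ?F w \<cdot> inj_coprod V I ?X i"
        using comp_extend[OF e'(3)] e' f coproductD[OF cX] i by simp
      then show "w i \<in> hom V (Dom V (w i)) (x i) \<and> f \<cdot> \<theta> \<cdot> inj_coprod V I ?X i = inj_coprod V I x i \<cdot> w i"
        using F(4)[OF i] w[OF i] by simp
    qed
  qed
qed

text \<open>A coproduct with an arbitrary index type is isomorphic to a chosen one indexed by a set of
  arrows, to which extensivity applies.\<close>

lemma coproduct_encoding:
  assumes "is_coproduct V (I :: 'i set) x s j" "small \<kappa> I"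
  obtains e :: "'i \<Rightarrow> 'a" and \<theta> \<theta>' y where "inj_on e I" "small \<kappa> (e ` I)" "\<forall>i\<in>I. y (e i) = x i"
    "\<forall>i\<in>e ` I. y i \<in> Obj V"
    "\<theta> \<in> hom V s (coprod V (e ` I) y)" "\<theta>' \<in> hom V (coprod V (e ` I) y) s" "\<theta>' \<cdot> \<theta> = Ident V s"
    "\<theta> \<cdot> \<theta>' = Ident V (coprod V (e ` I) y)"
    "\<forall>i\<in>I. \<theta> \<cdot> j i = inj_coprod V (e ` I) y (e i)"
proof -
  obtain e :: "'i \<Rightarrow> 'a" where e: "inj_on e I" "small \<kappa> (e ` I)"
    using small_encoding[OF assms(2)] .
  let ?g = "inv_into I e" let ?y = "\<lambda>i. x (?g i)"
  have bij: "bij_betw ?g (e ` I) I" using e by (intro bij_betw_inv_into) (simp add: bij_betw_def)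
  note c1 = coproduct_reindex[OF assms(1) bij]
  have c2: "is_coproduct V (e ` I) ?y (coprod V (e ` I) ?y) (inj_coprod V (e ` I) ?y)"
    by (rule coprod_is_coproduct) (use e coproductD(5)[OF c1] in auto)
  show thesis
    by (rule coproduct_iso[OF c1 c2], rule that[OF e, of ?y])
      (use e coproductD(5)[OF c1] in \<open>auto simp: inv_into_f_f\<close>)
qed

text \<open>The conclusion is an alternative and not a contradiction, since over an initial stage
  elements with different indices do agree. Later case distinctions therefore close the second
  branch by \<open>initial_eq\<close> or \<open>initial_ex1\<close>.\<close>

lemma coproduct_inj_eq:
  assumes "is_coproduct V I x s j" "small \<kappa> I" "i \<in> I" "i' \<in> I"
    "u \<in> hom V T (x i)" "v \<in> hom V T (x i')" "j i \<cdot> u = j i' \<cdot> v"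
  shows "if i = i' then u = v else initial T"
proof -
  obtain e :: "'b \<Rightarrow> 'a" and \<theta> \<theta>' y where e: "inj_on e I" "small \<kappa> (e ` I)" "\<forall>i\<in>I. y (e i) = x i"
    "\<forall>i\<in>e ` I. y i \<in> Obj V"
    "\<theta> \<in> hom V s (coprod V (e ` I) y)" "\<theta>' \<in> hom V (coprod V (e ` I) y) s" "\<theta>' \<cdot> \<theta> = Ident V s"
    "\<theta> \<cdot> \<theta>' = Ident V (coprod V (e ` I) y)"
    "\<forall>i\<in>I. \<theta> \<cdot> j i = inj_coprod V (e ` I) y (e i)"
    by (rule coproduct_encoding[OF assms(1,2)])
  note c = coproductD[OF assms(1)]
  have *: "inj_coprod V (e ` I) y (e i) \<cdot> u = \<theta> \<cdot> j i \<cdot> u" if "i \<in> I" "u \<in> hom V T (x i)" for i u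
    using e(5,9) c that by (auto simp del: assoc_C simp: assoc_C[symmetric])
  have "if e i = e i' then u = v else initial T"
    by (rule coprod_inj_eq_aux[OF e(2), of y])
      (use e(3,4) assms(3-7) *[OF assms(3,5)] *[OF assms(4,6)] in auto)
  then show ?thesis using e(1) assms(3,4) by (auto simp: inj_on_def split: if_splits)
qed

lemma coproduct_inj_cancel:
  assumes "is_coproduct V I x s j" "small \<kappa> I" "i \<in> I"
    "u \<in> Arr V" "v \<in> Arr V" "Cod V u = x i" "Cod V v = x i" "Dom V u = Dom V v" "j i \<cdot> u = j i \<cdot> v"
  shows "u = v"
  using coproduct_inj_eq[OF assms(1-3,3), of u "Dom V v" v] assms by simp

lemma coproduct_decompose:
  assumes "is_coproduct V I x s j" "small \<kappa> I" "f \<in> Arr V" "Cod V f = s"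
  obtains X k w where "is_coproduct V I X (Dom V f) k"
    "\<forall>i\<in>I. w i \<in> hom V (X i) (x i) \<and> f \<cdot> k i = j i \<cdot> w i"
proof -
  obtain e :: "'b \<Rightarrow> 'a" and \<theta> \<theta>' y where e: "inj_on e I" "small \<kappa> (e ` I)" "\<forall>i\<in>I. y (e i) = x i"
    "\<forall>i\<in>e ` I. y i \<in> Obj V"
    "\<theta> \<in> hom V s (coprod V (e ` I) y)" "\<theta>' \<in> hom V (coprod V (e ` I) y) s" "\<theta>' \<cdot> \<theta> = Ident V s"
    "\<theta> \<cdot> \<theta>' = Ident V (coprod V (e ` I) y)"
    "\<forall>i\<in>I. \<theta> \<cdot> j i = inj_coprod V (e ` I) y (e i)"
    by (rule coproduct_encoding[OF assms(1,2)])
  have tf: "\<theta> \<cdot> f \<in> Arr V" "Cod V (\<theta> \<cdot> f) = coprod V (e ` I) y" "Dom V (\<theta> \<cdot> f) = Dom V f"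
    using assms(3,4) e(5) by auto
  have y: "\<And>i. i \<in> e ` I \<Longrightarrow> y i \<in> Obj V" using e(4) by blast
  obtain X k w where X: "is_coproduct V (e ` I) X (Dom V f) k"
    and w: "\<forall>i\<in>e ` I. w i \<in> hom V (X i) (y i) \<and> (\<theta> \<cdot> f) \<cdot> k i = inj_coprod V (e ` I) y i \<cdot> w i"
    by (rule coprod_decompose_aux[OF e(2) y tf(1,2)]) (use tf(3) in auto)
  have bij: "bij_betw e I (e ` I)" using e(1) by (simp add: bij_betw_def)
  note c = coproductD[OF assms(1)] and cX = coproductD[OF X]
  have "f \<cdot> k (e i) = j i \<cdot> w (e i)" if i: "i \<in> I" for i
  proof -
    have wi: "w (e i) \<in> hom V (X (e i)) (x i)" and
      eq: "(\<theta> \<cdot> f) \<cdot> k (e i) = inj_coprod V (e ` I) y (e i) \<cdot> w (e i)"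
      using w e(3) i by auto
    have "\<theta> \<cdot> f \<cdot> k (e i) = (\<theta> \<cdot> j i) \<cdot> w (e i)"
      using eq e(5,9) i assms(3,4) cX by auto
    then have "(\<theta>' \<cdot> \<theta>) \<cdot> f \<cdot> k (e i) = (\<theta>' \<cdot> \<theta>) \<cdot> j i \<cdot> w (e i)"
      using e(5,6) assms(3,4) cX i c wi by simp
    then show ?thesis unfolding e(7) using assms(3,4) cX i c wi by simp
  qed
  moreover have "w (e i) \<in> hom V (X (e i)) (x i)" if "i \<in> I" for i
    using w e(3) that by auto
  ultimately show thesis
    using that[OF coproduct_reindex[OF X bij], of "\<lambda>i. w (e i)"] by blast
qed

text \<open>The pieces of the decomposition of \<open>f\<close> are the injections of a coproduct,
  hence jointly epic. All later rules that replace an element by a triple are instances of this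
  one.\<close>

lemma coproduct_local_eqI:
  assumes "is_coproduct V I x s j" "small \<kappa> I" "f \<in> Arr V" "Cod V f = s"
    "L \<in> Arr V" "R \<in> Arr V" "Dom V L = Dom V f" "Dom V R = Dom V f" "Cod V L = Cod V R"
    "\<And>k i w. k \<in> Arr V \<Longrightarrow> Cod V k = Dom V f \<Longrightarrow> i \<in> I \<Longrightarrow> w \<in> Arr V \<Longrightarrow> Dom V w = Dom V k \<Longrightarrow>
       Cod V w = x i \<Longrightarrow> f \<cdot> k = j i \<cdot> w \<Longrightarrow> L \<cdot> k = R \<cdot> k"
  shows "L = R"
proof -
  obtain X k w where X: "is_coproduct V I X (Dom V f) k"
    and w: "\<forall>i\<in>I. w i \<in> hom V (X i) (x i) \<and> f \<cdot> k i = j i \<cdot> w i"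
    by (rule coproduct_decompose[OF assms(1-4)])
  show ?thesis
    by (rule coproduct_eqI[OF X]) (use assms(5-10) w coproductD[OF X] in auto)
qed

text \<open>Stability of coproducts under pullback. A decomposition \<open>X\<close> of
  \<open>f\<close> maps into the pullbacks by comparison arrows \<open>m i\<close>, so the
  pulled-back family is jointly epic because that of \<open>X\<close> is. To glue arrows
  \<open>g i\<close>, the composites \<open>g i\<close> after \<open>m i\<close> are glued over
  \<open>X\<close>, and the result is compared with \<open>g i\<close> locally.\<close>

lemma coproduct_pullback:
  assumes c: "is_coproduct V I x s j" and I: "small \<kappa> I" and f: "f \<in> Arr V" "Cod V f = s"
  shows "is_coproduct V I (\<lambda>i. pbk V f (j i)) (Dom V f) (\<lambda>i. pbk1 V f (j i))"
proof -
  obtain X k w where X: "is_coproduct V I X (Dom V f) k"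
    and w: "\<forall>i\<in>I. w i \<in> hom V (X i) (x i) \<and> f \<cdot> k i = j i \<cdot> w i"
    by (rule coproduct_decompose[OF assms])
  note cD = coproductD[OF c] and XD = coproductD[OF X]
  have pb: "is_pullback V f (j i) (pbk V f (j i)) (pbk1 V f (j i)) (pbk2 V f (j i))" if "i \<in> I" for i
    by (rule pbk_is) (use f cD that in simp_all)
  have pt: "pbk V f (j i) \<in> Obj V" "pbk1 V f (j i) \<in> Arr V" "pbk2 V f (j i) \<in> Arr V"
    "Dom V (pbk1 V f (j i)) = pbk V f (j i)" "Dom V (pbk2 V f (j i)) = pbk V f (j i)"
    "Cod V (pbk1 V f (j i)) = Dom V f" "Cod V (pbk2 V f (j i)) = x i"
    "f \<cdot> pbk1 V f (j i) = j i \<cdot> pbk2 V f (j i)"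
    if "i \<in> I" for i
    using that f cD pbk_square[of f "j i"] by simp_all
  have "\<forall>i\<in>I. \<exists>m. m \<in> Arr V \<and> Dom V m = X i \<and> Cod V m = pbk V f (j i) \<and> pbk1 V f (j i) \<cdot> m = k i"
  proof
    fix i assume i: "i \<in> I"
    show "\<exists>m. m \<in> Arr V \<and> Dom V m = X i \<and> Cod V m = pbk V f (j i) \<and> pbk1 V f (j i) \<cdot> m = k i"
      by (rule pullback_lift[OF pb[OF i], of "k i" "w i"]) (use i f cD XD w in auto)
  qed
  then obtain m where m: "\<forall>i\<in>I. m i \<in> Arr V \<and> Dom V (m i) = X i \<and> Cod V (m i) = pbk V f (j i) \<and>
      pbk1 V f (j i) \<cdot> m i = k i"
    by (rule bchoice[THEN exE])
  show ?thesis
  proof (rule coproductI)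
    show "Dom V f \<in> Obj V" using f by simp
    show "\<And>i. i \<in> I \<Longrightarrow> pbk1 V f (j i) \<in> hom V (pbk V f (j i)) (Dom V f)" using pt by simp
    show "u = v" if uv: "u \<in> hom V (Dom V f) t" "v \<in> hom V (Dom V f) t"
      "\<And>i. i \<in> I \<Longrightarrow> u \<cdot> pbk1 V f (j i) = v \<cdot> pbk1 V f (j i)" for t u v
    proof (rule coproduct_eqI[OF X])
      show "u \<cdot> k i = v \<cdot> k i" if i: "i \<in> I" for i
      proof -
        have "(u \<cdot> pbk1 V f (j i)) \<cdot> m i = (v \<cdot> pbk1 V f (j i)) \<cdot> m i"
          using uv(3)[OF i] by simp
        then show ?thesis using pt[OF i] uv(1,2) m i by simp
      qed
    qed (use uv in auto)
    fix t g assume t: "t \<in> Obj V" and g: "\<And>i. i \<in> I \<Longrightarrow> g i \<in> hom V (pbk V f (j i)) t"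
    obtain h where h: "h \<in> Arr V" "Dom V h = Dom V f" "Cod V h = t" "\<forall>i\<in>I. h \<cdot> k i = g i \<cdot> m i"
      by (rule coproduct_glue[OF X t, of "\<lambda>i. g i \<cdot> m i"]) (use g m in auto)
    have "h \<cdot> pbk1 V f (j i) = g i" if i: "i \<in> I" for i
    \<comment> \<open>The projection from the pullback is itself decomposed along \<open>X\<close>.
      Where its index is not \<open>i\<close> the stage is initial; where it is \<open>i\<close> the
      piece passes through \<open>m i\<close>.\<close>
    proof (rule coproduct_local_eqI[OF X I, of "pbk1 V f (j i)"])
      fix q i' r assume q: "q \<in> Arr V" "Cod V q = Dom V (pbk1 V f (j i))" "i' \<in> I" "r \<in> Arr V"
        "Dom V r = Dom V q" "Cod V r = X i'" "pbk1 V f (j i) \<cdot> q = k i' \<cdot> r"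
      have gi: "g i \<in> Arr V" "Dom V (g i) = pbk V f (j i)" "Cod V (g i) = t" using g[OF i] by auto
      have "j i' \<cdot> w i' \<cdot> r = f \<cdot> k i' \<cdot> r"
        using comp_extend[of f "k i'" "j i' \<cdot> w i'" r] w q XD cD f by simp
      also have "\<dots> = f \<cdot> pbk1 V f (j i) \<cdot> q" using q by simp
      also have "\<dots> = j i \<cdot> pbk2 V f (j i) \<cdot> q"
        using comp_extend[OF pt(8)[OF i], of q] pt[OF i] q f cD i by simp
      finally have *: "j i' \<cdot> w i' \<cdot> r = j i \<cdot> pbk2 V f (j i) \<cdot> q" .
      have "if i' = i then w i' \<cdot> r = pbk2 V f (j i) \<cdot> q else initial (Dom V q)"
        by (rule coproduct_inj_eq[OF c I q(3) i _ _ *]) (use w q pt[OF i] in auto)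
      show "(h \<cdot> pbk1 V f (j i)) \<cdot> q = g i \<cdot> q"
      proof (cases "i' = i")
        case True
        \<comment> \<open>The first projections agree by the choice of \<open>m\<close>; the second
          ones agree after the injection \<open>j i\<close>, which is monic.\<close>
        have "m i \<cdot> r = q"
        proof (rule pullback_eqI[OF pb[OF i]])
          show A: "pbk1 V f (j i) \<cdot> m i \<cdot> r = pbk1 V f (j i) \<cdot> q"
            using q True m i XD pt[OF i] comp_extend[of "pbk1 V f (j i)" "m i" "k i" r] by simp
          have "f \<cdot> pbk1 V f (j i) \<cdot> m i \<cdot> r = j i \<cdot> pbk2 V f (j i) \<cdot> m i \<cdot> r"
            using comp_extend[OF pt(8)[OF i], of "m i \<cdot> r"] pt[OF i] q(1-6) f cD i m True by simp
          moreover have "f \<cdot> pbk1 V f (j i) \<cdot> q = j i \<cdot> pbk2 V f (j i) \<cdot> q"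
            using comp_extend[OF pt(8)[OF i], of q] pt[OF i] q(1-6) f cD i True by simp
          ultimately have "j i \<cdot> pbk2 V f (j i) \<cdot> m i \<cdot> r = j i \<cdot> pbk2 V f (j i) \<cdot> q"
            using A by simp
          from coproduct_inj_cancel[OF c I i _ _ _ _ _ this]
          show "pbk2 V f (j i) \<cdot> m i \<cdot> r = pbk2 V f (j i) \<cdot> q"
            using pt[OF i] q(1-6) m i True by simp
        qed (use f cD i m q True pt[OF i] in auto)
        moreover have "h \<cdot> k i \<cdot> r = g i \<cdot> m i \<cdot> r"
          using comp_extend[of h "k i" "g i \<cdot> m i" r] h i m q True XD gi by simp
        ultimately show ?thesis using q True h pt[OF i] by simp
      next
        case False
        then have "initial (Dom V q)"
          using \<open>if i' = i then _ else _\<close> by simp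
        then show ?thesis by (rule initial_eq) (use h q(1-6) gi pt[OF i] in auto)
      qed
    qed (use h g[OF i] pt[OF i] in auto)
    then show "\<exists>h \<in> hom V (Dom V f) t. \<forall>i \<in> I. h \<cdot> pbk1 V f (j i) = g i"
      using h by (intro bexI[of _ h]) auto
  qed
qed

lemma small_points_coproduct:
  assumes "is_coproduct V I x s j" "small \<kappa> I" "\<And>i. i \<in> I \<Longrightarrow> small \<kappa> (hom V (trm V) (x i))"
  shows "small \<kappa> (hom V (trm V) s)"
proof -
  obtain e :: "'b \<Rightarrow> 'a" and \<theta> \<theta>' y where e: "inj_on e I" "small \<kappa> (e ` I)" "\<forall>i\<in>I. y (e i) = x i"
    "\<forall>i\<in>e ` I. y i \<in> Obj V"
    "\<theta> \<in> hom V s (coprod V (e ` I) y)" "\<theta>' \<in> hom V (coprod V (e ` I) y) s" "\<theta>' \<cdot> \<theta> = Ident V s"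
    by (rule coproduct_encoding[OF assms(1,2)])
  have "small \<kappa> (e ` I) \<and> (\<forall>i\<in>e ` I. y i \<in> Obj V \<and> small \<kappa> (hom V (trm V) (y i)))"
    using e assms(3) by (auto simp del: in_hom)
  then have "small \<kappa> (hom V (trm V) (coprod V (e ` I) y))"
    using points_closed unfolding small_points_closed_def
    by (elim allE[of _ "e ` I"] allE[of _ y] impE)
  then show ?thesis
  proof (rule small_inj[rotated -1])
    show "inj_on (\<lambda>u. \<theta> \<cdot> u) (hom V (trm V) s)"
    proof (rule inj_onI)
      fix u v assume uv: "u \<in> hom V (trm V) s" "v \<in> hom V (trm V) s" "\<theta> \<cdot> u = \<theta> \<cdot> v"
      then have "(\<theta>' \<cdot> \<theta>) \<cdot> u = (\<theta>' \<cdot> \<theta>) \<cdot> v" using e(5,6) by simp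
      then show "u = v" unfolding e(7) using uv by simp
    qed
    show "(\<lambda>u. \<theta> \<cdot> u) ` hom V (trm V) s \<subseteq> hom V (trm V) (coprod V (e ` I) y)"
      using e(5) by auto
  qed
qed

subsection \<open>Enriched categories through generalized elements\<close>

text \<open>Composition of elements of hom-objects at a common stage. In terms of it the elements at
  each stage form an ordinary category, and the coherence arrow \<open>assoc\<close> disappears from
  calculations.\<close>

definition ec :: "('o, 'a) ecat \<Rightarrow> 'a \<Rightarrow> 'a \<Rightarrow> 'a \<Rightarrow> 'a \<Rightarrow> 'a \<Rightarrow> 'a" where
  "ec M a b c g f = ecomp M a b c \<cdot> pair V g f"

lemma enriched_typing [simp]:
  assumes "enriched_category V M" "a \<in> eobj M"
  shows "b \<in> eobj M \<Longrightarrow> ehom M a b \<in> Obj V"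
    "b \<in> eobj M \<Longrightarrow> c \<in> eobj M \<Longrightarrow> ecomp M a b c \<in> Arr V"
    "b \<in> eobj M \<Longrightarrow> c \<in> eobj M \<Longrightarrow> Dom V (ecomp M a b c) = prd V (ehom M b c) (ehom M a b)"
    "b \<in> eobj M \<Longrightarrow> c \<in> eobj M \<Longrightarrow> Cod V (ecomp M a b c) = ehom M a c"
    "eid M a \<in> Arr V" "Dom V (eid M a) = trm V" "Cod V (eid M a) = ehom M a a"
  using assms unfolding enriched_category_def by auto

lemma ec_typing [simp]:
  assumes "enriched_category V M" "a \<in> eobj M" "b \<in> eobj M" "c \<in> eobj M"
    "g \<in> Arr V" "f \<in> Arr V" "Dom V g = Dom V f" "Cod V g = ehom M b c" "Cod V f = ehom M a b"
  shows "ec M a b c g f \<in> Arr V" "Dom V (ec M a b c g f) = Dom V f" "Cod V (ec M a b c g f) = ehom M a c"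
  unfolding ec_def using assms by simp_all

lemma ec_comp [simp]:
  assumes "enriched_category V M" "a \<in> eobj M" "b \<in> eobj M" "c \<in> eobj M"
    "g \<in> Arr V" "f \<in> Arr V" "Dom V g = Dom V f" "Cod V g = ehom M b c" "Cod V f = ehom M a b"
    "k \<in> Arr V" "Cod V k = Dom V f"
  shows "ec M a b c g f \<cdot> k = ec M a b c (g \<cdot> k) (f \<cdot> k)"
  unfolding ec_def using assms by simp

lemma ec_assoc [simp]:
  assumes M: "enriched_category V M" "a \<in> eobj M" "b \<in> eobj M" "c \<in> eobj M" "d \<in> eobj M"
    and t: "h \<in> Arr V" "g \<in> Arr V" "f \<in> Arr V" "Dom V h = Dom V f" "Dom V g = Dom V f"
    "Cod V h = ehom M c d" "Cod V g = ehom M b c" "Cod V f = ehom M a b"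
  shows "ec M a b d (ec M b c d h g) f = ec M a c d h (ec M a b c g f)"
proof -
  let ?k = "pair V (pair V h g) f"
  have "ecomp M a b d \<cdot> times2 V (ecomp M b c d) (Ident V (ehom M a b)) =
        ecomp M a c d \<cdot> times2 V (Ident V (ehom M c d)) (ecomp M a b c) \<cdot>
          assoc V (ehom M c d) (ehom M b c) (ehom M a b)"
    using M unfolding enriched_category_def by blast
  then have "(ecomp M a b d \<cdot> times2 V (ecomp M b c d) (Ident V (ehom M a b))) \<cdot> ?k =
        (ecomp M a c d \<cdot> times2 V (Ident V (ehom M c d)) (ecomp M a b c) \<cdot>
          assoc V (ehom M c d) (ehom M b c) (ehom M a b)) \<cdot> ?k"
    by simp
  then show ?thesis
    using M t by (simp add: ec_def times2_def assoc_def)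
qed

lemma ec_ident [simp]:
  assumes M: "enriched_category V M" "a \<in> eobj M" "b \<in> eobj M"
    and t: "f \<in> Arr V" "Cod V f = ehom M a b" "t \<in> Arr V" "Dom V t = Dom V f" "Cod V t = trm V"
  shows "ec M a b b (eid M b \<cdot> t) f = f" "ec M a a b f (eid M a \<cdot> t) = f"
proof -
  have "ecomp M a b b \<cdot> times2 V (eid M b) (Ident V (ehom M a b)) = pr2 V (trm V) (ehom M a b)"
    "ecomp M a a b \<cdot> times2 V (Ident V (ehom M a b)) (eid M a) = pr1 V (ehom M a b) (trm V)"
    using M unfolding enriched_category_def by blast+
  then have
    "(ecomp M a b b \<cdot> times2 V (eid M b) (Ident V (ehom M a b))) \<cdot> pair V t f =
       pr2 V (trm V) (ehom M a b) \<cdot> pair V t f"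
    "(ecomp M a a b \<cdot> times2 V (Ident V (ehom M a b)) (eid M a)) \<cdot> pair V f t =
       pr1 V (ehom M a b) (trm V) \<cdot> pair V f t"
    by simp_all
  then show "ec M a b b (eid M b \<cdot> t) f = f" "ec M a a b f (eid M a \<cdot> t) = f"
    using M t by (simp_all add: ec_def times2_def)
qed

text \<open>A Yoneda argument: the diagrams in the definition are the laws for elements, evaluated
  at the product projections, which are the generic elements.\<close>

lemma enriched_categoryI:
  assumes obj: "\<And>a b. a \<in> eobj M \<Longrightarrow> b \<in> eobj M \<Longrightarrow> ehom M a b \<in> Obj V"
    and comp: "\<And>a b c. a \<in> eobj M \<Longrightarrow> b \<in> eobj M \<Longrightarrow> c \<in> eobj M \<Longrightarrow>
      ecomp M a b c \<in> hom V (prd V (ehom M b c) (ehom M a b)) (ehom M a c)"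
    and eid: "\<And>a. a \<in> eobj M \<Longrightarrow> eid M a \<in> hom V (trm V) (ehom M a a)"
    and assoc: "\<And>a b c d h g f X. a \<in> eobj M \<Longrightarrow> b \<in> eobj M \<Longrightarrow> c \<in> eobj M \<Longrightarrow> d \<in> eobj M \<Longrightarrow>
      h \<in> hom V X (ehom M c d) \<Longrightarrow> g \<in> hom V X (ehom M b c) \<Longrightarrow> f \<in> hom V X (ehom M a b) \<Longrightarrow>
      ec M a b d (ec M b c d h g) f = ec M a c d h (ec M a b c g f)"
    and ident_left: "\<And>a b f X. a \<in> eobj M \<Longrightarrow> b \<in> eobj M \<Longrightarrow> f \<in> hom V X (ehom M a b) \<Longrightarrow>
      ec M a b b (eid M b \<cdot> bang V X) f = f"
    and ident_right: "\<And>a b f X. a \<in> eobj M \<Longrightarrow> b \<in> eobj M \<Longrightarrow> f \<in> hom V X (ehom M a b) \<Longrightarrow>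
      ec M a a b f (eid M a \<cdot> bang V X) = f"
  shows "enriched_category V M"
  unfolding enriched_category_def
proof (intro conjI ballI)
  fix a b assume ab: "a \<in> eobj M" "b \<in> eobj M"
  note t = obj[OF ab] eid[OF ab(1)] eid[OF ab(2)] comp[OF ab ab(2)] comp[OF ab(1,1,2)]
  \<comment> \<open>The unit laws of the definition mention projections to the terminal object, the
    laws for elements mention \<open>bang\<close>; both are the unique arrow.\<close>
  have "pr1 V (trm V) (ehom M a b) = bang V (prd V (trm V) (ehom M a b))"
    "pr2 V (ehom M a b) (trm V) = bang V (prd V (ehom M a b) (trm V))"
    by (rule to_trm_eq; use t in simp)+
  then show "ecomp M a b b \<cdot> times2 V (eid M b) (Ident V (ehom M a b)) = pr2 V (trm V) (ehom M a b)"
    "ecomp M a a b \<cdot> times2 V (Ident V (ehom M a b)) (eid M a) = pr1 V (ehom M a b) (trm V)"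
    using ident_left[OF ab, of "pr2 V (trm V) (ehom M a b)"]
      ident_right[OF ab, of "pr1 V (ehom M a b) (trm V)"] t
    by (simp_all add: ec_def times2_def)
next
  fix a b c d assume *: "a \<in> eobj M" "b \<in> eobj M" "c \<in> eobj M" "d \<in> eobj M"
  let ?x = "ehom M c d" let ?y = "ehom M b c" let ?z = "ehom M a b"
  note t = obj[OF *(1,2)] obj[OF *(2,3)] obj[OF *(3,4)] obj[OF *(2,4)] obj[OF *(1,3)]
    comp[OF *(1,2,3)] comp[OF *(2,3,4)] comp[OF *(1,2,4)] comp[OF *(1,3,4)]
  have "pair V (pr1 V ?x ?y \<cdot> pr1 V (prd V ?x ?y) ?z) (pr2 V ?x ?y \<cdot> pr1 V (prd V ?x ?y) ?z) =
      pr1 V (prd V ?x ?y) ?z"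
    using t by simp
  then show "ecomp M a b d \<cdot> times2 V (ecomp M b c d) (Ident V ?z) =
        ecomp M a c d \<cdot> times2 V (Ident V ?x) (ecomp M a b c) \<cdot> assoc V ?x ?y ?z"
    using assoc[OF *, of "pr1 V ?x ?y \<cdot> pr1 V (prd V ?x ?y) ?z" "prd V (prd V ?x ?y) ?z"
        "pr2 V ?x ?y \<cdot> pr1 V (prd V ?x ?y) ?z" "pr2 V (prd V ?x ?y) ?z"] t
    by (simp add: ec_def times2_def assoc_def)
qed (use obj comp eid in blast)+

lemma enriched_functor_props:
  assumes "enriched_functor V F"
  shows efun_src: "enriched_category V (esrc F)" and efun_tgt: "enriched_category V (etgt F)"
    and efun0_ext: "efun0 F \<in> eobj (esrc F) \<rightarrow>\<^sub>E eobj (etgt F)"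
    and efun1_ext: "efun1 F = restrict2 (eobj (esrc F)) (efun1 F)"
  using assms unfolding enriched_functor_def Let_def by blast+

lemma efun_typing [simp]:
  assumes "enriched_functor V F" "a \<in> eobj (esrc F)"
  shows "efun0 F a \<in> eobj (etgt F)" "b \<in> eobj (esrc F) \<Longrightarrow> efun1 F a b \<in> Arr V"
    "b \<in> eobj (esrc F) \<Longrightarrow> Dom V (efun1 F a b) = ehom (esrc F) a b"
    "b \<in> eobj (esrc F) \<Longrightarrow> Cod V (efun1 F a b) = ehom (etgt F) (efun0 F a) (efun0 F b)"
  using assms unfolding enriched_functor_def Let_def by auto

lemma efun_ec [simp]:
  assumes F: "enriched_functor V F" "a \<in> eobj (esrc F)" "b \<in> eobj (esrc F)" "c \<in> eobj (esrc F)"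
    and t: "g \<in> Arr V" "f \<in> Arr V" "Dom V g = Dom V f" "Cod V g = ehom (esrc F) b c"
      "Cod V f = ehom (esrc F) a b"
  shows "efun1 F a c \<cdot> ec (esrc F) a b c g f =
    ec (etgt F) (efun0 F a) (efun0 F b) (efun0 F c) (efun1 F b c \<cdot> g) (efun1 F a b \<cdot> f)"
proof -
  note M = efun_src[OF F(1)] efun_tgt[OF F(1)]
  have "efun1 F a c \<cdot> ecomp (esrc F) a b c =
     ecomp (etgt F) (efun0 F a) (efun0 F b) (efun0 F c) \<cdot> times2 V (efun1 F b c) (efun1 F a b)"
    using F unfolding enriched_functor_def Let_def by blast
  then have "(efun1 F a c \<cdot> ecomp (esrc F) a b c) \<cdot> pair V g f =
     (ecomp (etgt F) (efun0 F a) (efun0 F b) (efun0 F c) \<cdot> times2 V (efun1 F b c) (efun1 F a b)) \<cdot> pair V g f"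
    by simp
  then show ?thesis
    using M F t by (simp add: ec_def times2_def)
qed

lemma efun_eid [simp]:
  assumes F: "enriched_functor V F" "a \<in> eobj (esrc F)"
  shows "efun1 F a a \<cdot> eid (esrc F) a = eid (etgt F) (efun0 F a)"
    and "t \<in> Arr V \<Longrightarrow> Cod V t = trm V \<Longrightarrow> efun1 F a a \<cdot> eid (esrc F) a \<cdot> t = eid (etgt F) (efun0 F a) \<cdot> t"
proof -
  show *: "efun1 F a a \<cdot> eid (esrc F) a = eid (etgt F) (efun0 F a)"
    using F unfolding enriched_functor_def Let_def by blast
  show "t \<in> Arr V \<Longrightarrow> Cod V t = trm V \<Longrightarrow> efun1 F a a \<cdot> eid (esrc F) a \<cdot> t = eid (etgt F) (efun0 F a) \<cdot> t"
    using comp_extend[OF *] F efun_src[OF F(1)] by simp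
qed

lemma enriched_functorI:
  assumes M: "enriched_category V (esrc F)" and N: "enriched_category V (etgt F)"
    and F0: "efun0 F \<in> eobj (esrc F) \<rightarrow>\<^sub>E eobj (etgt F)"
    and F1: "efun1 F = restrict2 (eobj (esrc F)) (efun1 F)"
    and ty: "\<And>a b. a \<in> eobj (esrc F) \<Longrightarrow> b \<in> eobj (esrc F) \<Longrightarrow>
      efun1 F a b \<in> hom V (ehom (esrc F) a b) (ehom (etgt F) (efun0 F a) (efun0 F b))"
    and comp: "\<And>a b c g f X. a \<in> eobj (esrc F) \<Longrightarrow> b \<in> eobj (esrc F) \<Longrightarrow> c \<in> eobj (esrc F) \<Longrightarrow>
      g \<in> hom V X (ehom (esrc F) b c) \<Longrightarrow> f \<in> hom V X (ehom (esrc F) a b) \<Longrightarrow>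
      efun1 F a c \<cdot> ec (esrc F) a b c g f =
        ec (etgt F) (efun0 F a) (efun0 F b) (efun0 F c) (efun1 F b c \<cdot> g) (efun1 F a b \<cdot> f)"
    and ident: "\<And>a. a \<in> eobj (esrc F) \<Longrightarrow> efun1 F a a \<cdot> eid (esrc F) a = eid (etgt F) (efun0 F a)"
  shows "enriched_functor V F"
  unfolding enriched_functor_def Let_def
proof (intro conjI ballI)
  fix a b c assume *: "a \<in> eobj (esrc F)" "b \<in> eobj (esrc F)" "c \<in> eobj (esrc F)"
  have o: "efun0 F x \<in> eobj (etgt F)" if "x \<in> eobj (esrc F)" for x using F0 that by auto
  let ?x = "ehom (esrc F) b c" let ?y = "ehom (esrc F) a b"
  \<comment> \<open>The two projections form the generic composable pair, and their pairing is the
    identity of the product.\<close>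
  have "pair V (pr1 V ?x ?y) (pr2 V ?x ?y) = Ident V (prd V ?x ?y)"
    using pair_pr[of ?x ?y "Ident V (prd V ?x ?y)"] M * by simp
  then show "efun1 F a c \<cdot> ecomp (esrc F) a b c =
     ecomp (etgt F) (efun0 F a) (efun0 F b) (efun0 F c) \<cdot> times2 V (efun1 F b c) (efun1 F a b)"
    using comp[OF *, of "pr1 V ?x ?y" "prd V ?x ?y" "pr2 V ?x ?y"] M N * ty[OF *(1,2)] ty[OF *(2,3)] ty[OF *(1,3)] o
    by (simp add: ec_def times2_def)
qed (use assms in blast)+

lemma efun_eqI:
  assumes "enriched_functor V F" "enriched_functor V G" "esrc F = esrc G" "etgt F = etgt G"
    "\<And>a. a \<in> eobj (esrc F) \<Longrightarrow> efun0 F a = efun0 G a"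
    "\<And>a b. a \<in> eobj (esrc F) \<Longrightarrow> b \<in> eobj (esrc F) \<Longrightarrow> efun1 F a b = efun1 G a b"
  shows "F = G"
proof -
  have "efun0 F = efun0 G"
    using efun0_ext[OF assms(1)] efun0_ext[OF assms(2)] assms(3,5)
    by (intro PiE_ext[of _ "eobj (esrc F)"]) auto
  moreover have "efun1 F = efun1 G"
  proof -
    have "efun1 F = restrict2 (eobj (esrc F)) (efun1 F)" by (rule efun1_ext[OF assms(1)])
    also have "\<dots> = restrict2 (eobj (esrc G)) (efun1 G)"
      using assms(3,6) by (intro ext) (simp add: restrict2_def)
    also have "\<dots> = efun1 G" by (rule efun1_ext[OF assms(2), symmetric])
    finally show ?thesis .
  qed
  ultimately show ?thesis using assms(3,4) by (cases F, cases G) simp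
qed

section \<open>The category of small enriched categories\<close>

definition id_efun :: "('o, 'a) ecat \<Rightarrow> ('o, 'a) efun" where
  "id_efun M = Ident (VCat V \<kappa>) M"

definition comp_efun :: "('o, 'a) efun \<Rightarrow> ('o, 'a) efun \<Rightarrow> ('o, 'a) efun" where
  "comp_efun G F = Comp (VCat V \<kappa>) G F"

lemma id_efun_simps [simp]:
  "esrc (id_efun M) = M" "etgt (id_efun M) = M" "a \<in> eobj M \<Longrightarrow> efun0 (id_efun M) a = a"
  "a \<in> eobj M \<Longrightarrow> b \<in> eobj M \<Longrightarrow> efun1 (id_efun M) a b = Ident V (ehom M a b)"
  by (simp_all add: id_efun_def VCat_def restrict2_def)

lemma comp_efun_simps [simp]:
  "esrc (comp_efun G F) = esrc F" "etgt (comp_efun G F) = etgt G"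
  "a \<in> eobj (esrc F) \<Longrightarrow> efun0 (comp_efun G F) a = efun0 G (efun0 F a)"
  "a \<in> eobj (esrc F) \<Longrightarrow> b \<in> eobj (esrc F) \<Longrightarrow>
     efun1 (comp_efun G F) a b = efun1 G (efun0 F a) (efun0 F b) \<cdot> efun1 F a b"
  by (simp_all add: comp_efun_def VCat_def restrict2_def)

lemma id_efun_functor:
  assumes "enriched_category V M"
  shows "enriched_functor V (id_efun M)"
proof (rule enriched_functorI)
  show "efun0 (id_efun M) \<in> eobj (esrc (id_efun M)) \<rightarrow>\<^sub>E eobj (etgt (id_efun M))"
    by (auto simp: id_efun_def VCat_def)
  show "efun1 (id_efun M) = restrict2 (eobj (esrc (id_efun M))) (efun1 (id_efun M))"
    by (intro ext) (simp add: id_efun_def VCat_def restrict2_def)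
qed (use assms in simp_all)

lemma comp_efun_functor:
  assumes F: "enriched_functor V F" and G: "enriched_functor V G" and "esrc G = etgt F"
  shows "enriched_functor V (comp_efun G F)"
proof (rule enriched_functorI)
  note M = efun_src[OF F] efun_tgt[OF F] efun_src[OF G] efun_tgt[OF G]
  have o: "efun0 F a \<in> eobj (esrc G)" if "a \<in> eobj (esrc F)" for a
    using F assms(3) that by simp
  show "efun0 (comp_efun G F) \<in> eobj (esrc (comp_efun G F)) \<rightarrow>\<^sub>E eobj (etgt (comp_efun G F))"
    using G o by (auto simp: comp_efun_def VCat_def)
  show "efun1 (comp_efun G F) = restrict2 (eobj (esrc (comp_efun G F))) (efun1 (comp_efun G F))"
    by (intro ext) (simp add: comp_efun_def VCat_def restrict2_def)
  show "efun1 (comp_efun G F) a b \<in> hom V (ehom (esrc (comp_efun G F)) a b)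
      (ehom (etgt (comp_efun G F)) (efun0 (comp_efun G F) a) (efun0 (comp_efun G F) b))"
    if "a \<in> eobj (esrc (comp_efun G F))" "b \<in> eobj (esrc (comp_efun G F))" for a b
    using that F G o assms(3) by simp
  show "efun1 (comp_efun G F) a c \<cdot> ec (esrc (comp_efun G F)) a b c g f =
        ec (etgt (comp_efun G F)) (efun0 (comp_efun G F) a) (efun0 (comp_efun G F) b)
          (efun0 (comp_efun G F) c) (efun1 (comp_efun G F) b c \<cdot> g) (efun1 (comp_efun G F) a b \<cdot> f)"
    if "a \<in> eobj (esrc (comp_efun G F))" "b \<in> eobj (esrc (comp_efun G F))" "c \<in> eobj (esrc (comp_efun G F))"
      "g \<in> hom V X (ehom (esrc (comp_efun G F)) b c)" "f \<in> hom V X (ehom (esrc (comp_efun G F)) a b)"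
    for a b c g f X
    using that F G o M assms(3) efun_ec[OF G, unfolded assms(3)] by simp
  show "efun1 (comp_efun G F) a a \<cdot> eid (esrc (comp_efun G F)) a =
      eid (etgt (comp_efun G F)) (efun0 (comp_efun G F) a)"
    if "a \<in> eobj (esrc (comp_efun G F))" for a
    using that F G o M assms(3) efun_eid(1)[OF G, unfolded assms(3)] by simp
qed (use efun_src[OF F] efun_tgt[OF G] in simp_all)

lemma VCat_Obj: "M \<in> Obj (VCat V \<kappa>) \<longleftrightarrow> small_enriched_category V \<kappa> M"
  by (simp add: VCat_def)

lemma VCat_hom: "F \<in> hom (VCat V \<kappa>) M N \<longleftrightarrow> enriched_functor V F \<and> esrc F = M \<and> etgt F = N \<and>
    small_enriched_category V \<kappa> M \<and> small_enriched_category V \<kappa> N"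
  by (auto simp: VCat_def)

lemma category_VCat: "category (VCat V \<kappa>)"
proof
  have enr: "enriched_category V M" if "small_enriched_category V \<kappa> M" for M
    using that unfolding small_enriched_category_def by blast
  show "Dom (VCat V \<kappa>) f \<in> Obj (VCat V \<kappa>)" "Cod (VCat V \<kappa>) f \<in> Obj (VCat V \<kappa>)"
    if "f \<in> Arr (VCat V \<kappa>)" for f
    using that by (simp_all add: VCat_def)
  show "Ident (VCat V \<kappa>) x \<in> hom (VCat V \<kappa>) x x" if "x \<in> Obj (VCat V \<kappa>)" for x
    using that enr id_efun_functor[of x] unfolding VCat_hom VCat_Obj id_efun_def[symmetric] by simp
  show *: "Comp (VCat V \<kappa>) g f \<in> hom (VCat V \<kappa>) x z"
    if "f \<in> hom (VCat V \<kappa>) x y" "g \<in> hom (VCat V \<kappa>) y z" for f g x y z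
    using that comp_efun_functor[of f g] unfolding VCat_hom comp_efun_def[symmetric] by simp
  show "Comp (VCat V \<kappa>) f (Ident (VCat V \<kappa>) x) = f" "Comp (VCat V \<kappa>) (Ident (VCat V \<kappa>) y) f = f"
    if "f \<in> hom (VCat V \<kappa>) x y" for f x y
  proof -
    have f: "enriched_functor V f" "esrc f = x" "etgt f = y" "enriched_category V x" "enriched_category V y"
      using that enr unfolding VCat_hom by auto
    then have i: "enriched_functor V (id_efun x)" "enriched_functor V (id_efun y)"
      using id_efun_functor by auto
    have "comp_efun f (id_efun x) = f" "comp_efun (id_efun y) f = f"
      by (rule efun_eqI; use f i comp_efun_functor[OF i(1) f(1)] comp_efun_functor[OF f(1) i(2)]
          efun_typing[OF f(1), unfolded f(2,3)] in simp)+
    then show "Comp (VCat V \<kappa>) f (Ident (VCat V \<kappa>) x) = f" "Comp (VCat V \<kappa>) (Ident (VCat V \<kappa>) y) f = f"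
      unfolding id_efun_def comp_efun_def .
  qed
  show "Comp (VCat V \<kappa>) h (Comp (VCat V \<kappa>) g f) = Comp (VCat V \<kappa>) (Comp (VCat V \<kappa>) h g) f"
    if "f \<in> hom (VCat V \<kappa>) w x" "g \<in> hom (VCat V \<kappa>) x y" "h \<in> hom (VCat V \<kappa>) y z" for f g h w x y z
  proof -
    have f: "enriched_functor V f" "esrc f = w" "etgt f = x" "enriched_functor V g" "esrc g = x" "etgt g = y"
      "enriched_functor V h" "esrc h = y" "etgt h = z"
      using that unfolding VCat_hom by auto
    have gf: "enriched_functor V (comp_efun g f)" "enriched_functor V (comp_efun h g)"
      using f comp_efun_functor by auto
    have "comp_efun h (comp_efun g f) = comp_efun (comp_efun h g) f"
      by (rule efun_eqI)
        (use f gf comp_efun_functor[OF gf(1) f(7)] comp_efun_functor[OF f(1) gf(2)] efun_typing[OF f(1), unfolded f(2,3)]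
          efun_typing[OF f(4), unfolded f(5,6)] efun_typing[OF f(7), unfolded f(8,9)] in simp_all)
    then show ?thesis unfolding comp_efun_def .
  qed
qed

subsection \<open>Internal categories through generalized elements\<close>

lemma internal_typing [simp]:
  assumes "internal_category V A"
  shows "A0 A \<in> Obj V" "A1 A \<in> Obj V"
    "d0 A \<in> Arr V" "Dom V (d0 A) = A1 A" "Cod V (d0 A) = A0 A"
    "d1 A \<in> Arr V" "Dom V (d1 A) = A1 A" "Cod V (d1 A) = A0 A"
    "iident A \<in> Arr V" "Dom V (iident A) = A0 A" "Cod V (iident A) = A1 A"
    "icomp A \<in> Arr V" "Dom V (icomp A) = A2 A" "Cod V (icomp A) = A1 A"
  using assms unfolding internal_category_def by auto

lemma internal_pullback:
  assumes "internal_category V A"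
  shows "is_pullback V (d0 A) (d1 A) (A2 A) (ipr1 A) (ipr2 A)"
  using assms unfolding internal_category_def by blast

lemma internal_pr_typing [simp]:
  assumes "internal_category V A"
  shows "A2 A \<in> Obj V" "ipr1 A \<in> Arr V" "Dom V (ipr1 A) = A2 A" "Cod V (ipr1 A) = A1 A"
    "ipr2 A \<in> Arr V" "Dom V (ipr2 A) = A2 A" "Cod V (ipr2 A) = A1 A" "d1 A \<cdot> ipr2 A = d0 A \<cdot> ipr1 A"
  using internal_pullback[OF assms] assms unfolding is_pullback_def by auto

lemma ipair_eqI:
  assumes "is_pullback V (d0 A) (d1 A) (A2 A) (ipr1 A) (ipr2 A)" "d0 A \<in> Arr V" "d1 A \<in> Arr V"
    "h \<in> Arr V" "Cod V h = A2 A" "ipr1 A \<cdot> h = u" "ipr2 A \<cdot> h = v"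
  shows "ipair V A u v = h"
proof -
  have t: "ipr1 A \<in> Arr V" "Dom V (ipr1 A) = A2 A" using assms(1) unfolding is_pullback_def by auto
  then have "Dom V u = Dom V h" using assms(4-6) by auto
  then show ?thesis
    unfolding ipair_def using assms pullback_eqI[OF assms(1-3)]
    by (intro the_equality) auto
qed

lemma ipair_typing [simp]:
  assumes A: "internal_category V A"
    and t: "u \<in> Arr V" "v \<in> Arr V" "Dom V u = Dom V v" "Cod V u = A1 A" "Cod V v = A1 A"
    "d0 A \<cdot> u = d1 A \<cdot> v"
  shows "ipair V A u v \<in> Arr V" "Dom V (ipair V A u v) = Dom V v" "Cod V (ipair V A u v) = A2 A"
    "ipr1 A \<cdot> ipair V A u v = u" "ipr2 A \<cdot> ipair V A u v = v"
proof -
  obtain h where h: "h \<in> Arr V" "Dom V h = Dom V v" "Cod V h = A2 A" "ipr1 A \<cdot> h = u" "ipr2 A \<cdot> h = v"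
    by (rule pullback_lift[OF internal_pullback[OF A], of u v]) (use A t in auto)
  have "ipair V A u v = h"
    by (rule ipair_eqI[OF internal_pullback[OF A]]) (use A h in auto)
  with h show "ipair V A u v \<in> Arr V" "Dom V (ipair V A u v) = Dom V v" "Cod V (ipair V A u v) = A2 A"
    "ipr1 A \<cdot> ipair V A u v = u" "ipr2 A \<cdot> ipair V A u v = v" by auto
qed

lemma cmp_typing [simp]:
  assumes A: "internal_category V A"
    and t: "u \<in> Arr V" "v \<in> Arr V" "Dom V u = Dom V v" "Cod V u = A1 A" "Cod V v = A1 A"
    "d0 A \<cdot> u = d1 A \<cdot> v"
  shows "cmp V A u v \<in> Arr V" "Dom V (cmp V A u v) = Dom V v" "Cod V (cmp V A u v) = A1 A"
    "d0 A \<cdot> cmp V A u v = d0 A \<cdot> v" "d1 A \<cdot> cmp V A u v = d1 A \<cdot> u"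
proof -
  show "cmp V A u v \<in> Arr V" "Dom V (cmp V A u v) = Dom V v" "Cod V (cmp V A u v) = A1 A"
    using assms unfolding cmp_def by simp_all
  have e: "d0 A \<cdot> icomp A = d0 A \<cdot> ipr2 A" "d1 A \<cdot> icomp A = d1 A \<cdot> ipr1 A"
    using A unfolding internal_category_def by blast+
  have "d0 A \<cdot> icomp A \<cdot> ipair V A u v = (d0 A \<cdot> ipr2 A) \<cdot> ipair V A u v"
    "d1 A \<cdot> icomp A \<cdot> ipair V A u v = (d1 A \<cdot> ipr1 A) \<cdot> ipair V A u v"
    using comp_extend[OF e(1), of "ipair V A u v"] comp_extend[OF e(2), of "ipair V A u v"] assms
    by simp_all
  then show "d0 A \<cdot> cmp V A u v = d0 A \<cdot> v" "d1 A \<cdot> cmp V A u v = d1 A \<cdot> u"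
    using assms unfolding cmp_def by (simp_all del: internal_pr_typing(8))
qed

lemma d_comp_eq:
  assumes "internal_category V A" "u \<in> Arr V" "v \<in> Arr V" "Cod V u = A1 A" "Cod V v = A1 A"
    "d0 A \<cdot> u = d1 A \<cdot> v" "k \<in> Arr V" "Cod V k = Dom V u" "Dom V u = Dom V v"
  shows "d0 A \<cdot> u \<cdot> k = d1 A \<cdot> v \<cdot> k"
  using comp_extend[OF assms(6), of k] assms by simp

lemma cmp_comp [simp]:
  assumes A: "internal_category V A"
    and t: "u \<in> Arr V" "v \<in> Arr V" "Dom V u = Dom V v" "Cod V u = A1 A" "Cod V v = A1 A"
    "d0 A \<cdot> u = d1 A \<cdot> v" and k: "k \<in> Arr V" "Cod V k = Dom V v"
  shows "cmp V A u v \<cdot> k = cmp V A (u \<cdot> k) (v \<cdot> k)"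
proof -
  have "ipr1 A \<cdot> ipair V A u v \<cdot> k = u \<cdot> k" "ipr2 A \<cdot> ipair V A u v \<cdot> k = v \<cdot> k"
    by (rule comp_extend; use assms in simp)+
  then have "ipair V A (u \<cdot> k) (v \<cdot> k) = ipair V A u v \<cdot> k"
    by (intro ipair_eqI[OF internal_pullback[OF A]]) (use assms in simp_all)
  then show ?thesis unfolding cmp_def using assms by simp
qed

lemma cmp_assoc [simp]:
  assumes A: "internal_category V A"
    and t: "u \<in> Arr V" "v \<in> Arr V" "w \<in> Arr V" "Dom V u = Dom V w" "Dom V v = Dom V w"
      "Cod V u = A1 A" "Cod V v = A1 A" "Cod V w = A1 A"
    "d0 A \<cdot> u = d1 A \<cdot> v" "d0 A \<cdot> v = d1 A \<cdot> w"
  shows "cmp V A (cmp V A u v) w = cmp V A u (cmp V A v w)"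
proof -
  have "u \<in> hom V (Dom V w) (A1 A) \<and> v \<in> hom V (Dom V w) (A1 A) \<and> w \<in> hom V (Dom V w) (A1 A) \<and>
        d0 A \<cdot> u = d1 A \<cdot> v \<and> d0 A \<cdot> v = d1 A \<cdot> w"
    using t by simp
  then show ?thesis using A unfolding internal_category_def by metis
qed

lemma d_ident [simp]:
  assumes "internal_category V A"
  shows "d0 A \<cdot> iident A = Ident V (A0 A)" "d1 A \<cdot> iident A = Ident V (A0 A)"
    "x \<in> Arr V \<Longrightarrow> Cod V x = A0 A \<Longrightarrow> d0 A \<cdot> iident A \<cdot> x = x"
    "x \<in> Arr V \<Longrightarrow> Cod V x = A0 A \<Longrightarrow> d1 A \<cdot> iident A \<cdot> x = x"
proof -
  show *: "d0 A \<cdot> iident A = Ident V (A0 A)" "d1 A \<cdot> iident A = Ident V (A0 A)"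
    using assms unfolding internal_category_def by blast+
  show "x \<in> Arr V \<Longrightarrow> Cod V x = A0 A \<Longrightarrow> d0 A \<cdot> iident A \<cdot> x = x"
    "x \<in> Arr V \<Longrightarrow> Cod V x = A0 A \<Longrightarrow> d1 A \<cdot> iident A \<cdot> x = x"
    using comp_extend[OF *(1), of x] comp_extend[OF *(2), of x] assms by simp_all
qed

lemma cmp_ident [simp]:
  assumes A: "internal_category V A" and u: "u \<in> Arr V" "Cod V u = A1 A"
  shows "d1 A \<cdot> u = x \<Longrightarrow> cmp V A (iident A \<cdot> x) u = u" "d0 A \<cdot> u = x \<Longrightarrow> cmp V A u (iident A \<cdot> x) = u"
proof -
  have "cmp V A (iident A \<cdot> d1 A) (Ident V (A1 A)) = Ident V (A1 A)"
    "cmp V A (Ident V (A1 A)) (iident A \<cdot> d0 A) = Ident V (A1 A)"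
    using A unfolding internal_category_def by blast+
  then have "cmp V A (iident A \<cdot> d1 A) (Ident V (A1 A)) \<cdot> u = Ident V (A1 A) \<cdot> u"
    "cmp V A (Ident V (A1 A)) (iident A \<cdot> d0 A) \<cdot> u = Ident V (A1 A) \<cdot> u"
    by simp_all
  then show "d1 A \<cdot> u = x \<Longrightarrow> cmp V A (iident A \<cdot> x) u = u" "d0 A \<cdot> u = x \<Longrightarrow> cmp V A u (iident A \<cdot> x) = u"
    using assms by auto
qed

text \<open>These are the elements that factor through \<open>EI V A\<close>, described without the
  two successive equalizers; \<open>idem_EI\<close> and \<open>star_typing\<close> give both
  directions.\<close>

definition idem :: "('o, 'a, 'z) icat_scheme \<Rightarrow> 'a \<Rightarrow> bool" where
  "idem A u \<longleftrightarrow> u \<in> Arr V \<and> Cod V u = A1 A \<and> d0 A \<cdot> u = d1 A \<cdot> u \<and> cmp V A u u = u"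

lemma idemD:
  assumes "idem A u"
  shows "u \<in> Arr V" "Cod V u = A1 A" "d1 A \<cdot> u = d0 A \<cdot> u" "cmp V A u u = u"
  using assms unfolding idem_def by auto

declare idemD(3,4) [simp]

lemma idem_comp [simp]:
  assumes "internal_category V A" "idem A u" "k \<in> Arr V" "Cod V k = Dom V u"
  shows "idem A (u \<cdot> k)"
proof -
  have "cmp V A u u \<cdot> k = cmp V A (u \<cdot> k) (u \<cdot> k)"
    by (rule cmp_comp) (use assms idemD(1,2)[OF assms(2)] in simp_all)
  then show ?thesis
    unfolding idem_def using assms idemD(1,2)[OF assms(2)] d_comp_eq[OF assms(1), of u u k] by simp
qed

lemma idem_ident:
  assumes "internal_category V A" "x \<in> Arr V" "Cod V x = A0 A"
  shows "idem A (iident A \<cdot> x)"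
  using assms unfolding idem_def by simp

text \<open>\<open>EI\<close> represents the idempotent elements. The first equalizer turns
  \<open>u\<close> into an element \<open>v\<close> of the endomorphisms, and the squaring arrow
  \<open>s\<close> fixes \<open>v\<close> exactly when \<open>u\<close> composed with itself is
  \<open>u\<close>; so \<open>v\<close> factors through the second.\<close>

lemma EI_idem:
  assumes A: "internal_category V A"
  shows "idem A (EI V A)" "Dom V (EI V A) = Idem V A" "mono_V (EI V A)"
    and EI_lift: "\<And>u. idem A u \<Longrightarrow> \<exists>t. t \<in> hom V (Dom V u) (Idem V A) \<and> EI V A \<cdot> t = u"
proof -
  let ?E = "End_incl V A"
  have dd: "d0 A \<in> Arr V" "d1 A \<in> Arr V" "Dom V (d0 A) = Dom V (d1 A)" "Cod V (d0 A) = Cod V (d1 A)"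
    using A by simp_all
  have E: "?E \<in> Arr V" "Cod V ?E = A1 A" "d0 A \<cdot> ?E = d1 A \<cdot> ?E" "mono_V ?E"
    using equalizer_props[OF dd] A unfolding End_incl_def by simp_all
  let ?s = "factor V ?E (cmp V A ?E ?E)"
  have "d0 A \<cdot> cmp V A ?E ?E = d1 A \<cdot> cmp V A ?E ?E" using A E by simp
  then have s: "?s \<in> Arr V" "Dom V ?s = Dom V ?E" "Cod V ?s = Dom V ?E" "?E \<cdot> ?s = cmp V A ?E ?E"
    using equalizer_factor[OF dd, of "cmp V A ?E ?E"] A E unfolding End_incl_def[symmetric] by simp_all
  have is_: "Ident V (Dom V ?E) \<in> Arr V" "?s \<in> Arr V" "Dom V (Ident V (Dom V ?E)) = Dom V ?s"
    "Cod V (Ident V (Dom V ?E)) = Cod V ?s" using E s by simp_all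
  let ?I = "Idem_incl V A"
  have I: "?I \<in> Arr V" "Cod V ?I = Dom V ?E" "?s \<cdot> ?I = ?I" "mono_V ?I"
    using equalizer_props[OF is_] E s unfolding Idem_incl_def by simp_all
  have EI: "EI V A \<in> Arr V" "Cod V (EI V A) = A1 A"
    using E I by (simp_all add: EI_def)
  show "Dom V (EI V A) = Idem V A" using E I by (simp add: EI_def Idem_def)
  show "mono_V (EI V A)" unfolding EI_def by (rule mono_V_comp) (use E I in simp_all)
  have "cmp V A ?E ?E \<cdot> ?I = ?E \<cdot> ?s \<cdot> ?I"
    using comp_extend[OF s(4), of ?I] E s I by simp
  then have "cmp V A (EI V A) (EI V A) = EI V A"
    using A E I by (simp add: EI_def)
  moreover have "d0 A \<cdot> EI V A = d1 A \<cdot> EI V A"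
    unfolding EI_def by (rule d_comp_eq[OF A]) (use E I in simp_all)
  ultimately show "idem A (EI V A)" unfolding idem_def using EI by simp
  fix u assume u': "idem A u"
  note u = u' idemD[OF u']
  let ?v = "factor V ?E u"
  have v: "?v \<in> Arr V" "Dom V ?v = Dom V u" "Cod V ?v = Dom V ?E" "?E \<cdot> ?v = u"
    using equalizer_factor[OF dd, of u] A u unfolding End_incl_def[symmetric] by simp_all
  have "?E \<cdot> ?s \<cdot> ?v = cmp V A ?E ?E \<cdot> ?v"
    using comp_extend[OF s(4), of ?v] E s v by simp
  also have "\<dots> = ?E \<cdot> ?v" using A E v u by simp
  finally have "?s \<cdot> ?v = ?v"
    using mono_V_D[OF E(4)] E s v by simp
  then have *: "Ident V (Dom V ?E) \<cdot> ?v = ?s \<cdot> ?v" using v by simp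
  let ?w = "factor V ?I ?v"
  have w: "?w \<in> Arr V" "Dom V ?w = Dom V ?v" "Cod V ?w = Dom V ?I" "?I \<cdot> ?w = ?v"
    using equalizer_factor[OF is_ v(1) _ *] E s v unfolding Idem_incl_def[symmetric] by simp_all
  have "EI V A \<cdot> ?w = u" using E I v w by (simp add: EI_def)
  then show "\<exists>t. t \<in> hom V (Dom V u) (Idem V A) \<and> EI V A \<cdot> t = u"
    using w v unfolding Idem_def by auto
qed

lemma EI_typing [simp]:
  assumes "internal_category V A"
  shows "EI V A \<in> Arr V" "Dom V (EI V A) = Idem V A" "Cod V (EI V A) = A1 A" "Idem V A \<in> Obj V"
proof -
  show *: "EI V A \<in> Arr V" "Dom V (EI V A) = Idem V A" "Cod V (EI V A) = A1 A"
    using EI_idem(2)[OF assms] idemD[OF EI_idem(1)[OF assms]] by simp_all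
  show "Idem V A \<in> Obj V" using * obj_dom by metis
qed

lemma star_eqI:
  assumes "internal_category V A" "t \<in> Arr V" "Cod V t = Idem V A" "EI V A \<cdot> t = u"
  shows "star V A u = t"
  unfolding star_def by (rule factor_eqI) (use EI_idem[OF assms(1)] assms in simp_all)

lemma star_typing [simp]:
  assumes "internal_category V A" "idem A u"
  shows "star V A u \<in> Arr V" "Dom V (star V A u) = Dom V u" "Cod V (star V A u) = Idem V A"
    "EI V A \<cdot> star V A u = u"
proof -
  obtain t where "t \<in> hom V (Dom V u) (Idem V A) \<and> EI V A \<cdot> t = u" using EI_lift[OF assms] by blast
  moreover from this have "star V A u = t" using star_eqI[OF assms(1)] by simp
  ultimately show "star V A u \<in> Arr V" "Dom V (star V A u) = Dom V u" "Cod V (star V A u) = Idem V A"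
    "EI V A \<cdot> star V A u = u" by auto
qed

lemma star_comp [simp]:
  assumes "internal_category V A" "idem A u" "k \<in> Arr V" "Cod V k = Dom V u"
  shows "star V A u \<cdot> k = star V A (u \<cdot> k)"
proof -
  have "EI V A \<cdot> star V A u \<cdot> k = u \<cdot> k"
    by (rule comp_extend) (use assms in simp_all)
  then show ?thesis
    by (intro star_eqI[OF assms(1), symmetric]) (use assms in simp_all)
qed

lemma idem_EI [simp]:
  assumes "internal_category V A" "t \<in> Arr V" "Cod V t = Idem V A"
  shows "idem A (EI V A \<cdot> t)" "star V A (EI V A \<cdot> t) = t"
  using assms EI_idem(1)[OF assms(1)] star_eqI[OF assms refl] by simp_all

text \<open>The retraction and section of a split, applied to an idempotent at an arbitrary stage.\<close>

definition Rt :: "('o, 'a) icat_split \<Rightarrow> 'a \<Rightarrow> 'a" where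
  "Rt A u = spR A \<cdot> star V A u"

definition Sc :: "('o, 'a) icat_split \<Rightarrow> 'a \<Rightarrow> 'a" where
  "Sc A u = spS A \<cdot> star V A u"

lemma split_typing:
  assumes "is_split V A"
  shows "spR A \<in> Arr V" "Dom V (spR A) = Idem V A" "Cod V (spR A) = A1 A"
    "spS A \<in> Arr V" "Dom V (spS A) = Idem V A" "Cod V (spS A) = A1 A"
  using assms unfolding is_split_def by auto

lemma split_props [simp]:
  assumes A: "internal_category V A" "is_split V A" "idem A u"
  shows "Rt A u \<in> Arr V" "Dom V (Rt A u) = Dom V u" "Cod V (Rt A u) = A1 A"
    "Sc A u \<in> Arr V" "Dom V (Sc A u) = Dom V u" "Cod V (Sc A u) = A1 A"
    "d0 A \<cdot> Rt A u = d0 A \<cdot> u" "d1 A \<cdot> Sc A u = d0 A \<cdot> u" "d0 A \<cdot> Sc A u = d1 A \<cdot> Rt A u"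
    "cmp V A (Sc A u) (Rt A u) = u" "cmp V A (Rt A u) (Sc A u) = iident A \<cdot> d1 A \<cdot> Rt A u"
proof -
  note s = split_typing[OF A(2)]
  show "Rt A u \<in> Arr V" "Dom V (Rt A u) = Dom V u" "Cod V (Rt A u) = A1 A"
    "Sc A u \<in> Arr V" "Dom V (Sc A u) = Dom V u" "Cod V (Sc A u) = A1 A"
    unfolding Rt_def Sc_def using A s by simp_all
  have e: "d0 A \<cdot> spR A = d0 A \<cdot> EI V A" "d1 A \<cdot> spS A = d0 A \<cdot> EI V A" "d0 A \<cdot> spS A = d1 A \<cdot> spR A"
    "cmp V A (spS A) (spR A) = EI V A" "cmp V A (spR A) (spS A) = iident A \<cdot> d0 A \<cdot> spS A"
    using A(2) unfolding is_split_def by auto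
  have "(d0 A \<cdot> spR A) \<cdot> star V A u = (d0 A \<cdot> EI V A) \<cdot> star V A u"
    "(d1 A \<cdot> spS A) \<cdot> star V A u = (d0 A \<cdot> EI V A) \<cdot> star V A u"
    "(d0 A \<cdot> spS A) \<cdot> star V A u = (d1 A \<cdot> spR A) \<cdot> star V A u"
    using e by simp_all
  then show d: "d0 A \<cdot> Rt A u = d0 A \<cdot> u" "d1 A \<cdot> Sc A u = d0 A \<cdot> u" "d0 A \<cdot> Sc A u = d1 A \<cdot> Rt A u"
    unfolding Rt_def Sc_def using A s by simp_all
  have "cmp V A (spS A) (spR A) \<cdot> star V A u = EI V A \<cdot> star V A u"
    "cmp V A (spR A) (spS A) \<cdot> star V A u = (iident A \<cdot> d1 A \<cdot> spR A) \<cdot> star V A u"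
    unfolding e(3)[symmetric] using e by simp_all
  then show "cmp V A (Sc A u) (Rt A u) = u" "cmp V A (Rt A u) (Sc A u) = iident A \<cdot> d1 A \<cdot> Rt A u"
    unfolding Rt_def Sc_def using A s e(1-3) by simp_all
qed

lemma split_comp [simp]:
  assumes A: "internal_category V A" "is_split V A" "idem A u" "k \<in> Arr V" "Cod V k = Dom V u"
  shows "Rt A u \<cdot> k = Rt A (u \<cdot> k)" "Sc A u \<cdot> k = Sc A (u \<cdot> k)"
  unfolding Rt_def Sc_def using assms split_typing[OF A(2)] by simp_all

lemma canonical_split_is_split: "is_canonical_split V A \<Longrightarrow> is_split V A"
  unfolding is_canonical_split_def by blast

lemma canonical_split_ident:
  assumes A: "internal_category V A" "is_canonical_split V A" "x \<in> Arr V" "Cod V x = A0 A"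
  shows "Rt A (iident A \<cdot> x) = iident A \<cdot> x" "Sc A (iident A \<cdot> x) = iident A \<cdot> x"
proof -
  note sp = canonical_split_is_split[OF A(2)]
  have i: "idem A (iident A)" using idem_ident[OF A(1), of "Ident V (A0 A)"] A(1) by simp
  have "Rt A (iident A) \<cdot> x = iident A \<cdot> x" "Sc A (iident A) \<cdot> x = iident A \<cdot> x"
    using A(2) unfolding is_canonical_split_def Rt_def Sc_def by auto
  then show "Rt A (iident A \<cdot> x) = iident A \<cdot> x" "Sc A (iident A \<cdot> x) = iident A \<cdot> x"
    using A sp i by simp_all
qed

lemma canonical_split_cond:
  assumes A: "internal_category V A" "is_canonical_split V A"
    and fg: "idem A f" "idem A g" "Dom V f = Dom V g" "d0 A \<cdot> f = d1 A \<cdot> g"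
      "cmp V A f (cmp V A g f) = g"
  shows "Rt A (cmp V A (Rt A f) (cmp V A g (Sc A f))) = cmp V A (Rt A g) (Sc A f)"
    "Sc A (cmp V A (Rt A f) (cmp V A g (Sc A f))) = cmp V A (Rt A f) (Sc A g)"
proof -
  have *: "star V A f \<in> hom V (Dom V g) (Idem V A) \<and> star V A g \<in> hom V (Dom V g) (Idem V A)"
    using A fg by simp
  \<comment> \<open>The copies \<open>f'\<close> and \<open>g'\<close> stand for the elements
    themselves where the names \<open>f\<close> and \<open>g\<close> are already captured by the
    let-bindings.\<close>
  have "let f = EI V A \<cdot> star V A f; g = EI V A \<cdot> star V A g;
             h = cmp V A (spR A \<cdot> star V A f') (cmp V A g (spS A \<cdot> star V A f')) in
         d0 A \<cdot> f = d1 A \<cdot> g \<and> d0 A \<cdot> g = d1 A \<cdot> f \<and> cmp V A f (cmp V A g f) = g \<longrightarrow>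
         spR A \<cdot> star V A h = cmp V A (spR A \<cdot> star V A g') (spS A \<cdot> star V A f') \<and>
         spS A \<cdot> star V A h = cmp V A (spR A \<cdot> star V A f') (spS A \<cdot> star V A g')"
    if "f' = f" "g' = g" for f' g'
    using A(2) * unfolding is_canonical_split_def that by blast
  from this[OF refl refl]
  show "Rt A (cmp V A (Rt A f) (cmp V A g (Sc A f))) = cmp V A (Rt A g) (Sc A f)"
    "Sc A (cmp V A (Rt A f) (cmp V A g (Sc A f))) = cmp V A (Rt A f) (Sc A g)"
    unfolding Rt_def Sc_def Let_def using A fg by simp_all
qed

subsection \<open>Internal functors\<close>

lemma internal_functor_props:
  assumes "internal_functor V F"
  shows ifun_src: "internal_category V (isrc F)" and ifun_tgt: "internal_category V (itgt F)"
  using assms unfolding internal_functor_def Let_def by blast+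

lemma ifun_typing [simp]:
  assumes "internal_functor V F"
  shows "ifun0 F \<in> Arr V" "Dom V (ifun0 F) = A0 (isrc F)" "Cod V (ifun0 F) = A0 (itgt F)"
    "ifun1 F \<in> Arr V" "Dom V (ifun1 F) = A1 (isrc F)" "Cod V (ifun1 F) = A1 (itgt F)"
    "ifun1 F \<cdot> iident (isrc F) = iident (itgt F) \<cdot> ifun0 F"
  using assms unfolding internal_functor_def Let_def by auto

lemma ifun_d [simp]:
  assumes "internal_functor V F"
  shows "d0 (itgt F) \<cdot> ifun1 F = ifun0 F \<cdot> d0 (isrc F)" "d1 (itgt F) \<cdot> ifun1 F = ifun0 F \<cdot> d1 (isrc F)"
    "u \<in> Arr V \<Longrightarrow> Cod V u = A1 (isrc F) \<Longrightarrow> d0 (itgt F) \<cdot> ifun1 F \<cdot> u = ifun0 F \<cdot> d0 (isrc F) \<cdot> u"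
    "u \<in> Arr V \<Longrightarrow> Cod V u = A1 (isrc F) \<Longrightarrow> d1 (itgt F) \<cdot> ifun1 F \<cdot> u = ifun0 F \<cdot> d1 (isrc F) \<cdot> u"
    "x \<in> Arr V \<Longrightarrow> Cod V x = A0 (isrc F) \<Longrightarrow> ifun1 F \<cdot> iident (isrc F) \<cdot> x = iident (itgt F) \<cdot> ifun0 F \<cdot> x"
proof -
  note A = ifun_src[OF assms] ifun_tgt[OF assms]
  show d: "d0 (itgt F) \<cdot> ifun1 F = ifun0 F \<cdot> d0 (isrc F)" "d1 (itgt F) \<cdot> ifun1 F = ifun0 F \<cdot> d1 (isrc F)"
    using assms unfolding internal_functor_def Let_def by auto
  show "u \<in> Arr V \<Longrightarrow> Cod V u = A1 (isrc F) \<Longrightarrow> d0 (itgt F) \<cdot> ifun1 F \<cdot> u = ifun0 F \<cdot> d0 (isrc F) \<cdot> u"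
    "u \<in> Arr V \<Longrightarrow> Cod V u = A1 (isrc F) \<Longrightarrow> d1 (itgt F) \<cdot> ifun1 F \<cdot> u = ifun0 F \<cdot> d1 (isrc F) \<cdot> u"
    "x \<in> Arr V \<Longrightarrow> Cod V x = A0 (isrc F) \<Longrightarrow> ifun1 F \<cdot> iident (isrc F) \<cdot> x = iident (itgt F) \<cdot> ifun0 F \<cdot> x"
    using comp_extend[OF d(1), of u] comp_extend[OF d(2), of u] comp_extend[OF ifun_typing(7)[OF assms], of x]
      A assms by simp_all
qed

lemma ifun_cmp [simp]:
  assumes F: "internal_functor V F" and t: "u \<in> Arr V" "v \<in> Arr V" "Dom V u = Dom V v"
    "Cod V u = A1 (isrc F)" "Cod V v = A1 (isrc F)" "d0 (isrc F) \<cdot> u = d1 (isrc F) \<cdot> v"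
  shows "ifun1 F \<cdot> cmp V (isrc F) u v = cmp V (itgt F) (ifun1 F \<cdot> u) (ifun1 F \<cdot> v)"
proof -
  let ?A = "isrc F" let ?B = "itgt F"
  note A = ifun_src[OF F] ifun_tgt[OF F]
  have "ifun1 F \<cdot> icomp ?A = cmp V ?B (ifun1 F \<cdot> ipr1 ?A) (ifun1 F \<cdot> ipr2 ?A)"
    using F unfolding internal_functor_def Let_def by auto
  then have "(ifun1 F \<cdot> icomp ?A) \<cdot> ipair V ?A u v =
      cmp V ?B (ifun1 F \<cdot> ipr1 ?A) (ifun1 F \<cdot> ipr2 ?A) \<cdot> ipair V ?A u v"
    by simp
  also have "\<dots> = cmp V ?B ((ifun1 F \<cdot> ipr1 ?A) \<cdot> ipair V ?A u v) ((ifun1 F \<cdot> ipr2 ?A) \<cdot> ipair V ?A u v)"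
    by (rule cmp_comp) (use A F t in simp_all)
  finally show ?thesis unfolding cmp_def[of V ?A] using A F t by simp
qed

lemma internal_functorI:
  assumes A: "internal_category V (isrc F)" and B: "internal_category V (itgt F)"
    and typ0: "ifun0 F \<in> hom V (A0 (isrc F)) (A0 (itgt F))"
    and typ1: "ifun1 F \<in> hom V (A1 (isrc F)) (A1 (itgt F))"
    and d: "d0 (itgt F) \<cdot> ifun1 F = ifun0 F \<cdot> d0 (isrc F)" "d1 (itgt F) \<cdot> ifun1 F = ifun0 F \<cdot> d1 (isrc F)"
    and ident: "ifun1 F \<cdot> iident (isrc F) = iident (itgt F) \<cdot> ifun0 F"
    and comp: "\<And>u v X. u \<in> hom V X (A1 (isrc F)) \<Longrightarrow> v \<in> hom V X (A1 (isrc F)) \<Longrightarrow>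
      d0 (isrc F) \<cdot> u = d1 (isrc F) \<cdot> v \<Longrightarrow>
      ifun1 F \<cdot> cmp V (isrc F) u v = cmp V (itgt F) (ifun1 F \<cdot> u) (ifun1 F \<cdot> v)"
  shows "internal_functor V F"
proof -
  let ?A = "isrc F" let ?B = "itgt F"
  \<comment> \<open>The two projections of \<open>A2\<close> are the generic composable pair;
    testing \<open>comp\<close> on them recovers the diagram for \<open>icomp\<close>.\<close>
  have "ipair V ?A (ipr1 ?A) (ipr2 ?A) = Ident V (A2 ?A)"
    by (rule ipair_eqI[OF internal_pullback[OF A]]) (use A in simp_all)
  then have "ifun1 F \<cdot> icomp ?A = cmp V ?B (ifun1 F \<cdot> ipr1 ?A) (ifun1 F \<cdot> ipr2 ?A)"
    using comp[of "ipr1 ?A" "A2 ?A" "ipr2 ?A"] A by (simp add: cmp_def[of V ?A])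
  then show ?thesis
    unfolding internal_functor_def Let_def using assms by blast
qed

lemma ifun_idem [simp]:
  assumes "internal_functor V F" "idem (isrc F) u"
  shows "idem (itgt F) (ifun1 F \<cdot> u)"
proof -
  have "ifun1 F \<cdot> cmp V (isrc F) u u = cmp V (itgt F) (ifun1 F \<cdot> u) (ifun1 F \<cdot> u)"
    by (rule ifun_cmp) (use assms ifun_src[OF assms(1)] idemD[OF assms(2)] in simp_all)
  then show ?thesis
    unfolding idem_def using assms idemD[OF assms(2)] ifun_src[OF assms(1)] ifun_tgt[OF assms(1)] by simp
qed

lemma Idem_map_props:
  assumes "internal_functor V F"
  shows "Idem_map V F \<in> Arr V" "Dom V (Idem_map V F) = Idem V (isrc F)" "Cod V (Idem_map V F) = Idem V (itgt F)"
    "idem (isrc F) u \<Longrightarrow> Idem_map V F \<cdot> star V (isrc F) u = star V (itgt F) (ifun1 F \<cdot> u)"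
proof -
  note A = ifun_src[OF assms] ifun_tgt[OF assms]
  have i: "idem (itgt F) (ifun1 F \<cdot> EI V (isrc F))" using EI_idem(1)[OF A(1)] assms by simp
  then show "Idem_map V F \<in> Arr V" "Dom V (Idem_map V F) = Idem V (isrc F)" "Cod V (Idem_map V F) = Idem V (itgt F)"
    unfolding Idem_map_def using A assms by simp_all
  show "idem (isrc F) u \<Longrightarrow> Idem_map V F \<cdot> star V (isrc F) u = star V (itgt F) (ifun1 F \<cdot> u)"
    unfolding Idem_map_def using A assms i by simp
qed

text \<open>Precomposing with \<open>star\<close> gives the values at every idempotent element;
  conversely the arrows \<open>spR\<close> and \<open>spS\<close> are the values at the generic
  idempotent \<open>EI\<close>, whose \<open>star\<close> is the identity.\<close>

lemma preserves_split_iff: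
  assumes F: "internal_functor V F" and A: "is_split V (isrc F)" and B: "is_split V (itgt F)"
  shows "preserves_split V F \<longleftrightarrow>
     (\<forall>u. idem (isrc F) u \<longrightarrow> ifun1 F \<cdot> Rt (isrc F) u = Rt (itgt F) (ifun1 F \<cdot> u) \<and>
        ifun1 F \<cdot> Sc (isrc F) u = Sc (itgt F) (ifun1 F \<cdot> u))"
proof -
  let ?A = "isrc F" let ?B = "itgt F"
  note I = ifun_src[OF F] ifun_tgt[OF F]
  note sA = split_typing[OF A] and sB = split_typing[OF B]
  note m = Idem_map_props[OF F]
  have pull: "ifun1 F \<cdot> Rt ?A u = (ifun1 F \<cdot> spR ?A) \<cdot> star V ?A u"
    "ifun1 F \<cdot> Sc ?A u = (ifun1 F \<cdot> spS ?A) \<cdot> star V ?A u"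
    "Rt ?B (ifun1 F \<cdot> u) = (spR ?B \<cdot> Idem_map V F) \<cdot> star V ?A u"
    "Sc ?B (ifun1 F \<cdot> u) = (spS ?B \<cdot> Idem_map V F) \<cdot> star V ?A u" if "idem ?A u" for u
    using that I sA sB F m by (simp_all add: Rt_def Sc_def)
  have E: "idem ?A (EI V ?A)" "star V ?A (EI V ?A) = Ident V (Idem V ?A)"
    using EI_idem(1)[OF I(1)] star_eqI[OF I(1), of "Ident V (Idem V ?A)"] I by simp_all
  show ?thesis
  proof
    assume "preserves_split V F"
    then show "\<forall>u. idem ?A u \<longrightarrow> ifun1 F \<cdot> Rt ?A u = Rt ?B (ifun1 F \<cdot> u) \<and>
        ifun1 F \<cdot> Sc ?A u = Sc ?B (ifun1 F \<cdot> u)"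
      using pull unfolding preserves_split_def by simp
  next
    assume "\<forall>u. idem ?A u \<longrightarrow> ifun1 F \<cdot> Rt ?A u = Rt ?B (ifun1 F \<cdot> u) \<and>
        ifun1 F \<cdot> Sc ?A u = Sc ?B (ifun1 F \<cdot> u)"
    then show "preserves_split V F"
      using pull[OF E(1)] E F sA sB m unfolding preserves_split_def by simp
  qed
qed

section \<open>The category of internal categories with canonical split\<close>

lemma Cat_sp_Obj: "A \<in> Obj (Cat_sp V \<kappa>) \<longleftrightarrow> small_split_category V \<kappa> A"
  by (simp add: Cat_sp_def)

lemma Cat_sp_hom: "F \<in> hom (Cat_sp V \<kappa>) A B \<longleftrightarrow> internal_functor V F \<and> preserves_split V F \<and>
    isrc F = A \<and> itgt F = B \<and> small_split_category V \<kappa> A \<and> small_split_category V \<kappa> B"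
  by (auto simp: Cat_sp_def)

lemma small_split_categoryD:
  assumes "small_split_category V \<kappa> A"
  shows "internal_category V A" "is_canonical_split V A" "is_split V A"
  using assms canonical_split_is_split unfolding small_split_category_def by blast+

lemma Cat_sp_Ident:
  "isrc (Ident (Cat_sp V \<kappa>) A) = A" "itgt (Ident (Cat_sp V \<kappa>) A) = A"
  "ifun0 (Ident (Cat_sp V \<kappa>) A) = Ident V (A0 A)" "ifun1 (Ident (Cat_sp V \<kappa>) A) = Ident V (A1 A)"
  by (simp_all add: Cat_sp_def)

lemma Cat_sp_Comp:
  "isrc (Comp (Cat_sp V \<kappa>) G F) = isrc F" "itgt (Comp (Cat_sp V \<kappa>) G F) = itgt G"
  "ifun0 (Comp (Cat_sp V \<kappa>) G F) = ifun0 G \<cdot> ifun0 F" "ifun1 (Comp (Cat_sp V \<kappa>) G F) = ifun1 G \<cdot> ifun1 F"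
  by (simp_all add: Cat_sp_def)

lemma ifun_eqI:
  fixes F G :: "('o, 'a) ifun"
  assumes "isrc F = isrc G" "itgt F = itgt G" "ifun0 F = ifun0 G" "ifun1 F = ifun1 G"
  shows "F = G"
  using assms by simp

lemma category_Cat_sp: "category (Cat_sp V \<kappa>)"
proof
  show "Dom (Cat_sp V \<kappa>) f \<in> Obj (Cat_sp V \<kappa>)" "Cod (Cat_sp V \<kappa>) f \<in> Obj (Cat_sp V \<kappa>)"
    if "f \<in> Arr (Cat_sp V \<kappa>)" for f
    using that by (simp_all add: Cat_sp_def)
  show "Ident (Cat_sp V \<kappa>) A \<in> hom (Cat_sp V \<kappa>) A A" if "A \<in> Obj (Cat_sp V \<kappa>)" for A
  proof -
    let ?F = "Ident (Cat_sp V \<kappa>) A"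
    have A: "small_split_category V \<kappa> A" using that unfolding Cat_sp_Obj .
    note a = small_split_categoryD[OF A]
    have F: "internal_functor V ?F"
      by (rule internal_functorI) (use a in \<open>simp_all add: Cat_sp_Ident\<close>)
    have "preserves_split V ?F"
      using a preserves_split_iff[OF F] idemD(1,2)[of A] by (simp add: Cat_sp_Ident)
    with F A show ?thesis unfolding Cat_sp_hom by (simp add: Cat_sp_Ident)
  qed
  show "Comp (Cat_sp V \<kappa>) g f \<in> hom (Cat_sp V \<kappa>) x z"
    if "f \<in> hom (Cat_sp V \<kappa>) x y" "g \<in> hom (Cat_sp V \<kappa>) y z" for f g x y z
  proof -
    let ?F = "Comp (Cat_sp V \<kappa>) g f"
    have f: "internal_functor V f" "preserves_split V f" "isrc f = x" "itgt f = y"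
      "internal_functor V g" "preserves_split V g" "isrc g = y" "itgt g = z"
      and s: "small_split_category V \<kappa> x" "small_split_category V \<kappa> y" "small_split_category V \<kappa> z"
      using that unfolding Cat_sp_hom by auto
    note a = small_split_categoryD[OF s(1)] small_split_categoryD[OF s(2)] small_split_categoryD[OF s(3)]
    note fr = ifun_typing[OF f(1), unfolded f(3,4)] ifun_d[OF f(1), unfolded f(3,4)]
      ifun_cmp[OF f(1), unfolded f(3,4)] ifun_idem[OF f(1), unfolded f(3,4)]
    note gr = ifun_typing[OF f(5), unfolded f(7,8)] ifun_d[OF f(5), unfolded f(7,8)]
      ifun_cmp[OF f(5), unfolded f(7,8)] ifun_idem[OF f(5), unfolded f(7,8)]
    have F: "internal_functor V ?F"
      by (rule internal_functorI) (use a f(3,4,7,8) fr gr in \<open>simp_all add: Cat_sp_Comp\<close>)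
    have "preserves_split V ?F"
      using a f(2,6) fr gr idemD(1,2)[of x] preserves_split_iff[OF F] preserves_split_iff[OF f(1)] preserves_split_iff[OF f(5)]
      by (simp add: Cat_sp_Comp f(3,4,7,8))
    with F f s show ?thesis unfolding Cat_sp_hom by (simp add: Cat_sp_Comp)
  qed
  show "Comp (Cat_sp V \<kappa>) f (Ident (Cat_sp V \<kappa>) x) = f" "Comp (Cat_sp V \<kappa>) (Ident (Cat_sp V \<kappa>) y) f = f"
    if "f \<in> hom (Cat_sp V \<kappa>) x y" for f x y
    by (rule ifun_eqI; use that in \<open>auto simp: Cat_sp_hom Cat_sp_Comp Cat_sp_Ident simp del: in_hom\<close>)+
  show "Comp (Cat_sp V \<kappa>) h (Comp (Cat_sp V \<kappa>) g f) = Comp (Cat_sp V \<kappa>) (Comp (Cat_sp V \<kappa>) h g) f"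
    if "f \<in> hom (Cat_sp V \<kappa>) w x" "g \<in> hom (Cat_sp V \<kappa>) x y" "h \<in> hom (Cat_sp V \<kappa>) y z" for f g h w x y z
    by (rule ifun_eqI) (use that in \<open>auto simp: Cat_sp_hom Cat_sp_Comp simp del: in_hom\<close>)
qed

subsection \<open>The underlying enriched category\<close>

lemma En_obj_simps [simp]:
  "eobj (En_obj V A) = hom V (trm V) (A0 A)"
  "ehom (En_obj V A) \<alpha> \<beta> = Dom V (up V A \<alpha> \<beta>)"
  by (simp_all add: En_obj_def Let_def del: in_hom)

text \<open>The hom-object is the fibre of the pair \<open>d0\<close>, \<open>d1\<close> over the
  point given by \<open>\<alpha>\<close> and \<open>\<beta>\<close>, obtained as the equalizer of
  that pair with a constant one.\<close>

lemma up_universal: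
  assumes A: "internal_category V A" and \<alpha>: "\<alpha> \<in> hom V (trm V) (A0 A)" and \<beta>: "\<beta> \<in> hom V (trm V) (A0 A)"
  shows "is_universal_between V A \<alpha> \<beta> (up V A \<alpha> \<beta>)"
proof -
  let ?f = "pair V (d0 A) (d1 A)" and ?g = "pair V (\<alpha> \<cdot> bang V (A1 A)) (\<beta> \<cdot> bang V (A1 A))"
  have fg: "?f \<in> Arr V" "?g \<in> Arr V" "Dom V ?f = Dom V ?g" "Cod V ?f = Cod V ?g"
    using A \<alpha> \<beta> by simp_all
  let ?e = "equalizer V ?f ?g"
  have e: "?e \<in> Arr V" "Cod V ?e = A1 A" "?f \<cdot> ?e = ?g \<cdot> ?e" "mono_V ?e"
    using equalizer_props[OF fg] A by simp_all
  have "pair V (d0 A \<cdot> ?e) (d1 A \<cdot> ?e) = pair V (\<alpha> \<cdot> bang V (Dom V ?e)) (\<beta> \<cdot> bang V (Dom V ?e))"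
    using e A \<alpha> \<beta> by simp
  from pair_inject[OF this] have d: "d0 A \<cdot> ?e = \<alpha> \<cdot> bang V (Dom V ?e)" "d1 A \<cdot> ?e = \<beta> \<cdot> bang V (Dom V ?e)"
    using e A \<alpha> \<beta> by simp_all
  have "is_universal_between V A \<alpha> \<beta> ?e"
    unfolding is_universal_between_def
  proof (intro conjI allI impI)
    show "?e \<in> Arr V" "Cod V ?e = A1 A" by fact+
    show "d0 A \<cdot> ?e = \<alpha> \<cdot> bang V (Dom V ?e)" "d1 A \<cdot> ?e = \<beta> \<cdot> bang V (Dom V ?e)" by fact+
    fix X u assume u: "u \<in> hom V X (A1 A) \<and> d0 A \<cdot> u = \<alpha> \<cdot> bang V X \<and> d1 A \<cdot> u = \<beta> \<cdot> bang V X"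
    have "?f \<cdot> u = ?g \<cdot> u" using u A \<alpha> \<beta> by simp
    then have h: "factor V ?e u \<in> Arr V" "Dom V (factor V ?e u) = X" "Cod V (factor V ?e u) = Dom V ?e"
      "?e \<cdot> factor V ?e u = u"
      using equalizer_factor[OF fg, of u] u A by simp_all
    show "\<exists>!h. h \<in> hom V X (Dom V ?e) \<and> ?e \<cdot> h = u"
    proof (rule ex1I[of _ "factor V ?e u"])
      show "factor V ?e u \<in> hom V X (Dom V ?e) \<and> ?e \<cdot> factor V ?e u = u" using h by simp
      fix k assume k: "k \<in> hom V X (Dom V ?e) \<and> ?e \<cdot> k = u"
      show "k = factor V ?e u" by (rule mono_V_D[OF e(4)]) (use h k in simp_all)
    qed
  qed
  then show ?thesis unfolding up_def by (rule someI)
qed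

lemma up_typing [simp]:
  assumes A: "internal_category V A" and \<alpha>: "\<alpha> \<in> hom V (trm V) (A0 A)" and \<beta>: "\<beta> \<in> hom V (trm V) (A0 A)"
  shows "up V A \<alpha> \<beta> \<in> Arr V" "Cod V (up V A \<alpha> \<beta>) = A1 A"
    "x \<in> Arr V \<Longrightarrow> Cod V x = Dom V (up V A \<alpha> \<beta>) \<Longrightarrow> d0 A \<cdot> up V A \<alpha> \<beta> \<cdot> x = \<alpha> \<cdot> bang V (Dom V x)"
    "x \<in> Arr V \<Longrightarrow> Cod V x = Dom V (up V A \<alpha> \<beta>) \<Longrightarrow> d1 A \<cdot> up V A \<alpha> \<beta> \<cdot> x = \<beta> \<cdot> bang V (Dom V x)"
    "d0 A \<cdot> up V A \<alpha> \<beta> = \<alpha> \<cdot> bang V (Dom V (up V A \<alpha> \<beta>))"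
    "d1 A \<cdot> up V A \<alpha> \<beta> = \<beta> \<cdot> bang V (Dom V (up V A \<alpha> \<beta>))"
proof -
  show u: "up V A \<alpha> \<beta> \<in> Arr V" "Cod V (up V A \<alpha> \<beta>) = A1 A"
    and d: "d0 A \<cdot> up V A \<alpha> \<beta> = \<alpha> \<cdot> bang V (Dom V (up V A \<alpha> \<beta>))"
      "d1 A \<cdot> up V A \<alpha> \<beta> = \<beta> \<cdot> bang V (Dom V (up V A \<alpha> \<beta>))"
    using up_universal[OF assms] unfolding is_universal_between_def by blast+
  show "x \<in> Arr V \<Longrightarrow> Cod V x = Dom V (up V A \<alpha> \<beta>) \<Longrightarrow> d0 A \<cdot> up V A \<alpha> \<beta> \<cdot> x = \<alpha> \<cdot> bang V (Dom V x)"
    "x \<in> Arr V \<Longrightarrow> Cod V x = Dom V (up V A \<alpha> \<beta>) \<Longrightarrow> d1 A \<cdot> up V A \<alpha> \<beta> \<cdot> x = \<beta> \<cdot> bang V (Dom V x)"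
    using comp_extend[OF d(1), of x] comp_extend[OF d(2), of x] u assms by simp_all
qed

lemma up_mono:
  assumes A: "internal_category V A" and \<alpha>: "\<alpha> \<in> hom V (trm V) (A0 A)" and \<beta>: "\<beta> \<in> hom V (trm V) (A0 A)"
  shows "mono_V (up V A \<alpha> \<beta>)"
  unfolding mono_V_def
proof (intro conjI allI impI)
  let ?e = "up V A \<alpha> \<beta>"
  show "?e \<in> Arr V" using assms by simp
  fix u v assume uv: "u \<in> Arr V \<and> v \<in> Arr V \<and> Dom V u = Dom V v \<and> Cod V u = Dom V ?e \<and>
    Cod V v = Dom V ?e \<and> ?e \<cdot> u = ?e \<cdot> v"
  have "?e \<cdot> u \<in> hom V (Dom V u) (A1 A) \<and> d0 A \<cdot> ?e \<cdot> u = \<alpha> \<cdot> bang V (Dom V u) \<and>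
      d1 A \<cdot> ?e \<cdot> u = \<beta> \<cdot> bang V (Dom V u)"
    using uv assms up_typing(3,4)[OF assms, of u] by simp
  then have "\<exists>!h. h \<in> hom V (Dom V u) (Dom V ?e) \<and> ?e \<cdot> h = ?e \<cdot> u"
    using up_universal[OF assms] unfolding is_universal_between_def by blast
  then show "u = v" using uv by auto
qed

lemma up_factor [simp]:
  assumes A: "internal_category V A" and \<alpha>: "\<alpha> \<in> hom V (trm V) (A0 A)" and \<beta>: "\<beta> \<in> hom V (trm V) (A0 A)"
    and u: "u \<in> Arr V" "Cod V u = A1 A" "d0 A \<cdot> u = \<alpha> \<cdot> bang V (Dom V u)" "d1 A \<cdot> u = \<beta> \<cdot> bang V (Dom V u)"
  shows "factor V (up V A \<alpha> \<beta>) u \<in> Arr V" "Dom V (factor V (up V A \<alpha> \<beta>) u) = Dom V u"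
    "Cod V (factor V (up V A \<alpha> \<beta>) u) = Dom V (up V A \<alpha> \<beta>)"
    "up V A \<alpha> \<beta> \<cdot> factor V (up V A \<alpha> \<beta>) u = u"
proof -
  have "u \<in> hom V (Dom V u) (A1 A) \<and> d0 A \<cdot> u = \<alpha> \<cdot> bang V (Dom V u) \<and> d1 A \<cdot> u = \<beta> \<cdot> bang V (Dom V u)"
    using u by simp
  then have "\<exists>!h. h \<in> hom V (Dom V u) (Dom V (up V A \<alpha> \<beta>)) \<and> up V A \<alpha> \<beta> \<cdot> h = u"
    using up_universal[OF A \<alpha> \<beta>] unfolding is_universal_between_def by blast
  from theI'[OF this] show "factor V (up V A \<alpha> \<beta>) u \<in> Arr V" "Dom V (factor V (up V A \<alpha> \<beta>) u) = Dom V u"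
    "Cod V (factor V (up V A \<alpha> \<beta>) u) = Dom V (up V A \<alpha> \<beta>)"
    "up V A \<alpha> \<beta> \<cdot> factor V (up V A \<alpha> \<beta>) u = u"
    unfolding factor_def by auto
qed

lemma up_eqI:
  assumes "internal_category V A" "\<alpha> \<in> hom V (trm V) (A0 A)" "\<beta> \<in> hom V (trm V) (A0 A)"
    "up V A \<alpha> \<beta> \<cdot> x = up V A \<alpha> \<beta> \<cdot> y" "x \<in> Arr V" "y \<in> Arr V" "Dom V x = Dom V y"
    "Cod V x = Dom V (up V A \<alpha> \<beta>)" "Cod V y = Dom V (up V A \<alpha> \<beta>)"
  shows "x = y"
  using mono_V_D[OF up_mono[OF assms(1-3)]] assms by blast

lemma En_ecomp_typing:
  assumes A: "internal_category V A" and \<alpha>: "\<alpha> \<in> hom V (trm V) (A0 A)" and \<beta>: "\<beta> \<in> hom V (trm V) (A0 A)"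
    and \<gamma>: "\<gamma> \<in> hom V (trm V) (A0 A)"
  shows "ecomp (En_obj V A) \<alpha> \<beta> \<gamma> \<in> Arr V"
    "Dom V (ecomp (En_obj V A) \<alpha> \<beta> \<gamma>) = prd V (Dom V (up V A \<beta> \<gamma>)) (Dom V (up V A \<alpha> \<beta>))"
    "Cod V (ecomp (En_obj V A) \<alpha> \<beta> \<gamma>) = Dom V (up V A \<alpha> \<gamma>)"
    "up V A \<alpha> \<gamma> \<cdot> ecomp (En_obj V A) \<alpha> \<beta> \<gamma> =
       cmp V A (up V A \<beta> \<gamma> \<cdot> pr1 V (Dom V (up V A \<beta> \<gamma>)) (Dom V (up V A \<alpha> \<beta>)))
         (up V A \<alpha> \<beta> \<cdot> pr2 V (Dom V (up V A \<beta> \<gamma>)) (Dom V (up V A \<alpha> \<beta>)))"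
  using assms by (simp_all add: En_obj_def Let_def)

lemma En_eid_typing [simp]:
  assumes A: "internal_category V A" and \<alpha>: "\<alpha> \<in> hom V (trm V) (A0 A)"
  shows "eid (En_obj V A) \<alpha> \<in> Arr V" "Dom V (eid (En_obj V A) \<alpha>) = trm V"
    "Cod V (eid (En_obj V A) \<alpha>) = Dom V (up V A \<alpha> \<alpha>)"
    "up V A \<alpha> \<alpha> \<cdot> eid (En_obj V A) \<alpha> = iident A \<cdot> \<alpha>"
    "t \<in> Arr V \<Longrightarrow> Cod V t = trm V \<Longrightarrow> up V A \<alpha> \<alpha> \<cdot> eid (En_obj V A) \<alpha> \<cdot> t = iident A \<cdot> \<alpha> \<cdot> t"
proof -
  have "bang V (trm V) = Ident V (trm V)" by (rule to_trm_eq) simp_all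
  then show *: "eid (En_obj V A) \<alpha> \<in> Arr V" "Dom V (eid (En_obj V A) \<alpha>) = trm V"
    "Cod V (eid (En_obj V A) \<alpha>) = Dom V (up V A \<alpha> \<alpha>)"
    "up V A \<alpha> \<alpha> \<cdot> eid (En_obj V A) \<alpha> = iident A \<cdot> \<alpha>"
    using assms by (simp_all add: En_obj_def Let_def)
  show "t \<in> Arr V \<Longrightarrow> Cod V t = trm V \<Longrightarrow> up V A \<alpha> \<alpha> \<cdot> eid (En_obj V A) \<alpha> \<cdot> t = iident A \<cdot> \<alpha> \<cdot> t"
    using comp_extend[OF *(4)] * assms by simp
qed

lemma En_ec [simp]:
  assumes A: "internal_category V A" and \<alpha>: "\<alpha> \<in> hom V (trm V) (A0 A)" and \<beta>: "\<beta> \<in> hom V (trm V) (A0 A)"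
    and \<gamma>: "\<gamma> \<in> hom V (trm V) (A0 A)"
    and t: "g \<in> Arr V" "f \<in> Arr V" "Dom V g = Dom V f" "Cod V g = Dom V (up V A \<beta> \<gamma>)" "Cod V f = Dom V (up V A \<alpha> \<beta>)"
  shows "ec (En_obj V A) \<alpha> \<beta> \<gamma> g f \<in> Arr V" "Dom V (ec (En_obj V A) \<alpha> \<beta> \<gamma> g f) = Dom V f"
    "Cod V (ec (En_obj V A) \<alpha> \<beta> \<gamma> g f) = Dom V (up V A \<alpha> \<gamma>)"
    "up V A \<alpha> \<gamma> \<cdot> ec (En_obj V A) \<alpha> \<beta> \<gamma> g f = cmp V A (up V A \<beta> \<gamma> \<cdot> g) (up V A \<alpha> \<beta> \<cdot> f)"
proof -
  note e = En_ecomp_typing[OF A \<alpha> \<beta> \<gamma>]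
  show "ec (En_obj V A) \<alpha> \<beta> \<gamma> g f \<in> Arr V" "Dom V (ec (En_obj V A) \<alpha> \<beta> \<gamma> g f) = Dom V f"
    "Cod V (ec (En_obj V A) \<alpha> \<beta> \<gamma> g f) = Dom V (up V A \<alpha> \<gamma>)"
    unfolding ec_def using e(1-3) assms by simp_all
  show "up V A \<alpha> \<gamma> \<cdot> ec (En_obj V A) \<alpha> \<beta> \<gamma> g f = cmp V A (up V A \<beta> \<gamma> \<cdot> g) (up V A \<alpha> \<beta> \<cdot> f)"
    unfolding ec_def using comp_extend[OF e(4), of "pair V g f"] e(1-3) assms by simp
qed

lemma En_enriched [simp]:
  assumes A: "internal_category V A"
  shows "enriched_category V (En_obj V A)"
proof (rule enriched_categoryI)
  show "ec (En_obj V A) a b d (ec (En_obj V A) b c d h g) f = ec (En_obj V A) a c d h (ec (En_obj V A) a b c g f)"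
    if "a \<in> eobj (En_obj V A)" "b \<in> eobj (En_obj V A)" "c \<in> eobj (En_obj V A)" "d \<in> eobj (En_obj V A)"
      "h \<in> hom V X (ehom (En_obj V A) c d)" "g \<in> hom V X (ehom (En_obj V A) b c)"
      "f \<in> hom V X (ehom (En_obj V A) a b)" for a b c d h g f X
    by (rule up_eqI[OF A, of a d]) (use that A in simp_all)
  show "ec (En_obj V A) a b b (eid (En_obj V A) b \<cdot> bang V X) f = f"
    "ec (En_obj V A) a a b f (eid (En_obj V A) a \<cdot> bang V X) = f"
    if "a \<in> eobj (En_obj V A)" "b \<in> eobj (En_obj V A)" "f \<in> hom V X (ehom (En_obj V A) a b)" for a b f X
  proof -
    have X: "X \<in> Obj V" using that by auto
    show "ec (En_obj V A) a b b (eid (En_obj V A) b \<cdot> bang V X) f = f"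
      "ec (En_obj V A) a a b f (eid (En_obj V A) a \<cdot> bang V X) = f"
      by (rule up_eqI[OF A, of a b]; use that A X in simp)+
  qed
qed (use A En_ecomp_typing in \<open>simp_all\<close>)

text \<open>The bound is given on the points of \<open>A1\<close>. Points of \<open>A0\<close> embed
  into these by \<open>iident\<close>, which has the retraction \<open>d0\<close>, and points of the
  hom-objects embed by the monic arrows \<open>up\<close>.\<close>

lemma En_small:
  assumes A: "small_split_category V \<kappa> A"
  shows "small_enriched_category V \<kappa> (En_obj V A)"
proof -
  note I = small_split_categoryD(1)[OF A]
  have s: "small \<kappa> (hom V (trm V) (A1 A))" using A unfolding small_split_category_def by blast
  have "small \<kappa> (hom V (trm V) (A0 A))"
  proof (rule small_inj[OF _ _ s])
    show "inj_on (\<lambda>x. iident A \<cdot> x) (hom V (trm V) (A0 A))"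
    proof (rule inj_onI)
      fix x y assume *: "x \<in> hom V (trm V) (A0 A)" "y \<in> hom V (trm V) (A0 A)" "iident A \<cdot> x = iident A \<cdot> y"
      have "x = d0 A \<cdot> iident A \<cdot> x" using *(1) I by simp
      also have "\<dots> = y" using *(2) I unfolding *(3) by simp
      finally show "x = y" .
    qed
    show "(\<lambda>x. iident A \<cdot> x) ` hom V (trm V) (A0 A) \<subseteq> hom V (trm V) (A1 A)" using I by auto
  qed
  moreover have "small \<kappa> (hom V (trm V) (Dom V (up V A a b)))"
    if ab: "a \<in> hom V (trm V) (A0 A)" "b \<in> hom V (trm V) (A0 A)" for a b
  proof (rule small_inj[OF _ _ s])
    show "inj_on (\<lambda>x. up V A a b \<cdot> x) (hom V (trm V) (Dom V (up V A a b)))"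
    proof (rule inj_onI)
      fix x y assume *: "x \<in> hom V (trm V) (Dom V (up V A a b))" "y \<in> hom V (trm V) (Dom V (up V A a b))"
        "up V A a b \<cdot> x = up V A a b \<cdot> y"
      show "x = y" by (rule up_eqI[OF I ab *(3)]) (use * in simp_all)
    qed
    show "(\<lambda>x. up V A a b \<cdot> x) ` hom V (trm V) (Dom V (up V A a b)) \<subseteq> hom V (trm V) (A1 A)" using I ab by auto
  qed
  ultimately show ?thesis
    unfolding small_enriched_category_def using I by (simp del: in_hom)
qed

lemma En_arr_simps [simp]:
  "esrc (En_arr V F) = En_obj V (isrc F)" "etgt (En_arr V F) = En_obj V (itgt F)"
  "\<alpha> \<in> hom V (trm V) (A0 (isrc F)) \<Longrightarrow> efun0 (En_arr V F) \<alpha> = ifun0 F \<cdot> \<alpha>"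
  by (simp_all add: En_arr_def)

lemma En_arr1 [simp]:
  assumes F: "internal_functor V F" and \<alpha>: "\<alpha> \<in> hom V (trm V) (A0 (isrc F))" and \<beta>: "\<beta> \<in> hom V (trm V) (A0 (isrc F))"
  shows "efun1 (En_arr V F) \<alpha> \<beta> \<in> Arr V" "Dom V (efun1 (En_arr V F) \<alpha> \<beta>) = Dom V (up V (isrc F) \<alpha> \<beta>)"
    "Cod V (efun1 (En_arr V F) \<alpha> \<beta>) = Dom V (up V (itgt F) (ifun0 F \<cdot> \<alpha>) (ifun0 F \<cdot> \<beta>))"
    "up V (itgt F) (ifun0 F \<cdot> \<alpha>) (ifun0 F \<cdot> \<beta>) \<cdot> efun1 (En_arr V F) \<alpha> \<beta> = ifun1 F \<cdot> up V (isrc F) \<alpha> \<beta>"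
    "x \<in> Arr V \<Longrightarrow> Cod V x = Dom V (up V (isrc F) \<alpha> \<beta>) \<Longrightarrow>
      up V (itgt F) (ifun0 F \<cdot> \<alpha>) (ifun0 F \<cdot> \<beta>) \<cdot> efun1 (En_arr V F) \<alpha> \<beta> \<cdot> x = ifun1 F \<cdot> up V (isrc F) \<alpha> \<beta> \<cdot> x"
proof -
  note A = ifun_src[OF F] ifun_tgt[OF F]
  show *: "efun1 (En_arr V F) \<alpha> \<beta> \<in> Arr V" "Dom V (efun1 (En_arr V F) \<alpha> \<beta>) = Dom V (up V (isrc F) \<alpha> \<beta>)"
    "Cod V (efun1 (En_arr V F) \<alpha> \<beta>) = Dom V (up V (itgt F) (ifun0 F \<cdot> \<alpha>) (ifun0 F \<cdot> \<beta>))"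
    "up V (itgt F) (ifun0 F \<cdot> \<alpha>) (ifun0 F \<cdot> \<beta>) \<cdot> efun1 (En_arr V F) \<alpha> \<beta> = ifun1 F \<cdot> up V (isrc F) \<alpha> \<beta>"
    using A F \<alpha> \<beta> by (simp_all add: En_arr_def restrict2_def)
  show "x \<in> Arr V \<Longrightarrow> Cod V x = Dom V (up V (isrc F) \<alpha> \<beta>) \<Longrightarrow>
      up V (itgt F) (ifun0 F \<cdot> \<alpha>) (ifun0 F \<cdot> \<beta>) \<cdot> efun1 (En_arr V F) \<alpha> \<beta> \<cdot> x = ifun1 F \<cdot> up V (isrc F) \<alpha> \<beta> \<cdot> x"
    using comp_extend[OF *(4), of x] * A F \<alpha> \<beta> by simp
qed

lemma En_arr_functor:
  assumes F: "internal_functor V F"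
  shows "enriched_functor V (En_arr V F)"
proof (rule enriched_functorI)
  note A = ifun_src[OF F] ifun_tgt[OF F]
  show "efun0 (En_arr V F) \<in> eobj (esrc (En_arr V F)) \<rightarrow>\<^sub>E eobj (etgt (En_arr V F))"
    using F by (auto simp: En_arr_def)
  show "efun1 (En_arr V F) = restrict2 (eobj (esrc (En_arr V F))) (efun1 (En_arr V F))"
    by (intro ext) (simp add: En_arr_def restrict2_def)
  show "efun1 (En_arr V F) a c \<cdot> ec (esrc (En_arr V F)) a b c g f =
      ec (etgt (En_arr V F)) (efun0 (En_arr V F) a) (efun0 (En_arr V F) b) (efun0 (En_arr V F) c)
        (efun1 (En_arr V F) b c \<cdot> g) (efun1 (En_arr V F) a b \<cdot> f)"
    if "a \<in> eobj (esrc (En_arr V F))" "b \<in> eobj (esrc (En_arr V F))" "c \<in> eobj (esrc (En_arr V F))"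
      "g \<in> hom V X (ehom (esrc (En_arr V F)) b c)" "f \<in> hom V X (ehom (esrc (En_arr V F)) a b)"
    for a b c g f X
    by (rule up_eqI[OF A(2), of "ifun0 F \<cdot> a" "ifun0 F \<cdot> c"]) (use that A F in simp_all)
  show "efun1 (En_arr V F) a a \<cdot> eid (esrc (En_arr V F)) a = eid (etgt (En_arr V F)) (efun0 (En_arr V F) a)"
    if "a \<in> eobj (esrc (En_arr V F))" for a
    by (rule up_eqI[OF A(2), of "ifun0 F \<cdot> a" "ifun0 F \<cdot> a"]) (use that A F in simp_all)
qed (use F ifun_src[OF F] ifun_tgt[OF F] in simp_all)

lemma functor_En: "cat_functor (Cat_sp V \<kappa>) (VCat V \<kappa>) (En V)"
proof -
  interpret C: category "Cat_sp V \<kappa>" by (rule category_Cat_sp)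
  interpret D: category "VCat V \<kappa>" by (rule category_VCat)
  show ?thesis
  proof
    show "FObj (En V) x \<in> Obj (VCat V \<kappa>)" if "x \<in> Obj (Cat_sp V \<kappa>)" for x
      using that En_small unfolding Cat_sp_Obj VCat_Obj En_def by simp
    show "FArr (En V) f \<in> hom (VCat V \<kappa>) (FObj (En V) x) (FObj (En V) y)" if "f \<in> hom (Cat_sp V \<kappa>) x y" for f x y
      using that En_small En_arr_functor[of f] unfolding Cat_sp_hom VCat_hom En_def by auto
    show "FArr (En V) (Ident (Cat_sp V \<kappa>) x) = Ident (VCat V \<kappa>) (FObj (En V) x)" if "x \<in> Obj (Cat_sp V \<kappa>)" for x
    proof -
      let ?F = "Ident (Cat_sp V \<kappa>) x"
      have A: "small_split_category V \<kappa> x" using that unfolding Cat_sp_Obj .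
      note I = small_split_categoryD(1)[OF A]
      have F: "internal_functor V ?F" using C.ident_hom[OF that] unfolding Cat_sp_hom by blast
      note s = Cat_sp_Ident[of x]
      have "En_arr V ?F = id_efun (En_obj V x)"
      proof (rule efun_eqI)
        show "enriched_functor V (En_arr V ?F)" by (rule En_arr_functor[OF F])
        show "enriched_functor V (id_efun (En_obj V x))" by (rule id_efun_functor) (use I in simp)
        show "efun1 (En_arr V ?F) a b = efun1 (id_efun (En_obj V x)) a b"
          if "a \<in> eobj (esrc (En_arr V ?F))" "b \<in> eobj (esrc (En_arr V ?F))" for a b
        proof -
          have ab: "a \<in> hom V (trm V) (A0 x)" "b \<in> hom V (trm V) (A0 x)" using that s by auto
          show ?thesis
            by (rule up_eqI[OF I ab]) (use En_arr1(1-4)[OF F, unfolded s, OF ab] ab I in simp_all)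
        qed
      qed (use s I in auto)
      then show ?thesis unfolding id_efun_def En_def by simp
    qed
    show "FArr (En V) (Comp (Cat_sp V \<kappa>) g f) = Comp (VCat V \<kappa>) (FArr (En V) g) (FArr (En V) f)"
      if fg: "f \<in> hom (Cat_sp V \<kappa>) x y" "g \<in> hom (Cat_sp V \<kappa>) y z" for f g x y z
    proof -
      let ?F = "Comp (Cat_sp V \<kappa>) g f"
      have f: "internal_functor V f" "isrc f = x" "itgt f = y" "internal_functor V g" "isrc g = y" "itgt g = z"
        using fg unfolding Cat_sp_hom by blast+
      have F: "internal_functor V ?F" using C.comp_hom[OF fg] unfolding Cat_sp_hom by blast
      note I = ifun_src[OF f(1), unfolded f] ifun_tgt[OF f(1), unfolded f] ifun_tgt[OF f(4), unfolded f]
      note ty = ifun_typing[OF f(1), unfolded f] ifun_typing[OF f(4), unfolded f]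
      note s = Cat_sp_Comp[of g f]
      have "En_arr V ?F = comp_efun (En_arr V g) (En_arr V f)"
      proof (rule efun_eqI)
        show "enriched_functor V (En_arr V ?F)" by (rule En_arr_functor[OF F])
        show "enriched_functor V (comp_efun (En_arr V g) (En_arr V f))"
          by (rule comp_efun_functor) (use En_arr_functor f in simp_all)
        show "efun1 (En_arr V ?F) a b = efun1 (comp_efun (En_arr V g) (En_arr V f)) a b"
          if "a \<in> eobj (esrc (En_arr V ?F))" "b \<in> eobj (esrc (En_arr V ?F))" for a b
        proof -
          have ab: "a \<in> hom V (trm V) (A0 x)" "b \<in> hom V (trm V) (A0 x)" using that s f by auto
          let ?a = "ifun0 f \<cdot> a" and ?b = "ifun0 f \<cdot> b"
          have ab': "?a \<in> hom V (trm V) (A0 y)" "?b \<in> hom V (trm V) (A0 y)"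
            "ifun0 g \<cdot> ?a \<in> hom V (trm V) (A0 z)" "ifun0 g \<cdot> ?b \<in> hom V (trm V) (A0 z)"
            using ab ty by simp_all
          note e1 = En_arr1[OF f(1), unfolded f, OF ab] and e2 = En_arr1[OF f(4), unfolded f, OF ab'(1,2)]
          have e3: "efun1 (En_arr V ?F) a b \<in> Arr V" "Dom V (efun1 (En_arr V ?F) a b) = Dom V (up V x a b)"
            "Cod V (efun1 (En_arr V ?F) a b) = Dom V (up V z (ifun0 g \<cdot> ?a) (ifun0 g \<cdot> ?b))"
            "up V z (ifun0 g \<cdot> ?a) (ifun0 g \<cdot> ?b) \<cdot> efun1 (En_arr V ?F) a b = ifun1 g \<cdot> ifun1 f \<cdot> up V x a b"
            using En_arr1(1-4)[OF F, of a b] s f ab ty I by simp_all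
          have c: "efun1 (comp_efun (En_arr V g) (En_arr V f)) a b = efun1 (En_arr V g) ?a ?b \<cdot> efun1 (En_arr V f) a b"
            using ab f by simp
          show ?thesis
            \<comment> \<open>Both components become \<open>ifun1 g\<close> after
              \<open>ifun1 f\<close> after \<open>up\<close> once they are composed with the monic
              arrow \<open>up\<close> of the target.\<close>
            unfolding c by (rule up_eqI[OF I(3) ab'(3,4)]) (use e1 e2 e3 ab ty I in simp_all)
        qed
        show "efun0 (En_arr V ?F) a = efun0 (comp_efun (En_arr V g) (En_arr V f)) a"
          if "a \<in> eobj (esrc (En_arr V ?F))" for a
          using that s f ty by simp
      qed (use s f in auto)
      then show ?thesis unfolding comp_efun_def En_def by simp
    qed
  qed
qed

subsection \<open>Local arguments over coproducts\<close>

text \<open>A universal property with two legs may be verified on the pieces of a decomposition: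
  local solutions glue to a global one, and local uniqueness both forces the legs of competitors to
  match and identifies them. This is the tool for the pullback property of
  \<open>Si2\<close>.\<close>

lemma coproduct_local_ex1:
  assumes c: "is_coproduct V I x s j" "small \<kappa> I" and f: "f \<in> hom V X s"
    and p: "p \<in> Arr V" "q \<in> Arr V" "Dom V p = T" "Dom V q = T"
    and uv: "u \<in> hom V X (Cod V p)" "v \<in> hom V X (Cod V q)"
    and local: "\<And>k i w. k \<in> Arr V \<Longrightarrow> Cod V k = X \<Longrightarrow> i \<in> I \<Longrightarrow> w \<in> Arr V \<Longrightarrow> Dom V w = Dom V k \<Longrightarrow>
       Cod V w = x i \<Longrightarrow> f \<cdot> k = j i \<cdot> w \<Longrightarrow>
       \<exists>!h. h \<in> hom V (Dom V k) T \<and> p \<cdot> h = u \<cdot> k \<and> q \<cdot> h = v \<cdot> k"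
  shows "\<exists>!h. h \<in> hom V X T \<and> p \<cdot> h = u \<and> q \<cdot> h = v"
proof -
  have f': "f \<in> Arr V" "Cod V f = s" "Dom V f = X" using f by auto
  obtain Y k w where Y: "is_coproduct V I Y X k"
    and w: "\<forall>i\<in>I. w i \<in> hom V (Y i) (x i) \<and> f \<cdot> k i = j i \<cdot> w i"
    by (rule coproduct_decompose[OF c f'(1,2), unfolded f'(3)])
  note YD = coproductD[OF Y]
  have loc: "\<exists>!h. h \<in> hom V (Y i) T \<and> p \<cdot> h = u \<cdot> k i \<and> q \<cdot> h = v \<cdot> k i" if "i \<in> I" for i
    using local[of "k i" i "w i"] w YD(2-4)[OF that] that by simp
  then have "\<forall>i\<in>I. \<exists>h. h \<in> hom V (Y i) T \<and> p \<cdot> h = u \<cdot> k i \<and> q \<cdot> h = v \<cdot> k i"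
    by blast
  then obtain h where h: "\<forall>i\<in>I. h i \<in> hom V (Y i) T \<and> p \<cdot> h i = u \<cdot> k i \<and> q \<cdot> h i = v \<cdot> k i"
    by (rule bchoice[THEN exE])
  have T: "T \<in> Obj V" using p by auto
  obtain g where g: "g \<in> Arr V" "Dom V g = X" "Cod V g = T" "\<forall>i\<in>I. g \<cdot> k i = h i"
    by (rule coproduct_glue[OF Y T, of h]) (use h in auto)
  show ?thesis
  proof (rule ex1I[of _ g])
    have "p \<cdot> g = u"
      by (rule coproduct_eqI[OF Y]) (use g h p uv YD in auto)
    moreover have "q \<cdot> g = v"
      by (rule coproduct_eqI[OF Y]) (use g h p uv YD in auto)
    ultimately show "g \<in> hom V X T \<and> p \<cdot> g = u \<and> q \<cdot> g = v" using g by simp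
    fix g' assume g': "g' \<in> hom V X T \<and> p \<cdot> g' = u \<and> q \<cdot> g' = v"
    show "g' = g"
    proof (rule coproduct_eqI[OF Y])
      fix i assume i: "i \<in> I"
      have "g' \<cdot> k i \<in> hom V (Y i) T \<and> p \<cdot> g' \<cdot> k i = u \<cdot> k i \<and> q \<cdot> g' \<cdot> k i = v \<cdot> k i"
        using g' p YD(2-4)[OF i] comp_extend[of p g' u "k i"] comp_extend[of q g' v "k i"] by simp
      moreover have "g \<cdot> k i \<in> hom V (Y i) T \<and> p \<cdot> g \<cdot> k i = u \<cdot> k i \<and> q \<cdot> g \<cdot> k i = v \<cdot> k i"
        using g h i by simp
      ultimately show "g' \<cdot> k i = g \<cdot> k i" using loc[OF i] by blast
    qed (use g g' in auto)
  qed
qed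

lemma initial_ex1:
  assumes "initial X" "p \<in> Arr V" "q \<in> Arr V" "Dom V p = T" "Dom V q = T"
    "u \<in> hom V X (Cod V p)" "v \<in> hom V X (Cod V q)"
  shows "\<exists>!h. h \<in> hom V X T \<and> p \<cdot> h = u \<and> q \<cdot> h = v"
proof -
  have "T \<in> Obj V" using assms by auto
  then have ex: "\<exists>!h. h \<in> hom V X T" using assms(1) unfolding initial_def by blast
  have "p \<cdot> h = u \<and> q \<cdot> h = v" if "h \<in> hom V X T" for h
    using initial_eq[OF assms(1), of "p \<cdot> h" u] initial_eq[OF assms(1), of "q \<cdot> h" v] that assms by simp
  then show ?thesis using ex by metis
qed

subsection \<open>Idempotents of an enriched category\<close>

text \<open>This is the size condition that lets the coproducts in \<open>Si_icat\<close> be formed;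
  the bound on the points of the hom-objects enters in \<open>Si_small\<close>.\<close>

definition small_ecat :: "('o, 'a) ecat \<Rightarrow> bool" where
  "small_ecat M \<longleftrightarrow> enriched_category V M \<and> small \<kappa> (eobj M)"

lemma small_ecatD [simp]: "small_ecat M \<Longrightarrow> enriched_category V M" "small_ecat M \<Longrightarrow> small \<kappa> (eobj M)"
  unfolding small_ecat_def by blast+

lemma eps_props:
  assumes M: "enriched_category V M" and a: "a \<in> eobj M"
  shows "eps V M a \<in> Arr V" "Dom V (eps V M a) = idems V M a" "Cod V (eps V M a) = ehom M a a"
    "idems V M a \<in> Obj V" "mono_V (eps V M a)"
    "ec M a a a (eps V M a) (eps V M a) = eps V M a"
proof -
  let ?i = "Ident V (ehom M a a)" let ?f = "ecomp M a a a \<cdot> pair V ?i ?i"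
  have fg: "?f \<in> Arr V" "?i \<in> Arr V" "Dom V ?f = Dom V ?i" "Cod V ?f = Cod V ?i"
    using M a by simp_all
  show e: "eps V M a \<in> Arr V" "Dom V (eps V M a) = idems V M a" "Cod V (eps V M a) = ehom M a a"
    "mono_V (eps V M a)"
    using equalizer_props[OF fg] M a unfolding eps_def idems_def by simp_all
  show "idems V M a \<in> Obj V" using e obj_dom by metis
  have "?f \<cdot> eps V M a = ?i \<cdot> eps V M a" using equalizer_props[OF fg] unfolding eps_def by simp
  then show "ec M a a a (eps V M a) (eps V M a) = eps V M a"
    using e M a by (simp add: ec_def)
qed

lemma eps_typing [simp]:
  assumes M: "enriched_category V M" and a: "a \<in> eobj M"
  shows "eps V M a \<in> Arr V" "Dom V (eps V M a) = idems V M a" "Cod V (eps V M a) = ehom M a a"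
    "idems V M a \<in> Obj V"
    "p \<in> Arr V \<Longrightarrow> Cod V p = idems V M a \<Longrightarrow> ec M a a a (eps V M a \<cdot> p) (eps V M a \<cdot> p) = eps V M a \<cdot> p"
proof -
  note e = eps_props[OF M a]
  show *: "eps V M a \<in> Arr V" "Dom V (eps V M a) = idems V M a" "Cod V (eps V M a) = ehom M a a"
    "idems V M a \<in> Obj V" using e by blast+
  show "p \<in> Arr V \<Longrightarrow> Cod V p = idems V M a \<Longrightarrow> ec M a a a (eps V M a \<cdot> p) (eps V M a \<cdot> p) = eps V M a \<cdot> p"
    using arg_cong[OF e(6), of "\<lambda>x. x \<cdot> p"] e(1-5) M a by simp
qed

text \<open>\<open>omega\<close> at an arbitrary stage: the element of the object of idempotents
  named by the idempotent \<open>x\<close>.\<close>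

definition om :: "('o, 'a) ecat \<Rightarrow> 'a \<Rightarrow> 'a \<Rightarrow> 'a" where
  "om M a x = factor V (eps V M a) x"

lemma om_eqI:
  assumes "enriched_category V M" "a \<in> eobj M" "eps V M a \<cdot> p = x" "p \<in> Arr V" "Cod V p = idems V M a"
  shows "om M a x = p"
  unfolding om_def by (rule factor_eqI) (use eps_props[OF assms(1,2)] assms in simp_all)

lemma om_typing [simp]:
  assumes M: "enriched_category V M" and a: "a \<in> eobj M"
    and x: "x \<in> Arr V" "Cod V x = ehom M a a" "ec M a a a x x = x"
  shows "om M a x \<in> Arr V" "Dom V (om M a x) = Dom V x" "Cod V (om M a x) = idems V M a"
    "eps V M a \<cdot> om M a x = x"
proof -
  let ?i = "Ident V (ehom M a a)" let ?f = "ecomp M a a a \<cdot> pair V ?i ?i"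
  have fg: "?f \<in> Arr V" "?i \<in> Arr V" "Dom V ?f = Dom V ?i" "Cod V ?f = Cod V ?i"
    using M a by simp_all
  have "?f \<cdot> x = ?i \<cdot> x" using M a x by (simp add: ec_def)
  then show "om M a x \<in> Arr V" "Dom V (om M a x) = Dom V x" "Cod V (om M a x) = idems V M a"
    "eps V M a \<cdot> om M a x = x"
    using equalizer_factor[OF fg, of x] M a x
    unfolding om_def eps_def[symmetric] eps_props(2)[OF M a] by simp_all
qed

lemma om_eps [simp]:
  assumes "enriched_category V M" "a \<in> eobj M" "p \<in> Arr V" "Cod V p = idems V M a"
  shows "om M a (eps V M a \<cdot> p) = p"
  using om_eqI[OF assms(1,2) refl assms(3,4)] .

lemma om_comp [simp]:
  assumes M: "enriched_category V M" and a: "a \<in> eobj M"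
    and x: "x \<in> Arr V" "Cod V x = ehom M a a" "ec M a a a x x = x" and k: "k \<in> Arr V" "Cod V k = Dom V x"
  shows "om M a x \<cdot> k = om M a (x \<cdot> k)"
proof -
  have "eps V M a \<cdot> om M a x \<cdot> k = x \<cdot> k" by (rule comp_extend) (use assms in simp_all)
  then show ?thesis by (intro om_eqI[symmetric, OF M a]) (use assms in simp_all)
qed

text \<open>\<open>trip M a b p x q\<close>: the triple \<open>(p, x, q)\<close> is an element of \<open>Si_hom V M a b\<close>.\<close>

definition trip :: "('o, 'a) ecat \<Rightarrow> 'a \<Rightarrow> 'a \<Rightarrow> 'a \<Rightarrow> 'a \<Rightarrow> 'a \<Rightarrow> bool" where
  "trip M a b p x q \<longleftrightarrow> a \<in> eobj M \<and> b \<in> eobj M \<and>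
     p \<in> Arr V \<and> Cod V p = idems V M b \<and> q \<in> Arr V \<and> Cod V q = idems V M a \<and>
     x \<in> Arr V \<and> Cod V x = ehom M a b \<and> Dom V p = Dom V q \<and> Dom V x = Dom V q \<and>
     ec M a b b (eps V M b \<cdot> p) x = x \<and> ec M a a b x (eps V M a \<cdot> q) = x"

lemma tripD:
  assumes "trip M a b p x q"
  shows "a \<in> eobj M" "b \<in> eobj M" "p \<in> Arr V" "Cod V p = idems V M b" "q \<in> Arr V" "Cod V q = idems V M a"
    "x \<in> Arr V" "Cod V x = ehom M a b" "Dom V p = Dom V q" "Dom V x = Dom V q"
    "ec M a b b (eps V M b \<cdot> p) x = x" "ec M a a b x (eps V M a \<cdot> q) = x"
  using assms unfolding trip_def by blast+

lemma trip_restrict [simp]: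
  assumes M: "enriched_category V M" and t: "trip M a b p x q" and k: "k \<in> Arr V" "Cod V k = Dom V q"
  shows "trip M a b (p \<cdot> k) (x \<cdot> k) (q \<cdot> k)"
proof -
  note d = tripD[OF t]
  show ?thesis
    using arg_cong[OF d(11), of "\<lambda>x. x \<cdot> k"] arg_cong[OF d(12), of "\<lambda>x. x \<cdot> k"] M d(1-10) k
    unfolding trip_def by simp
qed

lemma trip_comp:
  assumes M: "enriched_category V M" and t: "trip M b c p x q'" "trip M a b p' y r" "Dom V q' = Dom V r"
  shows "trip M a c p (ec M a b c x y) r"
proof -
  note d = tripD[OF t(1)] tripD[OF t(2)]
  have "ec M a c c (eps V M c \<cdot> p) (ec M a b c x y) = ec M a b c (ec M b c c (eps V M c \<cdot> p) x) y"
    by (rule ec_assoc[symmetric]) (use M d t(3) in simp_all)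
  moreover have "ec M a a c (ec M a b c x y) (eps V M a \<cdot> r) = ec M a b c x (ec M a a b y (eps V M a \<cdot> r))"
    by (rule ec_assoc) (use M d t(3) in simp_all)
  ultimately show ?thesis
    unfolding trip_def using M d t(3) by simp
qed

lemma trip_eps:
  assumes "enriched_category V M" "a \<in> eobj M" "q \<in> Arr V" "Cod V q = idems V M a"
  shows "trip M a a q (eps V M a \<cdot> q) q"
  unfolding trip_def using assms by simp

text \<open>An idempotent \<open>x\<close> on the object \<open>p\<close> of the idempotent
  completion splits through the object \<open>x\<close>: the two triples are its retraction from
  \<open>p\<close> to \<open>x\<close> and its section from \<open>x\<close> to
  \<open>p\<close>.\<close>

lemma trip_om:
  assumes "enriched_category V M" "trip M a a p x p" "ec M a a a x x = x"
  shows "trip M a a (om M a x) x p" "trip M a a p x (om M a x)"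
  using tripD[OF assms(2)] assms(1,3) unfolding trip_def by simp_all

section \<open>Elements of the hom-objects \<open>Si_hom\<close> as triples\<close>

lemma alpha_comp:
  assumes M: "enriched_category V M" and ab: "a \<in> eobj M" "b \<in> eobj M"
    and t: "p \<in> Arr V" "Cod V p = idems V M b" "q \<in> Arr V" "Cod V q = idems V M a"
     "x \<in> Arr V" "Cod V x = ehom M a b" "Dom V p = Dom V q" "Dom V x = Dom V q"
  shows "alpha V M a b \<in> Arr V" "Dom V (alpha V M a b) = prd3 V (idems V M b) (ehom M a b) (idems V M a)"
    "Cod V (alpha V M a b) = ehom M a b"
    "alpha V M a b \<cdot> tuple3 V p x q = ec M a b b (eps V M b \<cdot> p) (ec M a a b x (eps V M a \<cdot> q))"
  unfolding alpha_def times2_def times3_def prd3_def tuple3_def ec_def using assms by simp_all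

lemma alpha_hat_equalizer:
  assumes M: "enriched_category V M" and ab: "a \<in> eobj M" "b \<in> eobj M"
  defines "x \<equiv> idems V M b" and "y \<equiv> ehom M a b" and "z \<equiv> idems V M a"
  defines "f \<equiv> tuple3 V (proj1 V x y z) (alpha V M a b) (proj3 V x y z)" and "g \<equiv> Ident V (prd3 V x y z)"
  shows "f \<in> Arr V" "g \<in> Arr V" "Dom V f = Dom V g" "Cod V f = Cod V g" "Dom V f = prd3 V x y z"
    "alpha_hat V M a b = equalizer V f g"
proof -
  have o: "x \<in> Obj V" "y \<in> Obj V" "z \<in> Obj V" using M ab by (simp_all add: x_def y_def z_def)
  have al: "alpha V M a b \<in> Arr V" "Dom V (alpha V M a b) = prd3 V x y z" "Cod V (alpha V M a b) = y"
    using alpha_comp(1-3)[OF M ab, of "proj1 V x y z" "proj3 V x y z" "proj2 V x y z"] o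
    by (simp_all add: x_def y_def z_def proj1_def proj2_def proj3_def)
  show "f \<in> Arr V" "g \<in> Arr V" "Dom V f = Dom V g" "Cod V f = Cod V g" "Dom V f = prd3 V x y z"
    using o al by (simp_all add: f_def g_def proj1_def proj3_def prd3_def tuple3_def)
  show "alpha_hat V M a b = equalizer V f g"
    by (simp add: alpha_hat_def Let_def f_def g_def x_def y_def z_def)
qed

lemma proj_typing:
  assumes "x \<in> Obj V" "y \<in> Obj V" "z \<in> Obj V"
  shows "proj1 V x y z \<in> Arr V" "Dom V (proj1 V x y z) = prd3 V x y z" "Cod V (proj1 V x y z) = x"
    "proj2 V x y z \<in> Arr V" "Dom V (proj2 V x y z) = prd3 V x y z" "Cod V (proj2 V x y z) = y"
    "proj3 V x y z \<in> Arr V" "Dom V (proj3 V x y z) = prd3 V x y z" "Cod V (proj3 V x y z) = z"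
  using assms by (simp_all add: proj1_def proj2_def proj3_def prd3_def)

lemma tuple3_props:
  assumes "f \<in> Arr V" "g \<in> Arr V" "h \<in> Arr V" "Dom V f = Dom V h" "Dom V g = Dom V h"
    "Cod V f = x" "Cod V g = y" "Cod V h = z"
  shows "tuple3 V f g h \<in> Arr V" "Dom V (tuple3 V f g h) = Dom V h" "Cod V (tuple3 V f g h) = prd3 V x y z"
    "proj1 V x y z \<cdot> tuple3 V f g h = f" "proj2 V x y z \<cdot> tuple3 V f g h = g" "proj3 V x y z \<cdot> tuple3 V f g h = h"
    "k \<in> Arr V \<Longrightarrow> Cod V k = Dom V h \<Longrightarrow> tuple3 V f g h \<cdot> k = tuple3 V (f \<cdot> k) (g \<cdot> k) (h \<cdot> k)"
proof -
  have "x \<in> Obj V" "y \<in> Obj V" "z \<in> Obj V" using assms by auto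
  then show "tuple3 V f g h \<in> Arr V" "Dom V (tuple3 V f g h) = Dom V h" "Cod V (tuple3 V f g h) = prd3 V x y z"
    "proj1 V x y z \<cdot> tuple3 V f g h = f" "proj2 V x y z \<cdot> tuple3 V f g h = g" "proj3 V x y z \<cdot> tuple3 V f g h = h"
    "k \<in> Arr V \<Longrightarrow> Cod V k = Dom V h \<Longrightarrow> tuple3 V f g h \<cdot> k = tuple3 V (f \<cdot> k) (g \<cdot> k) (h \<cdot> k)"
    using assms by (simp_all add: proj1_def proj2_def proj3_def prd3_def tuple3_def)
qed

lemma tuple3_inject:
  assumes "tuple3 V f g h = tuple3 V f' g' h'" "f \<in> Arr V" "g \<in> Arr V" "h \<in> Arr V" "Dom V f = Dom V h" "Dom V g = Dom V h"
    "f' \<in> Arr V" "g' \<in> Arr V" "h' \<in> Arr V" "Dom V f' = Dom V h'" "Dom V g' = Dom V h'"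
    "Cod V f = Cod V f'" "Cod V g = Cod V g'" "Cod V h = Cod V h'"
  shows "f = f'" "g = g'" "h = h'"
  using tuple3_props(4-6)[of f g h] tuple3_props(4-6)[of f' g' h'] assms by metis+

lemma tuple3_eq:
  assumes "h \<in> Arr V" "Cod V h = prd3 V x y z" "x \<in> Obj V" "y \<in> Obj V" "z \<in> Obj V"
  shows "h = tuple3 V (proj1 V x y z \<cdot> h) (proj2 V x y z \<cdot> h) (proj3 V x y z \<cdot> h)"
  using assms by (simp add: proj1_def proj2_def proj3_def tuple3_def prd3_def)

definition mk :: "('o, 'a) ecat \<Rightarrow> 'a \<Rightarrow> 'a \<Rightarrow> 'a \<Rightarrow> 'a \<Rightarrow> 'a \<Rightarrow> 'a" where
  "mk M a b p x q = factor V (alpha_hat V M a b) (tuple3 V p x q)"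

lemma Si_hom_props:
  assumes M: "enriched_category V M" and ab: "a \<in> eobj M" "b \<in> eobj M"
  shows "alpha_hat V M a b \<in> Arr V" "Dom V (alpha_hat V M a b) = Si_hom V M a b"
    "Cod V (alpha_hat V M a b) = prd3 V (idems V M b) (ehom M a b) (idems V M a)" "mono_V (alpha_hat V M a b)"
    "Si_hom V M a b \<in> Obj V"
    "ah1 V M a b \<in> Arr V" "Dom V (ah1 V M a b) = Si_hom V M a b" "Cod V (ah1 V M a b) = idems V M b"
    "ah2 V M a b \<in> Arr V" "Dom V (ah2 V M a b) = Si_hom V M a b" "Cod V (ah2 V M a b) = ehom M a b"
    "ah3 V M a b \<in> Arr V" "Dom V (ah3 V M a b) = Si_hom V M a b" "Cod V (ah3 V M a b) = idems V M a"
    "alpha_hat V M a b = tuple3 V (ah1 V M a b) (ah2 V M a b) (ah3 V M a b)"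
    "trip M a b (ah1 V M a b) (ah2 V M a b) (ah3 V M a b)"
proof -
  let ?x = "idems V M b" let ?y = "ehom M a b" let ?z = "idems V M a"
  note e = alpha_hat_equalizer[OF M ab]
  note p = equalizer_props[OF e(1-4), folded e(6)]
  have o: "?x \<in> Obj V" "?y \<in> Obj V" "?z \<in> Obj V" using M ab by simp_all
  show h: "alpha_hat V M a b \<in> Arr V" "Dom V (alpha_hat V M a b) = Si_hom V M a b"
    "Cod V (alpha_hat V M a b) = prd3 V ?x ?y ?z" "mono_V (alpha_hat V M a b)"
    using p e(5) by (simp_all add: Si_hom_def)
  show "Si_hom V M a b \<in> Obj V" using h obj_dom by metis
  show t: "ah1 V M a b \<in> Arr V" "Dom V (ah1 V M a b) = Si_hom V M a b" "Cod V (ah1 V M a b) = idems V M b"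
    "ah2 V M a b \<in> Arr V" "Dom V (ah2 V M a b) = Si_hom V M a b" "Cod V (ah2 V M a b) = ehom M a b"
    "ah3 V M a b \<in> Arr V" "Dom V (ah3 V M a b) = Si_hom V M a b" "Cod V (ah3 V M a b) = idems V M a"
    using h o by (simp_all add: ah1_def ah2_def ah3_def proj1_def proj2_def proj3_def prd3_def)
  show tup: "alpha_hat V M a b = tuple3 V (ah1 V M a b) (ah2 V M a b) (ah3 V M a b)"
    unfolding ah1_def ah2_def ah3_def by (rule tuple3_eq[OF h(1,3) o])
  note al = alpha_comp[OF M ab t(1,3,7,9,4,6)]
  have "tuple3 V (proj1 V ?x ?y ?z) (alpha V M a b) (proj3 V ?x ?y ?z) \<cdot> alpha_hat V M a b = alpha_hat V M a b"
    using p(3) h o by (simp add: prd3_def)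
  then have "tuple3 V (proj1 V ?x ?y ?z \<cdot> alpha_hat V M a b) (alpha V M a b \<cdot> alpha_hat V M a b)
      (proj3 V ?x ?y ?z \<cdot> alpha_hat V M a b) = alpha_hat V M a b"
    using h o al(1-3) t by (simp add: prd3_def tuple3_def proj1_def proj3_def)
  then have *: "tuple3 V (ah1 V M a b) (alpha V M a b \<cdot> alpha_hat V M a b) (ah3 V M a b) =
      tuple3 V (ah1 V M a b) (ah2 V M a b) (ah3 V M a b)"
    unfolding tup[symmetric] by (simp add: ah1_def ah3_def)
  have "alpha V M a b \<cdot> alpha_hat V M a b = ah2 V M a b"
    by (rule tuple3_inject(2)[OF *]) (use t h al(1-3) in simp_all)
  then have E: "ec M a b b (eps V M b \<cdot> ah1 V M a b) (ec M a a b (ah2 V M a b) (eps V M a \<cdot> ah3 V M a b)) = ah2 V M a b"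
    using al(4) t tup by simp
  \<comment> \<open>The equalizer only provides \<open>p x q = x\<close>. Multiplying by
    \<open>p\<close> on the left or by \<open>q\<close> on the right and using that both are
    idempotent gives the separate laws \<open>p x = x\<close> and \<open>x q = x\<close>.\<close>
  have "ec M a b b (eps V M b \<cdot> ah1 V M a b) (ec M a b b (eps V M b \<cdot> ah1 V M a b) (ec M a a b (ah2 V M a b) (eps V M a \<cdot> ah3 V M a b)))
     = ec M a b b (ec M b b b (eps V M b \<cdot> ah1 V M a b) (eps V M b \<cdot> ah1 V M a b)) (ec M a a b (ah2 V M a b) (eps V M a \<cdot> ah3 V M a b))"
    by (rule ec_assoc[symmetric]) (use M ab t in simp_all)
  moreover have "ec M a a b (ec M a b b (eps V M b \<cdot> ah1 V M a b) (ec M a a b (ah2 V M a b) (eps V M a \<cdot> ah3 V M a b))) (eps V M a \<cdot> ah3 V M a b)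
     = ec M a b b (eps V M b \<cdot> ah1 V M a b) (ec M a a b (ah2 V M a b) (ec M a a a (eps V M a \<cdot> ah3 V M a b) (eps V M a \<cdot> ah3 V M a b)))"
    using M ab t by simp
  ultimately show "trip M a b (ah1 V M a b) (ah2 V M a b) (ah3 V M a b)"
    unfolding trip_def using E M ab t by simp
qed

lemma Si_hom_typing [simp]:
  assumes M: "enriched_category V M" and ab: "a \<in> eobj M" "b \<in> eobj M"
  shows "Si_hom V M a b \<in> Obj V"
    "ah1 V M a b \<in> Arr V" "Dom V (ah1 V M a b) = Si_hom V M a b" "Cod V (ah1 V M a b) = idems V M b"
    "ah2 V M a b \<in> Arr V" "Dom V (ah2 V M a b) = Si_hom V M a b" "Cod V (ah2 V M a b) = ehom M a b"
    "ah3 V M a b \<in> Arr V" "Dom V (ah3 V M a b) = Si_hom V M a b" "Cod V (ah3 V M a b) = idems V M a"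
  using Si_hom_props[OF assms] by blast+

lemma Si_hom_eqI:
  assumes M: "enriched_category V M" and ab: "a \<in> eobj M" "b \<in> eobj M"
    and uv: "u \<in> Arr V" "v \<in> Arr V" "Dom V u = Dom V v" "Cod V u = Si_hom V M a b" "Cod V v = Si_hom V M a b"
    "ah1 V M a b \<cdot> u = ah1 V M a b \<cdot> v" "ah2 V M a b \<cdot> u = ah2 V M a b \<cdot> v" "ah3 V M a b \<cdot> u = ah3 V M a b \<cdot> v"
  shows "u = v"
proof (rule mono_V_D[OF Si_hom_props(4)[OF M ab]])
  note h = Si_hom_props[OF M ab]
  show "alpha_hat V M a b \<cdot> u = alpha_hat V M a b \<cdot> v"
    unfolding h(15) tuple3_def using h(6-14) uv by simp
qed (use Si_hom_props[OF M ab] uv in simp_all)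

lemma mk_props [simp]:
  assumes M: "enriched_category V M" and t: "trip M a b p x q"
  shows "mk M a b p x q \<in> Arr V" "Dom V (mk M a b p x q) = Dom V q" "Cod V (mk M a b p x q) = Si_hom V M a b"
    "ah1 V M a b \<cdot> mk M a b p x q = p" "ah2 V M a b \<cdot> mk M a b p x q = x" "ah3 V M a b \<cdot> mk M a b p x q = q"
proof -
  note d = tripD[OF t]
  note e = alpha_hat_equalizer[OF M d(1,2)]
  note al = alpha_comp[OF M d(1-10)]
  note h = Si_hom_props[OF M d(1,2)]
  let ?x = "idems V M b" let ?y = "ehom M a b" let ?z = "idems V M a"
  have o: "?x \<in> Obj V" "?y \<in> Obj V" "?z \<in> Obj V" using M d(1,2) by simp_all
  have T: "tuple3 V p x q \<in> Arr V" "Cod V (tuple3 V p x q) = prd3 V ?x ?y ?z" "Dom V (tuple3 V p x q) = Dom V q"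
    "proj1 V ?x ?y ?z \<cdot> tuple3 V p x q = p" "proj3 V ?x ?y ?z \<cdot> tuple3 V p x q = q"
    using tuple3_props[of p x q] d(3-10) by simp_all
  note pt = proj_typing[OF o]
  \<comment> \<open>Conversely the two absorption laws combine to \<open>p x q = x\<close>, so the
    triple factors through the equalizer \<open>alpha_hat\<close>.\<close>
  have "alpha V M a b \<cdot> tuple3 V p x q = x" using al(4) d(11,12) by simp
  then have "tuple3 V (proj1 V ?x ?y ?z) (alpha V M a b) (proj3 V ?x ?y ?z) \<cdot> tuple3 V p x q = tuple3 V p x q"
    using tuple3_props(7)[of "proj1 V ?x ?y ?z" "alpha V M a b" "proj3 V ?x ?y ?z"] pt al(1-3) T by simp
  then have "tuple3 V (proj1 V ?x ?y ?z) (alpha V M a b) (proj3 V ?x ?y ?z) \<cdot> tuple3 V p x q =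
      Ident V (prd3 V ?x ?y ?z) \<cdot> tuple3 V p x q" using T by simp
  note eq = equalizer_factor[OF e(1-4) T(1), unfolded e(5), OF T(2) this, folded e(6), folded mk_def]
  show ty: "mk M a b p x q \<in> Arr V" "Dom V (mk M a b p x q) = Dom V q" "Cod V (mk M a b p x q) = Si_hom V M a b"
    using eq(1-3) T h by simp_all
  have *: "tuple3 V (ah1 V M a b \<cdot> mk M a b p x q) (ah2 V M a b \<cdot> mk M a b p x q) (ah3 V M a b \<cdot> mk M a b p x q) = tuple3 V p x q"
    using eq(4) unfolding h(15)
    using tuple3_props(7)[of "ah1 V M a b" "ah2 V M a b" "ah3 V M a b" _ _ _ "mk M a b p x q"] ty h(6-14) by simp
  show "ah1 V M a b \<cdot> mk M a b p x q = p" "ah2 V M a b \<cdot> mk M a b p x q = x" "ah3 V M a b \<cdot> mk M a b p x q = q"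
    by (rule tuple3_inject[OF *]; use ty h(6-14) d(3-10) in simp)+
qed

lemma mk_comp [simp]:
  assumes M: "enriched_category V M" and t: "trip M a b p x q" and k: "k \<in> Arr V" "Cod V k = Dom V q"
  shows "mk M a b p x q \<cdot> k = mk M a b (p \<cdot> k) (x \<cdot> k) (q \<cdot> k)"
proof -
  note d = tripD[OF t] and m = mk_props[OF M t] and m' = mk_props[OF M trip_restrict[OF M t k]]
  have "ah1 V M a b \<cdot> mk M a b p x q \<cdot> k = p \<cdot> k" "ah2 V M a b \<cdot> mk M a b p x q \<cdot> k = x \<cdot> k"
    "ah3 V M a b \<cdot> mk M a b p x q \<cdot> k = q \<cdot> k"
    by (rule comp_extend; use m d k M in simp)+
  note e = this
  show ?thesis
    by (rule Si_hom_eqI[OF M d(1,2)]) (use e m m' d k in simp_all)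
qed

lemma mk_eta:
  assumes M: "enriched_category V M" and ab: "a \<in> eobj M" "b \<in> eobj M" and u: "u \<in> Arr V" "Cod V u = Si_hom V M a b"
  shows "trip M a b (ah1 V M a b \<cdot> u) (ah2 V M a b \<cdot> u) (ah3 V M a b \<cdot> u)"
    "mk M a b (ah1 V M a b \<cdot> u) (ah2 V M a b \<cdot> u) (ah3 V M a b \<cdot> u) = u"
proof -
  show t: "trip M a b (ah1 V M a b \<cdot> u) (ah2 V M a b \<cdot> u) (ah3 V M a b \<cdot> u)"
    by (rule trip_restrict[OF M Si_hom_props(16)[OF M ab]]) (use M ab u in simp_all)
  show "mk M a b (ah1 V M a b \<cdot> u) (ah2 V M a b \<cdot> u) (ah3 V M a b \<cdot> u) = u"
    by (rule Si_hom_eqI[OF M ab]) (use M ab u mk_props[OF M t] in simp_all)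
qed

subsection \<open>The internal category of idempotents\<close>

definition inj2 :: "('o, 'a) ecat \<Rightarrow> 'a \<Rightarrow> 'a \<Rightarrow> 'a \<Rightarrow> 'a" where
  "inj2 M a b c = inj_coprod V (eobj M \<times> eobj M \<times> eobj M) (\<lambda>(a, b, c). Si_pairs V M a b c) (a, b, c)"

lemma Si_pairs_pullback:
  assumes M: "enriched_category V M" and abc: "a \<in> eobj M" "b \<in> eobj M" "c \<in> eobj M"
  shows "is_pullback V (ah3 V M b c) (ah1 V M a b) (Si_pairs V M a b c) (Si_pi1 V M a b c) (Si_pi2 V M a b c)"
  unfolding Si_pairs_def Si_pi1_def Si_pi2_def by (rule pbk_is) (use M abc in simp_all)

lemma Si_pairs_typing [simp]:
  assumes M: "enriched_category V M" and abc: "a \<in> eobj M" "b \<in> eobj M" "c \<in> eobj M"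
  shows "Si_pairs V M a b c \<in> Obj V" "Si_pi1 V M a b c \<in> Arr V" "Dom V (Si_pi1 V M a b c) = Si_pairs V M a b c"
    "Cod V (Si_pi1 V M a b c) = Si_hom V M b c"
    "Si_pi2 V M a b c \<in> Arr V" "Dom V (Si_pi2 V M a b c) = Si_pairs V M a b c"
    "Cod V (Si_pi2 V M a b c) = Si_hom V M a b"
    "ah3 V M b c \<cdot> Si_pi1 V M a b c = ah1 V M a b \<cdot> Si_pi2 V M a b c"
  using Si_pairs_pullback[OF assms] M abc unfolding is_pullback_def by auto

lemma Si_coproducts:
  assumes M: "small_ecat M"
  shows "is_coproduct V (eobj M) (idems V M) (Si0 V M) (inj0 V M)"
    "is_coproduct V (eobj M \<times> eobj M) (\<lambda>(a, b). Si_hom V M a b) (Si1 V M) (\<lambda>(a, b). inj1 V M a b)"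
    "is_coproduct V (eobj M \<times> eobj M \<times> eobj M) (\<lambda>(a, b, c). Si_pairs V M a b c) (Si2 V M)
       (\<lambda>(a, b, c). inj2 M a b c)"
    "small \<kappa> (eobj M \<times> eobj M)" "small \<kappa> (eobj M \<times> eobj M \<times> eobj M)"
proof -
  show s: "small \<kappa> (eobj M \<times> eobj M)" "small \<kappa> (eobj M \<times> eobj M \<times> eobj M)"
    using M by (simp_all add: small_Times)
  have "(\<lambda>a. inj_coprod V (eobj M) (idems V M) a) = inj0 V M"
    "(\<lambda>(a, b). inj_coprod V (eobj M \<times> eobj M) (\<lambda>(a, b). Si_hom V M a b) (a, b)) = (\<lambda>(a, b). inj1 V M a b)"
    "(\<lambda>(a, b, c). inj_coprod V (eobj M \<times> eobj M \<times> eobj M) (\<lambda>(a, b, c). Si_pairs V M a b c) (a, b, c)) =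
      (\<lambda>(a, b, c). inj2 M a b c)"
    by (intro ext; simp add: inj0_def inj1_def inj2_def split: prod.splits)+
  then show "is_coproduct V (eobj M) (idems V M) (Si0 V M) (inj0 V M)"
    "is_coproduct V (eobj M \<times> eobj M) (\<lambda>(a, b). Si_hom V M a b) (Si1 V M) (\<lambda>(a, b). inj1 V M a b)"
    "is_coproduct V (eobj M \<times> eobj M \<times> eobj M) (\<lambda>(a, b, c). Si_pairs V M a b c) (Si2 V M)
       (\<lambda>(a, b, c). inj2 M a b c)"
    using coprod_is_coproduct[of "eobj M" "idems V M"]
      coprod_is_coproduct[OF s(1), of "\<lambda>(a, b). Si_hom V M a b"]
      coprod_is_coproduct[OF s(2), of "\<lambda>(a, b, c). Si_pairs V M a b c"] M
    by (auto simp: Si0_def Si1_def Si2_def)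
qed

lemma inj_typing [simp]:
  assumes M: "small_ecat M" and a: "a \<in> eobj M"
  shows "Si0 V M \<in> Obj V" "Si1 V M \<in> Obj V" "Si2 V M \<in> Obj V"
    "inj0 V M a \<in> Arr V" "Dom V (inj0 V M a) = idems V M a" "Cod V (inj0 V M a) = Si0 V M"
    "b \<in> eobj M \<Longrightarrow> inj1 V M a b \<in> Arr V" "b \<in> eobj M \<Longrightarrow> Dom V (inj1 V M a b) = Si_hom V M a b"
    "b \<in> eobj M \<Longrightarrow> Cod V (inj1 V M a b) = Si1 V M"
    "b \<in> eobj M \<Longrightarrow> c \<in> eobj M \<Longrightarrow> inj2 M a b c \<in> Arr V"
    "b \<in> eobj M \<Longrightarrow> c \<in> eobj M \<Longrightarrow> Dom V (inj2 M a b c) = Si_pairs V M a b c"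
    "b \<in> eobj M \<Longrightarrow> c \<in> eobj M \<Longrightarrow> Cod V (inj2 M a b c) = Si2 V M"
  using coproductD[OF Si_coproducts(1)[OF M]] coproductD(1)[OF Si_coproducts(2)[OF M]]
    coproductD(1)[OF Si_coproducts(3)[OF M]] coproductD(2-4)[OF Si_coproducts(2)[OF M], where i = "(a, b)"]
    coproductD(2-4)[OF Si_coproducts(3)[OF M], where i = "(a, b, c)"] a by simp_all

lemma Si_obj_typing:
  assumes M: "small_ecat M"
  shows "Si0 V M \<in> Obj V" "Si1 V M \<in> Obj V" "Si2 V M \<in> Obj V"
  using coproductD(1)[OF Si_coproducts(1)[OF M]] coproductD(1)[OF Si_coproducts(2)[OF M]]
    coproductD(1)[OF Si_coproducts(3)[OF M]] by blast+

lemma Si_ident_eq: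
  assumes "enriched_category V M" "a \<in> eobj M"
  shows "Si_ident V M a = mk M a a (Ident V (idems V M a)) (eps V M a) (Ident V (idems V M a))"
    "trip M a a (Ident V (idems V M a)) (eps V M a) (Ident V (idems V M a))"
  using trip_eps[OF assms, of "Ident V (idems V M a)"] assms by (simp_all add: Si_ident_def mk_def)

lemma Si_comp_eq:
  assumes M: "enriched_category V M" and abc: "a \<in> eobj M" "b \<in> eobj M" "c \<in> eobj M"
  defines "u \<equiv> Si_pi1 V M a b c" and "v \<equiv> Si_pi2 V M a b c"
  shows "Si_comp V M a b c = mk M a c (ah1 V M b c \<cdot> u) (ec M a b c (ah2 V M b c \<cdot> u) (ah2 V M a b \<cdot> v)) (ah3 V M a b \<cdot> v)"
    "trip M a c (ah1 V M b c \<cdot> u) (ec M a b c (ah2 V M b c \<cdot> u) (ah2 V M a b \<cdot> v)) (ah3 V M a b \<cdot> v)"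
proof -
  show "Si_comp V M a b c = mk M a c (ah1 V M b c \<cdot> u) (ec M a b c (ah2 V M b c \<cdot> u) (ah2 V M a b \<cdot> v)) (ah3 V M a b \<cdot> v)"
    by (simp add: Si_comp_def mk_def ec_def u_def v_def)
  show "trip M a c (ah1 V M b c \<cdot> u) (ec M a b c (ah2 V M b c \<cdot> u) (ah2 V M a b \<cdot> v)) (ah3 V M a b \<cdot> v)"
    by (rule trip_comp[OF M mk_eta(1) mk_eta(1)]) (use M abc in \<open>simp_all add: u_def v_def\<close>)
qed

lemma Si_icat_simps [simp]:
  "A0 (Si_icat V M) = Si0 V M" "A1 (Si_icat V M) = Si1 V M" "A2 (Si_icat V M) = Si2 V M"
  by (simp_all add: Si_icat_def)

lemma Si_icat_typing:
  assumes M: "small_ecat M"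
  shows "d0 (Si_icat V M) \<in> Arr V" "Dom V (d0 (Si_icat V M)) = Si1 V M" "Cod V (d0 (Si_icat V M)) = Si0 V M"
    "d1 (Si_icat V M) \<in> Arr V" "Dom V (d1 (Si_icat V M)) = Si1 V M" "Cod V (d1 (Si_icat V M)) = Si0 V M"
    "ipr1 (Si_icat V M) \<in> Arr V" "Dom V (ipr1 (Si_icat V M)) = Si2 V M" "Cod V (ipr1 (Si_icat V M)) = Si1 V M"
    "ipr2 (Si_icat V M) \<in> Arr V" "Dom V (ipr2 (Si_icat V M)) = Si2 V M" "Cod V (ipr2 (Si_icat V M)) = Si1 V M"
    "iident (Si_icat V M) \<in> Arr V" "Dom V (iident (Si_icat V M)) = Si0 V M" "Cod V (iident (Si_icat V M)) = Si1 V M"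
    "icomp (Si_icat V M) \<in> Arr V" "Dom V (icomp (Si_icat V M)) = Si2 V M" "Cod V (icomp (Si_icat V M)) = Si1 V M"
    and Si_icat_inj:
    "\<And>a b. a \<in> eobj M \<Longrightarrow> b \<in> eobj M \<Longrightarrow> d0 (Si_icat V M) \<cdot> inj1 V M a b = inj0 V M a \<cdot> ah3 V M a b"
    "\<And>a b. a \<in> eobj M \<Longrightarrow> b \<in> eobj M \<Longrightarrow> d1 (Si_icat V M) \<cdot> inj1 V M a b = inj0 V M b \<cdot> ah1 V M a b"
    "\<And>a b c. a \<in> eobj M \<Longrightarrow> b \<in> eobj M \<Longrightarrow> c \<in> eobj M \<Longrightarrow>
      ipr1 (Si_icat V M) \<cdot> inj2 M a b c = inj1 V M b c \<cdot> Si_pi1 V M a b c"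
    "\<And>a b c. a \<in> eobj M \<Longrightarrow> b \<in> eobj M \<Longrightarrow> c \<in> eobj M \<Longrightarrow>
      ipr2 (Si_icat V M) \<cdot> inj2 M a b c = inj1 V M a b \<cdot> Si_pi2 V M a b c"
    "\<And>a. a \<in> eobj M \<Longrightarrow> iident (Si_icat V M) \<cdot> inj0 V M a = inj1 V M a a \<cdot> Si_ident V M a"
    "\<And>a b c. a \<in> eobj M \<Longrightarrow> b \<in> eobj M \<Longrightarrow> c \<in> eobj M \<Longrightarrow>
      icomp (Si_icat V M) \<cdot> inj2 M a b c = inj1 V M a c \<cdot> Si_comp V M a b c"
proof -
  let ?I1 = "eobj M" let ?I2 = "eobj M \<times> eobj M" let ?I3 = "eobj M \<times> eobj M \<times> eobj M"
  let ?f1 = "\<lambda>(a, b). Si_hom V M a b" let ?f2 = "\<lambda>(a, b, c). Si_pairs V M a b c"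
  note E = small_ecatD(1)[OF M]
  note s = small_ecatD(2)[OF M] Si_coproducts(4,5)[OF M] and o = Si_obj_typing[OF M]
  have i: "Si_ident V M a \<in> hom V (idems V M a) (Si_hom V M a a)" if "a \<in> eobj M" for a
    using mk_props(1-3)[OF E Si_ident_eq(2)[OF E that]] Si_ident_eq(1)[OF E that] E that by simp
  have cm: "Si_comp V M a b c \<in> hom V (Si_pairs V M a b c) (Si_hom V M a c)"
    if "a \<in> eobj M" "b \<in> eobj M" "c \<in> eobj M" for a b c
    using mk_props(1-3)[OF E Si_comp_eq(2)[OF E that]] Si_comp_eq(1)[OF E that] E that by simp
  have f: "?f1 i \<in> Obj V" if "i \<in> ?I2" for i using E that by auto
  have g: "?f2 i \<in> Obj V" if "i \<in> ?I3" for i using E that by auto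
  have h: "idems V M a \<in> Obj V" if "a \<in> ?I1" for a using E that by auto
  note S = Si_icat_def[of V M]
  have d0: "\<And>i. i \<in> ?I2 \<Longrightarrow> (\<lambda>(a, b). inj0 V M a \<cdot> ah3 V M a b) i \<in> hom V (?f1 i) (Si0 V M)"
    and d1: "\<And>i. i \<in> ?I2 \<Longrightarrow> (\<lambda>(a, b). inj0 V M b \<cdot> ah1 V M a b) i \<in> hom V (?f1 i) (Si0 V M)"
    using M by auto
  have p1: "\<And>i. i \<in> ?I3 \<Longrightarrow> (\<lambda>(a, b, c). inj1 V M b c \<cdot> Si_pi1 V M a b c) i \<in> hom V (?f2 i) (Si1 V M)"
    and p2: "\<And>i. i \<in> ?I3 \<Longrightarrow> (\<lambda>(a, b, c). inj1 V M a b \<cdot> Si_pi2 V M a b c) i \<in> hom V (?f2 i) (Si1 V M)"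
    and cc: "\<And>i. i \<in> ?I3 \<Longrightarrow> (\<lambda>(a, b, c). inj1 V M a c \<cdot> Si_comp V M a b c) i \<in> hom V (?f2 i) (Si1 V M)"
    using M cm by auto
  have ii: "\<And>a. a \<in> ?I1 \<Longrightarrow> inj1 V M a a \<cdot> Si_ident V M a \<in> hom V (idems V M a) (Si1 V M)"
    using M i by auto
  note D0 = cotuple_props[OF s(2) o(1) f d0] and D1 = cotuple_props[OF s(2) o(1) f d1]
    and P1 = cotuple_props[OF s(3) o(2) g p1] and P2 = cotuple_props[OF s(3) o(2) g p2]
    and CC = cotuple_props[OF s(3) o(2) g cc] and II = cotuple_props[OF s(1) o(2) h ii]
  show "d0 (Si_icat V M) \<in> Arr V" "Dom V (d0 (Si_icat V M)) = Si1 V M" "Cod V (d0 (Si_icat V M)) = Si0 V M"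
    using D0(1-3) by (simp_all add: S Si1_def)
  show "d1 (Si_icat V M) \<in> Arr V" "Dom V (d1 (Si_icat V M)) = Si1 V M" "Cod V (d1 (Si_icat V M)) = Si0 V M"
    using D1(1-3) by (simp_all add: S Si1_def)
  show "ipr1 (Si_icat V M) \<in> Arr V" "Dom V (ipr1 (Si_icat V M)) = Si2 V M" "Cod V (ipr1 (Si_icat V M)) = Si1 V M"
    using P1(1-3) by (simp_all add: S Si2_def)
  show "ipr2 (Si_icat V M) \<in> Arr V" "Dom V (ipr2 (Si_icat V M)) = Si2 V M" "Cod V (ipr2 (Si_icat V M)) = Si1 V M"
    using P2(1-3) by (simp_all add: S Si2_def)
  show "iident (Si_icat V M) \<in> Arr V" "Dom V (iident (Si_icat V M)) = Si0 V M" "Cod V (iident (Si_icat V M)) = Si1 V M"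
    using II(1-3) by (simp_all add: S Si0_def)
  show "icomp (Si_icat V M) \<in> Arr V" "Dom V (icomp (Si_icat V M)) = Si2 V M" "Cod V (icomp (Si_icat V M)) = Si1 V M"
    using CC(1-3) by (simp_all add: S Si2_def)
  show "d0 (Si_icat V M) \<cdot> inj1 V M a b = inj0 V M a \<cdot> ah3 V M a b"
    "d1 (Si_icat V M) \<cdot> inj1 V M a b = inj0 V M b \<cdot> ah1 V M a b"
    if "a \<in> eobj M" "b \<in> eobj M" for a b
    using D0(4)[where i = "(a, b)"] D1(4)[where i = "(a, b)"] that by (simp_all add: S inj1_def)
  show "ipr1 (Si_icat V M) \<cdot> inj2 M a b c = inj1 V M b c \<cdot> Si_pi1 V M a b c"
    "ipr2 (Si_icat V M) \<cdot> inj2 M a b c = inj1 V M a b \<cdot> Si_pi2 V M a b c"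
    "icomp (Si_icat V M) \<cdot> inj2 M a b c = inj1 V M a c \<cdot> Si_comp V M a b c"
    if "a \<in> eobj M" "b \<in> eobj M" "c \<in> eobj M" for a b c
    using P1(4)[where i = "(a, b, c)"] P2(4)[where i = "(a, b, c)"] CC(4)[where i = "(a, b, c)"] that by (simp_all add: S inj2_def)
  show "iident (Si_icat V M) \<cdot> inj0 V M a = inj1 V M a a \<cdot> Si_ident V M a" if "a \<in> eobj M" for a
    using II(4)[where i = a] that by (simp add: S inj0_def)
qed

lemma inj0_eq:
  assumes "small_ecat M" "a \<in> eobj M" "b \<in> eobj M" "inj0 V M a \<cdot> p = inj0 V M b \<cdot> q"
    "p \<in> Arr V" "q \<in> Arr V" "Dom V p = Dom V q" "Cod V p = idems V M a" "Cod V q = idems V M b"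
  shows "if a = b then p = q else initial (Dom V q)"
  using coproduct_inj_eq[OF Si_coproducts(1)[OF assms(1)] small_ecatD(2)[OF assms(1)] assms(2,3), of p "Dom V q" q] assms
  by simp

text \<open>The coproduct of the summandwise pullbacks is the pullback of the coproducts. The
  element \<open>u\<close> is decomposed over pairs of objects and then \<open>v\<close> over each
  piece; the equation between \<open>d0\<close> and \<open>d1\<close> forces equal middle indices or
  an initial stage, and in the first case the pullback of summands supplies the mediating
  arrow.\<close>

lemma Si_icat_pullback:
  assumes M: "small_ecat M"
  defines "S \<equiv> Si_icat V M"
  shows "is_pullback V (d0 S) (d1 S) (Si2 V M) (ipr1 S) (ipr2 S)"
  unfolding is_pullback_def
proof (intro conjI allI impI)
  note E = small_ecatD(1)[OF M] and ty = Si_icat_typing[OF M, folded S_def] and inj = Si_icat_inj[OF M, folded S_def]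
  note c1 = Si_coproducts(2)[OF M] and c2 = Si_coproducts(3)[OF M] and sml = Si_coproducts(4,5)[OF M]
  show "Si2 V M \<in> Obj V" using Si_obj_typing[OF M] by simp
  show "ipr1 S \<in> hom V (Si2 V M) (Dom V (d0 S))" "ipr2 S \<in> hom V (Si2 V M) (Dom V (d1 S))" using ty by simp_all
  show "d0 S \<cdot> ipr1 S = d1 S \<cdot> ipr2 S"
  proof (rule coproduct_eqI[OF c2])
    fix i assume "i \<in> eobj M \<times> eobj M \<times> eobj M"
    then obtain a b c where i: "i = (a, b, c)" "a \<in> eobj M" "b \<in> eobj M" "c \<in> eobj M" by auto
    have "d0 S \<cdot> ipr1 S \<cdot> inj2 M a b c = inj0 V M b \<cdot> ah3 V M b c \<cdot> Si_pi1 V M a b c"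
      using inj i ty M E comp_extend[OF inj(1)[of b c], of "Si_pi1 V M a b c"] by simp
    moreover have "d1 S \<cdot> ipr2 S \<cdot> inj2 M a b c = inj0 V M b \<cdot> ah1 V M a b \<cdot> Si_pi2 V M a b c"
      using inj i ty M E comp_extend[OF inj(2)[of a b], of "Si_pi2 V M a b c"] by simp
    ultimately show "(d0 S \<cdot> ipr1 S) \<cdot> (case i of (a, b, c) \<Rightarrow> inj2 M a b c) =
        (d1 S \<cdot> ipr2 S) \<cdot> (case i of (a, b, c) \<Rightarrow> inj2 M a b c)"
      using i ty M E by simp
  qed (use ty in simp_all)
  fix z u v assume uv: "u \<in> hom V z (Dom V (d0 S)) \<and> v \<in> hom V z (Dom V (d1 S)) \<and> d0 S \<cdot> u = d1 S \<cdot> v"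
  have u: "u \<in> Arr V" "Dom V u = z" "Cod V u = Si1 V M" and v: "v \<in> Arr V" "Dom V v = z" "Cod V v = Si1 V M"
    using uv ty by auto
  show "\<exists>!h. h \<in> hom V z (Si2 V M) \<and> ipr1 S \<cdot> h = u \<and> ipr2 S \<cdot> h = v"
  proof (rule coproduct_local_ex1[OF c1 sml(1), of u])
    fix k i w assume k: "k \<in> Arr V" "Cod V k = z" and i: "i \<in> eobj M \<times> eobj M"
      and w: "w \<in> Arr V" "Dom V w = Dom V k" "Cod V w = (case i of (a, b) \<Rightarrow> Si_hom V M a b)"
      and uk: "u \<cdot> k = (case i of (a, b) \<Rightarrow> inj1 V M a b) \<cdot> w"
    obtain b c where bc: "i = (b, c)" "b \<in> eobj M" "c \<in> eobj M" using i by auto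
    have w': "Cod V w = Si_hom V M b c" and uk': "u \<cdot> k = inj1 V M b c \<cdot> w" using w uk bc by simp_all
    show "\<exists>!h. h \<in> hom V (Dom V k) (Si2 V M) \<and> ipr1 S \<cdot> h = u \<cdot> k \<and> ipr2 S \<cdot> h = v \<cdot> k"
    proof (rule coproduct_local_ex1[OF c1 sml(1), of "v \<cdot> k"])
      fix l i' x assume l: "l \<in> Arr V" "Cod V l = Dom V k" and i': "i' \<in> eobj M \<times> eobj M"
        and x: "x \<in> Arr V" "Dom V x = Dom V l" "Cod V x = (case i' of (a, b) \<Rightarrow> Si_hom V M a b)"
        and vl: "(v \<cdot> k) \<cdot> l = (case i' of (a, b) \<Rightarrow> inj1 V M a b) \<cdot> x"
      obtain a b' where ab: "i' = (a, b')" "a \<in> eobj M" "b' \<in> eobj M" using i' by auto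
      have x': "Cod V x = Si_hom V M a b'" and vl': "v \<cdot> k \<cdot> l = inj1 V M a b' \<cdot> x"
        using x vl ab v k l by simp_all
      have ukl: "u \<cdot> k \<cdot> l = inj1 V M b c \<cdot> w \<cdot> l"
        using comp_extend[OF uk'] u k l w w' bc M E by simp
      have "d0 S \<cdot> u \<cdot> k \<cdot> l = d1 S \<cdot> v \<cdot> k \<cdot> l"
        using comp_extend[of "d0 S" u "d1 S \<cdot> v" "k \<cdot> l"] uv ty k l by simp
      then have "d0 S \<cdot> inj1 V M b c \<cdot> w \<cdot> l = d1 S \<cdot> inj1 V M a b' \<cdot> x"
        using ukl vl' by simp
      then have "inj0 V M b \<cdot> ah3 V M b c \<cdot> w \<cdot> l = inj0 V M b' \<cdot> ah1 V M a b' \<cdot> x"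
        using comp_extend[OF inj(1)[OF bc(2,3)], of "w \<cdot> l"] comp_extend[OF inj(2)[OF ab(2,3)], of x]
          ty bc ab w w' x x' l M E by simp
      from inj0_eq[OF M bc(2) ab(3) this]
      \<comment> \<open>Equality in the coproduct \<open>Si0\<close>: either the middle object and
        the middle idempotent coincide, or the stage is initial.\<close>
      have cases: "if b = b' then ah3 V M b c \<cdot> w \<cdot> l = ah1 V M a b' \<cdot> x else initial (Dom V l)"
        using bc ab w w' x x' l E by (simp split: if_splits)
      show "\<exists>!h. h \<in> hom V (Dom V l) (Si2 V M) \<and> ipr1 S \<cdot> h = (u \<cdot> k) \<cdot> l \<and> ipr2 S \<cdot> h = (v \<cdot> k) \<cdot> l"
      proof (cases "b = b'")
        case False
        with cases have "initial (Dom V l)" by simp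
        then show ?thesis by (rule initial_ex1) (use ty u v k l in auto)
      next
        case True
        with cases have e: "ah3 V M b c \<cdot> w \<cdot> l = ah1 V M a b \<cdot> x" by simp
        note pb = Si_pairs_pullback[OF E ab(2) bc(2,3)]
        obtain h where h: "h \<in> Arr V" "Dom V h = Dom V x" "Cod V h = Si_pairs V M a b c"
          "Si_pi1 V M a b c \<cdot> h = w \<cdot> l" "Si_pi2 V M a b c \<cdot> h = x"
          by (rule pullback_lift[OF pb, of "w \<cdot> l" x]) (use E ab bc True w w' x x' l e in auto)
        have p1: "ipr1 S \<cdot> inj2 M a b c \<cdot> h = inj1 V M b c \<cdot> w \<cdot> l"
          and p2: "ipr2 S \<cdot> inj2 M a b c \<cdot> h = inj1 V M a b \<cdot> x"
          using comp_extend[OF inj(3)[OF ab(2) bc(2,3)], of h] comp_extend[OF inj(4)[OF ab(2) bc(2,3)], of h]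
            h ty ab bc M E by simp_all
        show ?thesis
        proof (rule ex1I[of _ "inj2 M a b c \<cdot> h"])
          show "inj2 M a b c \<cdot> h \<in> hom V (Dom V l) (Si2 V M) \<and> ipr1 S \<cdot> inj2 M a b c \<cdot> h = (u \<cdot> k) \<cdot> l \<and>
              ipr2 S \<cdot> inj2 M a b c \<cdot> h = (v \<cdot> k) \<cdot> l"
            using p1 p2 ukl vl' True h x u v k l M E ab bc by simp
          fix g assume "g \<in> hom V (Dom V l) (Si2 V M) \<and> ipr1 S \<cdot> g = (u \<cdot> k) \<cdot> l \<and> ipr2 S \<cdot> g = (v \<cdot> k) \<cdot> l"
          then have g: "g \<in> Arr V" "Dom V g = Dom V l" "Cod V g = Si2 V M"
            "ipr1 S \<cdot> g = inj1 V M b c \<cdot> w \<cdot> l" "ipr2 S \<cdot> g = inj1 V M a b \<cdot> x"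
            using ukl vl' True u v k l by auto
          show "g = inj2 M a b c \<cdot> h"
          \<comment> \<open>A competing \<open>g\<close> need not lie in a single summand of
            \<open>Si2\<close>, so it is decomposed over triples of objects before it is
            compared.\<close>
          proof (rule coproduct_local_eqI[OF c2 sml(2), of g])
            fix m j y assume m: "m \<in> Arr V" "Cod V m = Dom V g" and j: "j \<in> eobj M \<times> eobj M \<times> eobj M"
              and y: "y \<in> Arr V" "Dom V y = Dom V m" "Cod V y = (case j of (a, b, c) \<Rightarrow> Si_pairs V M a b c)"
              and gm: "g \<cdot> m = (case j of (a, b, c) \<Rightarrow> inj2 M a b c) \<cdot> y"
            obtain a1 b1 c1 where j': "j = (a1, b1, c1)" "a1 \<in> eobj M" "b1 \<in> eobj M" "c1 \<in> eobj M"
              using j by auto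
            have y': "Cod V y = Si_pairs V M a1 b1 c1" and gm': "g \<cdot> m = inj2 M a1 b1 c1 \<cdot> y"
              using y gm j' by simp_all
            have t: "w \<cdot> l \<in> Arr V" "Dom V (w \<cdot> l) = Dom V l" "Cod V (w \<cdot> l) = Si_hom V M b c"
              using w w' l by simp_all
            have "inj1 V M b1 c1 \<cdot> Si_pi1 V M a1 b1 c1 \<cdot> y = ipr1 S \<cdot> g \<cdot> m"
              unfolding gm' using comp_extend[OF inj(3)[OF j'(2-4)], of y] y y' j' ty M E by simp
            also have "\<dots> = inj1 V M b c \<cdot> (w \<cdot> l) \<cdot> m"
              using comp_extend[OF g(4), of m] g m ty t bc M E by simp
            finally have 1: "inj1 V M b1 c1 \<cdot> Si_pi1 V M a1 b1 c1 \<cdot> y = inj1 V M b c \<cdot> (w \<cdot> l) \<cdot> m" .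
            have "inj1 V M a1 b1 \<cdot> Si_pi2 V M a1 b1 c1 \<cdot> y = ipr2 S \<cdot> g \<cdot> m"
              unfolding gm' using comp_extend[OF inj(4)[OF j'(2-4)], of y] y y' j' ty M E by simp
            also have "\<dots> = inj1 V M a b \<cdot> x \<cdot> m"
              using comp_extend[OF g(5), of m] g m ty x x' True ab bc M E by simp
            finally have 2: "inj1 V M a1 b1 \<cdot> Si_pi2 V M a1 b1 c1 \<cdot> y = inj1 V M a b \<cdot> x \<cdot> m" .
            \<comment> \<open>The first leg determines the last two indices and the second leg the
              first two. Together they determine the summand of \<open>g\<close>, unless the stage
              is initial.\<close>
            have 3: "if (b1, c1) = (b, c) then Si_pi1 V M a1 b1 c1 \<cdot> y = (w \<cdot> l) \<cdot> m else initial (Dom V m)"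
              by (rule coproduct_inj_eq[OF c1 sml(1)]) (use 1 y y' j' E t m g bc in simp_all)
            have 4: "if (a1, b1) = (a, b) then Si_pi2 V M a1 b1 c1 \<cdot> y = x \<cdot> m else initial (Dom V m)"
              by (rule coproduct_inj_eq[OF c1 sml(1)]) (use 2 y y' j' E x x' True m g ab bc in simp_all)
            have gh: "(inj2 M a b c \<cdot> h) \<cdot> m = inj2 M a b c \<cdot> h \<cdot> m"
              using h x m g M ab bc by simp
            show "g \<cdot> m = (inj2 M a b c \<cdot> h) \<cdot> m"
            proof (cases "(a1, b1, c1) = (a, b, c)")
              case True': True
              have "y = h \<cdot> m"
                by (rule pullback_eqI[OF pb])
                  (use True' 3 4 y y' h x m g t E ab bc True comp_extend[OF h(4), of m] comp_extend[OF h(5), of m] in simp_all)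
              then show ?thesis using gm' True' gh by simp
            next
              case False
              then have "initial (Dom V m)" using 3 4 by (auto split: if_splits)
              then show ?thesis by (rule initial_eq) (use g m h x M E ab bc in simp_all)
            qed
          qed (use g h x M E ab bc in simp_all)
        qed
      qed
    qed (use ty u v k in simp_all)
  qed (use ty u v in simp_all)
qed

text \<open>\<open>cmp_typing\<close> and \<open>cmp_comp\<close> presuppose an internal category.
  This version rests on the pullback and the types of the structure arrows, so it serves while the
  laws of \<open>Si_icat\<close> are still being established.\<close>

lemma pullback_cmp:
  assumes pb: "is_pullback V (d0 A) (d1 A) (A2 A) (ipr1 A) (ipr2 A)"
    and A: "d0 A \<in> hom V (A1 A) (A0 A)" "d1 A \<in> hom V (A1 A) (A0 A)" "icomp A \<in> hom V (A2 A) (A1 A)"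
    and t: "u \<in> Arr V" "v \<in> Arr V" "Dom V u = Dom V v" "Cod V u = A1 A" "Cod V v = A1 A"
    "d0 A \<cdot> u = d1 A \<cdot> v"
  obtains h where "h \<in> hom V (Dom V v) (A2 A)" "ipr1 A \<cdot> h = u" "ipr2 A \<cdot> h = v" "cmp V A u v = icomp A \<cdot> h"
    "\<And>k. k \<in> Arr V \<Longrightarrow> Cod V k = Dom V v \<Longrightarrow> cmp V A (u \<cdot> k) (v \<cdot> k) = cmp V A u v \<cdot> k"
proof -
  have pr: "ipr1 A \<in> Arr V" "Dom V (ipr1 A) = A2 A" "ipr2 A \<in> Arr V" "Dom V (ipr2 A) = A2 A"
    "Cod V (ipr1 A) = A1 A" "Cod V (ipr2 A) = A1 A"
    using pb A unfolding is_pullback_def by auto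
  have d: "d0 A \<in> Arr V" "d1 A \<in> Arr V" using A by auto
  obtain h where h: "h \<in> Arr V" "Dom V h = Dom V v" "Cod V h = A2 A" "ipr1 A \<cdot> h = u" "ipr2 A \<cdot> h = v"
    by (rule pullback_lift[OF pb, of u v]) (use A t in auto)
  have e: "cmp V A u v = icomp A \<cdot> h" unfolding cmp_def using ipair_eqI[OF pb d h(1,3,4,5)] by simp
  show thesis
  proof (rule that[OF _ h(4,5) e])
    show "h \<in> hom V (Dom V v) (A2 A)" using h by simp
    fix k assume k: "k \<in> Arr V" "Cod V k = Dom V v"
    have "ipr1 A \<cdot> h \<cdot> k = u \<cdot> k" "ipr2 A \<cdot> h \<cdot> k = v \<cdot> k"
      using comp_extend[OF h(4)] comp_extend[OF h(5)] h pr k by simp_all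
    from ipair_eqI[OF pb d _ _ this] have "ipair V A (u \<cdot> k) (v \<cdot> k) = h \<cdot> k"
      using h k by simp
    then show "cmp V A (u \<cdot> k) (v \<cdot> k) = cmp V A u v \<cdot> k"
      unfolding e cmp_def[of V A "u \<cdot> k"] using h A k by simp
  qed
qed

section \<open>Elements of the object of arrows and their composition\<close>

definition el :: "('o, 'a) ecat \<Rightarrow> 'a \<Rightarrow> 'a \<Rightarrow> 'a \<Rightarrow> 'a \<Rightarrow> 'a \<Rightarrow> 'a" where
  "el M a b p x q = inj1 V M a b \<cdot> mk M a b p x q"

lemma el_props [simp]:
  assumes M: "small_ecat M" and t: "trip M a b p x q"
  shows "el M a b p x q \<in> Arr V" "Dom V (el M a b p x q) = Dom V q" "Cod V (el M a b p x q) = Si1 V M"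
    "d0 (Si_icat V M) \<cdot> el M a b p x q = inj0 V M a \<cdot> q" "d1 (Si_icat V M) \<cdot> el M a b p x q = inj0 V M b \<cdot> p"
    "k \<in> Arr V \<Longrightarrow> Cod V k = Dom V q \<Longrightarrow> el M a b p x q \<cdot> k = el M a b (p \<cdot> k) (x \<cdot> k) (q \<cdot> k)"
proof -
  note E = small_ecatD(1)[OF M] and ab = tripD(1,2)[OF t] and d = tripD(3-10)[OF t]
  note m = mk_props[OF E t] and S = Si_icat_typing[OF M]
  show ty: "el M a b p x q \<in> Arr V" "Dom V (el M a b p x q) = Dom V q" "Cod V (el M a b p x q) = Si1 V M"
    unfolding el_def using M ab m by simp_all
  have "d0 (Si_icat V M) \<cdot> inj1 V M a b \<cdot> mk M a b p x q = (inj0 V M a \<cdot> ah3 V M a b) \<cdot> mk M a b p x q"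
    "d1 (Si_icat V M) \<cdot> inj1 V M a b \<cdot> mk M a b p x q = (inj0 V M b \<cdot> ah1 V M a b) \<cdot> mk M a b p x q"
    by (rule comp_extend[OF Si_icat_inj(1)[OF M ab]]; use M E ab m S in simp)
      (rule comp_extend[OF Si_icat_inj(2)[OF M ab]]; use M E ab m S in simp)
  then show "d0 (Si_icat V M) \<cdot> el M a b p x q = inj0 V M a \<cdot> q" "d1 (Si_icat V M) \<cdot> el M a b p x q = inj0 V M b \<cdot> p"
    unfolding el_def using M E ab m by simp_all
  show "k \<in> Arr V \<Longrightarrow> Cod V k = Dom V q \<Longrightarrow> el M a b p x q \<cdot> k = el M a b (p \<cdot> k) (x \<cdot> k) (q \<cdot> k)"
    unfolding el_def using M E ab m mk_comp[OF E t] by simp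
qed

lemma el_inject:
  assumes M: "small_ecat M" and t: "trip M a b p x q" "trip M a b p' x' q'" "Dom V q = Dom V q'"
    and eq: "el M a b p x q = el M a b p' x' q'"
  shows "p = p'" "x = x'" "q = q'"
proof -
  note E = small_ecatD(1)[OF M] and ab = tripD(1,2)[OF t(1)]
  note m = mk_props[OF E t(1)] and m' = mk_props[OF E t(2)]
  have "mk M a b p x q = mk M a b p' x' q'"
    by (rule coproduct_inj_cancel[OF Si_coproducts(2)[OF M] Si_coproducts(4)[OF M], of "(a, b)"])
      (use eq ab m m' t(3) in \<open>simp_all add: el_def\<close>)
  then show "p = p'" "x = x'" "q = q'" using m m' by metis+
qed

text \<open>Every element of \<open>Si1\<close> is locally a triple. Taking \<open>u\<close> to be
  the identity of \<open>Si1\<close>, the generic element, checks an equation between arrows out of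
  \<open>Si1\<close> on all triples.\<close>

lemma el_cases:
  assumes M: "small_ecat M" and u: "u \<in> Arr V" "Cod V u = Si1 V M"
    and LR: "L \<in> Arr V" "R \<in> Arr V" "Dom V L = Dom V u" "Dom V R = Dom V u" "Cod V L = Cod V R"
    and local: "\<And>k a b p x q. k \<in> Arr V \<Longrightarrow> Cod V k = Dom V u \<Longrightarrow> trip M a b p x q \<Longrightarrow> Dom V k = Dom V q \<Longrightarrow>
       u \<cdot> k = el M a b p x q \<Longrightarrow> L \<cdot> k = R \<cdot> k"
  shows "L = R"
proof (rule coproduct_local_eqI[OF Si_coproducts(2)[OF M] Si_coproducts(4)[OF M] u LR])
  note E = small_ecatD(1)[OF M]
  fix k i w assume k: "k \<in> Arr V" "Cod V k = Dom V u" and i: "i \<in> eobj M \<times> eobj M"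
    and w: "w \<in> Arr V" "Dom V w = Dom V k" "Cod V w = (case i of (a, b) \<Rightarrow> Si_hom V M a b)"
    and uk: "u \<cdot> k = (case i of (a, b) \<Rightarrow> inj1 V M a b) \<cdot> w"
  obtain a b where ab: "i = (a, b)" "a \<in> eobj M" "b \<in> eobj M" using i by auto
  have w': "Cod V w = Si_hom V M a b" using w ab by simp
  note e = mk_eta[OF E ab(2,3) w(1) w']
  show "L \<cdot> k = R \<cdot> k"
    by (rule local[OF k e(1)]) (use E ab w w' uk e(2) in \<open>simp_all add: el_def\<close>)
qed

lemma inj0_cases:
  assumes M: "small_ecat M" and u: "u \<in> Arr V" "Cod V u = Si0 V M"
    and LR: "L \<in> Arr V" "R \<in> Arr V" "Dom V L = Dom V u" "Dom V R = Dom V u" "Cod V L = Cod V R"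
    and local: "\<And>k a q. k \<in> Arr V \<Longrightarrow> Cod V k = Dom V u \<Longrightarrow> a \<in> eobj M \<Longrightarrow> q \<in> Arr V \<Longrightarrow> Dom V q = Dom V k \<Longrightarrow>
      Cod V q = idems V M a \<Longrightarrow> u \<cdot> k = inj0 V M a \<cdot> q \<Longrightarrow> L \<cdot> k = R \<cdot> k"
  shows "L = R"
  by (rule coproduct_local_eqI[OF Si_coproducts(1)[OF M] small_ecatD(2)[OF M] u LR]) (use local in blast)

text \<open>In the idempotent completion the identity of the object \<open>q\<close> is the
  idempotent \<open>q\<close> itself and not the identity of \<open>a\<close>.\<close>

lemma Si_iident_inj0 [simp]:
  assumes M: "small_ecat M" and a: "a \<in> eobj M" and q: "q \<in> Arr V" "Cod V q = idems V M a"
  shows "iident (Si_icat V M) \<cdot> inj0 V M a \<cdot> q = el M a a q (eps V M a \<cdot> q) q"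
proof -
  note E = small_ecatD(1)[OF M] and i = Si_ident_eq[OF small_ecatD(1)[OF M] a]
  have "iident (Si_icat V M) \<cdot> inj0 V M a \<cdot> q = (inj1 V M a a \<cdot> Si_ident V M a) \<cdot> q"
    by (rule comp_extend[OF Si_icat_inj(5)[OF M a]]) (use M E a q Si_icat_typing[OF M] in simp_all)
  also have "\<dots> = el M a a q (eps V M a \<cdot> q) q"
    unfolding el_def i(1) using M E a q mk_props[OF E i(2)] mk_comp[OF E i(2)] by simp
  finally show ?thesis .
qed

text \<open>Because the middle idempotents coincide, the pair lifts to the single summand
  \<open>abc\<close> of \<open>Si2\<close>, on which the composition is
  \<open>Si_comp\<close>.\<close>

lemma el_cmp [simp]:
  assumes M: "small_ecat M" and t: "trip M b c p x q" "trip M a b q y r"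
  shows "cmp V (Si_icat V M) (el M b c p x q) (el M a b q y r) = el M a c p (ec M a b c x y) r"
proof -
  let ?S = "Si_icat V M"
  note E = small_ecatD(1)[OF M] and d = tripD(1-10)[OF t(1)] tripD(1-10)[OF t(2)]
  have abc: "a \<in> eobj M" "b \<in> eobj M" "c \<in> eobj M" using d by blast+
  note m1 = mk_props[OF E t(1)] and m2 = mk_props[OF E t(2)] and ty = Si_icat_typing[OF M]
  note tc = trip_comp[OF E t d(19)]
  obtain h where h: "h \<in> Arr V" "Dom V h = Dom V (mk M a b q y r)" "Cod V h = Si_pairs V M a b c"
    "Si_pi1 V M a b c \<cdot> h = mk M b c p x q" "Si_pi2 V M a b c \<cdot> h = mk M a b q y r"
    by (rule pullback_lift[OF Si_pairs_pullback[OF E abc], of "mk M b c p x q" "mk M a b q y r"])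
      (use E abc m1 m2 d in auto)
  have "ipr1 ?S \<cdot> inj2 M a b c \<cdot> h = (inj1 V M b c \<cdot> Si_pi1 V M a b c) \<cdot> h"
    by (rule comp_extend[OF Si_icat_inj(3)[OF M abc]]) (use M abc h ty in simp_all)
  then have p1: "ipr1 ?S \<cdot> inj2 M a b c \<cdot> h = el M b c p x q" using M E abc h by (simp add: el_def)
  have "ipr2 ?S \<cdot> inj2 M a b c \<cdot> h = (inj1 V M a b \<cdot> Si_pi2 V M a b c) \<cdot> h"
    by (rule comp_extend[OF Si_icat_inj(4)[OF M abc]]) (use M abc h ty in simp_all)
  then have p2: "ipr2 ?S \<cdot> inj2 M a b c \<cdot> h = el M a b q y r" using M E abc h by (simp add: el_def)
  have "ipair V ?S (el M b c p x q) (el M a b q y r) = inj2 M a b c \<cdot> h"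
    by (rule ipair_eqI) (use Si_icat_pullback[OF M] M abc h ty p1 p2 in simp_all)
  then have "cmp V ?S (el M b c p x q) (el M a b q y r) = icomp ?S \<cdot> inj2 M a b c \<cdot> h"
    by (simp add: cmp_def)
  also have "\<dots> = (inj1 V M a c \<cdot> Si_comp V M a b c) \<cdot> h"
    by (rule comp_extend[OF Si_icat_inj(6)[OF M abc]]) (use M abc h ty in simp_all)
  also have "\<dots> = inj1 V M a c \<cdot> Si_comp V M a b c \<cdot> h"
    unfolding Si_comp_eq(1)[OF E abc]
    by (rule assoc_C) (use M E abc h mk_props[OF E Si_comp_eq(2)[OF E abc]] in simp_all)
  also have "Si_comp V M a b c \<cdot> h = mk M a c p (ec M a b c x y) r"
  proof -
    have e: "(ah1 V M b c \<cdot> Si_pi1 V M a b c) \<cdot> h = p" "(ah2 V M b c \<cdot> Si_pi1 V M a b c) \<cdot> h = x"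
      "(ah2 V M a b \<cdot> Si_pi2 V M a b c) \<cdot> h = y" "(ah3 V M a b \<cdot> Si_pi2 V M a b c) \<cdot> h = r"
      using h E abc m1 m2 by simp_all
    have "ec M a b c (ah2 V M b c \<cdot> Si_pi1 V M a b c) (ah2 V M a b \<cdot> Si_pi2 V M a b c) \<cdot> h =
      ec M a b c ((ah2 V M b c \<cdot> Si_pi1 V M a b c) \<cdot> h) ((ah2 V M a b \<cdot> Si_pi2 V M a b c) \<cdot> h)"
      by (rule ec_comp) (use h E abc in simp_all)
    then show ?thesis
      unfolding Si_comp_eq(1)[OF E abc]
      using mk_comp[OF E Si_comp_eq(2)[OF E abc] h(1)] h(2,3) E abc e by (simp del: assoc_C)
  qed
  finally show ?thesis by (simp add: el_def)
qed

text \<open>First \<open>u\<close> is made a triple, then \<open>v\<close> over each piece.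
  Composability, read in \<open>Si0\<close>, gives both triples the same middle object and the same
  middle idempotent, or leaves an initial stage.\<close>

lemma Si_composable_cases:
  assumes M: "small_ecat M" and uv: "u \<in> Arr V" "Cod V u = Si1 V M" "v \<in> Arr V" "Cod V v = Si1 V M" "Dom V u = Dom V v"
    "d0 (Si_icat V M) \<cdot> u = d1 (Si_icat V M) \<cdot> v"
    and LR: "L \<in> Arr V" "R \<in> Arr V" "Dom V L = Dom V v" "Dom V R = Dom V v" "Cod V L = Cod V R"
    and local: "\<And>k a b c p x q y r. k \<in> Arr V \<Longrightarrow> Cod V k = Dom V v \<Longrightarrow> trip M b c p x q \<Longrightarrow> trip M a b q y r \<Longrightarrow>
       Dom V k = Dom V r \<Longrightarrow> u \<cdot> k = el M b c p x q \<Longrightarrow> v \<cdot> k = el M a b q y r \<Longrightarrow> L \<cdot> k = R \<cdot> k"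
  shows "L = R"
proof (rule el_cases[OF M uv(1,2)])
  note E = small_ecatD(1)[OF M] and ty = Si_icat_typing[OF M]
  fix k b c p x q assume k: "k \<in> Arr V" "Cod V k = Dom V u" and t: "trip M b c p x q" "Dom V k = Dom V q"
    and uk: "u \<cdot> k = el M b c p x q"
  note d = tripD(1-10)[OF t(1)]
  show "L \<cdot> k = R \<cdot> k"
  proof (rule el_cases[OF M, of "v \<cdot> k"])
    fix l a b' p' y r assume l: "l \<in> Arr V" "Cod V l = Dom V (v \<cdot> k)" and t': "trip M a b' p' y r" "Dom V l = Dom V r"
      and vk: "(v \<cdot> k) \<cdot> l = el M a b' p' y r"
    note d' = tripD(1-10)[OF t'(1)]
    have l': "Cod V l = Dom V q" using l k t uv by simp
    have uv': "d0 (Si_icat V M) \<cdot> u \<cdot> k \<cdot> l = d1 (Si_icat V M) \<cdot> v \<cdot> k \<cdot> l"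
      using comp_extend[OF uv(6), of "k \<cdot> l"] ty uv k l by simp
    have ukl: "u \<cdot> k \<cdot> l = el M b c (p \<cdot> l) (x \<cdot> l) (q \<cdot> l)"
      using comp_extend[OF uk, of l] k l l' uv M t by simp
    have vkl: "v \<cdot> k \<cdot> l = el M a b' p' y r" using vk k l uv by simp
    have tl: "trip M b c (p \<cdot> l) (x \<cdot> l) (q \<cdot> l)" using E t l l' by simp
    have "inj0 V M b \<cdot> q \<cdot> l = inj0 V M b' \<cdot> p'"
      using uv' M t'(1) tl unfolding ukl vkl by simp
    from inj0_eq[OF M d(1) d'(2) this]
    have cases: "if b = b' then q \<cdot> l = p' else initial (Dom V l)"
      using d d' l l' t' by (simp split: if_splits)
    show "(L \<cdot> k) \<cdot> l = (R \<cdot> k) \<cdot> l"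
    proof (cases "b = b'")
      case True
      then have "L \<cdot> k \<cdot> l = R \<cdot> k \<cdot> l"
        using local[of "k \<cdot> l" b c "p \<cdot> l" "x \<cdot> l" "q \<cdot> l" a y r] cases tl t' ukl vkl k l uv by simp
      then show ?thesis using k l LR uv by simp
    next
      case False
      with cases have "initial (Dom V l)" by simp
      then show ?thesis by (rule initial_eq) (use k l LR uv in simp_all)
    qed
  qed (use k LR uv in simp_all)
qed (use LR uv in simp_all)

text \<open>Each law is tested on triples, where it reduces to the laws of \<open>M\<close> together
  with the absorption laws of a triple.\<close>

lemma Si_internal:
  assumes M: "small_ecat M"
  shows "internal_category V (Si_icat V M)"
proof -
  let ?S = "Si_icat V M"
  note E = small_ecatD(1)[OF M] and ty = Si_icat_typing[OF M] and pb = Si_icat_pullback[OF M] and o = Si_obj_typing[OF M]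
  have pb': "is_pullback V (d0 ?S) (d1 ?S) (A2 ?S) (ipr1 ?S) (ipr2 ?S)" using pb by simp
  have di: "d0 ?S \<cdot> iident ?S = Ident V (Si0 V M)" "d1 ?S \<cdot> iident ?S = Ident V (Si0 V M)"
  proof -
    \<comment> \<open>The generic element of \<open>Si0\<close>: its restriction along
      \<open>k\<close> is \<open>k\<close>, so the case rule makes \<open>k\<close> an indexed
      idempotent.\<close>
    let ?i = "Ident V (Si0 V M)"
    have *: "(d0 ?S \<cdot> iident ?S) \<cdot> k = ?i \<cdot> k" "(d1 ?S \<cdot> iident ?S) \<cdot> k = ?i \<cdot> k"
      if "k \<in> Arr V" "Cod V k = Dom V ?i" "a \<in> eobj M" "q \<in> Arr V" "Dom V q = Dom V k" "Cod V q = idems V M a"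
        "?i \<cdot> k = inj0 V M a \<cdot> q" for k a q
      using that ty o M E trip_eps[OF E that(3,4,6)] by simp_all
    show "d0 ?S \<cdot> iident ?S = ?i"
      by (rule inj0_cases[OF M, of ?i]; (rule *(1))?; use ty o in simp)
    show "d1 ?S \<cdot> iident ?S = ?i"
      by (rule inj0_cases[OF M, of ?i]; (rule *(2))?; use ty o in simp)
  qed
  have dc: "d0 ?S \<cdot> icomp ?S = d0 ?S \<cdot> ipr2 ?S" "d1 ?S \<cdot> icomp ?S = d1 ?S \<cdot> ipr1 ?S"
  proof -
    have "(d0 ?S \<cdot> icomp ?S) \<cdot> inj2 M a b c = (d0 ?S \<cdot> ipr2 ?S) \<cdot> inj2 M a b c"
      "(d1 ?S \<cdot> icomp ?S) \<cdot> inj2 M a b c = (d1 ?S \<cdot> ipr1 ?S) \<cdot> inj2 M a b c"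
      if abc: "a \<in> eobj M" "b \<in> eobj M" "c \<in> eobj M" for a b c
    proof -
      note C = mk_props[OF E Si_comp_eq(2)[OF E abc], folded Si_comp_eq(1)[OF E abc]]
      note inj = Si_icat_inj[OF M]
      have C': "Dom V (Si_comp V M a b c) = Si_pairs V M a b c" using C E abc by simp
      have "d0 ?S \<cdot> inj1 V M a c \<cdot> Si_comp V M a b c = inj0 V M a \<cdot> ah3 V M a b \<cdot> Si_pi2 V M a b c"
        "d1 ?S \<cdot> inj1 V M a c \<cdot> Si_comp V M a b c = inj0 V M c \<cdot> ah1 V M b c \<cdot> Si_pi1 V M a b c"
        "d0 ?S \<cdot> inj1 V M a b \<cdot> Si_pi2 V M a b c = inj0 V M a \<cdot> ah3 V M a b \<cdot> Si_pi2 V M a b c"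
        "d1 ?S \<cdot> inj1 V M b c \<cdot> Si_pi1 V M a b c = inj0 V M c \<cdot> ah1 V M b c \<cdot> Si_pi1 V M a b c"
        using comp_extend[OF inj(1)[OF abc(1,3)], of "Si_comp V M a b c"]
          comp_extend[OF inj(2)[OF abc(1,3)], of "Si_comp V M a b c"]
          comp_extend[OF inj(1)[OF abc(1,2)], of "Si_pi2 V M a b c"]
          comp_extend[OF inj(2)[OF abc(2,3)], of "Si_pi1 V M a b c"] C C' ty M E abc by simp_all
      then show "(d0 ?S \<cdot> icomp ?S) \<cdot> inj2 M a b c = (d0 ?S \<cdot> ipr2 ?S) \<cdot> inj2 M a b c"
        "(d1 ?S \<cdot> icomp ?S) \<cdot> inj2 M a b c = (d1 ?S \<cdot> ipr1 ?S) \<cdot> inj2 M a b c"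
        using inj ty M E abc by simp_all
    qed
    note * = this
    show "d0 ?S \<cdot> icomp ?S = d0 ?S \<cdot> ipr2 ?S"
      by (rule coproduct_eqI[OF Si_coproducts(3)[OF M]]; (elim SigmaE; hypsubst; unfold prod.case; rule *(1))?; use ty in simp)
    show "d1 ?S \<cdot> icomp ?S = d1 ?S \<cdot> ipr1 ?S"
      by (rule coproduct_eqI[OF Si_coproducts(3)[OF M]]; (elim SigmaE; hypsubst; unfold prod.case; rule *(2))?; use ty in simp)
  qed
  have S: "d0 ?S \<in> hom V (A1 ?S) (A0 ?S)" "d1 ?S \<in> hom V (A1 ?S) (A0 ?S)" "icomp ?S \<in> hom V (A2 ?S) (A1 ?S)"
    using ty by simp_all
  have cmp: "cmp V ?S u v \<in> Arr V \<and> Dom V (cmp V ?S u v) = Dom V v \<and> Cod V (cmp V ?S u v) = Si1 V M \<and>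
      d0 ?S \<cdot> cmp V ?S u v = d0 ?S \<cdot> v \<and> d1 ?S \<cdot> cmp V ?S u v = d1 ?S \<cdot> u \<and>
      (\<forall>k. k \<in> Arr V \<longrightarrow> Cod V k = Dom V v \<longrightarrow> cmp V ?S u v \<cdot> k = cmp V ?S (u \<cdot> k) (v \<cdot> k))"
    if t: "u \<in> Arr V" "v \<in> Arr V" "Dom V u = Dom V v" "Cod V u = Si1 V M" "Cod V v = Si1 V M"
      "d0 ?S \<cdot> u = d1 ?S \<cdot> v" for u v
  proof -
    obtain h where h: "h \<in> hom V (Dom V v) (A2 ?S)" "ipr1 ?S \<cdot> h = u" "ipr2 ?S \<cdot> h = v" "cmp V ?S u v = icomp ?S \<cdot> h"
      "\<And>k. k \<in> Arr V \<Longrightarrow> Cod V k = Dom V v \<Longrightarrow> cmp V ?S (u \<cdot> k) (v \<cdot> k) = cmp V ?S u v \<cdot> k"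
      by (rule pullback_cmp[OF pb' S, of u v]) (use t in auto)
    have "d0 ?S \<cdot> icomp ?S \<cdot> h = d0 ?S \<cdot> v" "d1 ?S \<cdot> icomp ?S \<cdot> h = d1 ?S \<cdot> u"
      using comp_extend[OF dc(1), of h] comp_extend[OF dc(2), of h] h(1-3) ty by simp_all
    then show ?thesis using h ty by auto
  qed
  have id: "cmp V ?S (iident ?S \<cdot> d1 ?S) (Ident V (Si1 V M)) = Ident V (Si1 V M)"
    "cmp V ?S (Ident V (Si1 V M)) (iident ?S \<cdot> d0 ?S) = Ident V (Si1 V M)"
  proof -
    let ?i = "Ident V (Si1 V M)"
    have c1: "d0 ?S \<cdot> iident ?S \<cdot> d1 ?S = d1 ?S \<cdot> ?i" and c2: "d0 ?S \<cdot> ?i = d1 ?S \<cdot> iident ?S \<cdot> d0 ?S"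
      using comp_extend[OF di(1), of "d1 ?S"] comp_extend[OF di(2), of "d0 ?S"] ty by simp_all
    note k1 = cmp[of "iident ?S \<cdot> d1 ?S" ?i] and k2 = cmp[of ?i "iident ?S \<cdot> d0 ?S"]
    have *: "cmp V ?S (iident ?S \<cdot> d1 ?S) ?i \<cdot> k = ?i \<cdot> k" "cmp V ?S ?i (iident ?S \<cdot> d0 ?S) \<cdot> k = ?i \<cdot> k"
      if k: "k \<in> Arr V" "Cod V k = Dom V ?i" "trip M a b p x q" "Dom V k = Dom V q" "?i \<cdot> k = el M a b p x q"
      for k a b p x q
    proof -
      note d = tripD[OF k(3)]
      have k': "k = el M a b p x q" using k o by simp
      show "cmp V ?S (iident ?S \<cdot> d1 ?S) ?i \<cdot> k = ?i \<cdot> k" "cmp V ?S ?i (iident ?S \<cdot> d0 ?S) \<cdot> k = ?i \<cdot> k"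
        using k1 k2 c1 c2 ty o k k' d M trip_eps[OF E d(1,5,6)] trip_eps[OF E d(2,3,4)] by simp_all
    qed
    show "cmp V ?S (iident ?S \<cdot> d1 ?S) ?i = ?i"
      by (rule el_cases[OF M, of ?i]; (rule *(1))?; use k1 c1 ty o in simp)
    show "cmp V ?S ?i (iident ?S \<cdot> d0 ?S) = ?i"
      by (rule el_cases[OF M, of ?i]; (rule *(2))?; use k2 c2 ty o in simp)
  qed
  have assoc: "cmp V ?S u (cmp V ?S v w) = cmp V ?S (cmp V ?S u v) w"
    if t: "u \<in> Arr V" "v \<in> Arr V" "w \<in> Arr V" "Dom V u = Dom V w" "Dom V v = Dom V w"
      "Cod V u = Si1 V M" "Cod V v = Si1 V M" "Cod V w = Si1 V M"
      "d0 ?S \<cdot> u = d1 ?S \<cdot> v" "d0 ?S \<cdot> v = d1 ?S \<cdot> w" for u v w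
  proof -
    have uv: "Dom V u = Dom V v" using t by simp
    note cuv = cmp[OF t(1,2) uv t(6,7,9)] and cvw = cmp[OF t(2,3,5,7,8,10)]
    have L: "d0 ?S \<cdot> u = d1 ?S \<cdot> cmp V ?S v w" and R: "d0 ?S \<cdot> cmp V ?S u v = d1 ?S \<cdot> w"
      using cuv cvw t by simp_all
    note cl = cmp[of u "cmp V ?S v w"] and cr = cmp[of "cmp V ?S u v" w]
    let ?L = "cmp V ?S u (cmp V ?S v w)" and ?R = "cmp V ?S (cmp V ?S u v) w"
    have LR: "?L \<in> Arr V" "?R \<in> Arr V" "Dom V ?L = Dom V w" "Dom V ?R = Dom V w" "Cod V ?L = Cod V ?R"
      using cl cr L R cuv cvw t by simp_all
    have dm: "Dom V u = Dom V v" "Dom V v = Dom V w" using t by simp_all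
    have pushL: "?L \<cdot> k = cmp V ?S (u \<cdot> k) (cmp V ?S (v \<cdot> k) (w \<cdot> k))"
      and pushR: "?R \<cdot> k = cmp V ?S (cmp V ?S (u \<cdot> k) (v \<cdot> k)) (w \<cdot> k)"
      if "k \<in> Arr V" "Cod V k = Dom V w" for k
      using cl cr L R cuv cvw t that by simp_all
    show ?thesis
    \<comment> \<open>The pair \<open>u\<close>, \<open>v\<close> is decomposed first and
      \<open>w\<close> over each of its pieces; whether \<open>v\<close> and \<open>w\<close> match
      is then settled by \<open>inj0_eq\<close>.\<close>
    proof (rule Si_composable_cases[OF M t(1,6,2,7) uv t(9)])
      fix k a b c p x q y r assume k: "k \<in> Arr V" "Cod V k = Dom V v" and tr: "trip M b c p x q" "trip M a b q y r"
        and dk: "Dom V k = Dom V r" and uk: "u \<cdot> k = el M b c p x q" and vk: "v \<cdot> k = el M a b q y r"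
      note d = tripD(1-10)[OF tr(1)] tripD(1-10)[OF tr(2)]
      show "?L \<cdot> k = ?R \<cdot> k"
      proof (rule el_cases[OF M, of "w \<cdot> k"])
        fix l e b' p' z s assume l: "l \<in> Arr V" "Cod V l = Dom V (w \<cdot> k)" and tr': "trip M e b' p' z s"
          and dl: "Dom V l = Dom V s" and wk: "(w \<cdot> k) \<cdot> l = el M e b' p' z s"
        note d' = tripD(1-10)[OF tr']
        have l': "Cod V l = Dom V r" using l k t dk by simp
        let ?k = "k \<cdot> l"
        have kl: "?k \<in> Arr V" "Cod V ?k = Dom V w" "Dom V ?k = Dom V s" using k l t dl by simp_all
        have ukl: "u \<cdot> ?k = el M b c (p \<cdot> l) (x \<cdot> l) (q \<cdot> l)"
          using comp_extend[OF uk, of l] k l l' t M tr d by simp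
        have vkl: "v \<cdot> ?k = el M a b (q \<cdot> l) (y \<cdot> l) (r \<cdot> l)"
          using comp_extend[OF vk, of l] k l l' t M tr d by simp
        have wkl: "w \<cdot> ?k = el M e b' p' z s" using wk k l t by simp
        have trl: "trip M b c (p \<cdot> l) (x \<cdot> l) (q \<cdot> l)" "trip M a b (q \<cdot> l) (y \<cdot> l) (r \<cdot> l)"
          using E tr l l' d by simp_all
        have "d0 ?S \<cdot> v \<cdot> ?k = d1 ?S \<cdot> w \<cdot> ?k"
          using comp_extend[OF t(10), of ?k] ty t kl by simp
        then have "inj0 V M a \<cdot> r \<cdot> l = inj0 V M b' \<cdot> p'"
          unfolding vkl wkl using M trl tr' by simp
        from inj0_eq[OF M d(11) d'(2) this]
        have cases: "if a = b' then r \<cdot> l = p' else initial (Dom V l)"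
          using d d' l l' dl by (simp split: if_splits)
        have "?L \<cdot> ?k = ?R \<cdot> ?k"
        proof (cases "a = b'")
          case True
          then have p': "p' = r \<cdot> l" using cases by simp
          have tz: "trip M e a (r \<cdot> l) z s" using tr' True p' by simp
          note d2 = tripD(1-10)[OF trl(1)] tripD(1-10)[OF trl(2)] tripD(1-10)[OF tz]
          \<comment> \<open>Both intermediate composites are triples again, so each bracketing
            evaluates to a single triple and the two differ by \<open>ec_assoc\<close>.\<close>
          have "trip M a c (p \<cdot> l) (ec M a b c (x \<cdot> l) (y \<cdot> l)) (r \<cdot> l)"
            "trip M e b (q \<cdot> l) (ec M e a b (y \<cdot> l) z) s"
            by (rule trip_comp[OF E trl d2(19)]) (rule trip_comp[OF E trl(2) tz d2(29)])
          then show ?thesis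
            unfolding pushL[OF kl(1,2)] pushR[OF kl(1,2)] ukl vkl wkl True[symmetric] p'
            using M E trl tz d2 by simp
        next
          case False
          with cases have "initial (Dom V l)" by simp
          then show ?thesis by (rule initial_eq) (use kl k l LR t in simp_all)
        qed
        then show "(?L \<cdot> k) \<cdot> l = (?R \<cdot> k) \<cdot> l" using k l LR t by simp
      qed (use k LR t in simp_all)
    qed (use LR t in simp_all)
  qed
  show ?thesis
    unfolding internal_category_def
  proof (intro conjI allI impI)
    fix X u v w assume *: "u \<in> hom V X (A1 ?S) \<and> v \<in> hom V X (A1 ?S) \<and> w \<in> hom V X (A1 ?S) \<and>
        d0 ?S \<cdot> u = d1 ?S \<cdot> v \<and> d0 ?S \<cdot> v = d1 ?S \<cdot> w"
    show "cmp V ?S u (cmp V ?S v w) = cmp V ?S (cmp V ?S u v) w"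
      by (rule assoc) (use * in simp_all)
  qed (use ty o pb' di dc id in simp_all)
qed

subsection \<open>The canonical split\<close>

lemma Si_obj_simps [simp]:
  "A0 (Si_obj V M) = Si0 V M" "A1 (Si_obj V M) = Si1 V M" "A2 (Si_obj V M) = Si2 V M"
  "d0 (Si_obj V M) = d0 (Si_icat V M)" "d1 (Si_obj V M) = d1 (Si_icat V M)"
  "ipr1 (Si_obj V M) = ipr1 (Si_icat V M)" "ipr2 (Si_obj V M) = ipr2 (Si_icat V M)"
  "iident (Si_obj V M) = iident (Si_icat V M)" "icomp (Si_obj V M) = icomp (Si_icat V M)"
  by (simp_all add: Si_obj_def icat.defs)

text \<open>These notions read fields of the underlying internal category only, so results about
  \<open>Si_icat\<close> carry over to \<open>Si_obj\<close>.\<close>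

lemma Si_obj_derived [simp]:
  "cmp V (Si_obj V M) = cmp V (Si_icat V M)" "EI V (Si_obj V M) = EI V (Si_icat V M)"
  "Idem V (Si_obj V M) = Idem V (Si_icat V M)" "star V (Si_obj V M) = star V (Si_icat V M)"
  "idem (Si_obj V M) = idem (Si_icat V M)"
proof -
  show *: "cmp V (Si_obj V M) = cmp V (Si_icat V M)"
    by (intro ext) (simp add: cmp_def ipair_def)
  show E: "EI V (Si_obj V M) = EI V (Si_icat V M)" "Idem V (Si_obj V M) = Idem V (Si_icat V M)"
    by (simp_all add: EI_def Idem_def Idem_incl_def End_incl_def *)
  show "star V (Si_obj V M) = star V (Si_icat V M)" by (intro ext) (simp add: star_def E)
  show "idem (Si_obj V M) = idem (Si_icat V M)" by (intro ext) (simp only: idem_def Si_obj_simps Si_icat_simps *)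
qed

lemma Si_obj_internal:
  assumes "small_ecat M"
  shows "internal_category V (Si_obj V M)"
  using Si_internal[OF assms] unfolding internal_category_def by simp

lemma el_idem:
  assumes "small_ecat M" "trip M a a p x p" "ec M a a a x x = x"
  shows "idem (Si_icat V M) (el M a a p x p)"
  using assms unfolding idem_def by simp

text \<open>For an idempotent element source and target agree; in \<open>Si0\<close> this means
  equal indices and equal idempotents, or an initial stage. Injectivity of \<open>el\<close> then
  turns idempotence of the element into idempotence of its middle component.\<close>

lemma Si_idem_cases:
  assumes M: "small_ecat M" and u: "idem (Si_icat V M) u"
    and LR: "L \<in> Arr V" "R \<in> Arr V" "Dom V L = Dom V u" "Dom V R = Dom V u" "Cod V L = Cod V R"
    and local: "\<And>k a p x. k \<in> Arr V \<Longrightarrow> Cod V k = Dom V u \<Longrightarrow> trip M a a p x p \<Longrightarrow> ec M a a a x x = x \<Longrightarrow>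
       Dom V k = Dom V p \<Longrightarrow> u \<cdot> k = el M a a p x p \<Longrightarrow> L \<cdot> k = R \<cdot> k"
  shows "L = R"
proof -
  let ?S = "Si_icat V M"
  note I = Si_internal[OF M] and E = small_ecatD(1)[OF M]
  have u': "u \<in> Arr V" "Cod V u = Si1 V M" using idemD[OF u] by simp_all
  show ?thesis
  proof (rule el_cases[OF M u' LR])
    fix k a b p x q assume k: "k \<in> Arr V" "Cod V k = Dom V u" and t: "trip M a b p x q"
      and dk: "Dom V k = Dom V q" and uk: "u \<cdot> k = el M a b p x q"
    note d = tripD(1-10)[OF t]
    have i: "idem ?S (el M a b p x q)" using idem_comp[OF I u k] uk by simp
    have "inj0 V M b \<cdot> p = inj0 V M a \<cdot> q" using idemD(3)[OF i] M t by simp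
    from inj0_eq[OF M d(2,1) this] have cases: "if b = a then p = q else initial (Dom V k)"
      using d dk by simp
    show "L \<cdot> k = R \<cdot> k"
    proof (cases "b = a")
      case True
      then have t': "trip M a a p x p" "q = p" using t cases by simp_all
      have "el M a a p (ec M a a a x x) p = el M a a p x p"
        using idemD(4)[OF i] True t' M by simp
      moreover have "trip M a a p (ec M a a a x x) p" by (rule trip_comp[OF E t'(1,1) refl])
      ultimately have "ec M a a a x x = x" using el_inject(2)[OF M _ t'(1) refl] by blast
      then show ?thesis using local[OF k t'(1)] dk uk True t' by simp
    next
      case False
      with cases have "initial (Dom V k)" by simp
      then show ?thesis by (rule initial_eq) (use k LR in simp_all)
    qed
  qed
qed

text \<open>Initial summands contribute nothing to a coproduct, so those off the diagonal may be
  dropped.\<close>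

lemma coproduct_diagonal:
  assumes c: "is_coproduct V (I \<times> I) x s j" and off: "\<And>a b. a \<in> I \<Longrightarrow> b \<in> I \<Longrightarrow> a \<noteq> b \<Longrightarrow> initial (x (a, b))"
  shows "is_coproduct V I (\<lambda>a. x (a, a)) s (\<lambda>a. j (a, a))"
proof (rule coproductI)
  note cD = coproductD[OF c]
  show "s \<in> Obj V" "\<And>a. a \<in> I \<Longrightarrow> j (a, a) \<in> hom V (x (a, a)) s" using cD by simp_all
  show "u = v" if uv: "u \<in> hom V s t" "v \<in> hom V s t" "\<And>a. a \<in> I \<Longrightarrow> u \<cdot> j (a, a) = v \<cdot> j (a, a)" for t u v
  proof (rule coproduct_eqI[OF c])
    fix i assume "i \<in> I \<times> I"
    then obtain a b where i: "i = (a, b)" "a \<in> I" "b \<in> I" by auto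
    show "u \<cdot> j i = v \<cdot> j i"
    proof (cases "a = b")
      case True
      then show ?thesis using uv(3) i by simp
    next
      case False
      then show ?thesis
        by (intro initial_eq[OF off[OF i(2,3) False]]) (use uv(1,2) cD i in simp_all)
    qed
  qed (use uv in auto)
  fix t f assume t: "t \<in> Obj V" and f: "\<And>a. a \<in> I \<Longrightarrow> f a \<in> hom V (x (a, a)) t"
  \<comment> \<open>Off the diagonal any arrow out of the initial summand will do; agreement with
    \<open>f\<close> is demanded on the diagonal alone.\<close>
  have "\<forall>i\<in>I \<times> I. \<exists>g. g \<in> hom V (x i) t \<and> (fst i = snd i \<longrightarrow> g = f (fst i))"
  proof
    fix i assume "i \<in> I \<times> I"
    then obtain a b where i: "i = (a, b)" "a \<in> I" "b \<in> I" by auto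
    show "\<exists>g. g \<in> hom V (x i) t \<and> (fst i = snd i \<longrightarrow> g = f (fst i))"
    proof (cases "a = b")
      case True
      then show ?thesis using f i by auto
    next
      case False
      then show ?thesis using initial_arrow[OF off[OF i(2,3) False] t] i by (metis fst_conv snd_conv in_hom)
    qed
  qed
  then obtain g where g: "\<forall>i\<in>I \<times> I. g i \<in> hom V (x i) t \<and> (fst i = snd i \<longrightarrow> g i = f (fst i))"
    by (rule bchoice[THEN exE])
  obtain h where h: "h \<in> Arr V" "Dom V h = s" "Cod V h = t" "\<forall>i\<in>I \<times> I. h \<cdot> j i = g i"
    by (rule coproduct_glue[OF c t, of g]) (use g in auto)
  then show "\<exists>h \<in> hom V s t. \<forall>a \<in> I. h \<cdot> j (a, a) = f a"
    using g by (intro bexI[of _ h]) auto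
qed

text \<open>The projection followed by \<open>EI\<close> is an idempotent element lying in the
  summand \<open>aa\<close>. Monicity of \<open>inj0\<close> identifies its source and target
  idempotents, and injectivity of \<open>el\<close> makes its middle idempotent: it is the generic
  triple \<open>(p, x, p)\<close> of this component.\<close>

lemma Idem_component:
  assumes M: "small_ecat M" and a: "a \<in> eobj M"
  defines "S \<equiv> Si_icat V M" and "P \<equiv> pbk V (EI V (Si_icat V M)) (inj1 V M a a)"
  defines "x \<equiv> ah2 V M a a \<cdot> Idem_comp V M a" and "p \<equiv> ah3 V M a a \<cdot> Idem_comp V M a"
  shows "is_pullback V (EI V S) (inj1 V M a a) P (Idem_inj V M a) (Idem_comp V M a)"
    "Idem_inj V M a \<in> Arr V" "Dom V (Idem_inj V M a) = P" "Cod V (Idem_inj V M a) = Idem V S"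
    "Idem_comp V M a \<in> Arr V" "Dom V (Idem_comp V M a) = P" "Cod V (Idem_comp V M a) = Si_hom V M a a"
    "trip M a a p x p" "ec M a a a x x = x" "Idem_comp V M a = mk M a a p x p"
    "EI V S \<cdot> Idem_inj V M a = el M a a p x p" "Dom V p = P"
proof -
  note E = small_ecatD(1)[OF M] and I = Si_internal[OF M, folded S_def]
  have t: "EI V S \<in> Arr V" "inj1 V M a a \<in> Arr V" "Cod V (EI V S) = Cod V (inj1 V M a a)"
    using I M a by (simp_all add: S_def)
  show ty: "Idem_inj V M a \<in> Arr V" "Dom V (Idem_inj V M a) = P" "Cod V (Idem_inj V M a) = Idem V S"
    "Idem_comp V M a \<in> Arr V" "Dom V (Idem_comp V M a) = P" "Cod V (Idem_comp V M a) = Si_hom V M a a"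
    using pbk_typing[OF t] I M a by (simp_all add: Idem_inj_def Idem_comp_def P_def S_def)
  show pb: "is_pullback V (EI V S) (inj1 V M a a) P (Idem_inj V M a) (Idem_comp V M a)"
    using pbk_is[OF t] unfolding S_def P_def Idem_inj_def Idem_comp_def .
  define p' where "p' = ah1 V M a a \<cdot> Idem_comp V M a"
  note m = mk_eta[OF E a a ty(4,6), folded x_def p_def p'_def]
  have e: "EI V S \<cdot> Idem_inj V M a = el M a a p' x p"
    unfolding el_def m(2) using pb unfolding is_pullback_def by blast
  have i: "idem S (el M a a p' x p)"
    unfolding e[symmetric] using idem_EI(1)[OF I ty(1,3)] .
  note d = tripD(1-10)[OF m(1)]
  have "inj0 V M a \<cdot> p' = inj0 V M a \<cdot> p"
    using idemD(3)[OF i] M m(1) unfolding S_def by simp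
  then have p': "p' = p" using inj0_eq[OF M a a] d by simp
  show tr: "trip M a a p x p" and "Idem_comp V M a = mk M a a p x p"
    and "EI V S \<cdot> Idem_inj V M a = el M a a p x p"
    using m e p' by simp_all
  show "Dom V p = P" unfolding p_def using ty E a by simp
  have "el M a a p (ec M a a a x x) p = el M a a p x p"
    using idemD(4)[OF i] p' tr M unfolding S_def by simp
  then show "ec M a a a x x = x"
    using el_inject(2)[OF M trip_comp[OF E tr tr refl] tr refl] by blast
qed

text \<open>Pull the coproduct \<open>Si1\<close> back along \<open>EI\<close>. Over a summand
  \<open>ab\<close> with distinct indices an idempotent would have its source indexed by
  \<open>a\<close> and its target by \<open>b\<close>, so that piece is initial and only the
  diagonal remains.\<close>

lemma Idem_coproduct:
  assumes M: "small_ecat M"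
  shows "is_coproduct V (eobj M) (\<lambda>a. pbk V (EI V (Si_icat V M)) (inj1 V M a a)) (Idem V (Si_icat V M)) (Idem_inj V M)"
proof -
  let ?E = "EI V (Si_icat V M)" let ?j = "\<lambda>(a, b). inj1 V M a b"
  note E = small_ecatD(1)[OF M] and I = Si_internal[OF M] and ty = Si_icat_typing[OF M]
  have c: "is_coproduct V (eobj M \<times> eobj M) (\<lambda>i. pbk V ?E (?j i)) (Idem V (Si_icat V M)) (\<lambda>i. pbk1 V ?E (?j i))"
    using coproduct_pullback[OF Si_coproducts(2)[OF M] Si_coproducts(4)[OF M], of ?E] I by simp
  have "initial (pbk V ?E (?j (a, b)))" if ab: "a \<in> eobj M" "b \<in> eobj M" "a \<noteq> b" for a b
  proof -
    have t: "?E \<in> Arr V" "inj1 V M a b \<in> Arr V" "Cod V ?E = Cod V (inj1 V M a b)" using I M ab by simp_all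
    let ?p = "pbk1 V ?E (inj1 V M a b)" and ?q = "pbk2 V ?E (inj1 V M a b)"
    note pt = pbk_typing[OF t] and sq = pbk_square[OF t]
    have "d0 (Si_icat V M) \<cdot> ?E \<cdot> ?p = d1 (Si_icat V M) \<cdot> ?E \<cdot> ?p"
      using idemD(3)[OF idem_EI(1)[OF I pt(2)]] pt I by simp
    then have "d0 (Si_icat V M) \<cdot> inj1 V M a b \<cdot> ?q = d1 (Si_icat V M) \<cdot> inj1 V M a b \<cdot> ?q"
      unfolding sq .
    then have "inj0 V M a \<cdot> ah3 V M a b \<cdot> ?q = inj0 V M b \<cdot> ah1 V M a b \<cdot> ?q"
      using comp_extend[OF Si_icat_inj(1)[OF M ab(1,2)], of ?q] comp_extend[OF Si_icat_inj(2)[OF M ab(1,2)], of ?q]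
        pt ty M E ab by simp
    from inj0_eq[OF M ab(1,2) this] show ?thesis
      using ab pt E M by simp
  qed
  from coproduct_diagonal[OF c this] show ?thesis
    by (simp add: Idem_inj_def[abs_def])
qed

text \<open>\<open>Ra\<close> and \<open>Sa\<close> are the retraction and section of
  \<open>trip_om\<close>, taken at the generic idempotent of the component.\<close>

lemma Ra_Sa_eq:
  assumes M: "small_ecat M" and a: "a \<in> eobj M"
  defines "x \<equiv> ah2 V M a a \<cdot> Idem_comp V M a" and "p \<equiv> ah3 V M a a \<cdot> Idem_comp V M a"
  shows "Ra V M a = mk M a a (om M a x) x p" "Sa V M a = mk M a a p x (om M a x)"
    "trip M a a (om M a x) x p" "trip M a a p x (om M a x)"
proof -
  note E = small_ecatD(1)[OF M]
  note c = Idem_component[OF M a, folded x_def p_def]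
  show t: "trip M a a (om M a x) x p" "trip M a a p x (om M a x)" by (rule trip_om[OF E c(8,9)])+
  have o: "omega V M a = om M a x" by (simp add: omega_def om_def x_def)
  have e: "eps V M a \<cdot> om M a x = x" using om_typing(4)[OF E a] c(9) tripD[OF c(8)] by simp
  show "Ra V M a = mk M a a (om M a x) x p"
    unfolding Ra_def o e mk_def p_def ..
  have "ah1 V M a a \<cdot> Idem_comp V M a = p" using c(10) mk_props(4)[OF E c(8)] by simp
  then show "Sa V M a = mk M a a p x (om M a x)"
    unfolding Sa_def o e mk_def by simp
qed

text \<open>The definite descriptions in \<open>Si_obj\<close> denote because the arrows
  \<open>Idem_inj\<close> form a coproduct cone on the object of idempotents.\<close>

lemma Si_split_arrows:
  assumes M: "small_ecat M"
  shows "spR (Si_obj V M) \<in> hom V (Idem V (Si_icat V M)) (Si1 V M)"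
    "spS (Si_obj V M) \<in> hom V (Idem V (Si_icat V M)) (Si1 V M)"
    "\<And>a. a \<in> eobj M \<Longrightarrow> spR (Si_obj V M) \<cdot> Idem_inj V M a = inj1 V M a a \<cdot> Ra V M a"
    "\<And>a. a \<in> eobj M \<Longrightarrow> spS (Si_obj V M) \<cdot> Idem_inj V M a = inj1 V M a a \<cdot> Sa V M a"
proof -
  let ?P = "\<lambda>f h. h \<in> hom V (Idem V (Si_icat V M)) (Si1 V M) \<and>
    (\<forall>a \<in> eobj M. h \<cdot> Idem_inj V M a = inj1 V M a a \<cdot> f a)"
  have E: "enriched_category V M" using M by simp
  have "\<exists>!h. ?P (Ra V M) h" "\<exists>!h. ?P (Sa V M) h"
  proof -
    have *: "inj1 V M a a \<cdot> Ra V M a \<in> hom V (pbk V (EI V (Si_icat V M)) (inj1 V M a a)) (Si1 V M)"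
      "inj1 V M a a \<cdot> Sa V M a \<in> hom V (pbk V (EI V (Si_icat V M)) (inj1 V M a a)) (Si1 V M)" if a: "a \<in> eobj M" for a
      using mk_props(1-3)[OF E Ra_Sa_eq(3)[OF M a]] mk_props(1-3)[OF E Ra_Sa_eq(4)[OF M a]]
        Idem_component(12)[OF M a] tripD(9)[OF Ra_Sa_eq(3)[OF M a]] M a
      unfolding Ra_Sa_eq(1,2)[OF M a] by simp_all
    show "\<exists>!h. ?P (Ra V M) h"
      by (rule coproduct_ex1[OF Idem_coproduct[OF M] Si_obj_typing(2)[OF M]]) (rule *(1))
    show "\<exists>!h. ?P (Sa V M) h"
      by (rule coproduct_ex1[OF Idem_coproduct[OF M] Si_obj_typing(2)[OF M]]) (rule *(2))
  qed
  from this[THEN theI']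
  have "?P (Ra V M) (spR (Si_obj V M))" "?P (Sa V M) (spS (Si_obj V M))"
    by (simp_all add: Si_obj_def icat.defs del: in_hom)
  then show "spR (Si_obj V M) \<in> hom V (Idem V (Si_icat V M)) (Si1 V M)"
    "spS (Si_obj V M) \<in> hom V (Idem V (Si_icat V M)) (Si1 V M)"
    "\<And>a. a \<in> eobj M \<Longrightarrow> spR (Si_obj V M) \<cdot> Idem_inj V M a = inj1 V M a a \<cdot> Ra V M a"
    "\<And>a. a \<in> eobj M \<Longrightarrow> spS (Si_obj V M) \<cdot> Idem_inj V M a = inj1 V M a a \<cdot> Sa V M a"
    by blast+
qed

lemma Si_split_el [simp]:
  assumes M: "small_ecat M" and t: "trip M a a p x p" and x: "ec M a a a x x = x"
  shows "Rt (Si_obj V M) (el M a a p x p) = el M a a (om M a x) x p"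
    "Sc (Si_obj V M) (el M a a p x p) = el M a a p x (om M a x)"
proof -
  let ?S = "Si_icat V M" let ?t = "star V ?S (el M a a p x p)"
  note E = small_ecatD(1)[OF M] and I = Si_internal[OF M] and d = tripD(1-10)[OF t]
  have a: "a \<in> eobj M" using d by blast
  let ?X = "ah2 V M a a \<cdot> Idem_comp V M a" and ?P = "ah3 V M a a \<cdot> Idem_comp V M a"
  note c = Idem_component[OF M a] and rs = Ra_Sa_eq[OF M a] and sp = Si_split_arrows[OF M] and m = mk_props[OF E t]
  note i = el_idem[OF M t x]
  have T: "?t \<in> Arr V" "Dom V ?t = Dom V p" "Cod V ?t = Idem V ?S" "EI V ?S \<cdot> ?t = el M a a p x p"
    using star_typing[OF I i] M t by simp_all
  \<comment> \<open>The idempotent lies in the summand \<open>aa\<close>, so its \<open>star\<close>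
    lifts through the component by some \<open>s\<close>; restricting the generic triple along
    \<open>s\<close> returns \<open>(p, x, p)\<close>.\<close>
  obtain s where s: "s \<in> Arr V" "Dom V s = Dom V (mk M a a p x p)"
    "Cod V s = pbk V (EI V ?S) (inj1 V M a a)" "Idem_inj V M a \<cdot> s = ?t" "Idem_comp V M a \<cdot> s = mk M a a p x p"
    by (rule pullback_lift[OF c(1), of ?t "mk M a a p x p"]) (use I M E a m T in \<open>simp_all add: el_def\<close>)
  have s': "Cod V s = Dom V ?P" using s(3) c(12) by simp
  have Xs: "?X \<cdot> s = x" "?P \<cdot> s = p" using s c(5-7) E a m by simp_all
  note X = tripD[OF c(8)]
  have "spR (Si_obj V M) \<cdot> Idem_inj V M a \<cdot> s = (inj1 V M a a \<cdot> Ra V M a) \<cdot> s"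
    by (rule comp_extend[OF sp(3)[OF a]]) (use sp(1) c(2-4) s in simp_all)
  then have "Rt (Si_obj V M) (el M a a p x p) = (inj1 V M a a \<cdot> Ra V M a) \<cdot> s"
    unfolding Rt_def using s(4) by simp
  also have "\<dots> = el M a a (om M a ?X) ?X ?P \<cdot> s" unfolding rs(1) el_def ..
  also have "\<dots> = el M a a (om M a ?X \<cdot> s) (?X \<cdot> s) (?P \<cdot> s)"
    by (rule el_props(6)[OF M rs(3) s(1) s'])
  also have "om M a ?X \<cdot> s = om M a (?X \<cdot> s)"
    by (rule om_comp[OF E a X(7,8) c(9) s(1)]) (use s' X(10) in simp)
  finally show "Rt (Si_obj V M) (el M a a p x p) = el M a a (om M a x) x p" unfolding Xs .
  have od: "Dom V (om M a ?X) = Dom V ?P" "Cod V s = Dom V (om M a ?X)"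
    using om_typing(2)[OF E a X(7,8) c(9)] s' X(10) by simp_all
  have "spS (Si_obj V M) \<cdot> Idem_inj V M a \<cdot> s = (inj1 V M a a \<cdot> Sa V M a) \<cdot> s"
    by (rule comp_extend[OF sp(4)[OF a]]) (use sp(2) c(2-4) s in simp_all)
  then have "Sc (Si_obj V M) (el M a a p x p) = (inj1 V M a a \<cdot> Sa V M a) \<cdot> s"
    unfolding Sc_def using s(4) by simp
  also have "\<dots> = el M a a ?P ?X (om M a ?X) \<cdot> s" unfolding rs(2) el_def ..
  also have "\<dots> = el M a a (?P \<cdot> s) (?X \<cdot> s) (om M a ?X \<cdot> s)"
    by (rule el_props(6)[OF M rs(4) s(1) od(2)])
  also have "om M a ?X \<cdot> s = om M a (?X \<cdot> s)"
    by (rule om_comp[OF E a X(7,8) c(9) s(1)]) (use s' X(10) in simp)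
  finally show "Sc (Si_obj V M) (el M a a p x p) = el M a a p x (om M a x)" unfolding Xs .
qed

lemma Si_is_split:
  assumes M: "small_ecat M"
  shows "is_split V (Si_obj V M)"
proof -
  let ?S = "Si_icat V M" let ?R = "spR (Si_obj V M)" and ?T = "spS (Si_obj V M)" and ?E = "EI V (Si_icat V M)"
  note I = Si_internal[OF M] and E = small_ecatD(1)[OF M] and sp = Si_split_arrows[OF M]
  have ty: "?R \<in> Arr V" "Dom V ?R = Idem V ?S" "Cod V ?R = Si1 V M" "?T \<in> Arr V" "Dom V ?T = Idem V ?S" "Cod V ?T = Si1 V M"
    using sp(1,2) by simp_all
  have i: "idem ?S ?E" using EI_idem(1)[OF I] .
  have S: "d0 ?S \<in> Arr V" "Dom V (d0 ?S) = Si1 V M" "Cod V (d0 ?S) = Si0 V M"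
    "d1 ?S \<in> Arr V" "Dom V (d1 ?S) = Si1 V M" "Cod V (d1 ?S) = Si0 V M"
    "iident ?S \<in> Arr V" "Dom V (iident ?S) = Si0 V M" "Cod V (iident ?S) = Si1 V M"
    "?E \<in> Arr V" "Dom V ?E = Idem V ?S" "Cod V ?E = Si1 V M"
    using Si_icat_typing[OF M] I by simp_all
  have loc: "?R \<cdot> k = el M a a (om M a x) x p" "?T \<cdot> k = el M a a p x (om M a x)"
    "trip M a a (om M a x) x p" "trip M a a p x (om M a x)"
    if k: "k \<in> Arr V" "Cod V k = Dom V ?E" "trip M a a p x p" "ec M a a a x x = x" "?E \<cdot> k = el M a a p x p" for k a p x
  proof -
    \<comment> \<open>\<open>EI\<close> is the generic idempotent, so an element of
      \<open>Idem\<close> is the \<open>star\<close> of its own image under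
      \<open>EI\<close>.\<close>
    have "star V ?S (el M a a p x p) = k" by (rule star_eqI[OF I k(1) _ k(5)]) (use k(2) S in simp)
    then show "?R \<cdot> k = el M a a (om M a x) x p" "?T \<cdot> k = el M a a p x (om M a x)"
      using Si_split_el[OF M k(3,4)] unfolding Rt_def Sc_def by simp_all
    show "trip M a a (om M a x) x p" "trip M a a p x (om M a x)" by (rule trip_om[OF E k(3,4)])+
  qed
  note icases = Si_idem_cases[OF M i]
  have d: "d0 ?S \<cdot> ?R = d0 ?S \<cdot> ?E" "d1 ?S \<cdot> ?T = d0 ?S \<cdot> ?E" "d1 ?S \<cdot> ?R = d0 ?S \<cdot> ?T"
  proof -
    have *: "(d0 ?S \<cdot> ?R) \<cdot> k = (d0 ?S \<cdot> ?E) \<cdot> k" "(d1 ?S \<cdot> ?T) \<cdot> k = (d0 ?S \<cdot> ?E) \<cdot> k" "(d1 ?S \<cdot> ?R) \<cdot> k = (d0 ?S \<cdot> ?T) \<cdot> k"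
      if k: "k \<in> Arr V" "Cod V k = Dom V ?E" "trip M a a p x p" "ec M a a a x x = x" "Dom V k = Dom V p"
        "?E \<cdot> k = el M a a p x p" for k a p x
      using loc[OF k(1-4,6)] k S ty M by simp_all
    show "d0 ?S \<cdot> ?R = d0 ?S \<cdot> ?E" by (rule icases; (rule *(1))?; use S ty in simp)
    show "d1 ?S \<cdot> ?T = d0 ?S \<cdot> ?E" by (rule icases; (rule *(2))?; use S ty in simp)
    show "d1 ?S \<cdot> ?R = d0 ?S \<cdot> ?T" by (rule icases; (rule *(3))?; use S ty in simp)
  qed
  have c: "cmp V ?S ?T ?R = ?E" "cmp V ?S ?R ?T = iident ?S \<cdot> d0 ?S \<cdot> ?T"
  proof -
    have comp: "d0 ?S \<cdot> ?T = d1 ?S \<cdot> ?R" "d0 ?S \<cdot> ?R = d1 ?S \<cdot> ?T" using d by simp_all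
    note c1 = cmp_typing(1-3)[OF I, of ?T ?R] cmp_comp[OF I, of ?T ?R]
    note c2 = cmp_typing(1-3)[OF I, of ?R ?T] cmp_comp[OF I, of ?R ?T]
    have *: "cmp V ?S ?T ?R \<cdot> k = ?E \<cdot> k" "cmp V ?S ?R ?T \<cdot> k = (iident ?S \<cdot> d0 ?S \<cdot> ?T) \<cdot> k"
      if k: "k \<in> Arr V" "Cod V k = Dom V ?E" "trip M a a p x p" "ec M a a a x x = x" "Dom V k = Dom V p"
        "?E \<cdot> k = el M a a p x p" for k a p x
    proof -
      note l = loc[OF k(1-4,6)]
      show "cmp V ?S ?T ?R \<cdot> k = ?E \<cdot> k"
        using c1 l k S ty comp M by simp
      have e: "eps V M a \<cdot> om M a x = x" using om_typing(4)[OF E] k(4) tripD[OF k(3)] by simp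
      have "iident ?S \<cdot> inj0 V M a \<cdot> om M a x = el M a a (om M a x) x (om M a x)"
        using Si_iident_inj0[OF M _ tripD(3,4)[OF l(3)]] tripD(1)[OF l(3)] e by simp
      then show "cmp V ?S ?R ?T \<cdot> k = (iident ?S \<cdot> d0 ?S \<cdot> ?T) \<cdot> k"
        using c2 l k S ty comp M by simp
    qed
    show "cmp V ?S ?T ?R = ?E" by (rule icases; (rule *(1))?; use c1 comp S ty in simp)
    show "cmp V ?S ?R ?T = iident ?S \<cdot> d0 ?S \<cdot> ?T" by (rule icases; (rule *(2))?; use c2 comp S ty in simp)
  qed
  show ?thesis unfolding is_split_def using ty d c S by simp
qed

text \<open>In the second condition let \<open>f = (P, x, P)\<close> and
  \<open>g = (P, y, P)\<close>. From \<open>x y x = y\<close> and idempotence of \<open>x\<close>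
  follow \<open>x y = y = y x\<close>, so the conjugate \<open>h\<close> is
  \<open>(x, y, x)\<close>. Its retraction \<open>(y, y, x)\<close> is the composite of
  \<open>(y, y, P)\<close> and \<open>(P, x, x)\<close>; the statement for sections is dual.\<close>

lemma Si_canonical:
  assumes M: "small_ecat M"
  shows "is_canonical_split V (Si_obj V M)"
proof -
  let ?A = "Si_obj V M" let ?S = "Si_icat V M"
  note I = Si_internal[OF M] and E = small_ecatD(1)[OF M] and sp = Si_is_split[OF M] and IA = Si_obj_internal[OF M]
  note ty = Si_icat_typing[OF M] and o = Si_obj_typing[OF M]
  have RT: "Rt ?A u \<in> Arr V" "Dom V (Rt ?A u) = Dom V u" "Cod V (Rt ?A u) = Si1 V M"
    "Sc ?A u \<in> Arr V" "Dom V (Sc ?A u) = Dom V u" "Cod V (Sc ?A u) = Si1 V M"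
    "d0 ?S \<cdot> Rt ?A u = d0 ?S \<cdot> u" "d1 ?S \<cdot> Sc ?A u = d0 ?S \<cdot> u" "d0 ?S \<cdot> Sc ?A u = d1 ?S \<cdot> Rt ?A u"
    "\<And>k. k \<in> Arr V \<Longrightarrow> Cod V k = Dom V u \<Longrightarrow> Rt ?A u \<cdot> k = Rt ?A (u \<cdot> k)"
    "\<And>k. k \<in> Arr V \<Longrightarrow> Cod V k = Dom V u \<Longrightarrow> Sc ?A u \<cdot> k = Sc ?A (u \<cdot> k)" if "idem ?S u" for u
    using split_props[OF IA sp, of u] split_comp[OF IA sp, of u] that by simp_all
  have one: "Rt ?A (iident ?S) = iident ?S" "Sc ?A (iident ?S) = iident ?S"
  proof -
    \<comment> \<open>First condition: the identity at \<open>q\<close> is \<open>(q, q, q)\<close>,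
      and \<open>om\<close> of its middle component is \<open>q\<close>, so splitting leaves it
      unchanged.\<close>
    let ?i = "Ident V (Si0 V M)"
    have ii: "idem ?S (iident ?S)" using idem_ident[OF I, of ?i] ty o by simp
    have *: "Rt ?A (iident ?S) \<cdot> k = iident ?S \<cdot> k" "Sc ?A (iident ?S) \<cdot> k = iident ?S \<cdot> k"
      if k: "k \<in> Arr V" "Cod V k = Dom V ?i" "a \<in> eobj M" "q \<in> Arr V" "Dom V q = Dom V k" "Cod V q = idems V M a"
        "?i \<cdot> k = inj0 V M a \<cdot> q" for k a q
    proof -
      have "k = inj0 V M a \<cdot> q" using k o by simp
      then show "Rt ?A (iident ?S) \<cdot> k = iident ?S \<cdot> k" "Sc ?A (iident ?S) \<cdot> k = iident ?S \<cdot> k"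
        using RT(10,11)[OF ii] k ty M E o trip_eps[OF E k(3,4,6)] by simp_all
    qed
    show "Rt ?A (iident ?S) = iident ?S" by (rule inj0_cases[OF M, of ?i]; (rule *(1))?; use RT[OF ii] ty o in simp)
    show "Sc ?A (iident ?S) = iident ?S" by (rule inj0_cases[OF M, of ?i]; (rule *(2))?; use RT[OF ii] ty o in simp)
  qed
  have two: "Rt ?A (cmp V ?S (Rt ?A f) (cmp V ?S g (Sc ?A f))) = cmp V ?S (Rt ?A g) (Sc ?A f) \<and>
      Sc ?A (cmp V ?S (Rt ?A f) (cmp V ?S g (Sc ?A f))) = cmp V ?S (Rt ?A f) (Sc ?A g)"
    if fg: "idem ?S f" "idem ?S g" "Dom V f = Dom V g" "d0 ?S \<cdot> f = d1 ?S \<cdot> g"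
      "d0 ?S \<cdot> g = d1 ?S \<cdot> f" "cmp V ?S f (cmp V ?S g f) = g" for f g
  proof -
    note f = idemD[OF fg(1)] and g = idemD[OF fg(2)]
    have dd: "d0 ?S \<cdot> f = d0 ?S \<cdot> g" using fg(4) g by simp
    have t: "f \<in> Arr V" "Cod V f = Si1 V M" "g \<in> Arr V" "Cod V g = Si1 V M" using f g by simp_all
    note rf = RT[OF fg(1)] and rg = RT[OF fg(2)]
    let ?gs = "cmp V ?S g (Sc ?A f)" let ?h = "cmp V ?S (Rt ?A f) ?gs"
    have gs: "?gs \<in> Arr V" "Dom V ?gs = Dom V g" "Cod V ?gs = Si1 V M" "d0 ?S \<cdot> ?gs = d1 ?S \<cdot> Rt ?A f"
      "d1 ?S \<cdot> ?gs = d0 ?S \<cdot> f" "\<And>k. k \<in> Arr V \<Longrightarrow> Cod V k = Dom V g \<Longrightarrow> ?gs \<cdot> k = cmp V ?S (g \<cdot> k) (Sc ?A f \<cdot> k)"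
      using cmp_typing[OF I, of g "Sc ?A f"] cmp_comp[OF I, of g "Sc ?A f"] fg(3) dd t rf g(3) by simp_all
    have h: "?h \<in> Arr V" "Dom V ?h = Dom V g" "Cod V ?h = Si1 V M" "d0 ?S \<cdot> ?h = d1 ?S \<cdot> Rt ?A f"
      "d1 ?S \<cdot> ?h = d1 ?S \<cdot> Rt ?A f" "\<And>k. k \<in> Arr V \<Longrightarrow> Cod V k = Dom V g \<Longrightarrow> ?h \<cdot> k = cmp V ?S (Rt ?A f \<cdot> k) (?gs \<cdot> k)"
      using cmp_typing[OF I, of "Rt ?A f" ?gs] cmp_comp[OF I, of "Rt ?A f" ?gs] fg(3) dd t rf gs(1-5) by simp_all
    \<comment> \<open>Composability of \<open>f\<close> and \<open>g\<close> forces a common object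
      and a common idempotent \<open>P\<close>. A clash of indices would make the stage initial,
      which is excluded by \<open>ni\<close> and treated separately in \<open>glue\<close>.\<close>
    have local: "\<exists>P x y. trip M a a P x P \<and> trip M a a P y P \<and> ec M a a a x x = x \<and> ec M a a a y y = y \<and>
        ec M a a a x y = y \<and> ec M a a a y x = y \<and> Dom V l = Dom V P \<and> f \<cdot> k \<cdot> l = el M a a P x P \<and> g \<cdot> k \<cdot> l = el M a a P y P"
      if k: "k \<in> Arr V" "Cod V k = Dom V f" "trip M a a p x p" "ec M a a a x x = x" "Dom V k = Dom V p" "f \<cdot> k = el M a a p x p"
        and l: "l \<in> Arr V" "Cod V l = Dom V (g \<cdot> k)" "trip M b b q y q" "ec M b b b y y = y" "Dom V l = Dom V q"
          "(g \<cdot> k) \<cdot> l = el M b b q y q" and ni: "\<not> initial (Dom V l)" for k a p x l b q y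
    proof -
      note d = tripD(1-10)[OF k(3)] and d' = tripD(1-10)[OF l(3)]
      have kl: "k \<cdot> l \<in> Arr V" "Cod V (k \<cdot> l) = Dom V g" "Cod V l = Dom V p" using k l t fg(3) by simp_all
      have fl: "f \<cdot> k \<cdot> l = el M a a (p \<cdot> l) (x \<cdot> l) (p \<cdot> l)"
        using comp_extend[OF k(6), of l] k(1-5) kl(3) l(1) t M by simp
      have gl: "g \<cdot> k \<cdot> l = el M b b q y q" using l(6) k(1,2) l(1,2) t fg(3) by simp
      have tl: "trip M a a (p \<cdot> l) (x \<cdot> l) (p \<cdot> l)" using E k(3) l(1) kl(3) by simp
      have xl: "ec M a a a (x \<cdot> l) (x \<cdot> l) = x \<cdot> l"
        using arg_cong[OF k(4), of "\<lambda>z. z \<cdot> l"] E d l(1) kl(3) by simp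
      have "d0 ?S \<cdot> f \<cdot> k \<cdot> l = d1 ?S \<cdot> g \<cdot> k \<cdot> l"
        using comp_extend[OF fg(4), of "k \<cdot> l"] kl t ty fg(3) by simp
      then have "inj0 V M a \<cdot> p \<cdot> l = inj0 V M b \<cdot> q" unfolding fl gl using M tl l(3) by simp
      from inj0_eq[OF M d(1) d'(1) this] have ab: "a = b" "p \<cdot> l = q"
        using d d' l(1) kl(3) l(5) ni by (simp_all split: if_splits)
      have gl': "g \<cdot> k \<cdot> l = el M a a (p \<cdot> l) y (p \<cdot> l)" and tq: "trip M a a (p \<cdot> l) y (p \<cdot> l)" and yy: "ec M a a a y y = y"
        using gl l(3,4) ab by simp_all
      have gf: "d0 ?S \<cdot> f = d1 ?S \<cdot> cmp V ?S g f"
        using cmp_typing(5)[OF I, of g f] t fg(3,4,5) by simp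
      have "cmp V ?S f (cmp V ?S g f) \<cdot> k \<cdot> l = g \<cdot> k \<cdot> l" using fg(6) by simp
      then have "cmp V ?S (f \<cdot> k \<cdot> l) (cmp V ?S (g \<cdot> k \<cdot> l) (f \<cdot> k \<cdot> l)) = g \<cdot> k \<cdot> l"
        using cmp_comp[OF I, of f "cmp V ?S g f" "k \<cdot> l"] cmp_comp[OF I, of g f "k \<cdot> l"] cmp_typing(1-3)[OF I, of g f]
          t fg(3,5) gf kl by simp
      then have eq: "el M a a (p \<cdot> l) (ec M a a a (x \<cdot> l) (ec M a a a y (x \<cdot> l))) (p \<cdot> l) = el M a a (p \<cdot> l) y (p \<cdot> l)"
        unfolding fl gl' using M tl tq trip_comp[OF E tq tl refl] by simp
      have x3: "ec M a a a (x \<cdot> l) (ec M a a a y (x \<cdot> l)) = y"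
        using el_inject(2)[OF M trip_comp[OF E tl trip_comp[OF E tq tl refl] refl] tq refl eq] .
      note e = tripD(1-10)[OF tl] tripD(1-10)[OF tq]
      have "ec M a a a (x \<cdot> l) (ec M a a a (x \<cdot> l) (ec M a a a y (x \<cdot> l))) = ec M a a a (ec M a a a (x \<cdot> l) (x \<cdot> l)) (ec M a a a y (x \<cdot> l))"
        by (rule ec_assoc[symmetric]) (use E e in simp_all)
      \<comment> \<open>Multiplying \<open>x y x = y\<close> by \<open>x\<close> on the left, and
        below on the right, absorbs the extra factor by idempotence.\<close>
      then have xy: "ec M a a a (x \<cdot> l) y = y" using x3 xl by simp
      have "ec M a a a (ec M a a a (x \<cdot> l) (ec M a a a y (x \<cdot> l))) (x \<cdot> l) = ec M a a a (x \<cdot> l) (ec M a a a y (ec M a a a (x \<cdot> l) (x \<cdot> l)))"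
        using E e by simp
      then have yx: "ec M a a a y (x \<cdot> l) = y" using x3 xl by simp
      show ?thesis
        using tl tq xl yy xy yx fl gl' k(5) kl(3) l(1,5) d e ab by (intro exI[of _ "p \<cdot> l"] exI[of _ "x \<cdot> l"] exI[of _ y]) simp
    qed
    have glue: "L = R" if LR: "L \<in> Arr V" "R \<in> Arr V" "Dom V L = Dom V g" "Dom V R = Dom V g" "Cod V L = Cod V R"
      and loc: "\<And>k a P x y. k \<in> Arr V \<Longrightarrow> Cod V k = Dom V g \<Longrightarrow> Dom V k = Dom V P \<Longrightarrow> trip M a a P x P \<Longrightarrow> trip M a a P y P \<Longrightarrow>
        ec M a a a x x = x \<Longrightarrow> ec M a a a y y = y \<Longrightarrow> ec M a a a x y = y \<Longrightarrow> ec M a a a y x = y \<Longrightarrow>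
        f \<cdot> k = el M a a P x P \<Longrightarrow> g \<cdot> k = el M a a P y P \<Longrightarrow> L \<cdot> k = R \<cdot> k" for L R
    proof (rule Si_idem_cases[OF M fg(1)])
      fix k a p x assume k: "k \<in> Arr V" "Cod V k = Dom V f" "trip M a a p x p" "ec M a a a x x = x" "Dom V k = Dom V p" "f \<cdot> k = el M a a p x p"
      have gk: "idem ?S (g \<cdot> k)" using idem_comp[OF I fg(2)] k fg(3) by simp
      show "L \<cdot> k = R \<cdot> k"
      proof (rule Si_idem_cases[OF M gk])
        fix l b q y assume l: "l \<in> Arr V" "Cod V l = Dom V (g \<cdot> k)" "trip M b b q y q" "ec M b b b y y = y" "Dom V l = Dom V q"
          "(g \<cdot> k) \<cdot> l = el M b b q y q"
        have kl: "k \<cdot> l \<in> Arr V" "Cod V (k \<cdot> l) = Dom V g" "Dom V (k \<cdot> l) = Dom V l" "Cod V l = Dom V k" using k l t fg(3) by simp_all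
        show "(L \<cdot> k) \<cdot> l = (R \<cdot> k) \<cdot> l"
        proof (cases "initial (Dom V l)")
          case True
          then show ?thesis by (rule initial_eq) (use kl k l(1) LR fg(3) in simp_all)
        next
          case False
          obtain P x y where "trip M a a P x P" "trip M a a P y P" "ec M a a a x x = x" "ec M a a a y y = y"
            "ec M a a a x y = y" "ec M a a a y x = y" "Dom V l = Dom V P" "f \<cdot> k \<cdot> l = el M a a P x P" "g \<cdot> k \<cdot> l = el M a a P y P"
            using local[OF k l False] by blast
          then have "L \<cdot> k \<cdot> l = R \<cdot> k \<cdot> l" using loc[of "k \<cdot> l" P a x y] kl by simp
          then show ?thesis using kl k l(1) LR fg(3) by simp
        qed
      qed (use k LR fg(3) t in simp_all)
    qed (use LR fg(3) in simp_all)
    have elem: "?h \<cdot> k = el M a a (om M a x) y (om M a x) \<and> idem ?S (el M a a (om M a x) y (om M a x)) \<and>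
        Rt ?A (el M a a (om M a x) y (om M a x)) = el M a a (om M a y) y (om M a x) \<and>
        Sc ?A (el M a a (om M a x) y (om M a x)) = el M a a (om M a x) y (om M a y) \<and>
        cmp V ?S (Rt ?A (g \<cdot> k)) (Sc ?A (f \<cdot> k)) = el M a a (om M a y) y (om M a x) \<and>
        cmp V ?S (Rt ?A (f \<cdot> k)) (Sc ?A (g \<cdot> k)) = el M a a (om M a x) y (om M a y)"
      if k: "k \<in> Arr V" "Cod V k = Dom V g" "Dom V k = Dom V P" "trip M a a P x P" "trip M a a P y P"
        "ec M a a a x x = x" "ec M a a a y y = y" "ec M a a a x y = y" "ec M a a a y x = y"
        "f \<cdot> k = el M a a P x P" "g \<cdot> k = el M a a P y P" for k a P x y
    proof -
      note d = tripD[OF k(4)] tripD[OF k(5)]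
      note tx = trip_om[OF E k(4,6)] and tyy = trip_om[OF E k(5,7)]
      have e: "eps V M a \<cdot> om M a x = x" using om_typing(4)[OF E] k(6) d by simp
      have tt: "trip M a a (om M a x) y (om M a x)"
        unfolding trip_def using tripD(1-10)[OF tx(1)] d k(8,9) e by simp
      have t2: "trip M a a P y (om M a x)"
        unfolding trip_def using tripD(1-10)[OF tx(1)] d k(8,9) e by simp
      have "?h \<cdot> k = el M a a (om M a x) y (om M a x)"
        using h(6) gs(6) rf(10,11) k M tx t2 fg(3) by simp
      then show ?thesis
        using el_idem[OF M tt k(7)] Si_split_el[OF M tt k(7)] k M tx tyy by simp
    qed
    \<comment> \<open>\<open>star\<close> is meaningful on idempotents only, so idempotence of
      \<open>h\<close> must be known globally before the local values of its retraction and section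
      can be used.\<close>
    have ih: "idem ?S ?h"
    proof -
      have hh: "d0 ?S \<cdot> ?h = d1 ?S \<cdot> ?h" using h by simp
      note chh = cmp_typing[OF I h(1,1) refl] cmp_comp[OF I h(1,1) refl]
      have "cmp V ?S ?h ?h = ?h"
      proof (rule glue)
        fix k a P x y assume k: "k \<in> Arr V" "Cod V k = Dom V g" "Dom V k = Dom V P" "trip M a a P x P" "trip M a a P y P"
        "ec M a a a x x = x" "ec M a a a y y = y" "ec M a a a x y = y" "ec M a a a y x = y"
        "f \<cdot> k = el M a a P x P" "g \<cdot> k = el M a a P y P"
        note e = elem[OF k]
        have "cmp V ?S ?h ?h \<cdot> k = cmp V ?S (?h \<cdot> k) (?h \<cdot> k)"
          by (rule chh(6)) (use h hh k in simp_all)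
        also have "\<dots> = ?h \<cdot> k" using e idemD(4) by metis
        finally show "cmp V ?S ?h ?h \<cdot> k = ?h \<cdot> k" .
      qed (use chh(1-3) h hh in simp_all)
      then show ?thesis unfolding idem_def using h by simp
    qed
    note rh = RT[OF ih]
    have cgf: "d0 ?S \<cdot> Rt ?A g = d1 ?S \<cdot> Sc ?A f" "d0 ?S \<cdot> Rt ?A f = d1 ?S \<cdot> Sc ?A g" using rf rg dd by simp_all
    note c1 = cmp_typing(1-3)[OF I, of "Rt ?A g" "Sc ?A f"] cmp_comp[OF I, of "Rt ?A g" "Sc ?A f"]
    note c2 = cmp_typing(1-3)[OF I, of "Rt ?A f" "Sc ?A g"] cmp_comp[OF I, of "Rt ?A f" "Sc ?A g"]
    have *: "Rt ?A ?h \<cdot> k = cmp V ?S (Rt ?A g) (Sc ?A f) \<cdot> k" "Sc ?A ?h \<cdot> k = cmp V ?S (Rt ?A f) (Sc ?A g) \<cdot> k"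
      if k: "k \<in> Arr V" "Cod V k = Dom V g" "Dom V k = Dom V P" "trip M a a P x P" "trip M a a P y P"
        "ec M a a a x x = x" "ec M a a a y y = y" "ec M a a a x y = y" "ec M a a a y x = y"
        "f \<cdot> k = el M a a P x P" "g \<cdot> k = el M a a P y P" for k a P x y
    proof -
      note e = elem[OF k]
      have "Rt ?A ?h \<cdot> k = Rt ?A (?h \<cdot> k)" "Sc ?A ?h \<cdot> k = Sc ?A (?h \<cdot> k)"
        by (rule rh(10,11); use k h(2) in simp)+
      moreover have "cmp V ?S (Rt ?A g) (Sc ?A f) \<cdot> k = cmp V ?S (Rt ?A (g \<cdot> k)) (Sc ?A (f \<cdot> k))"
        "cmp V ?S (Rt ?A f) (Sc ?A g) \<cdot> k = cmp V ?S (Rt ?A (f \<cdot> k)) (Sc ?A (g \<cdot> k))"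
        using c1(4) c2(4) cgf rf(1-6,10,11) rg(1-6,10,11) k(1,2) fg(3) by (simp_all del: Si_split_el)
      ultimately show "Rt ?A ?h \<cdot> k = cmp V ?S (Rt ?A g) (Sc ?A f) \<cdot> k" "Sc ?A ?h \<cdot> k = cmp V ?S (Rt ?A f) (Sc ?A g) \<cdot> k"
        using e by metis+
    qed
    show ?thesis
    proof
      show "Rt ?A ?h = cmp V ?S (Rt ?A g) (Sc ?A f)"
        by (rule glue; (rule *(1))?; use rh(1-6) h(2) c1(1-3) cgf rf(1-6) rg(1-6) fg(3) in simp)
      show "Sc ?A ?h = cmp V ?S (Rt ?A f) (Sc ?A g)"
        by (rule glue; (rule *(2))?; use rh(1-6) h(2) c2(1-3) cgf rf(1-6) rg(1-6) fg(3) in simp)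
    qed
  qed
  show ?thesis
    unfolding is_canonical_split_def
  proof (intro conjI allI impI)
    show "is_split V ?A" by (rule sp)
    show "spR ?A \<cdot> star V ?A (iident ?A) = iident ?A" "spS ?A \<cdot> star V ?A (iident ?A) = iident ?A"
      using one unfolding Rt_def Sc_def by simp_all
    fix X fs gs assume t: "fs \<in> hom V X (Idem V ?A) \<and> gs \<in> hom V X (Idem V ?A)"
    let ?f = "EI V ?S \<cdot> fs" and ?g = "EI V ?S \<cdot> gs"
    have fs: "fs \<in> Arr V" "Dom V fs = X" "Cod V fs = Idem V ?S" and gs: "gs \<in> Arr V" "Dom V gs = X" "Cod V gs = Idem V ?S"
      using t by simp_all
    have i: "idem ?S ?f" "idem ?S ?g" "Dom V ?f = Dom V ?g"
      using idem_EI(1)[OF I] fs gs I by simp_all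
    have r: "spR ?A \<cdot> fs = Rt ?A ?f" "spS ?A \<cdot> fs = Sc ?A ?f" "spR ?A \<cdot> gs = Rt ?A ?g" "spS ?A \<cdot> gs = Sc ?A ?g"
      using idem_EI(2)[OF I fs(1,3)] idem_EI(2)[OF I gs(1,3)] unfolding Rt_def Sc_def by simp_all
    show "let f = EI V ?A \<cdot> fs; g = EI V ?A \<cdot> gs;
             h = cmp V ?A (spR ?A \<cdot> fs) (cmp V ?A g (spS ?A \<cdot> fs)) in
         d0 ?A \<cdot> f = d1 ?A \<cdot> g \<and> d0 ?A \<cdot> g = d1 ?A \<cdot> f \<and> cmp V ?A f (cmp V ?A g f) = g \<longrightarrow>
         spR ?A \<cdot> star V ?A h = cmp V ?A (spR ?A \<cdot> gs) (spS ?A \<cdot> fs) \<and>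
         spS ?A \<cdot> star V ?A h = cmp V ?A (spR ?A \<cdot> fs) (spS ?A \<cdot> gs)"
      unfolding Let_def Si_obj_derived Si_obj_simps r
      using two[OF i] unfolding Rt_def[of _ "cmp V ?S (Rt ?A ?f) (cmp V ?S ?g (Sc ?A ?f))"]
        Sc_def[of _ "cmp V ?S (Rt ?A ?f) (cmp V ?S ?g (Sc ?A ?f))"] by simp
  qed
qed

text \<open>A point of \<open>Si_hom\<close> is determined by three points of hom-objects of
  \<open>M\<close>, since the arrows \<open>eps\<close> are monic; hence these points form a small
  set. The closure of small point sets under small coproducts then bounds the points of
  \<open>Si1\<close>.\<close>

lemma Si_small:
  assumes M: "small_enriched_category V \<kappa> M"
  shows "small_ecat M" "small_split_category V \<kappa> (Si_obj V M)"
proof -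
  show m: "small_ecat M" using M unfolding small_enriched_category_def small_ecat_def by blast
  note E = small_ecatD(1)[OF m]
  have s: "small \<kappa> (hom V (trm V) (ehom M a b))" if "a \<in> eobj M" "b \<in> eobj M" for a b
    using M that unfolding small_enriched_category_def by blast
  have "small \<kappa> (hom V (trm V) (Si_hom V M a b))" if ab: "a \<in> eobj M" "b \<in> eobj M" for a b
  proof -
    let ?f = "\<lambda>u. (eps V M b \<cdot> ah1 V M a b \<cdot> u, ah2 V M a b \<cdot> u, eps V M a \<cdot> ah3 V M a b \<cdot> u)"
    let ?H = "\<lambda>a b. hom V (trm V) (ehom M a b)"
    have "small \<kappa> (?H b b \<times> ?H a b \<times> ?H a a)" using s ab by (intro small_Times)
    then show ?thesis
    proof (rule small_inj[rotated -1])
      show "?f ` hom V (trm V) (Si_hom V M a b) \<subseteq> ?H b b \<times> ?H a b \<times> ?H a a"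
        using E ab by auto
      show "inj_on ?f (hom V (trm V) (Si_hom V M a b))"
      proof (rule inj_onI)
        fix u v assume uv: "u \<in> hom V (trm V) (Si_hom V M a b)" "v \<in> hom V (trm V) (Si_hom V M a b)" "?f u = ?f v"
        have "ah1 V M a b \<cdot> u = ah1 V M a b \<cdot> v"
          by (rule mono_V_D[OF eps_props(5)[OF E ab(2)]]) (use uv E ab in simp_all)
        moreover have "ah3 V M a b \<cdot> u = ah3 V M a b \<cdot> v"
          by (rule mono_V_D[OF eps_props(5)[OF E ab(1)]]) (use uv E ab in simp_all)
        ultimately show "u = v"
          using Si_hom_eqI[OF E ab, of u v] uv by simp
      qed
    qed
  qed
  then have "small \<kappa> (hom V (trm V) (Si1 V M))"
    by (intro small_points_coproduct[OF Si_coproducts(2)[OF m] Si_coproducts(4)[OF m]]) (auto simp del: in_hom)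
  then show "small_split_category V \<kappa> (Si_obj V M)"
    unfolding small_split_category_def using Si_obj_internal[OF m] Si_canonical[OF m] by simp
qed

end

subsection \<open>Adjunctions from universal arrows\<close>

text \<open>Transposition along the unit is bijective by universality. Functoriality of
  \<open>F\<close> is a conclusion: the two sides of each functor equation have the same transpose
  by naturality, so they coincide.\<close>

lemma adjunction_from_universal_arrows:
  assumes C: "category C" and G: "cat_functor D C G"
    and obj: "\<And>x. x \<in> Obj C \<Longrightarrow> FObj F x \<in> Obj D"
    and unit: "\<And>x. x \<in> Obj C \<Longrightarrow> \<eta> x \<in> hom C x (FObj G (FObj F x))"
    and universal: "\<And>x y f. x \<in> Obj C \<Longrightarrow> y \<in> Obj D \<Longrightarrow> f \<in> hom C x (FObj G y) \<Longrightarrow>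
      \<exists>!h. h \<in> hom D (FObj F x) y \<and> Comp C (FArr G h) (\<eta> x) = f"
    and arr: "\<And>f x y. f \<in> hom C x y \<Longrightarrow> FArr F f \<in> hom D (FObj F x) (FObj F y)"
    and natural: "\<And>f x y. f \<in> hom C x y \<Longrightarrow> Comp C (FArr G (FArr F f)) (\<eta> x) = Comp C (\<eta> y) f"
  shows "adjunction C D F G (\<lambda>x y h. Comp C (FArr G h) (\<eta> x))"
proof -
  interpret C: category C by (fact C)
  interpret G: cat_functor D C G by (fact G)
  have ob: "x \<in> Obj C" "y \<in> Obj C" if "f \<in> hom C x y" for f x y using that by auto
  have obD: "x \<in> Obj D" "y \<in> Obj D" if "f \<in> hom D x y" for f x y using that by auto
  \<comment> \<open>Membership in hom-sets stays folded, so that facts stated with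
    \<open>hom\<close> apply directly.\<close>
  note [simp del] = in_hom
  have uniq: "h = h'" if "x \<in> Obj C" "y \<in> Obj D" "h \<in> hom D (FObj F x) y" "h' \<in> hom D (FObj F x) y"
    "Comp C (FArr G h) (\<eta> x) = Comp C (FArr G h') (\<eta> x)" for x y h h'
  proof -
    have "Comp C (FArr G h) (\<eta> x) \<in> hom C x (FObj G y)"
      using C.comp_hom[OF unit[OF that(1)] G.map_hom[OF that(3)]] .
    then show ?thesis using universal[OF that(1,2)] that(3-5) by metis
  qed
  have F: "cat_functor C D F"
  proof
    show "FObj F x \<in> Obj D" if "x \<in> Obj C" for x using obj that .
    show "FArr F f \<in> hom D (FObj F x) (FObj F y)" if "f \<in> hom C x y" for f x y using arr that .
    show "FArr F (Ident C x) = Ident D (FObj F x)" if x: "x \<in> Obj C" for x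
    proof (rule uniq[OF x obj[OF x]])
      show "FArr F (Ident C x) \<in> hom D (FObj F x) (FObj F x)" by (rule arr[OF C.ident_hom[OF x]])
      show "Ident D (FObj F x) \<in> hom D (FObj F x) (FObj F x)" by (rule G.C.ident_hom[OF obj[OF x]])
      have "Comp C (FArr G (FArr F (Ident C x))) (\<eta> x) = \<eta> x"
        using natural[OF C.ident_hom[OF x]] C.comp_ident_right[OF unit[OF x]] by simp
      also have "\<dots> = Comp C (FArr G (Ident D (FObj F x))) (\<eta> x)"
        unfolding G.map_ident[OF obj[OF x]] using C.comp_ident_left[OF unit[OF x]] by simp
      finally show "Comp C (FArr G (FArr F (Ident C x))) (\<eta> x) = Comp C (FArr G (Ident D (FObj F x))) (\<eta> x)" .
    qed
    show "FArr F (Comp C g f) = Comp D (FArr F g) (FArr F f)" if f: "f \<in> hom C x y" and g: "g \<in> hom C y z" for f g x y z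
    proof (rule uniq[OF ob(1)[OF f] obj[OF ob(2)[OF g]]])
      note Ff = arr[OF f] and Fg = arr[OF g] and gf = C.comp_hom[OF f g]
      note GF = G.map_hom[OF Ff] and GG = G.map_hom[OF Fg]
      note ux = unit[OF ob(1)[OF f]] and uy = unit[OF ob(2)[OF f]] and uz = unit[OF ob(2)[OF g]]
      show "FArr F (Comp C g f) \<in> hom D (FObj F x) (FObj F z)" by (rule arr[OF gf])
      show "Comp D (FArr F g) (FArr F f) \<in> hom D (FObj F x) (FObj F z)" by (rule G.C.comp_hom[OF Ff Fg])
      have "Comp C (FArr G (FArr F (Comp C g f))) (\<eta> x) = Comp C (\<eta> z) (Comp C g f)" by (rule natural[OF gf])
      also have "\<dots> = Comp C (Comp C (\<eta> z) g) f" by (rule C.comp_assoc[OF f g uz])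
      also have "\<dots> = Comp C (Comp C (FArr G (FArr F g)) (\<eta> y)) f" using natural[OF g] by simp
      also have "\<dots> = Comp C (FArr G (FArr F g)) (Comp C (\<eta> y) f)" by (rule C.comp_assoc[OF f uy GG, symmetric])
      also have "\<dots> = Comp C (FArr G (FArr F g)) (Comp C (FArr G (FArr F f)) (\<eta> x))" using natural[OF f] by simp
      also have "\<dots> = Comp C (Comp C (FArr G (FArr F g)) (FArr G (FArr F f))) (\<eta> x)" by (rule C.comp_assoc[OF ux GF GG])
      also have "\<dots> = Comp C (FArr G (Comp D (FArr F g) (FArr F f))) (\<eta> x)" using G.map_comp[OF Ff Fg] by simp
      finally show "Comp C (FArr G (FArr F (Comp C g f))) (\<eta> x) = Comp C (FArr G (Comp D (FArr F g) (FArr F f))) (\<eta> x)" .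
    qed
  qed
  show ?thesis
  proof (intro adjunction.intro F G adjunction_axioms.intro)
    show "bij_betw (\<lambda>h. Comp C (FArr G h) (\<eta> x)) (hom D (FObj F x) y) (hom C x (FObj G y))"
      if x: "x \<in> Obj C" and y: "y \<in> Obj D" for x y
      unfolding bij_betw_def
    proof (intro conjI subset_antisym subsetI)
      show "inj_on (\<lambda>h. Comp C (FArr G h) (\<eta> x)) (hom D (FObj F x) y)"
        by (rule inj_onI) (rule uniq[OF x y])
      show "f \<in> hom C x (FObj G y)" if "f \<in> (\<lambda>h. Comp C (FArr G h) (\<eta> x)) ` hom D (FObj F x) y" for f
        using that C.comp_hom[OF unit[OF x] G.map_hom] by blast
      show "f \<in> (\<lambda>h. Comp C (FArr G h) (\<eta> x)) ` hom D (FObj F x) y" if "f \<in> hom C x (FObj G y)" for f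
        using universal[OF x y that] by blast
    qed
    show "Comp C (FArr G (Comp D g (Comp D h (FArr F f)))) (\<eta> x') =
        Comp C (FArr G g) (Comp C (Comp C (FArr G h) (\<eta> x)) f)"
      if f: "f \<in> hom C x' x" and g: "g \<in> hom D y y'" and h: "h \<in> hom D (FObj F x) y" for f g h x x' y y'
    proof -
      note Ff = arr[OF f] and GFf = G.map_hom[OF arr[OF f]] and Gg = G.map_hom[OF g] and Gh = G.map_hom[OF h]
      note ux = unit[OF ob(2)[OF f]] and ux' = unit[OF ob(1)[OF f]]
      have "FArr G (Comp D g (Comp D h (FArr F f))) = Comp C (FArr G g) (Comp C (FArr G h) (FArr G (FArr F f)))"
        using G.map_comp[OF G.C.comp_hom[OF Ff h] g] G.map_comp[OF Ff h] by simp
      then have "Comp C (FArr G (Comp D g (Comp D h (FArr F f)))) (\<eta> x') =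
          Comp C (FArr G g) (Comp C (Comp C (FArr G h) (FArr G (FArr F f))) (\<eta> x'))"
        using C.comp_assoc[OF ux' C.comp_hom[OF GFf Gh] Gg] by simp
      also have "Comp C (Comp C (FArr G h) (FArr G (FArr F f))) (\<eta> x') = Comp C (FArr G h) (Comp C (FArr G (FArr F f)) (\<eta> x'))"
        by (rule C.comp_assoc[OF ux' GFf Gh, symmetric])
      also have "\<dots> = Comp C (FArr G h) (Comp C (\<eta> x) f)" using natural[OF f] by simp
      also have "\<dots> = Comp C (Comp C (FArr G h) (\<eta> x)) f" by (rule C.comp_assoc[OF f ux Gh])
      finally show ?thesis .
    qed
  qed
qed

section \<open>Absorption laws for a split idempotent\<close>

context ambient
begin

lemma cmp_extend:
  assumes A: "internal_category V A"
    and t: "u \<in> Arr V" "v \<in> Arr V" "w \<in> Arr V" "Dom V u = Dom V w" "Dom V v = Dom V w"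
      "Cod V u = A1 A" "Cod V v = A1 A" "Cod V w = A1 A" "d0 A \<cdot> u = d1 A \<cdot> v" "d0 A \<cdot> v = d1 A \<cdot> w"
    and e: "cmp V A u v = z"
  shows "cmp V A u (cmp V A v w) = cmp V A z w"
  using cmp_assoc[OF A t] e by simp

text \<open>With \<open>u = S R\<close> and \<open>R S\<close> an identity,
  \<open>R u = (R S) R = R\<close> and \<open>u S = S (R S) = S\<close>.\<close>

lemma split_absorb:
  assumes A: "internal_category V A" "is_split V A" "idem A u"
  shows "cmp V A (Rt A u) u = Rt A u" "cmp V A u (Sc A u) = Sc A u"
proof -
  note s = split_props[OF A] and u = idemD[OF A(3)]
  have "cmp V A (Rt A u) (cmp V A (Sc A u) (Rt A u)) = cmp V A (iident A \<cdot> d1 A \<cdot> Rt A u) (Rt A u)"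
    by (rule cmp_extend[OF A(1)]) (use s u in simp_all)
  then show "cmp V A (Rt A u) u = Rt A u" using s u A by simp
  have "cmp V A (cmp V A (Sc A u) (Rt A u)) (Sc A u) = cmp V A (Sc A u) (cmp V A (Rt A u) (Sc A u))"
    by (rule cmp_assoc[OF A(1)]) (use s u in simp_all)
  also have "\<dots> = Sc A u" unfolding s(11) by (rule cmp_ident(2)[OF A(1)]) (use s in simp_all)
  finally show "cmp V A u (Sc A u) = Sc A u" using s by simp
qed

end

subsection \<open>Extending an enriched functor along the unit\<close>

locale transpose = ambient V \<kappa> for V :: "('o, 'a) cat" and \<kappa> :: "'a rel" +
  fixes M :: "('o, 'a) ecat" and A :: "('o, 'a) icat_split" and F :: "('o, 'a) efun"
  assumes M: "small_ecat M" and A: "internal_category V A" "is_canonical_split V A"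
    and F: "enriched_functor V F" and esrc_F: "esrc F = M" and etgt_F: "etgt F = En_obj V A"
begin

lemmas F_typing = efun_typing[OF F, unfolded esrc_F etgt_F]
lemmas F_ec = efun_ec[OF F, unfolded esrc_F etgt_F]
lemmas F_eid = efun_eid[OF F, unfolded esrc_F etgt_F]
lemmas E = small_ecatD(1)[OF M]
lemmas sp = canonical_split_is_split[OF A(2)]

lemma F_obj:
  assumes "a \<in> eobj M"
  shows "efun0 F a \<in> hom V (trm V) (A0 A)"
  using F_typing(1)[OF assms] by (simp del: in_hom)

text \<open>The arrow into \<open>A1 A\<close> named by the image of a generalized element of a hom-object.\<close>

definition tr :: "'a \<Rightarrow> 'a \<Rightarrow> 'a \<Rightarrow> 'a" where
  "tr a b x = up V A (efun0 F a) (efun0 F b) \<cdot> efun1 F a b \<cdot> x"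

lemma tr_props:
  assumes a: "a \<in> eobj M" and b: "b \<in> eobj M" and x: "x \<in> Arr V" "Cod V x = ehom M a b"
  shows "tr a b x \<in> Arr V" "Dom V (tr a b x) = Dom V x" "Cod V (tr a b x) = A1 A"
    "d0 A \<cdot> tr a b x = efun0 F a \<cdot> bang V (Dom V x)" "d1 A \<cdot> tr a b x = efun0 F b \<cdot> bang V (Dom V x)"
    "k \<in> Arr V \<Longrightarrow> Cod V k = Dom V x \<Longrightarrow> tr a b x \<cdot> k = tr a b (x \<cdot> k)"
  unfolding tr_def using A(1) F_typing[OF a] F_typing[OF b] b x by simp_all

lemma tr_ec:
  assumes a: "a \<in> eobj M" and b: "b \<in> eobj M" and c: "c \<in> eobj M"
    and t: "x \<in> Arr V" "y \<in> Arr V" "Dom V x = Dom V y" "Cod V x = ehom M b c" "Cod V y = ehom M a b"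
  shows "tr a c (ec M a b c x y) = cmp V A (tr b c x) (tr a b y)"
  unfolding tr_def F_ec[OF a b c t]
  using A(1) F_typing[OF a] F_typing[OF b] F_typing[OF c] a b c t by simp

lemma tr_eid:
  assumes a: "a \<in> eobj M" and t: "t \<in> Arr V" "Cod V t = trm V"
  shows "tr a a (eid M a \<cdot> t) = iident A \<cdot> efun0 F a \<cdot> t"
  unfolding tr_def F_eid(2)[OF a t] using A(1) F_typing[OF a] t by simp

lemma tr_idem:
  assumes a: "a \<in> eobj M" and x: "x \<in> Arr V" "Cod V x = ehom M a a" "ec M a a a x x = x"
  shows "idem A (tr a a x)"
  using tr_props[OF a a x(1,2)] tr_ec[OF a a a x(1,1) refl x(2,2)] x(3) unfolding idem_def by simp

text \<open>The value of the extension at the element \<open>(p, x, q)\<close>.\<close>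

definition val :: "'a \<Rightarrow> 'a \<Rightarrow> 'a \<Rightarrow> 'a \<Rightarrow> 'a \<Rightarrow> 'a" where
  "val a b p x q = cmp V A (Rt A (tr b b (eps V M b \<cdot> p)))
     (cmp V A (tr a b x) (Sc A (tr a a (eps V M a \<cdot> q))))"

text \<open>The object through which the image of the idempotent \<open>q\<close> splits in
  \<open>A\<close>.\<close>

definition val0 :: "'a \<Rightarrow> 'a \<Rightarrow> 'a" where
  "val0 a q = d1 A \<cdot> Rt A (tr a a (eps V M a \<cdot> q))"

lemma eps_idem:
  assumes "a \<in> eobj M" "q \<in> Arr V" "Cod V q = idems V M a"
  shows "idem A (tr a a (eps V M a \<cdot> q))"
  by (rule tr_idem) (use assms E in simp_all)

lemma sandwich_typing:
  assumes "trip M a b p x q"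
  shows "Rt A (tr b b (eps V M b \<cdot> p)) \<in> Arr V" "Dom V (Rt A (tr b b (eps V M b \<cdot> p))) = Dom V q"
    "Cod V (Rt A (tr b b (eps V M b \<cdot> p))) = A1 A" "d0 A \<cdot> Rt A (tr b b (eps V M b \<cdot> p)) = efun0 F b \<cdot> bang V (Dom V q)"
    "d1 A \<cdot> Rt A (tr b b (eps V M b \<cdot> p)) = val0 b p"
    "Sc A (tr a a (eps V M a \<cdot> q)) \<in> Arr V" "Dom V (Sc A (tr a a (eps V M a \<cdot> q))) = Dom V q"
    "Cod V (Sc A (tr a a (eps V M a \<cdot> q))) = A1 A" "d1 A \<cdot> Sc A (tr a a (eps V M a \<cdot> q)) = efun0 F a \<cdot> bang V (Dom V q)"
    "d0 A \<cdot> Sc A (tr a a (eps V M a \<cdot> q)) = val0 a q"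
    "tr a b x \<in> Arr V" "Dom V (tr a b x) = Dom V q" "Cod V (tr a b x) = A1 A"
    "d0 A \<cdot> tr a b x = efun0 F a \<cdot> bang V (Dom V q)" "d1 A \<cdot> tr a b x = efun0 F b \<cdot> bang V (Dom V q)"
    "cmp V A (tr a b x) (Sc A (tr a a (eps V M a \<cdot> q))) \<in> Arr V"
    "Dom V (cmp V A (tr a b x) (Sc A (tr a a (eps V M a \<cdot> q)))) = Dom V q"
    "Cod V (cmp V A (tr a b x) (Sc A (tr a a (eps V M a \<cdot> q)))) = A1 A"
    "d0 A \<cdot> cmp V A (tr a b x) (Sc A (tr a a (eps V M a \<cdot> q))) = val0 a q"
    "d1 A \<cdot> cmp V A (tr a b x) (Sc A (tr a a (eps V M a \<cdot> q))) = efun0 F b \<cdot> bang V (Dom V q)"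
proof -
  note d = tripD(1-10)[OF assms]
  note ep = eps_idem[OF d(2,3,4)] and eq = eps_idem[OF d(1,5,6)]
  note tp = tr_props[OF d(2,2), of "eps V M b \<cdot> p"] and tq = tr_props[OF d(1,1), of "eps V M a \<cdot> q"]
    and tx = tr_props[OF d(1,2,7,8)]
  note s1 = split_props[OF A(1) sp ep] and s2 = split_props[OF A(1) sp eq]
  show 1: "Rt A (tr b b (eps V M b \<cdot> p)) \<in> Arr V" "Dom V (Rt A (tr b b (eps V M b \<cdot> p))) = Dom V q"
    "Cod V (Rt A (tr b b (eps V M b \<cdot> p))) = A1 A" "d0 A \<cdot> Rt A (tr b b (eps V M b \<cdot> p)) = efun0 F b \<cdot> bang V (Dom V q)"
    "d1 A \<cdot> Rt A (tr b b (eps V M b \<cdot> p)) = val0 b p"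
    "Sc A (tr a a (eps V M a \<cdot> q)) \<in> Arr V" "Dom V (Sc A (tr a a (eps V M a \<cdot> q))) = Dom V q"
    "Cod V (Sc A (tr a a (eps V M a \<cdot> q))) = A1 A" "d1 A \<cdot> Sc A (tr a a (eps V M a \<cdot> q)) = efun0 F a \<cdot> bang V (Dom V q)"
    "d0 A \<cdot> Sc A (tr a a (eps V M a \<cdot> q)) = val0 a q"
    "tr a b x \<in> Arr V" "Dom V (tr a b x) = Dom V q" "Cod V (tr a b x) = A1 A"
    "d0 A \<cdot> tr a b x = efun0 F a \<cdot> bang V (Dom V q)" "d1 A \<cdot> tr a b x = efun0 F b \<cdot> bang V (Dom V q)"
    using s1 s2 tp tq tx d E by (simp_all add: val0_def)
  show "cmp V A (tr a b x) (Sc A (tr a a (eps V M a \<cdot> q))) \<in> Arr V"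
    "Dom V (cmp V A (tr a b x) (Sc A (tr a a (eps V M a \<cdot> q)))) = Dom V q"
    "Cod V (cmp V A (tr a b x) (Sc A (tr a a (eps V M a \<cdot> q)))) = A1 A"
    "d0 A \<cdot> cmp V A (tr a b x) (Sc A (tr a a (eps V M a \<cdot> q))) = val0 a q"
    "d1 A \<cdot> cmp V A (tr a b x) (Sc A (tr a a (eps V M a \<cdot> q))) = efun0 F b \<cdot> bang V (Dom V q)"
    using 1 A(1) by simp_all
qed

lemma val0_props:
  assumes "a \<in> eobj M" "q \<in> Arr V" "Cod V q = idems V M a"
  shows "val0 a q \<in> Arr V" "Dom V (val0 a q) = Dom V q" "Cod V (val0 a q) = A0 A"
    "k \<in> Arr V \<Longrightarrow> Cod V k = Dom V q \<Longrightarrow> val0 a q \<cdot> k = val0 a (q \<cdot> k)"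
proof -
  note t = tr_props[OF assms(1,1), of "eps V M a \<cdot> q"]
  show "val0 a q \<in> Arr V" "Dom V (val0 a q) = Dom V q" "Cod V (val0 a q) = A0 A"
    "k \<in> Arr V \<Longrightarrow> Cod V k = Dom V q \<Longrightarrow> val0 a q \<cdot> k = val0 a (q \<cdot> k)"
    unfolding val0_def
    using assms A(1) E split_props[OF A(1) sp eps_idem[OF assms]] split_comp[OF A(1) sp eps_idem[OF assms]] t
    by simp_all
qed

lemma val_props:
  assumes "trip M a b p x q"
  shows "val a b p x q \<in> Arr V" "Dom V (val a b p x q) = Dom V q" "Cod V (val a b p x q) = A1 A"
    "d0 A \<cdot> val a b p x q = val0 a q" "d1 A \<cdot> val a b p x q = val0 b p"
    "k \<in> Arr V \<Longrightarrow> Cod V k = Dom V q \<Longrightarrow> val a b p x q \<cdot> k = val a b (p \<cdot> k) (x \<cdot> k) (q \<cdot> k)"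
proof -
  note s = sandwich_typing[OF assms] and d = tripD(1-10)[OF assms]
  show "val a b p x q \<in> Arr V" "Dom V (val a b p x q) = Dom V q" "Cod V (val a b p x q) = A1 A"
    "d0 A \<cdot> val a b p x q = val0 a q" "d1 A \<cdot> val a b p x q = val0 b p"
    unfolding val_def using s A(1) by simp_all
  assume k: "k \<in> Arr V" "Cod V k = Dom V q"
  note t = tr_props[OF d(1,1), of "eps V M a \<cdot> q"] tr_props[OF d(2,2), of "eps V M b \<cdot> p"] tr_props[OF d(1,2,7,8)]
  have "Rt A (tr b b (eps V M b \<cdot> p)) \<cdot> k = Rt A (tr b b (eps V M b \<cdot> p \<cdot> k))"
    "Sc A (tr a a (eps V M a \<cdot> q)) \<cdot> k = Sc A (tr a a (eps V M a \<cdot> q \<cdot> k))"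
    using split_comp[OF A(1) sp eps_idem[OF d(2,3,4)]] split_comp[OF A(1) sp eps_idem[OF d(1,5,6)]] t k d E
    by simp_all
  moreover have "tr a b x \<cdot> k = tr a b (x \<cdot> k)" using t k d by simp
  ultimately show "val a b p x q \<cdot> k = val a b (p \<cdot> k) (x \<cdot> k) (q \<cdot> k)"
    unfolding val_def using s A(1) k d by simp
qed

text \<open>In \<open>R(F p) F x S(F q) R(F q) F y S(F r)\<close> the inner \<open>S R\<close> is
  \<open>F q\<close>, and \<open>F x\<close> absorbs it because \<open>x q = x\<close>.\<close>

lemma val_comp:
  assumes t: "trip M b c p x q" "trip M a b q y r"
  shows "cmp V A (val b c p x q) (val a b q y r) = val a c p (ec M a b c x y) r"
proof -
  let ?P = "Rt A (tr c c (eps V M c \<cdot> p))" and ?Q = "Sc A (tr b b (eps V M b \<cdot> q))" and ?Q' = "Rt A (tr b b (eps V M b \<cdot> q))"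
    and ?R = "Sc A (tr a a (eps V M a \<cdot> r))" and ?e = "tr b b (eps V M b \<cdot> q)" and ?x = "tr b c x" and ?y = "tr a b y"
  note s1 = sandwich_typing[OF t(1)] and s2 = sandwich_typing[OF t(2)] and d1 = tripD[OF t(1)] and d2 = tripD[OF t(2)]
  have dm: "Dom V q = Dom V r" using d2 by simp
  note e = idemD[OF eps_idem[OF d1(1,5,6)]] and te = tr_props[OF d1(1,1), of "eps V M b \<cdot> q"]
  have te': "?e \<in> Arr V" "Cod V ?e = A1 A" "Dom V ?e = Dom V r" "d0 A \<cdot> ?e = efun0 F b \<cdot> bang V (Dom V r)"
    "d1 A \<cdot> ?e = efun0 F b \<cdot> bang V (Dom V r)"
    using te d1 E dm by simp_all
  have 1: "cmp V A ?Q (cmp V A ?Q' (cmp V A ?y ?R)) = cmp V A ?e (cmp V A ?y ?R)"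
    by (rule cmp_extend[OF A(1)])
      (use s1 s2 dm A split_props(10)[OF A(1) sp eps_idem[OF d1(1,5,6)]] in simp_all)
  have "cmp V A ?x ?e = ?x"
    using tr_ec[OF d1(1,1,2,7), of "eps V M b \<cdot> q"] d1 E by simp
  then have 2: "cmp V A ?x (cmp V A ?e (cmp V A ?y ?R)) = cmp V A ?x (cmp V A ?y ?R)"
    by (intro cmp_extend[OF A(1)]) (use s1 s2 te' dm A in simp_all)
  have 3: "tr a c (ec M a b c x y) = cmp V A ?x ?y"
    by (rule tr_ec) (use d1 d2 in simp_all)
  have "cmp V A (val b c p x q) (val a b q y r) = cmp V A ?P (cmp V A (cmp V A ?x ?Q) (cmp V A ?Q' (cmp V A ?y ?R)))"
    unfolding val_def by (rule cmp_assoc[OF A(1)]) (use s1 s2 dm A in simp_all)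
  also have "cmp V A (cmp V A ?x ?Q) (cmp V A ?Q' (cmp V A ?y ?R)) = cmp V A ?x (cmp V A ?Q (cmp V A ?Q' (cmp V A ?y ?R)))"
    by (rule cmp_assoc[OF A(1)]) (use s1 s2 dm A in simp_all)
  also have "\<dots> = cmp V A ?x (cmp V A ?y ?R)" unfolding 1 2 ..
  also have "\<dots> = cmp V A (cmp V A ?x ?y) ?R"
    by (rule cmp_assoc[OF A(1), symmetric]) (use s1 s2 dm A in simp_all)
  finally show ?thesis unfolding val_def 3 .
qed

text \<open>The middle factor \<open>F q\<close> is absorbed by the section next to it, and what
  remains, the retraction after the section, is the identity of the splitting object.\<close>

lemma val_eps:
  assumes q: "a \<in> eobj M" "q \<in> Arr V" "Cod V q = idems V M a"
  shows "val a a q (eps V M a \<cdot> q) q = iident A \<cdot> val0 a q"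
proof -
  note i = eps_idem[OF q]
  show ?thesis
    unfolding val_def split_absorb(2)[OF A(1) sp i] split_props(11)[OF A(1) sp i] val0_def ..
qed

text \<open>The second condition on canonical splits, applied to \<open>f = F p\<close> and
  \<open>g = F x\<close>: the conjugate of \<open>g\<close> by the splitting of \<open>f\<close> is
  exactly \<open>val a a p x p\<close>.\<close>

lemma val_split:
  assumes t: "trip M a a p x p" and x: "ec M a a a x x = x"
  shows "idem A (val a a p x p)" "Rt A (val a a p x p) = val a a (om M a x) x p" "Sc A (val a a p x p) = val a a p x (om M a x)"
proof -
  note d = tripD[OF t]
  let ?f = "tr a a (eps V M a \<cdot> p)" and ?g = "tr a a x"
  note i = eps_idem[OF d(2,3,4)] and j = tr_idem[OF d(1,7,8) x]
  note tf = tr_props[OF d(1,1), of "eps V M a \<cdot> p"] and tg = tr_props[OF d(1,2,7,8)]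
  have dd: "Dom V ?f = Dom V ?g" "d0 A \<cdot> ?f = d1 A \<cdot> ?g" "d0 A \<cdot> ?g = d1 A \<cdot> ?f" using tf tg d E by simp_all
  have fg: "cmp V A ?f ?g = ?g" "cmp V A ?g ?f = ?g"
    using tr_ec[OF d(1,1,1), of "eps V M a \<cdot> p" x] tr_ec[OF d(1,1,1), of x "eps V M a \<cdot> p"] d E by simp_all
  then have fgf: "cmp V A ?f (cmp V A ?g ?f) = ?g" by simp
  note c = canonical_split_cond[OF A i j dd(1,2) fgf]
  have "cmp V A (val a a p x p) (val a a p x p) = val a a p x p" using val_comp[OF t t] x by simp
  then show "idem A (val a a p x p)" unfolding idem_def using val_props(1,3-5)[OF t] by simp
  have e: "eps V M a \<cdot> om M a x = x" using om_typing(4)[OF E d(1,7,8) x] .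
  note sf = split_props[OF A(1) sp i] and sg = split_props[OF A(1) sp j] and ii = idemD[OF i] and jj = idemD[OF j]
  \<comment> \<open>\<open>val\<close> keeps the middle factor \<open>F x\<close>, whereas the
    condition omits it; the retraction of \<open>F x\<close> absorbs it.\<close>
  have "cmp V A (Rt A ?g) (cmp V A ?g (Sc A ?f)) = cmp V A (Rt A ?g) (Sc A ?f)"
    by (rule cmp_extend[OF A(1) _ _ _ _ _ _ _ _ _ _ split_absorb(1)[OF A(1) sp j]]) (use sf sg jj dd in simp_all)
  then show "Rt A (val a a p x p) = val a a (om M a x) x p"
    unfolding val_def e using c(1) by simp
  show "Sc A (val a a p x p) = val a a p x (om M a x)"
    unfolding val_def e split_absorb(2)[OF A(1) sp j] using c(2) by simp
qed

definition extension :: "('o, 'a) ifun" where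
  "extension = \<lparr>isrc = Si_obj V M, itgt = A,
     ifun0 = cotuple V (eobj M) (idems V M) (A0 A) (\<lambda>a. val0 a (Ident V (idems V M a))),
     ifun1 = cotuple V (eobj M \<times> eobj M) (\<lambda>(a, b). Si_hom V M a b) (A1 A)
       (\<lambda>(a, b). val a b (ah1 V M a b) (ah2 V M a b) (ah3 V M a b))\<rparr>"

lemma extension_simps [simp]: "isrc extension = Si_obj V M" "itgt extension = A"
  by (simp_all add: extension_def)

text \<open>The components are \<open>val0\<close> and \<open>val\<close> at generic elements. Both
  are stable under restriction of the stage, which yields the value at every element.\<close>

lemma extension_props:
  shows "ifun0 extension \<in> Arr V" "Dom V (ifun0 extension) = Si0 V M" "Cod V (ifun0 extension) = A0 A"
    "ifun1 extension \<in> Arr V" "Dom V (ifun1 extension) = Si1 V M" "Cod V (ifun1 extension) = A1 A"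
    and extension_inj0: "\<And>a q. a \<in> eobj M \<Longrightarrow> q \<in> Arr V \<Longrightarrow> Cod V q = idems V M a \<Longrightarrow>
      ifun0 extension \<cdot> inj0 V M a \<cdot> q = val0 a q"
    and extension_el: "\<And>a b p x q. trip M a b p x q \<Longrightarrow> ifun1 extension \<cdot> el M a b p x q = val a b p x q"
proof -
  have v0: "val0 a (Ident V (idems V M a)) \<in> hom V (idems V M a) (A0 A)" if "a \<in> eobj M" for a
    using val0_props[OF that, of "Ident V (idems V M a)"] E that by simp
  have v1: "val a b (ah1 V M a b) (ah2 V M a b) (ah3 V M a b) \<in> hom V (Si_hom V M a b) (A1 A)"
    if "a \<in> eobj M" "b \<in> eobj M" for a b
    using val_props[OF Si_hom_props(16)[OF E that]] E that by simp
  have v1': "\<And>i. i \<in> eobj M \<times> eobj M \<Longrightarrow> (\<lambda>(a, b). val a b (ah1 V M a b) (ah2 V M a b) (ah3 V M a b)) i \<in>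
      hom V ((\<lambda>(a, b). Si_hom V M a b) i) (A1 A)" using v1 by auto
  have o1: "\<And>i. i \<in> eobj M \<times> eobj M \<Longrightarrow> (\<lambda>(a, b). Si_hom V M a b) i \<in> Obj V" using E by auto
  have o0: "\<And>a. a \<in> eobj M \<Longrightarrow> idems V M a \<in> Obj V" using E by auto
  have A01: "A0 A \<in> Obj V" "A1 A \<in> Obj V" using A(1) by simp_all
  note c0 = cotuple_props[OF small_ecatD(2)[OF M] A01(1) o0 v0] and c1 = cotuple_props[OF Si_coproducts(4)[OF M] A01(2) o1 v1']
  show ty: "ifun0 extension \<in> Arr V" "Dom V (ifun0 extension) = Si0 V M" "Cod V (ifun0 extension) = A0 A"
    "ifun1 extension \<in> Arr V" "Dom V (ifun1 extension) = Si1 V M" "Cod V (ifun1 extension) = A1 A"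
    using c0(1-3) c1(1-3) by (simp_all add: extension_def Si0_def Si1_def)
  show "ifun0 extension \<cdot> inj0 V M a \<cdot> q = val0 a q" if "a \<in> eobj M" "q \<in> Arr V" "Cod V q = idems V M a" for a q
  proof -
    have "ifun0 extension \<cdot> inj0 V M a = val0 a (Ident V (idems V M a))"
      using c0(4)[OF _ _ that(1)] by (simp add: extension_def inj0_def)
    from comp_extend[OF this, of q] show ?thesis
      using ty M that val0_props(4)[OF that(1), of "Ident V (idems V M a)" q] E by simp
  qed
  show "ifun1 extension \<cdot> el M a b p x q = val a b p x q" if t: "trip M a b p x q" for a b p x q
  proof -
    note d = tripD(1-10)[OF t] and m = mk_props[OF E t]
    note v = Si_hom_props(16)[OF E d(1,2)]
    have "ifun1 extension \<cdot> inj1 V M a b = val a b (ah1 V M a b) (ah2 V M a b) (ah3 V M a b)"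
      using c1(4)[where i = "(a, b)"] d by (simp add: extension_def inj1_def)
    from comp_extend[OF this, of "mk M a b p x q"] show ?thesis
      using ty M d E m val_props(6)[OF v, of "mk M a b p x q"] by (simp add: el_def)
  qed
qed

text \<open>Tested on triples, the functor equations become the typing rules of \<open>val\<close>,
  \<open>val_eps\<close> and \<open>val_comp\<close>.\<close>

lemma extension_functor: "internal_functor V extension"
proof -
  let ?S = "Si_icat V M" let ?F0 = "ifun0 extension" and ?F1 = "ifun1 extension"
  note ty = Si_icat_typing[OF M] and o = Si_obj_typing[OF M] and e = extension_props(1-6) and I = Si_internal[OF M]
  have d: "d0 A \<cdot> ?F1 = ?F0 \<cdot> d0 ?S" "d1 A \<cdot> ?F1 = ?F0 \<cdot> d1 ?S"
  proof -
    let ?i = "Ident V (Si1 V M)"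
    have *: "(d0 A \<cdot> ?F1) \<cdot> k = (?F0 \<cdot> d0 ?S) \<cdot> k" "(d1 A \<cdot> ?F1) \<cdot> k = (?F0 \<cdot> d1 ?S) \<cdot> k"
      if k: "k \<in> Arr V" "Cod V k = Dom V ?i" "trip M a b p x q" "Dom V k = Dom V q" "?i \<cdot> k = el M a b p x q" for k a b p x q
    proof -
      have k': "k = el M a b p x q" using k o by simp
      note dd = tripD(1-10)[OF k(3)]
      show "(d0 A \<cdot> ?F1) \<cdot> k = (?F0 \<cdot> d0 ?S) \<cdot> k" "(d1 A \<cdot> ?F1) \<cdot> k = (?F0 \<cdot> d1 ?S) \<cdot> k"
        using k(1,2,3) e ty o A(1) M dd extension_el[OF k(3)] extension_inj0[OF dd(1,5,6)] extension_inj0[OF dd(2,3,4)]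
          val_props[OF k(3)] unfolding k' by simp_all
    qed
    show "d0 A \<cdot> ?F1 = ?F0 \<cdot> d0 ?S" by (rule el_cases[OF M, of ?i]; (rule *(1))?; use e ty o A(1) in simp)
    show "d1 A \<cdot> ?F1 = ?F0 \<cdot> d1 ?S" by (rule el_cases[OF M, of ?i]; (rule *(2))?; use e ty o A(1) in simp)
  qed
  have id: "?F1 \<cdot> iident ?S = iident A \<cdot> ?F0"
  proof -
    let ?i = "Ident V (Si0 V M)"
    have *: "(?F1 \<cdot> iident ?S) \<cdot> k = (iident A \<cdot> ?F0) \<cdot> k"
      if k: "k \<in> Arr V" "Cod V k = Dom V ?i" "a \<in> eobj M" "q \<in> Arr V" "Dom V q = Dom V k" "Cod V q = idems V M a"
        "?i \<cdot> k = inj0 V M a \<cdot> q" for k a q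
    proof -
      have k': "k = inj0 V M a \<cdot> q" using k o by simp
      show ?thesis
        using k(1-6) e ty o A(1) M extension_el[OF trip_eps[OF E k(3,4,6)]] extension_inj0[OF k(3,4,6)]
          val_eps[OF k(3,4,6)] unfolding k' by simp
    qed
    show ?thesis by (rule inj0_cases[OF M, of ?i]; (rule *)?; use e ty o A(1) in simp)
  qed
  have comp: "?F1 \<cdot> cmp V ?S u v = cmp V A (?F1 \<cdot> u) (?F1 \<cdot> v)"
    if uv: "u \<in> Arr V" "Cod V u = Si1 V M" "v \<in> Arr V" "Cod V v = Si1 V M" "Dom V u = Dom V v" "d0 ?S \<cdot> u = d1 ?S \<cdot> v" for u v
  proof -
    have "d0 A \<cdot> ?F1 \<cdot> u = ?F0 \<cdot> d0 ?S \<cdot> u" "d1 A \<cdot> ?F1 \<cdot> v = ?F0 \<cdot> d1 ?S \<cdot> v"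
      using comp_extend[OF d(1), of u] comp_extend[OF d(2), of v] uv e ty A(1) by simp_all
    then have c: "d0 A \<cdot> ?F1 \<cdot> u = d1 A \<cdot> ?F1 \<cdot> v" using uv(6) by simp
    note cS = cmp_typing(1-3)[OF I, of u v] cmp_comp[OF I, of u v]
    note cA = cmp_typing(1-3)[OF A(1), of "?F1 \<cdot> u" "?F1 \<cdot> v"] cmp_comp[OF A(1), of "?F1 \<cdot> u" "?F1 \<cdot> v"]
    have *: "(?F1 \<cdot> cmp V ?S u v) \<cdot> k = cmp V A (?F1 \<cdot> u) (?F1 \<cdot> v) \<cdot> k"
      if k: "k \<in> Arr V" "Cod V k = Dom V v" "trip M b c p x q" "trip M a b q y r" "Dom V k = Dom V r"
        "u \<cdot> k = el M b c p x q" "v \<cdot> k = el M a b q y r" for k a b c p x q y r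
    proof -
      have "trip M a c p (ec M a b c x y) r" by (rule trip_comp[OF E k(3,4)]) (use tripD(9)[OF k(4)] in simp)
      from extension_el[OF this] val_comp[OF k(3,4)]
      have "?F1 \<cdot> el M a c p (ec M a b c x y) r = cmp V A (?F1 \<cdot> el M b c p x q) (?F1 \<cdot> el M a b q y r)"
        using extension_el[OF k(3)] extension_el[OF k(4)] by simp
      then show ?thesis
        using cS cA c uv e k M by simp
    qed
    show ?thesis
      by (rule Si_composable_cases[OF M uv]; (rule *)?; use cS(1-3) cA(1-3) c uv e in simp)
  qed
  show ?thesis
    by (rule internal_functorI) (use Si_obj_internal[OF M] A(1) e d id comp in \<open>simp_all\<close>)
qed

text \<open>At a triple \<open>(p, x, p)\<close> both sides are explicit: \<open>Si_split_el\<close>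
  evaluates the split of the source and \<open>val_split\<close> that of the target.\<close>

lemma extension_preserves: "preserves_split V extension"
proof -
  let ?S = "Si_icat V M" let ?F1 = "ifun1 extension" let ?T = "Si_obj V M"
  note G = extension_functor and e = extension_props(1-6) and spS = Si_is_split[OF M] and IS = Si_obj_internal[OF M]
  have "?F1 \<cdot> Rt ?T u = Rt A (?F1 \<cdot> u) \<and> ?F1 \<cdot> Sc ?T u = Sc A (?F1 \<cdot> u)" if u: "idem ?S u" for u
  proof -
    have iu: "idem A (?F1 \<cdot> u)" using ifun_idem[OF G] u by simp
    have iu': "idem ?T u" using u by simp
    note s1 = split_props(1-6)[OF IS spS iu'] split_comp[OF IS spS iu'] and s2 = split_props(1-6)[OF A(1) sp iu] split_comp[OF A(1) sp iu]
    note uu = idemD(1,2)[OF u]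
    have *: "(?F1 \<cdot> Rt ?T u) \<cdot> k = Rt A (?F1 \<cdot> u) \<cdot> k" "(?F1 \<cdot> Sc ?T u) \<cdot> k = Sc A (?F1 \<cdot> u) \<cdot> k"
      if k: "k \<in> Arr V" "Cod V k = Dom V u" "trip M a a p x p" "ec M a a a x x = x" "Dom V k = Dom V p" "u \<cdot> k = el M a a p x p"
      for k a p x
    proof -
      note t = trip_om[OF E k(3,4)]
      have "?F1 \<cdot> Rt ?T (u \<cdot> k) = Rt A (?F1 \<cdot> u \<cdot> k)" "?F1 \<cdot> Sc ?T (u \<cdot> k) = Sc A (?F1 \<cdot> u \<cdot> k)"
        unfolding k(6) extension_el[OF k(3)] val_split(2,3)[OF k(3,4)] Si_split_el[OF M k(3,4)]
          extension_el[OF t(1)] extension_el[OF t(2)] by simp_all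
      then show "(?F1 \<cdot> Rt ?T u) \<cdot> k = Rt A (?F1 \<cdot> u) \<cdot> k" "(?F1 \<cdot> Sc ?T u) \<cdot> k = Sc A (?F1 \<cdot> u) \<cdot> k"
        using s1 s2 uu e k(1,2) by simp_all
    qed
    show ?thesis
    proof
      show "?F1 \<cdot> Rt ?T u = Rt A (?F1 \<cdot> u)"
        by (rule Si_idem_cases[OF M u]; (rule *(1))?; use s1(1-6) s2(1-6) uu e in simp)
      show "?F1 \<cdot> Sc ?T u = Sc A (?F1 \<cdot> u)"
        by (rule Si_idem_cases[OF M u]; (rule *(2))?; use s1(1-6) s2(1-6) uu e in simp)
    qed
  qed
  then show ?thesis
    using preserves_split_iff[OF G] spS sp by simp
qed

end

context ambient
begin

subsection \<open>The unit\<close>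

text \<open>The identity of \<open>a\<close>, regarded as a point of the object of idempotents on
  \<open>a\<close>. It names the object of the completion that represents \<open>a\<close>.\<close>

definition base :: "('o, 'a) ecat \<Rightarrow> 'a \<Rightarrow> 'a" where
  "base M a = om M a (eid M a)"

lemma base_props [simp]:
  assumes M: "small_ecat M" and a: "a \<in> eobj M"
  shows "base M a \<in> Arr V" "Dom V (base M a) = trm V" "Cod V (base M a) = idems V M a"
    "eps V M a \<cdot> base M a = eid M a"
    "t \<in> Arr V \<Longrightarrow> Cod V t = trm V \<Longrightarrow> eps V M a \<cdot> base M a \<cdot> t = eid M a \<cdot> t"
proof -
  note E = small_ecatD(1)[OF M]
  have "bang V (trm V) = Ident V (trm V)" by (rule to_trm_eq) simp_all
  then have "ec M a a a (eid M a) (eid M a) = eid M a"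
    using ec_ident(1)[OF E a a, of "eid M a" "bang V (trm V)"] E a by simp
  then show *: "base M a \<in> Arr V" "Dom V (base M a) = trm V" "Cod V (base M a) = idems V M a"
    "eps V M a \<cdot> base M a = eid M a"
    using om_typing[OF E a, of "eid M a"] E a by (simp_all add: base_def)
  show "t \<in> Arr V \<Longrightarrow> Cod V t = trm V \<Longrightarrow> eps V M a \<cdot> base M a \<cdot> t = eid M a \<cdot> t"
    using comp_extend[OF *(4), of t] * E a by simp
qed

text \<open>The element \<open>(1, x, 1)\<close>.\<close>

definition unit_el :: "('o, 'a) ecat \<Rightarrow> 'a \<Rightarrow> 'a \<Rightarrow> 'a \<Rightarrow> 'a" where
  "unit_el M a b x = el M a b (base M b \<cdot> bang V (Dom V x)) x (base M a \<cdot> bang V (Dom V x))"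

lemma trip_base:
  assumes M: "small_ecat M" and ab: "a \<in> eobj M" "b \<in> eobj M" and x: "x \<in> Arr V" "Cod V x = ehom M a b"
    and t: "t \<in> Arr V" "Dom V t = Dom V x" "Cod V t = trm V" "t' \<in> Arr V" "Dom V t' = Dom V x" "Cod V t' = trm V"
  shows "trip M a b (base M b \<cdot> t) x (base M a \<cdot> t')"
  unfolding trip_def using assms by simp

lemma unit_el_props:
  assumes M: "small_ecat M" and ab: "a \<in> eobj M" "b \<in> eobj M" and x: "x \<in> Arr V" "Cod V x = ehom M a b"
  shows "unit_el M a b x \<in> Arr V" "Dom V (unit_el M a b x) = Dom V x" "Cod V (unit_el M a b x) = Si1 V M"
    "d0 (Si_icat V M) \<cdot> unit_el M a b x = (inj0 V M a \<cdot> base M a) \<cdot> bang V (Dom V x)"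
    "d1 (Si_icat V M) \<cdot> unit_el M a b x = (inj0 V M b \<cdot> base M b) \<cdot> bang V (Dom V x)"
    "k \<in> Arr V \<Longrightarrow> Cod V k = Dom V x \<Longrightarrow> unit_el M a b x \<cdot> k = unit_el M a b (x \<cdot> k)"
  using trip_base[OF assms, of "bang V (Dom V x)" "bang V (Dom V x)"] assms by (simp_all add: unit_el_def)

text \<open>On hom-objects the unit is prescribed at the identity, the generic element;
  \<open>up\<close> is monic, so this determines the factorization and its value at all
  elements.\<close>

definition eta :: "('o, 'a) ecat \<Rightarrow> ('o, 'a) efun" where
  "eta M = \<lparr>esrc = M, etgt = En_obj V (Si_obj V M), efun0 = (\<lambda>a\<in>eobj M. inj0 V M a \<cdot> base M a),
     efun1 = restrict2 (eobj M) (\<lambda>a b. factor V (up V (Si_obj V M) (inj0 V M a \<cdot> base M a) (inj0 V M b \<cdot> base M b))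
       (unit_el M a b (Ident V (ehom M a b))))\<rparr>"

lemma eta_simps [simp]:
  "esrc (eta M) = M" "etgt (eta M) = En_obj V (Si_obj V M)"
  "a \<in> eobj M \<Longrightarrow> efun0 (eta M) a = inj0 V M a \<cdot> base M a"
  by (simp_all add: eta_def)

lemma eta_arr:
  assumes M: "small_ecat M" and ab: "a \<in> eobj M" "b \<in> eobj M"
  defines "\<alpha> \<equiv> inj0 V M a \<cdot> base M a" and "\<beta> \<equiv> inj0 V M b \<cdot> base M b"
  shows "\<alpha> \<in> hom V (trm V) (A0 (Si_obj V M))" "\<beta> \<in> hom V (trm V) (A0 (Si_obj V M))"
    "efun1 (eta M) a b \<in> Arr V" "Dom V (efun1 (eta M) a b) = ehom M a b"
    "Cod V (efun1 (eta M) a b) = Dom V (up V (Si_obj V M) \<alpha> \<beta>)"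
    "x \<in> Arr V \<Longrightarrow> Cod V x = ehom M a b \<Longrightarrow> up V (Si_obj V M) \<alpha> \<beta> \<cdot> efun1 (eta M) a b \<cdot> x = unit_el M a b x"
    "up V (Si_obj V M) \<alpha> \<beta> \<cdot> efun1 (eta M) a b = unit_el M a b (Ident V (ehom M a b))"
proof -
  note E = small_ecatD(1)[OF M] and I = Si_obj_internal[OF M]
  show \<alpha>: "\<alpha> \<in> hom V (trm V) (A0 (Si_obj V M))" and \<beta>: "\<beta> \<in> hom V (trm V) (A0 (Si_obj V M))"
    using M E ab by (simp_all add: \<alpha>_def \<beta>_def)
  let ?i = "Ident V (ehom M a b)"
  have i: "?i \<in> Arr V" "Cod V ?i = ehom M a b" "Dom V ?i = ehom M a b" using E ab by simp_all
  note b = unit_el_props[OF M ab i(1,2), folded \<alpha>_def \<beta>_def, unfolded i(3)]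
  have e: "efun1 (eta M) a b = factor V (up V (Si_obj V M) \<alpha> \<beta>) (unit_el M a b ?i)"
    using ab by (simp add: eta_def restrict2_def \<alpha>_def \<beta>_def)
  show *: "efun1 (eta M) a b \<in> Arr V" "Dom V (efun1 (eta M) a b) = ehom M a b"
    "Cod V (efun1 (eta M) a b) = Dom V (up V (Si_obj V M) \<alpha> \<beta>)"
    "up V (Si_obj V M) \<alpha> \<beta> \<cdot> efun1 (eta M) a b = unit_el M a b ?i"
    unfolding e using up_factor[OF I \<alpha> \<beta>, of "unit_el M a b ?i"] b by simp_all
  show "x \<in> Arr V \<Longrightarrow> Cod V x = ehom M a b \<Longrightarrow> up V (Si_obj V M) \<alpha> \<beta> \<cdot> efun1 (eta M) a b \<cdot> x = unit_el M a b x"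
    using comp_extend[OF *(4), of x] * up_typing(1)[OF I \<alpha> \<beta>] b by simp
qed

lemma unit_el_cmp:
  assumes M: "small_ecat M" and abc: "a \<in> eobj M" "b \<in> eobj M" "c \<in> eobj M"
    and t: "x \<in> Arr V" "y \<in> Arr V" "Dom V x = Dom V y" "Cod V x = ehom M b c" "Cod V y = ehom M a b"
  shows "cmp V (Si_icat V M) (unit_el M b c x) (unit_el M a b y) = unit_el M a c (ec M a b c x y)"
proof -
  let ?b = "bang V (Dom V y)"
  have tr: "trip M b c (base M c \<cdot> ?b) x (base M b \<cdot> ?b)" "trip M a b (base M b \<cdot> ?b) y (base M a \<cdot> ?b)"
    using trip_base[OF M] abc t by simp_all
  show ?thesis
    using el_cmp[OF M tr] t M abc by (simp add: unit_el_def)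
qed

lemma unit_el_eid:
  assumes "small_ecat M" "a \<in> eobj M" "t \<in> Arr V" "Cod V t = trm V"
  shows "unit_el M a a (eid M a \<cdot> t) = iident (Si_icat V M) \<cdot> (inj0 V M a \<cdot> base M a) \<cdot> t"
proof -
  have "bang V (Dom V t) = t" by (rule to_trm_eq) (use assms in simp_all)
  then show ?thesis using assms by (simp add: unit_el_def)
qed

lemma eta_functor:
  assumes M: "small_ecat M"
  shows "enriched_functor V (eta M)"
proof (rule enriched_functorI)
  note E = small_ecatD(1)[OF M] and I = Si_obj_internal[OF M] and I' = Si_internal[OF M]
  show "enriched_category V (esrc (eta M))" "enriched_category V (etgt (eta M))" using E I by simp_all
  show "efun0 (eta M) \<in> eobj (esrc (eta M)) \<rightarrow>\<^sub>E eobj (etgt (eta M))"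
    using M by (auto simp: eta_def)
  show "efun1 (eta M) = restrict2 (eobj (esrc (eta M))) (efun1 (eta M))"
    by (intro ext) (simp add: eta_def restrict2_def)
  show "efun1 (eta M) a b \<in> hom V (ehom (esrc (eta M)) a b) (ehom (etgt (eta M)) (efun0 (eta M) a) (efun0 (eta M) b))"
    if "a \<in> eobj (esrc (eta M))" "b \<in> eobj (esrc (eta M))" for a b
    using eta_arr(3-5)[OF M] that by simp
  show "efun1 (eta M) a c \<cdot> ec (esrc (eta M)) a b c g f =
        ec (etgt (eta M)) (efun0 (eta M) a) (efun0 (eta M) b) (efun0 (eta M) c) (efun1 (eta M) b c \<cdot> g) (efun1 (eta M) a b \<cdot> f)"
    if abc: "a \<in> eobj (esrc (eta M))" "b \<in> eobj (esrc (eta M))" "c \<in> eobj (esrc (eta M))"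
      and t: "g \<in> hom V X (ehom (esrc (eta M)) b c)" "f \<in> hom V X (ehom (esrc (eta M)) a b)" for a b c g f X
  proof -
    have o: "a \<in> eobj M" "b \<in> eobj M" "c \<in> eobj M" using abc by simp_all
    note ac = eta_arr[OF M o(1,3)] and bc = eta_arr[OF M o(2,3)] and ab = eta_arr[OF M o(1,2)]
    have tt: "g \<in> Arr V" "f \<in> Arr V" "Dom V g = Dom V f" "Cod V g = ehom M b c" "Cod V f = ehom M a b" using t by auto
    let ?g = "efun1 (eta M) b c \<cdot> g" and ?f = "efun1 (eta M) a b \<cdot> f"
    have gf: "?g \<in> Arr V" "?f \<in> Arr V" "Dom V ?g = Dom V ?f"
      "Cod V ?g = Dom V (up V (Si_obj V M) (inj0 V M b \<cdot> base M b) (inj0 V M c \<cdot> base M c))"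
      "Cod V ?f = Dom V (up V (Si_obj V M) (inj0 V M a \<cdot> base M a) (inj0 V M b \<cdot> base M b))"
      using ab(3-5) bc(3-5) tt by simp_all
    note en = En_ec[OF I ab(1) ab(2) bc(2) gf]
    have "efun1 (eta M) a c \<cdot> ec M a b c g f =
      ec (En_obj V (Si_obj V M)) (inj0 V M a \<cdot> base M a) (inj0 V M b \<cdot> base M b) (inj0 V M c \<cdot> base M c) ?g ?f"
    proof (rule up_eqI[OF I ac(1,2)])
      have "up V (Si_obj V M) (inj0 V M a \<cdot> base M a) (inj0 V M c \<cdot> base M c) \<cdot> efun1 (eta M) a c \<cdot> ec M a b c g f =
          unit_el M a c (ec M a b c g f)"
        by (rule ac(6)) (use E o tt in simp_all)
      also have "\<dots> = cmp V (Si_obj V M) (unit_el M b c g) (unit_el M a b f)" using unit_el_cmp[OF M o tt] by simp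
      finally show "up V (Si_obj V M) (inj0 V M a \<cdot> base M a) (inj0 V M c \<cdot> base M c) \<cdot> efun1 (eta M) a c \<cdot> ec M a b c g f =
          up V (Si_obj V M) (inj0 V M a \<cdot> base M a) (inj0 V M c \<cdot> base M c) \<cdot>
          ec (En_obj V (Si_obj V M)) (inj0 V M a \<cdot> base M a) (inj0 V M b \<cdot> base M b) (inj0 V M c \<cdot> base M c) ?g ?f"
        unfolding en(4) ab(6)[OF tt(2,5)] bc(6)[OF tt(1,4)] .
    qed (use en(1-3) ac(3-5) E o tt ab(3,4) in simp_all)
    then show ?thesis using o by simp
  qed
  show "efun1 (eta M) a a \<cdot> eid (esrc (eta M)) a = eid (etgt (eta M)) (efun0 (eta M) a)"
    if "a \<in> eobj (esrc (eta M))" for a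
  proof -
    have a: "a \<in> eobj M" using that by simp
    note e = eta_arr[OF M a a] and n = En_eid_typing[OF I eta_arr(1)[OF M a a]]
    have "efun1 (eta M) a a \<cdot> eid M a = eid (En_obj V (Si_obj V M)) (inj0 V M a \<cdot> base M a)"
    proof (rule up_eqI[OF I e(1,2)])
      have "up V (Si_obj V M) (inj0 V M a \<cdot> base M a) (inj0 V M a \<cdot> base M a) \<cdot> efun1 (eta M) a a \<cdot> eid M a =
          unit_el M a a (eid M a)"
        by (rule e(6)) (use E a in simp_all)
      also have "\<dots> = iident (Si_obj V M) \<cdot> inj0 V M a \<cdot> base M a"
        using unit_el_eid[OF M a, of "Ident V (trm V)"] M E a by simp
      finally show "up V (Si_obj V M) (inj0 V M a \<cdot> base M a) (inj0 V M a \<cdot> base M a) \<cdot> efun1 (eta M) a a \<cdot> eid M a =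
          up V (Si_obj V M) (inj0 V M a \<cdot> base M a) (inj0 V M a \<cdot> base M a) \<cdot> eid (En_obj V (Si_obj V M)) (inj0 V M a \<cdot> base M a)"
        unfolding n(4) .
    qed (use e n E a in simp_all)
    then show ?thesis using a by simp
  qed
qed

lemma el_factorization:
  assumes M: "small_ecat M" and t: "trip M a b p x q"
  shows "el M a b p x q = cmp V (Si_icat V M) (Rt (Si_obj V M) (unit_el M b b (eps V M b \<cdot> p)))
    (cmp V (Si_icat V M) (unit_el M a b x) (Sc (Si_obj V M) (unit_el M a a (eps V M a \<cdot> q))))"
    "idem (Si_icat V M) (unit_el M b b (eps V M b \<cdot> p))" "idem (Si_icat V M) (unit_el M a a (eps V M a \<cdot> q))"
proof -
  note E = small_ecatD(1)[OF M] and d = tripD[OF t]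
  let ?t = "bang V (Dom V q)" let ?u = "base M b \<cdot> ?t" and ?v = "base M a \<cdot> ?t"
  have p: "trip M b b ?u (eps V M b \<cdot> p) ?u" and q: "trip M a a ?v (eps V M a \<cdot> q) ?v" and x: "trip M a b ?u x ?v"
    by (rule trip_base; use M d in simp)+
  have i: "ec M b b b (eps V M b \<cdot> p) (eps V M b \<cdot> p) = eps V M b \<cdot> p"
    "ec M a a a (eps V M a \<cdot> q) (eps V M a \<cdot> q) = eps V M a \<cdot> q" using E d by simp_all
  have bp: "unit_el M b b (eps V M b \<cdot> p) = el M b b ?u (eps V M b \<cdot> p) ?u"
    and bq: "unit_el M a a (eps V M a \<cdot> q) = el M a a ?v (eps V M a \<cdot> q) ?v"
    and bx: "unit_el M a b x = el M a b ?u x ?v" using d E by (simp_all add: unit_el_def)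
  show "idem (Si_icat V M) (unit_el M b b (eps V M b \<cdot> p))" "idem (Si_icat V M) (unit_el M a a (eps V M a \<cdot> q))"
    unfolding bp bq by (rule el_idem[OF M p i(1)], rule el_idem[OF M q i(2)])
  have tp: "trip M b b p (eps V M b \<cdot> p) ?u" and tq: "trip M a a ?v (eps V M a \<cdot> q) q"
    using trip_om(1)[OF E p i(1)] trip_om(2)[OF E q i(2)] E d by simp_all
  \<comment> \<open>Composition starts with the section \<open>(1, q, q)\<close>: since
    \<open>x q = x\<close>, the product \<open>(1, x, 1)(1, q, q)\<close> is
    \<open>(1, x, q)\<close>, and the retraction then changes its target to
    \<open>p\<close>.\<close>
  have txq: "trip M a b ?u x q" using trip_comp[OF E x tq] d M by simp
  show "el M a b p x q = cmp V (Si_icat V M) (Rt (Si_obj V M) (unit_el M b b (eps V M b \<cdot> p)))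
    (cmp V (Si_icat V M) (unit_el M a b x) (Sc (Si_obj V M) (unit_el M a a (eps V M a \<cdot> q))))"
    unfolding bp bq bx using M E d p q x i tp tq txq by simp
qed

end

context transpose
begin

lemma extension_unit: "comp_efun (En_arr V extension) (eta M) = F"
proof (rule efun_eqI)
  note G = extension_functor and \<eta> = eta_functor[OF M]
  let ?H = "comp_efun (En_arr V extension) (eta M)"
  show "enriched_functor V ?H"
    by (rule comp_efun_functor[OF \<eta> En_arr_functor[OF G]]) simp
  show "enriched_functor V F" by (rule F)
  show "esrc ?H = esrc F" "etgt ?H = etgt F" using esrc_F etgt_F by simp_all
  note can = canonical_split_ident[OF A]
  have ob: "efun0 F a \<in> Arr V \<and> Dom V (efun0 F a) = trm V \<and> Cod V (efun0 F a) = A0 A" if "a \<in> eobj M" for a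
    using F_obj[OF that] by simp
  have v: "val0 a (base M a) = efun0 F a" if a: "a \<in> eobj M" for a
  proof -
    have "tr a a (eid M a) = iident A \<cdot> efun0 F a"
      using tr_eid[OF a, of "Ident V (trm V)"] E a ob[OF a] by simp
    then show ?thesis using can(1)[of "efun0 F a"] ob[OF a] a M A(1) by (simp add: val0_def)
  qed
  have H0: "ifun0 extension \<cdot> inj0 V M a \<cdot> base M a = efun0 F a" if a: "a \<in> eobj M" for a
    using extension_inj0[OF a] v[OF a] M a by simp
  show e0: "efun0 ?H a = efun0 F a" if "a \<in> eobj (esrc ?H)" for a
  proof -
    have a: "a \<in> eobj M" using that by simp
    then show ?thesis using H0[OF a] M by simp
  qed
  show "efun1 ?H a b = efun1 F a b" if "a \<in> eobj (esrc ?H)" "b \<in> eobj (esrc ?H)" for a b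
  proof -
    have ab: "a \<in> eobj M" "b \<in> eobj M" using that by simp_all
    let ?i = "Ident V (ehom M a b)" let ?t = "bang V (ehom M a b)"
    let ?\<alpha> = "inj0 V M a \<cdot> base M a" and ?\<beta> = "inj0 V M b \<cdot> base M b"
    note e = eta_arr[OF M ab]
    have e': "?\<alpha> \<in> hom V (trm V) (A0 (isrc extension))" "?\<beta> \<in> hom V (trm V) (A0 (isrc extension))"
      using e(1,2) by simp_all
    note n = En_arr1[OF G e', unfolded extension_simps H0[OF ab(1)] H0[OF ab(2)]]
    have i: "?i \<in> Arr V" "Dom V ?i = ehom M a b" "Cod V ?i = ehom M a b" using E ab by simp_all
    have tt: "trip M a b (base M b \<cdot> ?t) ?i (base M a \<cdot> ?t)" by (rule trip_base) (use M E ab in simp_all)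
    have he: "ifun1 extension \<cdot> unit_el M a b ?i = val a b (base M b \<cdot> ?t) ?i (base M a \<cdot> ?t)"
      using extension_el[OF tt] i by (simp add: unit_el_def)
    \<comment> \<open>The first condition on canonical splits: \<open>F\<close> sends identities to
      identities and these split trivially, so the outer factors of \<open>val\<close>
      disappear.\<close>
    have r: "Rt A (tr b b (eid M b \<cdot> ?t)) = iident A \<cdot> efun0 F b \<cdot> ?t"
      "Sc A (tr a a (eid M a \<cdot> ?t)) = iident A \<cdot> efun0 F a \<cdot> ?t"
      using can[of "efun0 F b \<cdot> ?t"] can[of "efun0 F a \<cdot> ?t"] tr_eid[OF ab(1), of ?t] tr_eid[OF ab(2), of ?t]
        ob[OF ab(1)] ob[OF ab(2)] E ab by simp_all
    note tp = tr_props[OF ab i(1,3), unfolded i(2)]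
    have "val a b (base M b \<cdot> ?t) ?i (base M a \<cdot> ?t) = tr a b ?i"
      unfolding val_def using r tp M E ab A(1) ob[OF ab(1)] ob[OF ab(2)] by simp
    also have "\<dots> = up V A (efun0 F a) (efun0 F b) \<cdot> efun1 F a b" using F_typing[OF ab(1)] ab by (simp add: tr_def)
    finally have val: "ifun1 extension \<cdot> unit_el M a b ?i = up V A (efun0 F a) (efun0 F b) \<cdot> efun1 F a b" using he by simp
    have "efun1 (En_arr V extension) ?\<alpha> ?\<beta> \<cdot> efun1 (eta M) a b = efun1 F a b"
    proof (rule up_eqI[OF A(1) F_obj[OF ab(1)] F_obj[OF ab(2)]])
      show "up V A (efun0 F a) (efun0 F b) \<cdot> efun1 (En_arr V extension) ?\<alpha> ?\<beta> \<cdot> efun1 (eta M) a b =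
          up V A (efun0 F a) (efun0 F b) \<cdot> efun1 F a b"
        using n(5)[OF e(3,5)] e(7) val by simp
    qed (use n(1-3) e(3-5) F_typing[OF ab(1)] ab in simp_all)
    then show ?thesis using ab by simp
  qed
qed

text \<open>The unit equation fixes \<open>G\<close> on \<open>unit_el\<close>, preservation of
  splits fixes it on the retractions and sections of such elements, and
  \<open>el_factorization\<close> writes every triple as a composite of these.\<close>

lemma extension_unique:
  assumes G: "internal_functor V G" "preserves_split V G" "isrc G = Si_obj V M" "itgt G = A"
    and unit: "comp_efun (En_arr V G) (eta M) = F"
  shows "G = extension"
proof -
  let ?S = "Si_icat V M" let ?T = "Si_obj V M"
  note I = Si_internal[OF M] and IS = Si_obj_internal[OF M] and spS = Si_is_split[OF M]
  note g = ifun_typing[OF G(1), unfolded G(3,4) Si_obj_simps] ifun_d[OF G(1), unfolded G(3,4) Si_obj_simps]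
  note gc = ifun_cmp[OF G(1), unfolded G(3,4) Si_obj_simps Si_obj_derived]
  have gsp: "ifun1 G \<cdot> Rt ?T u = Rt A (ifun1 G \<cdot> u)" "ifun1 G \<cdot> Sc ?T u = Sc A (ifun1 G \<cdot> u)" if "idem ?S u" for u
    using preserves_split_iff[OF G(1)] G(2-4) spS sp that by auto
  \<comment> \<open>Composing the unit equation with \<open>up\<close> turns an equation of enriched
    components into one between arrows into \<open>A1\<close>.\<close>
  have unit_el: "ifun1 G \<cdot> unit_el M a b x = tr a b x" if ab: "a \<in> eobj M" "b \<in> eobj M" and x: "x \<in> Arr V" "Cod V x = ehom M a b" for a b x
  proof -
    let ?\<alpha> = "inj0 V M a \<cdot> base M a" and ?\<beta> = "inj0 V M b \<cdot> base M b"
    note e = eta_arr[OF M ab]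
    have e': "?\<alpha> \<in> hom V (trm V) (A0 (isrc G))" "?\<beta> \<in> hom V (trm V) (A0 (isrc G))"
      using e(1,2) G(3) by simp_all
    have F0: "efun0 F c = ifun0 G \<cdot> inj0 V M c \<cdot> base M c" if c: "c \<in> eobj M" for c
      unfolding unit[symmetric] using eta_arr(1)[OF M c c] G(3) c by simp
    have F1: "efun1 F a b = efun1 (En_arr V G) ?\<alpha> ?\<beta> \<cdot> efun1 (eta M) a b"
      unfolding unit[symmetric] using ab by simp
    note n = En_arr1[OF G(1) e', unfolded G(3,4)]
    have "tr a b x = up V A (ifun0 G \<cdot> ?\<alpha>) (ifun0 G \<cdot> ?\<beta>) \<cdot> efun1 (En_arr V G) ?\<alpha> ?\<beta> \<cdot> efun1 (eta M) a b \<cdot> x"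
      unfolding tr_def F0[OF ab(1)] F0[OF ab(2)] F1 using n(1-3) e(3-5) x by simp
    also have "\<dots> = ifun1 G \<cdot> up V ?T ?\<alpha> ?\<beta> \<cdot> efun1 (eta M) a b \<cdot> x"
      by (rule n(5)) (use e(3-5) x in simp_all)
    also have "\<dots> = ifun1 G \<cdot> unit_el M a b x" using e(6)[OF x] by simp
    finally show ?thesis by simp
  qed
  have el: "ifun1 G \<cdot> el M a b p x q = val a b p x q" if t: "trip M a b p x q" for a b p x q
  proof -
    note d = tripD(1-10)[OF t] and f = el_factorization[OF M t]
    let ?P = "unit_el M b b (eps V M b \<cdot> p)" and ?Q = "unit_el M a a (eps V M a \<cdot> q)" and ?X = "unit_el M a b x"
    have P: "eps V M b \<cdot> p \<in> Arr V" "Cod V (eps V M b \<cdot> p) = ehom M b b" "Dom V (eps V M b \<cdot> p) = Dom V q"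
      and Q: "eps V M a \<cdot> q \<in> Arr V" "Cod V (eps V M a \<cdot> q) = ehom M a a" "Dom V (eps V M a \<cdot> q) = Dom V q"
      using E d by simp_all
    note bp = unit_el_props[OF M d(2,2) P(1,2), unfolded P(3)] and bq = unit_el_props[OF M d(1,1) Q(1,2), unfolded Q(3)]
      and bx = unit_el_props[OF M d(1,2,7,8), unfolded d(10)]
    have iP: "idem ?T ?P" and iQ: "idem ?T ?Q" using f by simp_all
    note sP = split_props[OF IS spS iP, unfolded Si_obj_simps] and sQ = split_props[OF IS spS iQ, unfolded Si_obj_simps]
    have c: "d0 ?S \<cdot> ?X = d1 ?S \<cdot> Sc ?T ?Q" "d0 ?S \<cdot> Rt ?T ?P = d1 ?S \<cdot> ?X" using bp bq bx sP sQ by simp_all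
    have XQ: "cmp V ?S ?X (Sc ?T ?Q) \<in> Arr V" "Dom V (cmp V ?S ?X (Sc ?T ?Q)) = Dom V q"
      "Cod V (cmp V ?S ?X (Sc ?T ?Q)) = Si1 V M" "d1 ?S \<cdot> cmp V ?S ?X (Sc ?T ?Q) = d1 ?S \<cdot> ?X"
      using cmp_typing[OF I, of ?X "Sc ?T ?Q"] c bx sQ bq by simp_all
    have "ifun1 G \<cdot> el M a b p x q = cmp V A (ifun1 G \<cdot> Rt ?T ?P) (ifun1 G \<cdot> cmp V ?S ?X (Sc ?T ?Q))"
      unfolding f(1) by (rule gc) (use XQ c sP bp in simp_all)
    also have "ifun1 G \<cdot> cmp V ?S ?X (Sc ?T ?Q) = cmp V A (ifun1 G \<cdot> ?X) (ifun1 G \<cdot> Sc ?T ?Q)"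
      by (rule gc) (use c bx sQ bq in simp_all)
    finally show ?thesis
      unfolding val_def gsp(1)[OF f(2)] gsp(2)[OF f(3)] unit_el[OF d(2,2) P(1,2)] unit_el[OF d(1,1) Q(1,2)] unit_el[OF d(1,2,7,8)] .
  qed
  note e = extension_props(1-6) and o = Si_obj_typing[OF M] and ty = Si_icat_typing[OF M]
  have G1: "ifun1 G = ifun1 extension"
  proof (rule el_cases[OF M, of "Ident V (Si1 V M)"])
    fix k a b p x q assume k: "k \<in> Arr V" "Cod V k = Dom V (Ident V (Si1 V M))" "trip M a b p x q"
      "Ident V (Si1 V M) \<cdot> k = el M a b p x q"
    then have "k = el M a b p x q" using o by simp
    then show "ifun1 G \<cdot> k = ifun1 extension \<cdot> k" using el[OF k(3)] extension_el[OF k(3)] by simp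
  qed (use g e o in simp_all)
  note h = ifun_typing[OF extension_functor, unfolded extension_simps Si_obj_simps]
    ifun_d[OF extension_functor, unfolded extension_simps Si_obj_simps]
  \<comment> \<open>The action on objects is recovered from the action on arrows by evaluating at
    identities and taking the source.\<close>
  have "ifun0 G = d0 A \<cdot> ifun1 G \<cdot> iident ?S" using g(10) ty d_ident(1)[OF I] g(1-3) by simp
  also have "\<dots> = ifun0 extension" unfolding G1 using h(10) ty d_ident(1)[OF I] h(1-3) by simp
  finally show ?thesis by (rule ifun_eqI[rotated 2]) (use G(3,4) G1 in simp_all)
qed

end

section \<open>Universality of the unit and the action of \<open>Si\<close> on enriched
  functors\<close>

context ambient
begin

lemma eta_hom:
  assumes "small_enriched_category V \<kappa> M"
  shows "eta M \<in> hom (VCat V \<kappa>) M (En_obj V (Si_obj V M))"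
  unfolding VCat_hom using Si_small[OF assms] assms eta_functor En_small by simp

lemma transposeI:
  assumes "small_enriched_category V \<kappa> M" "small_split_category V \<kappa> A" "F \<in> hom (VCat V \<kappa>) M (En_obj V A)"
  shows "transpose V \<kappa> M A F"
proof (intro transpose.intro ambient_axioms transpose_axioms.intro)
  show "small_ecat M" by (rule Si_small[OF assms(1)])
  show "internal_category V A" "is_canonical_split V A" using small_split_categoryD[OF assms(2)] by blast+
  show "enriched_functor V F" "esrc F = M" "etgt F = En_obj V A" using assms(3) unfolding VCat_hom by blast+
qed

lemma unit_universal:
  assumes "small_enriched_category V \<kappa> M" "small_split_category V \<kappa> A" "F \<in> hom (VCat V \<kappa>) M (En_obj V A)"
  shows "\<exists>!h. h \<in> hom (Cat_sp V \<kappa>) (Si_obj V M) A \<and> Comp (VCat V \<kappa>) (En_arr V h) (eta M) = F"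
proof -
  interpret t: transpose V \<kappa> M A F by (rule transposeI[OF assms])
  show ?thesis
  proof (rule ex1I[of _ t.extension])
    show "t.extension \<in> hom (Cat_sp V \<kappa>) (Si_obj V M) A \<and> Comp (VCat V \<kappa>) (En_arr V t.extension) (eta M) = F"
      unfolding Cat_sp_hom using t.extension_functor t.extension_preserves t.extension_unit Si_small(2)[OF assms(1)] assms(2)
      by (simp add: comp_efun_def)
    show "h = t.extension" if "h \<in> hom (Cat_sp V \<kappa>) (Si_obj V M) A \<and> Comp (VCat V \<kappa>) (En_arr V h) (eta M) = F" for h
      by (rule t.extension_unique) (use that in \<open>auto simp: Cat_sp_hom comp_efun_def simp del: in_hom\<close>)
  qed
qed

lemma cotuple_cong:
  assumes "\<And>i. i \<in> I \<Longrightarrow> f i = g i"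
  shows "cotuple V I x t f = cotuple V I x t g"
  using assms unfolding cotuple_def by (simp cong: ball_cong)

text \<open>Once \<open>Si_arr V f\<close> is identified with an extension, functoriality and naturality follow from
  the universal property of the unit.\<close>

lemma Si_arr_extension:
  assumes f: "f \<in> hom (VCat V \<kappa>) M N"
  shows "Si_arr V f = transpose.extension V M (Si_obj V N) (comp_efun (eta N) f)"
proof -
  have F: "enriched_functor V f" "esrc f = M" "etgt f = N" and sM: "small_enriched_category V \<kappa> M"
    and sN: "small_enriched_category V \<kappa> N" using f unfolding VCat_hom by blast+
  note M = Si_small(1)[OF sM] and N = Si_small(1)[OF sN]
  interpret C: category "VCat V \<kappa>" by (rule category_VCat)
  have "comp_efun (eta N) f \<in> hom (VCat V \<kappa>) M (En_obj V (Si_obj V N))"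
    using C.comp_hom[OF f eta_hom[OF sN]] unfolding comp_efun_def .
  then interpret t: transpose V \<kappa> M "Si_obj V N" "comp_efun (eta N) f"
    using transposeI[OF sM Si_small(2)[OF sN]] by blast
  note E = small_ecatD(1)[OF M] and E' = small_ecatD(1)[OF N]
  note ft = efun_typing[OF F(1), unfolded F(2,3)] and fec = efun_ec[OF F(1), unfolded F(2,3)]
  \<comment> \<open>For the composite of the unit of \<open>N\<close> with \<open>f\<close>, the
    arrow named by \<open>x\<close> is the triple \<open>(1, f x, 1)\<close>.\<close>
  have tr: "t.tr a b x = unit_el N (efun0 f a) (efun0 f b) (efun1 f a b \<cdot> x)"
    if ab: "a \<in> eobj M" "b \<in> eobj M" and x: "x \<in> Arr V" "Cod V x = ehom M a b" for a b x
    using eta_arr[OF N ft(1)[OF ab(1)] ft(1)[OF ab(2)]] ft[OF ab(1)] ft(1)[OF ab(2)] F ab x by (simp add: t.tr_def)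
  have fe: "efun1 f a a \<cdot> eps V M a \<cdot> q \<in> Arr V" "Cod V (efun1 f a a \<cdot> eps V M a \<cdot> q) = ehom N (efun0 f a) (efun0 f a)"
    "Dom V (efun1 f a a \<cdot> eps V M a \<cdot> q) = Dom V q"
    "ec N (efun0 f a) (efun0 f a) (efun0 f a) (efun1 f a a \<cdot> eps V M a \<cdot> q) (efun1 f a a \<cdot> eps V M a \<cdot> q) = efun1 f a a \<cdot> eps V M a \<cdot> q"
    if a: "a \<in> eobj M" and q: "q \<in> Arr V" "Cod V q = idems V M a" for a q
    using ft[OF a] fec[OF a a a, of "eps V M a \<cdot> q" "eps V M a \<cdot> q"] E a q by simp_all
  have S0: "Si_arr0 V f a \<in> Arr V" "Dom V (Si_arr0 V f a) = idems V M a" "Cod V (Si_arr0 V f a) = idems V N (efun0 f a)"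
    "\<And>q. q \<in> Arr V \<Longrightarrow> Cod V q = idems V M a \<Longrightarrow> om N (efun0 f a) (efun1 f a a \<cdot> eps V M a \<cdot> q) = Si_arr0 V f a \<cdot> q"
    if a: "a \<in> eobj M" for a
  proof -
    have "Si_arr0 V f a = om N (efun0 f a) (efun1 f a a \<cdot> eps V M a)" using F by (simp add: Si_arr0_def om_def)
    moreover have "efun1 f a a \<cdot> eps V M a = efun1 f a a \<cdot> eps V M a \<cdot> Ident V (idems V M a)" using E a by simp
    ultimately have e: "Si_arr0 V f a = om N (efun0 f a) (efun1 f a a \<cdot> eps V M a \<cdot> Ident V (idems V M a))" by simp
    have i: "Ident V (idems V M a) \<in> Arr V" "Cod V (Ident V (idems V M a)) = idems V M a" using E a by simp_all
    note fi = fe[OF a i] and na = ft(1)[OF a]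
    show "Si_arr0 V f a \<in> Arr V" "Dom V (Si_arr0 V f a) = idems V M a" "Cod V (Si_arr0 V f a) = idems V N (efun0 f a)"
      unfolding e using om_typing[OF E' na fi(1,2,4)] fi(3) E a by simp_all
    show "om N (efun0 f a) (efun1 f a a \<cdot> eps V M a \<cdot> q) = Si_arr0 V f a \<cdot> q" if q: "q \<in> Arr V" "Cod V q = idems V M a" for q
      unfolding e using om_comp[OF E' na fi(1,2,4) q(1)] fi(3) ft[OF a] E a q by simp
  qed
  \<comment> \<open>The image of an idempotent \<open>q\<close> is \<open>(1, f q, 1)\<close>, so
    its retraction is \<open>(f q, f q, 1)\<close> and its section is \<open>(1, f q, f q)\<close>;
    \<open>Si_arr0\<close> names the idempotent \<open>f q\<close>.\<close>
  have RS: "Rt (Si_obj V N) (t.tr a a (eps V M a \<cdot> q)) =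
      el N (efun0 f a) (efun0 f a) (Si_arr0 V f a \<cdot> q) (efun1 f a a \<cdot> eps V M a \<cdot> q) (base N (efun0 f a) \<cdot> bang V (Dom V q))"
    "Sc (Si_obj V N) (t.tr a a (eps V M a \<cdot> q)) =
      el N (efun0 f a) (efun0 f a) (base N (efun0 f a) \<cdot> bang V (Dom V q)) (efun1 f a a \<cdot> eps V M a \<cdot> q) (Si_arr0 V f a \<cdot> q)"
    "trip N (efun0 f a) (efun0 f a) (Si_arr0 V f a \<cdot> q) (efun1 f a a \<cdot> eps V M a \<cdot> q) (base N (efun0 f a) \<cdot> bang V (Dom V q))"
    "trip N (efun0 f a) (efun0 f a) (base N (efun0 f a) \<cdot> bang V (Dom V q)) (efun1 f a a \<cdot> eps V M a \<cdot> q) (Si_arr0 V f a \<cdot> q)"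
    if a: "a \<in> eobj M" and q: "q \<in> Arr V" "Cod V q = idems V M a" for a q
  proof -
    let ?a = "efun0 f a" let ?x = "efun1 f a a \<cdot> eps V M a \<cdot> q" let ?t = "bang V (Dom V q)"
    note x = fe[OF a q] and na = ft(1)[OF a]
    have b: "t.tr a a (eps V M a \<cdot> q) = el N ?a ?a (base N ?a \<cdot> ?t) ?x (base N ?a \<cdot> ?t)"
      using tr[OF a a, of "eps V M a \<cdot> q"] x(3) E a q by (simp add: unit_el_def)
    have tt: "trip N ?a ?a (base N ?a \<cdot> ?t) ?x (base N ?a \<cdot> ?t)"
      by (rule trip_base[OF N na na x(1,2)]) (use x(3) q in simp_all)
    show "Rt (Si_obj V N) (t.tr a a (eps V M a \<cdot> q)) = el N ?a ?a (Si_arr0 V f a \<cdot> q) ?x (base N ?a \<cdot> ?t)"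
      "Sc (Si_obj V N) (t.tr a a (eps V M a \<cdot> q)) = el N ?a ?a (base N ?a \<cdot> ?t) ?x (Si_arr0 V f a \<cdot> q)"
      unfolding b Si_split_el[OF N tt x(4)] S0(4)[OF a q] by simp_all
    show "trip N ?a ?a (Si_arr0 V f a \<cdot> q) ?x (base N ?a \<cdot> ?t)" "trip N ?a ?a (base N ?a \<cdot> ?t) ?x (Si_arr0 V f a \<cdot> q)"
      using trip_om[OF E' tt x(4)] unfolding S0(4)[OF a q] by blast+
  qed
  show ?thesis
  proof (rule ifun_eqI)
    show "isrc (Si_arr V f) = isrc t.extension" "itgt (Si_arr V f) = itgt t.extension"
      using F by (simp_all add: Si_arr_def Let_def)
    \<comment> \<open>Both object parts are cotuples over the same family, so it is enough to
      compare components, that is, values at the generic idempotent.\<close>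
    have "inj0 V N (efun0 f a) \<cdot> Si_arr0 V f a = t.val0 a (Ident V (idems V M a))" if a: "a \<in> eobj M" for a
      unfolding t.val0_def using RS[OF a, of "Ident V (idems V M a)"] S0[OF a] E a N by simp
    then have "cotuple V (eobj M) (idems V M) (Si0 V N) (\<lambda>a. inj0 V N (efun0 f a) \<cdot> Si_arr0 V f a) =
       cotuple V (eobj M) (idems V M) (Si0 V N) (\<lambda>a. t.val0 a (Ident V (idems V M a)))"
      by (rule cotuple_cong)
    then show "ifun0 (Si_arr V f) = ifun0 t.extension"
      using F by (simp add: Si_arr_def Let_def t.extension_def)
    have "inj1 V N (efun0 f a) (efun0 f b) \<cdot> Si_arr1 V f a b = t.val a b (ah1 V M a b) (ah2 V M a b) (ah3 V M a b)"
      if ab: "a \<in> eobj M" "b \<in> eobj M" for a b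
    proof -
      let ?a = "efun0 f a" and ?b = "efun0 f b" let ?p = "ah1 V M a b" and ?x = "ah2 V M a b" and ?q = "ah3 V M a b"
      note d = tripD[OF Si_hom_props(16)[OF E ab]] and h = Si_hom_props[OF E ab] and na = ft(1)[OF ab(1)] and nb = ft(1)[OF ab(2)]
      let ?t = "bang V (Si_hom V M a b)" let ?y = "efun1 f a b \<cdot> ?x"
      have y: "?y \<in> Arr V" "Dom V ?y = Si_hom V M a b" "Cod V ?y = ehom N ?a ?b" using ft[OF ab(1)] ab h by simp_all
      have tx: "t.tr a b ?x = el N ?a ?b (base N ?b \<cdot> ?t) ?y (base N ?a \<cdot> ?t)"
        using tr[OF ab, of ?x] h y by (simp add: unit_el_def)
      have tt: "trip N ?a ?b (base N ?b \<cdot> ?t) ?y (base N ?a \<cdot> ?t)"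
        by (rule trip_base[OF N na nb y(1,3)]) (use h y in simp_all)
      note P = RS[OF ab(2) d(3,4), unfolded h(7)] and Q = RS[OF ab(1) d(5,6), unfolded h(13)]
      have yq: "ec N ?a ?a ?b ?y (efun1 f a a \<cdot> eps V M a \<cdot> ?q) = ?y"
        using fec[OF ab(1,1,2), of ?x "eps V M a \<cdot> ?q"] d E ab by simp
      have py: "ec N ?a ?b ?b (efun1 f b b \<cdot> eps V M b \<cdot> ?p) ?y = ?y"
        using fec[OF ab(1,2,2), of "eps V M b \<cdot> ?p" ?x] d E ab by simp
      have t2: "trip N ?a ?b (base N ?b \<cdot> ?t) ?y (Si_arr0 V f a \<cdot> ?q)"
        using trip_comp[OF E' tt Q(4)] yq S0[OF ab(1)] d h N na by simp
      have t3: "trip N ?a ?b (Si_arr0 V f b \<cdot> ?p) ?y (Si_arr0 V f a \<cdot> ?q)"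
        using trip_comp[OF E' P(3) t2] py S0[OF ab(1)] S0[OF ab(2)] d h N na nb by simp
      \<comment> \<open>Here \<open>(f p, f p, 1)(1, f x, 1)(1, f q, f q)\<close> collapses to
        \<open>(f p, f x, f q)\<close> by the absorption laws \<open>py\<close> and
        \<open>yq\<close>; this is the triple in the definition of \<open>Si_arr1\<close>.\<close>
      have "t.val a b ?p ?x ?q = el N ?a ?b (Si_arr0 V f b \<cdot> ?p) ?y (Si_arr0 V f a \<cdot> ?q)"
        unfolding t.val_def P(1) Q(2) tx using N tt P(3) Q(4) t2 yq py by simp
      moreover have "Si_arr1 V f a b = mk N ?a ?b (Si_arr0 V f b \<cdot> ?p) ?y (Si_arr0 V f a \<cdot> ?q)"
      proof -
        have "times3 V (Si_arr0 V f b) (efun1 f a b) (Si_arr0 V f a) \<cdot> alpha_hat V M a b =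
            tuple3 V (Si_arr0 V f b \<cdot> ?p) ?y (Si_arr0 V f a \<cdot> ?q)"
          unfolding h(15) tuple3_def times3_def times2_def
          using h(6-14) S0(1-3)[OF ab(1)] S0(1-3)[OF ab(2)] ft[OF ab(1)] E ab by simp
        then show ?thesis using F by (simp add: Si_arr1_def mk_def)
      qed
      ultimately show ?thesis by (simp add: el_def)
    qed
    then have "cotuple V (eobj M \<times> eobj M) (\<lambda>(a, b). Si_hom V M a b) (Si1 V N)
         (\<lambda>(a, b). inj1 V N (efun0 f a) (efun0 f b) \<cdot> Si_arr1 V f a b) =
       cotuple V (eobj M \<times> eobj M) (\<lambda>(a, b). Si_hom V M a b) (Si1 V N)
         (\<lambda>(a, b). t.val a b (ah1 V M a b) (ah2 V M a b) (ah3 V M a b))"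
      by (intro cotuple_cong) auto
    then show "ifun1 (Si_arr V f) = ifun1 t.extension"
      using F by (simp add: Si_arr_def Let_def t.extension_def)
  qed
qed

lemma Si_arr_natural:
  assumes f: "f \<in> hom (VCat V \<kappa>) M N"
  shows "Si_arr V f \<in> hom (Cat_sp V \<kappa>) (Si_obj V M) (Si_obj V N)"
    "Comp (VCat V \<kappa>) (En_arr V (Si_arr V f)) (eta M) = Comp (VCat V \<kappa>) (eta N) f"
proof -
  have sM: "small_enriched_category V \<kappa> M" and sN: "small_enriched_category V \<kappa> N" using f unfolding VCat_hom by blast+
  interpret C: category "VCat V \<kappa>" by (rule category_VCat)
  have "comp_efun (eta N) f \<in> hom (VCat V \<kappa>) M (En_obj V (Si_obj V N))"
    using C.comp_hom[OF f eta_hom[OF sN]] unfolding comp_efun_def .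
  then interpret t: transpose V \<kappa> M "Si_obj V N" "comp_efun (eta N) f"
    using transposeI[OF sM Si_small(2)[OF sN]] by blast
  show "Si_arr V f \<in> hom (Cat_sp V \<kappa>) (Si_obj V M) (Si_obj V N)"
    unfolding Si_arr_extension[OF f] Cat_sp_hom
    using t.extension_functor t.extension_preserves Si_small(2)[OF sM] Si_small(2)[OF sN] by simp
  show "Comp (VCat V \<kappa>) (En_arr V (Si_arr V f)) (eta M) = Comp (VCat V \<kappa>) (eta N) f"
    unfolding Si_arr_extension[OF f] using t.extension_unit unfolding comp_efun_def .
qed

lemma Si_En_adjunction:
  "adjunction (VCat V \<kappa>) (Cat_sp V \<kappa>) (Si V) (En V)
     (\<lambda>x y h. Comp (VCat V \<kappa>) (FArr (En V) h) (eta x))"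
  by (rule adjunction_from_universal_arrows[OF category_VCat functor_En])
    (use Si_small(2) eta_hom unit_universal Si_arr_natural in \<open>simp_all add: VCat_Obj Cat_sp_Obj Si_def En_def del: in_hom\<close>)

end

theorem theorem4p22:
  fixes V :: "('o, 'a) cat" and \<kappa> :: "'a rel"
  assumes "Card_order \<kappa>" and "infinite (Field \<kappa>)"
    and "category V"
    and "has_finite_limits V"
    and "has_small_coproducts V \<kappa>"
    and "extensive V \<kappa>"
    and "small_points_closed V \<kappa>"
  shows "\<exists>\<phi>. adjunction (VCat V \<kappa>) (Cat_sp V \<kappa>) (Si V) (En V) \<phi>"
proof -
  interpret ambient V \<kappa>
    using assms by (intro ambient.intro ambient_axioms.intro)
  show ?thesis using Si_En_adjunction by blast
qed

end
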